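(* Let $q\in(0,1)$, $n\ge 2$, and let $A\in\mathfrak{gl}_n(\mathbb C)$. Let $\lambda^{(k)}_1,\dots,\lambda^{(k)}_k$ be the eigenvalues of the upper left $k\times k$ submatrix $A^{(k)}$ of $A$. Assume $1-(1-q)\lambda^{(n)}_i\neq0$ and $1-(1-q)\lambda_i^{(n-1)}\ne0$ for all $i$, and put $\mu_i=\log_q(1-(1-q)\lambda^{(n)}_i)$ for $1\le i\le n$, $\nu_i=\log_q(1-(1-q)\lambda^{(n-1)}_i)$ for $1\le i\le n-1$ (principal branch), and $\nu_n=\sum_{l=1}^n\mu_l-\sum_{l=1}^{n-1}\nu_l$. Suppose that $$\mu_i-\mu_j\notin\mathbb Z\ (1\le i\ne j\le n),\qquad \nu_i-\nu_j\notin\mathbb Z\ (1\le i\neq j\le n-1),\qquad \lambda^{(n-1)}_j\ne\lambda^{(n-2)}_l\ (1\le j\le n-1,\ 1\le l\le n-2).$$ Let $\lambda,\mu\in\mathbb C^*$ with $\mu\notin\lambda q^{\mathbb Z}$ and $\lambda,\mu\notin-\frac{1-q}{q^{\nu_l}}q^{\mathbb Z}$ for $1\le l\le n-1$, and let $z\in\mathbb C^*$ with $z\notin-\frac1\mu q^{\mathbb Z}$ and $z\notin-\frac1\lambda q^{\mathbb Z}$. Then the $q$-Stokes matrix $S_q(z,\lambda,\mu;E_{nn},A)$ of the system $D_qF_q(z)=\left(E_{nn}+\frac Az\right)F_q(z)$ is $$S_q(z,\lambda,\mu;E_{nn},A)=\begin{pmatrix}\mathrm{Id}_{n-1}&0\\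 b_q&1\end{pmatrix},\qquad b_q=((b_q)_1,\dots,(b_q)_{n-1}),$$ where \begin{align*} (b_q)_k=&\sum_{j=1}^{n-1}\frac{(-1)^{n+k}\Delta^{1,\dots,n-2,n}_{1,\dots,n-1}\big(A-\lambda^{(n-1)}_j\mathrm{Id}_n\big)\,\Delta^{1,\dots,\hat k,\dots,n-1}_{1,\dots,n-2}\big(A-\lambda^{(n-1)}_j\mathrm{Id}_n\big)}{\prod_{l=1,l\ne j}^{n-1}\big(\lambda^{(n-1)}_l-\lambda^{(n-1)}_j\big)\prod_{l=1}^{n-2}\big(\lambda^{(n-2)}_l-\lambda^{(n-1)}_j\big)}\\ &\times\sum_{s=1}^n\frac{\prod_{l=1}^{n-1}(q^{1+\mu_s-\nu_l};q)_\infty}{\prod_{l=1,l\ne s}^n(q^{1+\mu_s-\mu_l};q)_\infty}\,\frac{\prod_{l=1,l\ne s}^n\theta_q((1-q)q^{1-\mu_l}/\lambda)}{\prod_{l=1}^{n-1}\theta_q((1-q)q^{1-\nu_l}/\lambda)}\,\frac{\theta_q(q^{\mu_s-\nu_n}\lambda z)}{\theta_q(\lambda z)}\\ &\times\frac{\prod_{l=1,l\ne s}^n(q^{1+\mu_l-\nu_j};q)_\infty\prod_{l=1,l\ne j}^{n-1}(q^{\nu_l-\mu_s};q)_\infty}{\prod_{l=1,l\ne j}^{n-1}(q^{1+\nu_l-\nu_j};q)_\infty\prod_{l=1,l\ne s}^n(q^{\mu_l-\mu_s};q)_\infty}\,\frac{\theta_q(q^{\nu_j-\mu_s-1}\mu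 z)}{\theta_q(\mu z)}\,\frac{\theta_q(q^{\mu_s}\mu/(1-q))}{\theta_q(q^{\nu_j-1}\mu/(1-q))}\,\frac{z^{\nu_j}}{z^{\nu_n+1}}. \end{align*}
   Context: Notation: $(a;q)_\infty=\prod_{l\ge0}(1-aq^l)$; $\theta_q(z)=\sum_{m\in\mathbb Z}q^{m(m-1)/2}z^m$ for $z\in\mathbb C^*$; $e_q(z)=1/((1-q)z;q)_\infty$; $D_qF(z)=\frac{F(qz)-F(z)}{qz-z}$; $E_{nn}=\mathrm{diag}(0,\dots,0,1)$; $\log_q x=\log x/\log q$ with the principal logarithm. A branch of $\log z$ is fixed and all powers $z^{c}$ (and $z^{\delta}$ for a matrix $\delta$) are taken with it. $\Delta^{I}_{J}(M)$ is the minor of $M$ with rows $I$ and columns $J$; a hat means that the index is omitted. $q$-Borel resummation: for $\hat f=\sum_{m\ge0}c_mz^{-m}\in\mathbb C[[z^{-1}]]$, put $(\hat{\mathcal B}_{q;1}\hat f)(\xi)=\sum_{m\ge0}c_mq^{m(m-1)/2}\xi^m$. If this converges near $0$ and continues analytically so that it is defined on the $q$-spiral $\lambda q^{\mathbb Z}$ with $q$-exponential growth of order $1$ (bounded by $M\theta_q(L|\xi|)$ for some constants $L,M>0$), then the $[\lambda;q]$-sum of $\hat f$ is $(\mathcal L^{[\lambda;q]}_{q;1}\hat{\mathcal B}_{q;1}\hat f)(z)=\sum_{m\in\mathbb Z}\frac{(\hat{\mathcal B}_{q;1}\hat f)(\lambda q^m)}{\theta_q(\lambda q^mz)}$ (for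 $|z|$ large, $z\notin-\lambda^{-1}q^{\mathbb Z}$, and then continued meromorphically). The $[\lambda;q]$-sum of a convergent series is its ordinary sum. Fundamental solutions: let $\delta=\delta_q^{(n-1)}(A)$ be the block diagonal matrix with upper left $(n-1)\times(n-1)$ block $\log_q(1-(1-q)A^{(n-1)})$ (principal logarithm, eigenvalues $\nu_1,\dots,\nu_{n-1}$) and $(n,n)$ entry $\nu_n$. The system has a unique formal fundamental solution of the form $\hat F_q(z)=\hat H_q(z)\,z^{\delta}\,\mathrm{diag}(1,\dots,1,e_q(q^{-\nu_n}z))$ with $\hat H_q(z)=\mathrm{Id}_n+\sum_{m\ge1}H_mz^{-m}$. For $\lambda\in\mathbb C^*\setminus\bigcup_{j=1}^{n-1}\big(-\frac{1-q}{q^{\nu_j}}q^{\mathbb Z}\big)$ all entries of $\hat H_q$ are $[\lambda;q]$-summable; replacing each entry of $\hat H_q$ by its $[\lambda;q]$-sum gives a meromorphic fundamental solution $F_q^{(\infty)}(z,\lambda;E_{nn},A)$ of the system. The $q$-Stokes matrix is defined by $$F_q^{(\infty)}(z,\mu;E_{nn},A)=F_q^{(\infty)}(z,\lambda;E_{nn},A)\,S_q(z,\lambda,\mu;E_{nn},A),$$ and is meromorphically continued in $z$ where necessary. *)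

theory Defs
  imports
    "HOL-Complex_Analysis.Complex_Analysis"
    "Jordan_Normal_Form.Char_Poly"
    "Jordan_Normal_Form.DL_Submatrix"
begin

subsection \<open>Scalar \<open>q\<close>-functions\<close>

definition qpoch :: "real \<Rightarrow> complex \<Rightarrow> complex" where
  "qpoch q a = (\<Prod>l. 1 - a * of_real q ^ l)"

text \<open>The exponent \<open>m * (m - 1) div 2\<close> is exact, since \<open>m * (m - 1)\<close> is even.\<close>

definition qtheta :: "real \<Rightarrow> complex \<Rightarrow> complex" where
  "qtheta q z = (\<Sum>\<^sub>\<infinity>m::int. of_real q powi (m * (m - 1) div 2) * z powi m)"

definition qexp :: "real \<Rightarrow> complex \<Rightarrow> complex" where
  "qexp q z = 1 / qpoch q ((1 - of_real q) * z)"

definition logq :: "real \<Rightarrow> complex \<Rightarrow> complex" where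
  "logq q x = Ln x / of_real (ln q)"

definition qspiral :: "real \<Rightarrow> complex \<Rightarrow> complex set" where
  "qspiral q a = range (\<lambda>m::int. a * of_real q powi m)"

text \<open>
  A branch of the logarithm on an open set \<open>\<Omega>\<close> (which cannot contain 0). The power \<open>z\<^sup>c\<close> taken
  with the branch \<open>Log\<close> is \<open>cpow (Log z) c\<close>. The Stokes matrix at \<open>z\<close> depends only on \<open>Log\<close> near
  \<open>z\<close>, so \<open>\<Omega>\<close> is not required to be invariant under \<open>z \<mapsto> q z\<close>; every nonzero \<open>z\<close> and every
  value of its logarithm occur for some such branch.
\<close>

definition log_branch :: "complex set \<Rightarrow> (complex \<Rightarrow> complex) \<Rightarrow> bool" where
  "log_branch \<Omega> Log \<longleftrightarrow>
     open \<Omega> \<and> continuous_on \<Omega> Log \<and> (\<forall>z\<in>\<Omega>. exp (Log z) = z)"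

definition cpow :: "complex \<Rightarrow> complex \<Rightarrow> complex" where
  "cpow L c = exp (c * L)"


subsection \<open>\<open>q\<close>-Borel resummation\<close>

text \<open>
  An element of \<open>\<complex>[[z\<^sup>-\<^sup>1]]\<close> is represented by the power series in the variable
  \<open>X = z\<^sup>-\<^sup>1\<close>.
\<close>

definition qborel :: "real \<Rightarrow> complex fps \<Rightarrow> complex fps" where
  "qborel q f = Abs_fps (\<lambda>m. of_real q ^ (m * (m - 1) div 2) * fps_nth f m)"

text \<open>
  \<open>has_qsum q l f F\<close>: the series \<open>f\<close> is \<open>[l;q]\<close>-summable with \<open>[l;q]\<close>-sum \<open>F\<close>, a meromorphic
  function on the punctured plane. Here \<open>g\<close> is the analytic continuation of the Borel transform to
  a domain containing 0 and the \<open>q\<close>-spiral of \<open>l\<close>, on which spiral it has \<open>q\<close>-exponential growth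
  of order 1. Convergent series need no separate clause: if \<open>f\<close> converges near infinity, its
  Borel transform is entire with the required growth, and since
  \<open>(\<Sum>m. (l q\<^sup>m)\<^sup>k / \<theta>(l q\<^sup>m z)) = q powi (- (k (k - 1) / 2)) * z powi (- k)\<close>,
  its \<open>[l;q]\<close>-sum is its ordinary sum.
\<close>

definition has_qsum :: "real \<Rightarrow> complex \<Rightarrow> complex fps \<Rightarrow> (complex \<Rightarrow> complex) \<Rightarrow> bool" where
  "has_qsum q l f F \<longleftrightarrow>
     (\<exists>U g L M R.
        open U \<and> connected U \<and> 0 \<in> U \<and> qspiral q l \<subseteq> U \<and>
        g holomorphic_on U \<and> g has_fps_expansion qborel q f \<and>
        (0::real) < L \<and> (0::real) < M \<and>
        (\<forall>\<xi>\<in>qspiral q l. norm (g \<xi>) \<le> M * Re (qtheta q (of_real (L * norm \<xi>)))) \<and>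
        F nicely_meromorphic_on (- {0}) \<and> (0::real) < R \<and>
        (\<forall>z. norm z > R \<longrightarrow> z \<notin> qspiral q (- 1 / l) \<longrightarrow>
           ((\<lambda>m::int. g (l * of_real q powi m) / qtheta q (l * of_real q powi m * z))
              has_sum F z) UNIV))"

definition qsum :: "real \<Rightarrow> complex \<Rightarrow> complex fps \<Rightarrow> complex \<Rightarrow> complex" where
  "qsum q l f = (SOME F. has_qsum q l f F)"


subsection \<open>Matrices\<close>

definition leading :: "nat \<Rightarrow> complex mat \<Rightarrow> complex mat" where
  "leading k A = mat k k (\<lambda>(i, j). index_mat A (i, j))"

text \<open>Minor with rows \<open>I\<close> and columns \<open>J\<close>; \<open>I\<close> and \<open>J\<close> are sets of 1-based indices, while
  \<^const>\<open>submatrix\<close> counts from 0.\<close>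

definition minor :: "nat set \<Rightarrow> nat set \<Rightarrow> complex mat \<Rightarrow> complex" where
  "minor I J M = det (submatrix M {i. Suc i \<in> I} {j. Suc j \<in> J})"

definition mat_exp :: "complex mat \<Rightarrow> complex mat" where
  "mat_exp M = mat (dim_row M) (dim_row M)
     (\<lambda>(i, j). \<Sum>k. index_mat (M ^\<^sub>m k) (i, j) / fact k)"

text \<open>Principal logarithm of an invertible matrix.\<close>

definition mat_Ln :: "complex mat \<Rightarrow> complex mat" where
  "mat_Ln M = (THE L. L \<in> carrier_mat (dim_row M) (dim_row M) \<and> mat_exp L = M \<and>
     (\<forall>x. eigenvalue L x \<longrightarrow> - pi < Im x \<and> Im x \<le> pi))"

definition mat_logq :: "real \<Rightarrow> complex mat \<Rightarrow> complex mat" where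
  "mat_logq q M = (1 / of_real (ln q)) \<cdot>\<^sub>m mat_Ln M"

text \<open>\<open>x\<^sup>D\<close> for a matrix \<open>D\<close>, where \<open>L\<close> is the chosen value of \<open>log x\<close>.\<close>

definition mat_cpow :: "complex \<Rightarrow> complex mat \<Rightarrow> complex mat" where
  "mat_cpow L D = mat_exp (L \<cdot>\<^sub>m D)"

definition E_last :: "nat \<Rightarrow> 'a::zero_neq_one mat" where
  "E_last n = mat_diag n (\<lambda>i. if i = n - 1 then 1 else 0)"

definition diag_last :: "nat \<Rightarrow> 'a::zero_neq_one \<Rightarrow> 'a mat" where
  "diag_last n x = mat_diag n (\<lambda>i. if i = n - 1 then x else 1)"


subsection \<open>The system \<open>D\<^sub>q F = (E\<^sub>n\<^sub>n + A / z) F\<close> and its solutions\<close>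

text \<open>\<open>\<Sum>\<^sub>i log\<^sub>q (1 - (1 - q) x\<^sub>i)\<close> over the eigenvalues \<open>x\<^sub>i\<close> of the upper left \<open>k \<times> k\<close> block,
  with multiplicity.\<close>

definition sum_logq_eigenvalues :: "real \<Rightarrow> nat \<Rightarrow> complex mat \<Rightarrow> complex" where
  "sum_logq_eigenvalues q k A =
     (\<Sum>x\<in>#proots (char_poly (leading k A)). logq q (1 - (1 - of_real q) * x))"

definition nu_last :: "real \<Rightarrow> complex mat \<Rightarrow> complex" where
  "nu_last q A = (let n = dim_row A in
     sum_logq_eigenvalues q n A - sum_logq_eigenvalues q (n - 1) A)"

definition delta :: "real \<Rightarrow> complex mat \<Rightarrow> complex mat" where
  "delta q A = (let n = dim_row A in
     four_block_mat
       (mat_logq q (1\<^sub>m (n - 1) - (1 - of_real q) \<cdot>\<^sub>m leading (n - 1) A)) (0\<^sub>m (n - 1) 1)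
       (0\<^sub>m 1 (n - 1)) (mat 1 1 (\<lambda>_. nu_last q A)))"

text \<open>Formal Laurent series are in \<open>X = z\<^sup>-\<^sup>1\<close>, so \<open>z\<close> is \<^const>\<open>fls_X_inv\<close>, and
  \<open>f(z) \<mapsto> f(q z)\<close> is the substitution of \<open>X / q\<close> for \<open>X\<close>.\<close>

definition formal_qshift :: "real \<Rightarrow> complex fls \<Rightarrow> complex fls" where
  "formal_qshift q f = fls_compose_fps f (fps_const (1 / of_real q) * fps_X)"

text \<open>
  Put \<open>G(z) = z\<^sup>\<delta> diag(1,\<dots>,1,e\<^sub>q(q\<^sup>-\<^sup>\<nu> z))\<close> with \<open>\<nu> = \<nu>\<^sub>n\<close>. Since \<open>(q z)\<^sup>\<delta> = z\<^sup>\<delta> q\<^sup>\<delta>\<close> and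
  \<open>e\<^sub>q(q x) = (1 - (1 - q) x) e\<^sub>q(x)\<close>, one has \<open>G(q z) = J(z) G(z)\<close>, where
  \<open>J(z) = q\<^sup>\<delta> diag(1,\<dots>,1,1 - (1 - q) q\<^sup>-\<^sup>\<nu> z)\<close>. Hence
  \<open>D\<^sub>q (H G)(z) = ((H(q z) J(z) - H(z)) / (q z - z)) G(z)\<close>,
  and \<open>formal_qderiv\<close> is the factor in front of \<open>G(z)\<close>.
\<close>

definition formal_J :: "real \<Rightarrow> complex mat \<Rightarrow> complex fls mat" where
  "formal_J q A =
     map_mat fls_const (mat_cpow (of_real (ln q)) (delta q A)) *
     diag_last (dim_row A)
       (1 - fls_const ((1 - of_real q) * of_real q powr (- nu_last q A)) * fls_X_inv)"

definition formal_qderiv :: "real \<Rightarrow> complex mat \<Rightarrow> complex fls mat \<Rightarrow> complex fls mat" where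
  "formal_qderiv q A H =
     (1 / (fls_const (of_real q) * fls_X_inv - fls_X_inv)) \<cdot>\<^sub>m
     (map_mat (formal_qshift q) H * formal_J q A - H)"

text \<open>\<open>formal_H q A\<close> is the factor \<open>H\<close> of the formal fundamental solution \<open>H G\<close>.\<close>

definition formal_H :: "real \<Rightarrow> complex mat \<Rightarrow> complex fps mat" where
  "formal_H q A = (THE H. let n = dim_row A; H' = map_mat fps_to_fls H in
     H \<in> carrier_mat n n \<and>
     map_mat (\<lambda>f. fps_nth f 0) H = 1\<^sub>m n \<and>
     formal_qderiv q A H' = (E_last n + (1 / fls_X_inv) \<cdot>\<^sub>m map_mat fls_const A) * H')"

definition fund_sol ::
  "real \<Rightarrow> (complex \<Rightarrow> complex) \<Rightarrow> complex mat \<Rightarrow> complex \<Rightarrow> complex \<Rightarrow> complex mat" where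
  "fund_sol q Log A l z =
     map_mat (\<lambda>f. qsum q l f z) (formal_H q A) *
     mat_cpow (Log z) (delta q A) *
     diag_last (dim_row A) (qexp q (of_real q powr (- nu_last q A) * z))"

text \<open>
  The \<open>q\<close>-Stokes matrix on the domain \<open>\<Omega>\<close> of the branch. The relation \<open>F\<^sub>m = F\<^sub>l S\<close> is required
  away from a discrete set, and \<open>S\<close> is the meromorphic continuation, normalised so that it is
  analytic wherever it can be.
\<close>

definition is_q_stokes ::
  "real \<Rightarrow> complex set \<Rightarrow> (complex \<Rightarrow> complex) \<Rightarrow> complex mat \<Rightarrow> complex \<Rightarrow> complex \<Rightarrow>
    (complex \<Rightarrow> complex mat) \<Rightarrow> bool" where
  "is_q_stokes q \<Omega> Log A l m S \<longleftrightarrow> (let n = dim_row A in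
     (\<forall>z\<in>\<Omega>. S z \<in> carrier_mat n n) \<and>
     (\<forall>i<n. \<forall>j<n. (\<lambda>z. index_mat (S z) (i, j)) nicely_meromorphic_on \<Omega>) \<and>
     (\<forall>\<^sub>\<approx>z\<in>\<Omega>. fund_sol q Log A m z = fund_sol q Log A l z * S z))"

definition q_stokes ::
  "real \<Rightarrow> complex set \<Rightarrow> (complex \<Rightarrow> complex) \<Rightarrow> complex mat \<Rightarrow> complex \<Rightarrow> complex \<Rightarrow>
    complex \<Rightarrow> complex mat" where
  "q_stokes q \<Omega> Log A l m = (SOME S. is_q_stokes q \<Omega> Log A l m S)"


subsection \<open>The explicit entries\<close>

text \<open>
  \<open>stokes_b q n A lam mu nu l m z Lz k\<close> is \<open>(b\<^sub>q)\<^sub>k\<close> for \<open>1 \<le> k \<le> n - 1\<close>; here \<open>lam r i\<close> is the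
  \<open>i\<close>-th eigenvalue of the upper left \<open>r \<times> r\<close> block, \<open>l\<close> and \<open>m\<close> are the two directions, and
  \<open>Lz\<close> is the chosen value of \<open>log z\<close>. All indices are 1-based.
\<close>

definition stokes_b ::
  "real \<Rightarrow> nat \<Rightarrow> complex mat \<Rightarrow> (nat \<Rightarrow> nat \<Rightarrow> complex) \<Rightarrow> (nat \<Rightarrow> complex) \<Rightarrow>
    (nat \<Rightarrow> complex) \<Rightarrow> complex \<Rightarrow> complex \<Rightarrow> complex \<Rightarrow> complex \<Rightarrow> nat \<Rightarrow> complex" where
  "stokes_b q n A lam mu nu l m z Lz k =
    (let Q = complex_of_real q in
     \<Sum>j=1..n-1.
       ((-1) ^ (n + k)
          * minor ({1..n-2} \<union> {n}) {1..n-1} (A - lam (n-1) j \<cdot>\<^sub>m 1\<^sub>m n)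
          * minor ({1..n-1} - {k}) {1..n-2} (A - lam (n-1) j \<cdot>\<^sub>m 1\<^sub>m n)
        / ((\<Prod>i\<in>{1..n-1}-{j}. lam (n-1) i - lam (n-1) j)
           * (\<Prod>i=1..n-2. lam (n-2) i - lam (n-1) j)))
       * (\<Sum>s=1..n.
           ((\<Prod>i=1..n-1. qpoch q (Q powr (1 + mu s - nu i)))
             / (\<Prod>i\<in>{1..n}-{s}. qpoch q (Q powr (1 + mu s - mu i))))
         * ((\<Prod>i\<in>{1..n}-{s}. qtheta q ((1 - Q) * Q powr (1 - mu i) / l))
             / (\<Prod>i=1..n-1. qtheta q ((1 - Q) * Q powr (1 - nu i) / l)))
         * (qtheta q (Q powr (mu s - nu n) * l * z) / qtheta q (l * z))
         * (((\<Prod>i\<in>{1..n}-{s}. qpoch q (Q powr (1 + mu i - nu j)))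
              * (\<Prod>i\<in>{1..n-1}-{j}. qpoch q (Q powr (nu i - mu s))))
             / ((\<Prod>i\<in>{1..n-1}-{j}. qpoch q (Q powr (1 + nu i - nu j)))
              * (\<Prod>i\<in>{1..n}-{s}. qpoch q (Q powr (mu i - mu s)))))
         * (qtheta q (Q powr (nu j - mu s - 1) * m * z) / qtheta q (m * z))
         * (qtheta q (Q powr (mu s) * m / (1 - Q)) / qtheta q (Q powr (nu j - 1) * m / (1 - Q)))
         * (cpow Lz (nu j) / cpow Lz (nu n + 1))))"

end

theory Submission
  imports Defs
begin

text \<open>
  With \<open>B = 1 - (1 - q) A\<close> the system reads \<open>F(q z) = (B - (1 - q) z E\<^sub>n\<^sub>n) F(z)\<close>. Diagonalising the
  upper left block of \<open>B\<close> turns \<open>B\<close> into an arrow matrix, for which the columns of the formal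
  solution can be studied one at a time. The last column converges. The Borel transform of
  another column becomes entire after multiplication by a \<open>q\<close>-Pochhammer symbol, so that its poles
  lie on one \<open>q\<close>-spiral, that of \<open>\<xi>\<^sub>j = - (1 - q) / q powr \<nu>\<^sub>j\<close>.

  As a function of the direction \<open>\<mu>\<close>, the sum of such a column times \<open>\<theta>(\<mu> z) \<theta>(- \<mu> / \<xi>\<^sub>j)\<close> is
  holomorphic on the punctured plane, is multiplied by a monomial under \<open>\<mu> \<mapsto> q \<mu>\<close>, and at
  \<open>\<mu> = \<xi>\<^sub>j\<close> is a multiple of the last column. A function of this kind is determined by two values,
  hence the sums for two directions differ by a quotient of theta functions times the last column.
  The constant is the residue of the Borel transform, which is the limit of its rescaled
  coefficients. The sum over \<open>s\<close> in the formula is the interpolation of that quotient of theta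
  functions at \<open>n\<close> points.

  The determinant of the resummed \<open>H\<close> tends to 1 along \<open>z q\<^sup>-\<^sup>k\<close>, so the fundamental solutions are
  invertible off a discrete set and the Stokes matrix is unique.
\<close>

text \<open>The objects \<open>qsum\<close>, \<open>mat_Ln\<close>, \<open>formal_H\<close> and
  \<open>q_stokes\<close> are introduced by choice or description, so each is computed by exhibiting
  a candidate and proving uniqueness. For the sums this is an identity theorem, for the logarithm
  commutation with a matrix with simple spectrum, for the formal series nonresonance. The last
  column appears in the difference of two sums for the following reason. The Borel transform obeys a
  first-order equation from q w to w whose only singular factor, 1 / (1 - w / \<open>xi j\<close>),
  sits in the last component. The residue at \<open>xi j\<close> is therefore a multiple of the last
  unit vector, and the equation carries it along the spiral by the recursion for the coefficients of
  the last column. Comparing directions through zeros of theta functions in \<mu> replaces contour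
  integrals and connection formulas of basic hypergeometric series: Jacobi's triple product and the
  simplicity of the zeros of theta suffice. The factor 1 / (z / \<open>aa\<close>; q) of the last
  formal solution and the denominator of the last column combine to \<theta>(- z /
  \<open>aa\<close>), which is the factor that the interpolation needs.\<close>

lemma tri_nat_Suc: "Suc n * n div 2 = n * (n - 1) div 2 + n"
proof -
  have "even (n * (n - 1))" by (cases n) auto
  moreover have "Suc n * n = n * (n - 1) + 2 * n" by (cases n) auto
  ultimately show ?thesis by simp
qed

lemma tri_int_double: "2 * (m * (m - 1) div 2) = m * (m - 1)" for m :: int
  by simp

lemma tri_int_add:
  "(m + k) * (m + k - 1) div 2 = m * (m - 1) div 2 + k * (k - 1) div 2 + m * k" for m k :: int
proof -
  have "2 * ((m + k) * (m + k - 1) div 2) = 2 * (m * (m - 1) div 2 + k * (k - 1) div 2 + m * k)"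
    unfolding distrib_left tri_int_double by (simp add: algebra_simps)
  thus ?thesis by (metis mult_left_cancel zero_neq_numeral)
qed

lemma tri_int_nat: "int n * (int n - 1) div 2 = int (n * (n - 1) div 2)"
proof -
  have "int n * (int n - 1) = int (n * (n - 1))" by (cases n) (auto simp: algebra_simps)
  hence "int n * (int n - 1) div 2 = int (n * (n - 1)) div 2" by (simp only:)
  thus ?thesis by (simp only: zdiv_int of_nat_numeral)
qed

lemma tri_int_uminus: "(- m) * (- m - 1) div 2 = m * (m - 1) div 2 + m" for m :: int
proof -
  have "2 * ((- m) * (- m - 1) div 2) = 2 * (m * (m - 1) div 2 + m)"
    unfolding distrib_left tri_int_double by (simp add: algebra_simps)
  thus ?thesis by simp
qed

lemma tri_int_Suc: "(m + 1) * m div 2 = m * (m - 1) div 2 + m" for m :: int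
  using tri_int_add[of m 1] by simp

text \<open>Tannery's theorem: the majorant makes the finite partial sums converge uniformly in the
  parameter, so that the two limits may be exchanged.\<close>

lemma tendsto_infsum_dominated:
  fixes f :: "'a \<Rightarrow> 'b \<Rightarrow> 'c :: banach"
  assumes lim: "\<And>x. ((\<lambda>n. f x n) \<longlongrightarrow> g x) F"
    and bd: "\<And>x n. norm (f x n) \<le> M x" and M: "M summable_on UNIV" and F: "F \<noteq> bot"
  shows "((\<lambda>n. \<Sum>\<^sub>\<infinity>x. f x n) \<longlongrightarrow> (\<Sum>\<^sub>\<infinity>x. g x)) F"
proof -
  have ul: "uniform_limit UNIV (\<lambda>X n. \<Sum>x\<in>X. f x n) (\<lambda>n. \<Sum>\<^sub>\<infinity>x. f x n) (finite_subsets_at_top UNIV)"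
    by (rule Weierstrass_m_test_general[OF _ M]) (use bd in auto)
  have gb: "norm (g x) \<le> M x" for x
    by (rule tendsto_upperbound[OF tendsto_norm[OF lim]]) (use bd F in auto)
  have "(\<lambda>x. norm (g x)) summable_on UNIV"
    by (rule Infinite_Sum.abs_summable_on_comparison_test'[OF M]) (use gb in auto)
  hence "g summable_on UNIV" by (rule abs_summable_summable)
  hence gs: "(sum g \<longlongrightarrow> (\<Sum>\<^sub>\<infinity>x. g x)) (finite_subsets_at_top UNIV)"
    using has_sum_infsum has_sum_def by blast
  show ?thesis
    by (rule swap_uniform_limit'[OF _ gs ul])
       (use lim in \<open>auto intro!: tendsto_sum always_eventually\<close>)
qed

text \<open>Local uniform convergence suffices. The majorant is asked only near each point because
  the bilateral series below have none on the whole punctured plane.\<close>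

lemma holomorphic_on_infsum:
  fixes f :: "'a \<Rightarrow> complex \<Rightarrow> complex"
  assumes S: "open S" and hol: "\<And>x. f x holomorphic_on S"
    and bd: "\<And>w. w \<in> S \<Longrightarrow> \<exists>r M. r > 0 \<and> cball w r \<subseteq> S \<and> M summable_on UNIV \<and>
               (\<forall>x. \<forall>z\<in>cball w r. norm (f x z) \<le> M x)"
  shows "(\<lambda>z. \<Sum>\<^sub>\<infinity>x. f x z) holomorphic_on S"
proof (subst analytic_on_open[OF S, symmetric], subst analytic_on_analytic_at, intro ballI)
  fix w assume "w \<in> S"
  then obtain r M where r: "r > 0" "cball w r \<subseteq> S" and M: "M summable_on UNIV"
    and b: "\<And>x z. z \<in> cball w r \<Longrightarrow> norm (f x z) \<le> M x" using bd[of w] by blast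
  have ul: "uniform_limit (cball w r) (\<lambda>X z. \<Sum>x\<in>X. f x z) (\<lambda>z. \<Sum>\<^sub>\<infinity>x. f x z) (finite_subsets_at_top UNIV)"
    by (rule Weierstrass_m_test_general[OF _ M]) (use b in auto)
  have "(\<lambda>z. \<Sum>x\<in>X. f x z) holomorphic_on cball w r" for X
    by (intro holomorphic_intros holomorphic_on_subset[OF hol r(2)])
  hence "\<forall>\<^sub>F X in finite_subsets_at_top UNIV. continuous_on (cball w r) (\<lambda>z. \<Sum>x\<in>X. f x z) \<and>
           (\<lambda>z. \<Sum>x\<in>X. f x z) holomorphic_on ball w r"
    by (intro always_eventually allI conjI holomorphic_on_imp_continuous_on)
       (auto intro: holomorphic_on_subset[OF _ ball_subset_cball])
  from holomorphic_uniform_limit[OF this ul]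
  have "(\<lambda>z. \<Sum>\<^sub>\<infinity>x. f x z) holomorphic_on ball w r" by auto
  thus "(\<lambda>z. \<Sum>\<^sub>\<infinity>x. f x z) analytic_on {w}"
    using r(1) by (meson analytic_on_open analytic_on_subset centre_in_ball empty_subsetI insert_subset open_ball)
qed

lemma summable_on_int:
  fixes f :: "int \<Rightarrow> real"
  assumes f1: "summable (\<lambda>n::nat. norm (f (int n)))" and f2: "summable (\<lambda>n::nat. norm (f (- int (Suc n))))"
  shows "f summable_on UNIV"
proof -
  have "(f \<circ> int) summable_on UNIV" using norm_summable_imp_summable_on[OF f1] by (simp add: o_def)
  hence "f summable_on (range int)" by (subst summable_on_reindex) (auto simp: inj_on_def)
  moreover have "(f \<circ> (\<lambda>n. - int (Suc n))) summable_on UNIV"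
    using norm_summable_imp_summable_on[OF f2] by (simp add: o_def)
  hence "f summable_on (range (\<lambda>n. - int (Suc n)))" by (subst summable_on_reindex) (auto simp: inj_on_def)
  moreover have "UNIV = range int \<union> range (\<lambda>n. - int (Suc n))"
  proof (intro equalityI subsetI)
    fix m :: int show "m \<in> range int \<union> range (\<lambda>n. - int (Suc n))"
    proof (cases m rule: int_cases)
      case (neg n) thus ?thesis by blast
    qed auto
  qed auto
  ultimately show ?thesis by (metis summable_on_union)
qed

locale q_base =
  fixes q :: real
  assumes q0: "0 < q" and q1: "q < 1"
begin

abbreviation Q :: complex where "Q \<equiv> complex_of_real q"

lemma Q_nz [simp]: "Q \<noteq> 0" using q0 by simp
lemma q_nz [simp]: "q \<noteq> 0" using q0 by simp
lemma normQ [simp]: "norm Q = q" using q0 by simp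

lemma Q_pow_ne_1: "n > 0 \<Longrightarrow> Q ^ n \<noteq> 1"
  using q0 q1 by (metis norm_one norm_power normQ power_eq_1_iff less_irrefl less_numeral_extra(3) less_imp_le)

lemma one_minus_Q [simp]: "1 - Q ^ Suc n \<noteq> 0"
  using Q_pow_ne_1[of "Suc n"] by auto

subsection \<open>Series with Gaussian coefficients\<close>

lemma gauss_nat_ratio:
  "summable (\<lambda>n::nat. K ^ n * q ^ (n * (n - 1) div 2))" if K: "K \<ge> 0"
proof -
  have "(\<lambda>n. K * q ^ n) \<longlonglongrightarrow> K * 0"
    by (intro tendsto_intros LIMSEQ_realpow_zero) (use q0 q1 in auto)
  hence "eventually (\<lambda>n. K * q ^ n < 1/2) sequentially"
    by (rule order_tendstoD) auto
  then obtain N where N: "\<And>n. n \<ge> N \<Longrightarrow> K * q ^ n < 1/2" by (auto simp: eventually_sequentially)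
  show ?thesis
  proof (rule summable_ratio_test[of "1/2" N])
    fix n assume n: "n \<ge> N"
    have "norm (K ^ Suc n * q ^ (Suc n * (Suc n - 1) div 2)) = (K * q ^ n) * (K ^ n * q ^ (n * (n - 1) div 2))"
      using K q0 by (simp add: tri_nat_Suc power_add abs_mult power_abs del: mult_Suc)
    also have "\<dots> \<le> 1/2 * (K ^ n * q ^ (n * (n - 1) div 2))"
      using N[OF n] K q0 by (intro mult_right_mono) auto
    finally show "norm (K ^ Suc n * q ^ (Suc n * (Suc n - 1) div 2)) \<le> 1/2 * norm (K ^ n * q ^ (n * (n - 1) div 2))"
      using K q0 by simp
  qed simp
qed

lemma gauss_int:
  assumes K: "K > 0"
  shows "(\<lambda>m::int. K powi m * q powi (m * (m - 1) div 2)) summable_on UNIV"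
proof (rule summable_on_int)
  show "summable (\<lambda>n. norm (K powi int n * q powi (int n * (int n - 1) div 2)))"
    using gauss_nat_ratio[of K] K q0 unfolding tri_int_nat by simp
  \<comment> \<open>The Gaussian exponent at -(n + 1) is (n + 1)(n + 2) / 2, so the negative half is
    again a Gaussian series, now in q / K, with the harmless extra factor q^n.\<close>
  have "K powi (- int (Suc n)) * q powi ((- int (Suc n)) * (- int (Suc n) - 1) div 2) =
      (q / K) * ((q / K) ^ n * q ^ (n * (n - 1) div 2)) * q ^ n" for n
  proof -
    have "K powi (- int (Suc n)) = inverse (K ^ Suc n)" by (metis power_int_minus power_int_of_nat)
    moreover have "q powi ((- int (Suc n)) * (- int (Suc n) - 1) div 2) = q ^ (n * (n-1) div 2 + n + Suc n)"
    proof -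
      have "(- int (Suc n)) * (- int (Suc n) - 1) div 2 = int (Suc n * (Suc n - 1) div 2) + int (Suc n)"
        unfolding tri_int_uminus tri_int_nat ..
      also have "\<dots> = int (n * (n-1) div 2 + n + Suc n)" by (simp add: tri_nat_Suc del: mult_Suc)
      finally show ?thesis by (metis power_int_of_nat)
    qed
    ultimately show ?thesis using K by (simp add: field_simps power_add)
  qed
  note eq = this
  have "summable (\<lambda>n. (q / K) * ((q / K) ^ n * q ^ (n * (n - 1) div 2)))"
    by (intro summable_mult gauss_nat_ratio) (use K q0 in auto)
  thus "summable (\<lambda>n. norm (K powi (- int (Suc n)) * q powi ((- int (Suc n)) * (- int (Suc n) - 1) div 2)))"
    unfolding eq
  proof (rule summable_comparison_test[rotated], intro exI allI impI)
    fix n :: nat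
    have "q ^ n \<le> 1" using q0 q1 by (simp add: power_le_one)
    hence "(q / K) * ((q / K) ^ n * q ^ (n * (n - 1) div 2)) * q ^ n \<le> (q / K) * ((q / K) ^ n * q ^ (n * (n - 1) div 2)) * 1"
      using K q0 by (intro mult_left_mono) auto
    thus "norm (norm ((q / K) * ((q / K) ^ n * q ^ (n * (n - 1) div 2)) * q ^ n)) \<le> (q / K) * ((q / K) ^ n * q ^ (n * (n - 1) div 2))"
      using K q0 by (simp add: abs_mult power_abs)
  qed
qed

lemma powi_abs_bound:
  fixes x K :: real assumes "x > 0" "K \<ge> x" "K \<ge> inverse x"
  shows "x powi m \<le> K ^ nat \<bar>m\<bar>"
proof (cases "m \<ge> 0")
  case True
  then obtain n where "m = int n" using nonneg_int_cases by blast
  thus ?thesis using assms by (simp add: power_mono)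
next
  case False
  then obtain n where "m = - int n" by (metis int_cases2 of_nat_0_le_iff)
  thus ?thesis using assms by (simp add: power_int_minus power_inverse[symmetric] power_mono)
qed

lemma gauss_int_abs:
  assumes K: "K > 0"
  shows "(\<lambda>m::int. K ^ nat \<bar>m\<bar> * q powi (m * (m - 1) div 2)) summable_on UNIV"
proof (rule summable_on_comparison_test[OF summable_on_add[OF gauss_int[OF K] gauss_int[of "inverse K"]]])
  show "0 < inverse K" using K by simp
  fix m :: int
  have "K ^ nat \<bar>m\<bar> \<le> K powi m + inverse K powi m"
  proof (cases "m \<ge> 0")
    case True
    then obtain n where "m = int n" using nonneg_int_cases by blast
    thus ?thesis using K by simp
  next
    case False
    then obtain n where "m = - int n" by (metis int_cases2 of_nat_0_le_iff)
    thus ?thesis using K by (simp add: power_int_minus power_inverse)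
  qed
  thus "K ^ nat \<bar>m\<bar> * q powi (m * (m - 1) div 2) \<le> K powi m * q powi (m * (m - 1) div 2) + inverse K powi m * q powi (m * (m - 1) div 2)"
    using q0 by (subst distrib_right[symmetric], intro mult_right_mono) auto
  show "0 \<le> K ^ nat \<bar>m\<bar> * q powi (m * (m - 1) div 2)" using K q0 by simp
qed

text \<open>The Gaussian factor beats geometric growth of the coefficients in both directions. Theta
  functions and the numerators of all q-Laplace sums have this shape.\<close>

lemma gauss_laurent:
  assumes a: "\<And>m::int. norm (a m) \<le> M * K ^ nat \<bar>m\<bar>" and K: "K > 0"
  shows gauss_laurent_summable: "z \<noteq> 0 \<Longrightarrow> (\<lambda>m::int. a m * Q powi (m * (m - 1) div 2) * z powi m) summable_on UNIV"
    and gauss_laurent_holomorphic: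
      "(\<lambda>z. \<Sum>\<^sub>\<infinity>m::int. a m * Q powi (m * (m - 1) div 2) * z powi m) holomorphic_on - {0}"
proof -
  have M: "M \<ge> 0" using a[of 0] norm_ge_zero[of "a 0"] by (simp del: norm_ge_zero)
  have key: "\<exists>r B. r > 0 \<and> cball w r \<subseteq> - {0} \<and> B summable_on UNIV \<and>
        (\<forall>m. \<forall>z\<in>cball w r. norm (a m * Q powi (m * (m - 1) div 2) * z powi m) \<le> B m)" if w: "w \<noteq> 0" for w
  proof -
    \<comment> \<open>On this disc |z| lies between r and 3 r, so L bounds both |z| and 1 / |z|, and
      L^|m| serves for both signs of m.\<close>
    define r where "r = norm w / 2"
    define L where "L = max (3 * r) (1 / r)"
    have r: "r > 0" using w by (simp add: r_def)
    have L: "L > 0" using r by (simp add: L_def less_max_iff_disj)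
    have zr: "r \<le> norm z \<and> norm z \<le> 3 * r" if "z \<in> cball w r" for z
    proof -
      have "norm (w - z) \<le> r" using that by (simp add: dist_norm)
      thus ?thesis using norm_triangle_ineq2[of w z] norm_triangle_ineq2[of z w] 
        by (simp add: r_def norm_minus_commute)
    qed
    have "norm (a m * Q powi (m * (m - 1) div 2) * z powi m) \<le> M * ((K * L) ^ nat \<bar>m\<bar> * q powi (m * (m - 1) div 2))"
      if z: "z \<in> cball w r" for m z
    proof -
      have zp: "norm z > 0" using zr[OF z] r by linarith
      have i: "inverse (norm z) \<le> L"
      proof -
        have "inverse (norm z) \<le> inverse r" using zr[OF z] r by (intro le_imp_inverse_le) auto
        thus ?thesis by (simp add: L_def inverse_eq_divide)
      qed
      have "norm (z powi m) \<le> L ^ nat \<bar>m\<bar>"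
        unfolding norm_power_int using zr[OF z] i zp by (intro powi_abs_bound) (auto simp: L_def)
      hence "norm (a m * Q powi (m * (m - 1) div 2) * z powi m) \<le> (M * K ^ nat \<bar>m\<bar>) * q powi (m * (m - 1) div 2) * L ^ nat \<bar>m\<bar>"
        unfolding norm_mult norm_power_int normQ using a q0 K M
        by (intro mult_mono) auto
      thus ?thesis by (simp add: power_mult_distrib mult_ac)
    qed
    moreover have "(\<lambda>m::int. M * ((K * L) ^ nat \<bar>m\<bar> * q powi (m * (m - 1) div 2))) summable_on UNIV"
      using K L by (intro summable_on_cmult_right gauss_int_abs) auto
    moreover have "cball w r \<subseteq> - {0}" using zr[of 0] r by auto
    ultimately show ?thesis using r by (intro exI[of _ r] exI[of _ "\<lambda>m. M * ((K * L) ^ nat \<bar>m\<bar> * q powi (m * (m - 1) div 2))"]) auto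
  qed
  show "(\<lambda>m::int. a m * Q powi (m * (m - 1) div 2) * z powi m) summable_on UNIV" if "z \<noteq> 0"
  proof -
    from key[OF that] obtain r B where "r > 0" and B: "B summable_on UNIV"
      and b0: "\<forall>m. \<forall>w\<in>cball z r. norm (a m * Q powi (m * (m - 1) div 2) * w powi m) \<le> B m" by blast
    have b: "norm (a m * Q powi (m * (m - 1) div 2) * z powi m) \<le> B m" for m
      using b0 \<open>r > 0\<close> by simp
    have "(\<lambda>m. norm (a m * Q powi (m * (m - 1) div 2) * z powi m)) summable_on UNIV"
      by (rule Infinite_Sum.abs_summable_on_comparison_test'[OF B]) (use b in auto)
    thus ?thesis by (rule abs_summable_summable)
  qed
  show "(\<lambda>z. \<Sum>\<^sub>\<infinity>m::int. a m * Q powi (m * (m - 1) div 2) * z powi m) holomorphic_on - {0}"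
    by (rule holomorphic_on_infsum) (use key in \<open>auto intro!: holomorphic_intros\<close>)
qed

lemma gauss_fps_conv_radius:
  assumes "\<And>n. norm (fps_nth f n) \<le> M * K ^ n * q ^ (n * (n - 1) div 2)" "K \<ge> 0"
  shows "fps_conv_radius (f :: complex fps) = \<infinity>"
  unfolding fps_conv_radius_def
proof (rule conv_radius_inftyI'')
  fix z :: complex
  show "summable (\<lambda>n. fps_nth f n * z ^ n)"
  proof (rule summable_comparison_test[OF exI, OF allI, OF impI])
    fix n
    have "norm (fps_nth f n * z ^ n) \<le> M * K ^ n * q ^ (n * (n - 1) div 2) * norm z ^ n"
      unfolding norm_mult norm_power by (intro mult_right_mono assms) auto
    thus "norm (fps_nth f n * z ^ n) \<le> M * ((K * norm z) ^ n * q ^ (n * (n - 1) div 2))"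
      by (simp add: power_mult_distrib mult_ac)
  next
    show "summable (\<lambda>n. M * ((K * norm z) ^ n * q ^ (n * (n - 1) div 2)))"
      using assms(2) by (intro summable_mult gauss_nat_ratio) auto
  qed
qed

text \<open>The factors K q^k for k < n multiply to K^n q^(n (n - 1) / 2). Every Gaussian
  coefficient bound below comes from a recursion of this form.\<close>

lemma gauss_rec_bound:
  fixes a :: "nat \<Rightarrow> real"
  assumes "\<And>n. a (Suc n) \<le> K * q ^ n * a n" "K \<ge> 0"
  shows "a n \<le> a 0 * K ^ n * q ^ (n * (n - 1) div 2)"
proof (induction n)
  case (Suc n)
  have "a (Suc n) \<le> K * q ^ n * a n" by fact
  also have "\<dots> \<le> K * q ^ n * (a 0 * K ^ n * q ^ (n * (n - 1) div 2))"
    using Suc assms(2) q0 by (intro mult_left_mono) auto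
  also have "\<dots> = a 0 * K ^ Suc n * q ^ (Suc n * n div 2)"
    unfolding tri_nat_Suc power_add by (simp add: mult_ac)
  finally show ?case by simp
qed auto

definition fps_scale :: "complex \<Rightarrow> complex fps \<Rightarrow> complex fps" where
  "fps_scale c f = Abs_fps (\<lambda>n. c ^ n * fps_nth f n)"

lemma fps_scale_nth [simp]: "fps_nth (fps_scale c f) n = c ^ n * fps_nth f n"
  by (simp add: fps_scale_def)

lemma eval_fps_scale: "eval_fps (fps_scale c f) z = eval_fps f (c * z)"
  by (simp add: eval_fps_def power_mult_distrib mult_ac)

subsection \<open>The \<open>q\<close>-Pochhammer symbol\<close>

primrec qfact :: "nat \<Rightarrow> complex" where
  "qfact 0 = 1"
| "qfact (Suc n) = qfact n * (1 - Q ^ Suc n)"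

lemma qfact_nz [simp]: "qfact n \<noteq> 0"
  by (induction n) (use Q_pow_ne_1 in \<open>auto simp del: power_Suc\<close>)

text \<open>Euler's expansion of (a w; q)_\<infinity> in powers of w; \<open>qfact n\<close> is the
  finite product (q; q)_n.\<close>

definition poch_fps :: "complex \<Rightarrow> complex fps" where
  "poch_fps a = Abs_fps (\<lambda>n. (- a) ^ n * Q ^ (n * (n - 1) div 2) / qfact n)"

lemma poch_fps_0 [simp]: "fps_nth (poch_fps a) 0 = 1"
  by (simp add: poch_fps_def)

lemma poch_fps_Suc: "fps_nth (poch_fps a) (Suc n) * (1 - Q ^ Suc n) = - a * Q ^ n * fps_nth (poch_fps a) n"
  using Q_pow_ne_1[of "Suc n"] unfolding poch_fps_def fps_nth_Abs_fps diff_Suc_1 tri_nat_Suc power_add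
  by (simp add: field_simps)

lemma poch_fps_rec: "poch_fps a = (1 - fps_const a * fps_X) * fps_scale Q (poch_fps a)"
proof (rule fps_ext)
  fix n
  show "fps_nth (poch_fps a) n = fps_nth ((1 - fps_const a * fps_X) * fps_scale Q (poch_fps a)) n"
  proof (cases n)
    case (Suc k)
    have "fps_nth ((1 - fps_const a * fps_X) * fps_scale Q (poch_fps a)) (Suc k) =
          Q ^ Suc k * fps_nth (poch_fps a) (Suc k) - a * (Q ^ k * fps_nth (poch_fps a) k)"
      by (simp add: left_diff_distrib mult.assoc)
    thus ?thesis using poch_fps_Suc[of a k] unfolding Suc right_diff_distrib by (simp add: mult_ac diff_eq_eq)
  qed (simp add: fps_mult_nth)
qed

lemma norm_one_minus_Q: "1 - q \<le> norm (1 - Q ^ Suc n)"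
proof -
  have "1 - Q ^ Suc n = of_real (1 - q ^ Suc n)" by simp
  hence "norm (1 - Q ^ Suc n) = \<bar>1 - q ^ Suc n\<bar>" by (metis norm_of_real)
  moreover have "q ^ Suc n \<le> q" using power_decreasing[of 1 "Suc n" q] q0 q1 by simp
  ultimately show ?thesis by linarith
qed

lemma poch_fps_conv [simp]: "fps_conv_radius (poch_fps a) = \<infinity>"
proof (rule gauss_fps_conv_radius)
  let ?p = "\<lambda>n. norm (fps_nth (poch_fps a) n)"
  show "?p n \<le> 1 * (norm a / (1 - q)) ^ n * q ^ (n * (n - 1) div 2)" for n
  proof -
    have "?p (Suc n) \<le> norm a / (1 - q) * q ^ n * ?p n" for n
    proof -
      have "?p (Suc n) * (1 - q) \<le> ?p (Suc n) * norm (1 - Q ^ Suc n)"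
        by (intro mult_left_mono norm_one_minus_Q) auto
      also have "\<dots> = norm a * q ^ n * ?p n"
        unfolding norm_mult[symmetric] poch_fps_Suc using q0 by (simp add: norm_mult norm_power)
      finally show ?thesis using q1 by (simp add: field_simps)
    qed
    from gauss_rec_bound[of ?p, OF this] show ?thesis using q1 by simp
  qed
qed (use q1 in auto)

lemma tendsto_Q_pow: "(\<lambda>n. Q ^ n * a) \<longlonglongrightarrow> 0"
  using tendsto_mult_left_zero[OF LIMSEQ_power_zero[of Q]] q0 q1 by simp

lemma qpoch_has_prod: "(\<lambda>l. 1 - a * Q ^ l) has_prod qpoch q a"
  unfolding qpoch_def
proof (rule convergent_prod_has_prod, rule abs_convergent_prod_imp_convergent_prod,
    subst abs_convergent_prod_conv_summable)
  show "summable (\<lambda>i. norm (1 - a * Q ^ i - 1))"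
    using q0 q1 by (auto simp: norm_mult norm_power intro!: summable_mult summable_geometric)
qed

lemma eval_poch_fps_rec: "eval_fps (poch_fps a) z = (1 - a * z) * eval_fps (poch_fps a) (Q * z)"
proof -
  have r: "fps_conv_radius (fps_scale Q (poch_fps a)) = \<infinity>"
    unfolding fps_conv_radius_def
  proof (rule conv_radius_inftyI'')
    fix z :: complex
    have "summable (\<lambda>n. fps_nth (poch_fps a) n * (Q * z) ^ n)"
      by (rule summable_fps) simp
    thus "summable (\<lambda>n. fps_nth (fps_scale Q (poch_fps a)) n * z ^ n)"
      by (simp add: power_mult_distrib mult_ac)
  qed
  have r2: "fps_conv_radius (1 - fps_const a * fps_X) = \<infinity>"
    using fps_conv_radius_fps_of_poly[of "[:1, -a:]"] by (simp add: fps_of_poly_pCons fps_of_poly_const mult_ac flip: fps_const_neg)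
  have "eval_fps (poch_fps a) z = eval_fps ((1 - fps_const a * fps_X) * fps_scale Q (poch_fps a)) z"
    by (subst poch_fps_rec) simp
  also have "\<dots> = eval_fps (1 - fps_const a * fps_X) z * eval_fps (poch_fps a) (Q * z)"
    by (subst eval_fps_mult) (use r r2 in \<open>auto simp: eval_fps_scale\<close>)
  also have "eval_fps (1 - fps_const a * fps_X) z = eval_fps (fps_of_poly [:1, -a:]) z"
    by (simp add: fps_of_poly_pCons fps_of_poly_const mult_ac flip: fps_const_neg)
  also have "\<dots> = 1 - a * z" by (simp add: eval_fps_of_poly)
  finally show ?thesis .
qed

text \<open>Iterating the functional equation pushes the argument to Q^n z, where the series tends
  to its constant term 1. What remains is the product that defines \<open>qpoch\<close>.\<close>

lemma qpoch_eval: "qpoch q (a * z) = eval_fps (poch_fps a) z"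
proof -
  have *: "eval_fps (poch_fps a) z = (\<Prod>l<n. 1 - a * z * Q ^ l) * eval_fps (poch_fps a) (Q ^ n * z)" for n
  proof (induction n)
    case (Suc n)
    show ?case by (subst Suc, subst eval_poch_fps_rec) (simp add: mult_ac)
  qed auto
  have "(\<lambda>n. eval_fps (poch_fps a) (Q ^ n * z)) \<longlonglongrightarrow> eval_fps (poch_fps a) 0"
  proof (rule isCont_tendsto_compose[OF _ tendsto_Q_pow])
    show "isCont (eval_fps (poch_fps a)) 0"
      by (rule continuous_eval_fps) auto
  qed
  hence "(\<lambda>n. (\<Prod>l<n. 1 - a * z * Q ^ l) * eval_fps (poch_fps a) (Q ^ n * z)) \<longlonglongrightarrow> qpoch q (a * z) * 1"
    by (intro tendsto_mult has_prod_imp_tendsto' qpoch_has_prod) (simp add: eval_fps_at_0)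
  hence "(\<lambda>n. eval_fps (poch_fps a) z) \<longlonglongrightarrow> qpoch q (a * z)"
    unfolding *[symmetric] by simp
  thus ?thesis using LIMSEQ_unique tendsto_const by blast
qed

lemma qpoch_eval1: "qpoch q z = eval_fps (poch_fps 1) z"
  using qpoch_eval[of 1 z] by simp

lemma qpoch_tendsto: "(\<lambda>n. \<Prod>l<n. 1 - a * Q ^ l) \<longlonglongrightarrow> qpoch q a"
  by (rule has_prod_imp_tendsto'[OF qpoch_has_prod])

lemma qpoch_rec: "qpoch q a = (1 - a) * qpoch q (Q * a)"
  unfolding qpoch_eval1 by (subst eval_poch_fps_rec) simp

lemma qpoch_0 [simp]: "qpoch q 0 = 1"
  by (simp add: qpoch_eval1 eval_fps_at_0)

lemma qpoch_eq_0_iff: "qpoch q a = 0 \<longleftrightarrow> (\<exists>n. a * Q ^ n = 1)"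
  using has_prod_eq_0_iff[OF qpoch_has_prod[of a]] by (auto simp: image_iff)

lemma qpoch_Q_nz [simp]: "qpoch q Q \<noteq> 0"
  unfolding qpoch_eq_0_iff using Q_pow_ne_1 by (metis power_Suc zero_less_Suc)

lemma qpoch_holomorphic [holomorphic_intros]:
  "f holomorphic_on S \<Longrightarrow> (\<lambda>x. qpoch q (f x)) holomorphic_on S"
  using holomorphic_on_compose_gen[of f S "eval_fps (poch_fps 1)" UNIV] holomorphic_on_eval_fps[of UNIV "poch_fps 1"]
  unfolding qpoch_eval1 by (auto simp: o_def)

lemma qpoch_analytic [analytic_intros]:
  "f analytic_on S \<Longrightarrow> (\<lambda>x. qpoch q (f x)) analytic_on S"
  using analytic_on_compose_gen[of f S "eval_fps (poch_fps 1)" UNIV] holomorphic_on_eval_fps[of UNIV "poch_fps 1"]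
  unfolding qpoch_eval1 by (auto simp: o_def analytic_on_open)

lemma qpoch_isCont: "isCont (qpoch q) a"
  using holomorphic_on_imp_continuous_on[OF qpoch_holomorphic[OF holomorphic_on_ident[of UNIV]]]
  by (simp add: continuous_on_eq_continuous_at)

lemma qfact_eq: "qfact n = (\<Prod>l<n. 1 - Q * Q ^ l)"
  by (induction n) auto

lemma qfact_tendsto: "qfact \<longlonglongrightarrow> qpoch q Q"
  using qpoch_tendsto[of Q] unfolding qfact_eq[abs_def] .

subsection \<open>The theta function\<close>

lemma qtheta_has_sum:
  "z \<noteq> 0 \<Longrightarrow> ((\<lambda>m::int. Q powi (m * (m - 1) div 2) * z powi m) has_sum qtheta q z) UNIV"
  using gauss_laurent_summable[of "\<lambda>_. 1" 1 1 z] unfolding qtheta_def by simp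

lemma qtheta_holomorphic0: "qtheta q holomorphic_on - {0}"
  using gauss_laurent_holomorphic[of "\<lambda>_. 1" 1 1] unfolding qtheta_def[abs_def] by simp

lemma qtheta_holomorphic [holomorphic_intros]:
  assumes "f holomorphic_on S" "\<And>x. x \<in> S \<Longrightarrow> f x \<noteq> 0"
  shows "(\<lambda>x. qtheta q (f x)) holomorphic_on S"
proof -
  have "f ` S \<subseteq> - {0}" using assms(2) by auto
  thus ?thesis using holomorphic_on_compose_gen[OF assms(1) qtheta_holomorphic0] by (simp add: o_def)
qed

lemma qtheta_analytic [analytic_intros]:
  assumes "f analytic_on S" "\<And>x. x \<in> S \<Longrightarrow> f x \<noteq> 0"
  shows "(\<lambda>x. qtheta q (f x)) analytic_on S"
proof -
  have "qtheta q analytic_on - {0}" by (subst analytic_on_open) (auto intro: qtheta_holomorphic0)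
  moreover have "f z \<in> - {0}" if "z \<in> S" for z using assms(2) that by simp
  ultimately show ?thesis using analytic_on_compose_gen[OF assms(1), of "qtheta q" "- {0}"] by (simp add: o_def)
qed

text \<open>Reindexing by k splits the Gaussian exponent by \<open>tri_int_add\<close>. All
  multipliers of quasi-periodic functions below derive from this.\<close>

lemma qtheta_powi:
  assumes z: "z \<noteq> 0"
  shows "qtheta q (z * Q powi k) = Q powi (- (k * (k - 1) div 2)) * z powi (- k) * qtheta q z"
proof -
  have "((\<lambda>m::int. Q powi ((m + k) * (m + k - 1) div 2) * z powi (m + k)) has_sum qtheta q z) UNIV"
    by (rule has_sum_reindex_bij_witness[THEN iffD1, OF _ _ _ _ _ _ qtheta_has_sum[OF z], of "\<lambda>m. m + k" "\<lambda>m. m - k"]) auto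
  hence "((\<lambda>m::int. Q powi (- (k * (k - 1) div 2)) * z powi (- k) * (Q powi ((m + k) * (m + k - 1) div 2) * z powi (m + k))) has_sum
      (Q powi (- (k * (k - 1) div 2)) * z powi (- k) * qtheta q z)) UNIV"
    by (rule has_sum_cmult_right)
  moreover have "Q powi (- (k * (k - 1) div 2)) * z powi (- k) * (Q powi ((m + k) * (m + k - 1) div 2) * z powi (m + k)) =
      Q powi (m * (m - 1) div 2) * (z * Q powi k) powi m" for m :: int
    unfolding tri_int_add using z
    by (simp add: power_int_add power_int_minus power_int_mult_distrib mult_ac flip: power_int_mult)
  moreover have "((\<lambda>m::int. Q powi (m * (m - 1) div 2) * (z * Q powi k) powi m) has_sum qtheta q (z * Q powi k)) UNIV"
    using z by (intro qtheta_has_sum) simp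
  ultimately show ?thesis using has_sum_unique by fastforce
qed

lemma qtheta_Q: "z \<noteq> 0 \<Longrightarrow> qtheta q (Q * z) = qtheta q z / z"
  using qtheta_powi[of z 1] by (simp add: mult.commute power_int_minus divide_inverse)

lemma qtheta_refl:
  assumes z: "z \<noteq> 0" shows "qtheta q (Q / z) = qtheta q z"
proof -
  have "((\<lambda>m::int. Q powi ((- m) * (- m - 1) div 2) * z powi (- m)) has_sum qtheta q z) UNIV"
    by (rule has_sum_reindex_bij_witness[THEN iffD1, OF _ _ _ _ _ _ qtheta_has_sum[OF z], of uminus uminus]) auto
  moreover have "Q powi ((- m) * (- m - 1) div 2) * z powi (- m) = Q powi (m * (m - 1) div 2) * (Q / z) powi m" for m :: int
    unfolding tri_int_uminus using z by (simp add: power_int_add power_int_minus power_int_divide_distrib field_simps)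
  moreover have "((\<lambda>m::int. Q powi (m * (m - 1) div 2) * (Q / z) powi m) has_sum qtheta q (Q / z)) UNIV"
    using z by (intro qtheta_has_sum) simp
  ultimately show ?thesis using has_sum_unique by fastforce
qed

lemma qtheta_inverse: "z \<noteq> 0 \<Longrightarrow> qtheta q (1 / z) = qtheta q z / z"
  using qtheta_Q[of "1 / z"] qtheta_refl[of z] by (simp add: field_simps)

text \<open>The reciprocal of (q; q)_k. Its value 0 at negative k is forced by
  \<open>rqfact_rec\<close>, first at k = -1.\<close>

definition rqfact :: "int \<Rightarrow> complex" where
  "rqfact k = (if k \<ge> 0 then 1 / qfact (nat k) else 0)"

lemma rqfact_rec: "rqfact (k + 1) = rqfact k + Q powi (k + 1) * rqfact (k + 1)"
proof (cases "k \<ge> 0")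
  case True
  then obtain n where [simp]: "k = int n" using nonneg_int_cases by blast
  have [simp]: "nat (1 + int n) = Suc n" by simp
  have "Q powi (int n + 1) = Q ^ Suc n" by (metis of_nat_Suc add.commute power_int_of_nat)
  thus ?thesis using one_minus_Q[of n] by (simp add: rqfact_def field_simps del: one_minus_Q)
next
  case False
  thus ?thesis by (cases "k = -1") (auto simp: rqfact_def)
qed

text \<open>Interpolates between Euler's expansion, N = 0, and the triple product, N \<rightarrow>
  \<infinity>. Multiplication by the factor 1 + Q^(N + 1) / z adds a copy of the series shifted by
  one, and the coefficients recombine by \<open>rqfact_rec\<close>.\<close>

lemma finite_triple_product:
  assumes z: "z \<noteq> 0"
  shows "((\<lambda>m::int. rqfact (m + int N) * (Q powi (m * (m - 1) div 2) * z powi m)) has_sum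
     (\<Prod>k<N. 1 - (- Q / z) * Q ^ k) * qpoch q (- z)) UNIV"
proof (induction N)
  case 0
  have s: "(\<lambda>n. fps_nth (poch_fps (-1)) n * z ^ n) sums qpoch q (- z)"
    using sums_eval_fps[of z "poch_fps (-1)"] qpoch_eval[of "-1" z] by simp
  have "summable (\<lambda>n. norm (fps_nth (poch_fps (-1)) n * z ^ n))"
    by (rule norm_summable_fps) simp
  from norm_summable_imp_has_sum[OF this s]
  have "((\<lambda>n. fps_nth (poch_fps (-1)) n * z ^ n) has_sum qpoch q (- z)) UNIV" .
  also have "(\<lambda>n. fps_nth (poch_fps (-1)) n * z ^ n) = 
     (\<lambda>m::int. rqfact m * (Q powi (m * (m - 1) div 2) * z powi m)) \<circ> int"
    by (rule ext) (simp only: o_def tri_int_nat, simp add: poch_fps_def rqfact_def)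
  finally have "((\<lambda>m::int. rqfact m * (Q powi (m * (m - 1) div 2) * z powi m)) has_sum qpoch q (- z)) (range int)"
    by (subst has_sum_reindex) (auto simp: inj_on_def o_def)
  hence "((\<lambda>m::int. rqfact m * (Q powi (m * (m - 1) div 2) * z powi m)) has_sum qpoch q (- z)) UNIV"
    by (rule has_sum_cong_neutral[THEN iffD1, rotated -1])
       (auto simp: rqfact_def image_iff, metis nat_0_le)
  thus ?case by simp
next
  case (Suc N)
  let ?f = "\<lambda>m::int. rqfact (m + int N) * (Q powi (m * (m - 1) div 2) * z powi m)"
  have "(?f has_sum (\<Prod>k<N. 1 - (- Q / z) * Q ^ k) * qpoch q (- z)) UNIV" by fact
  hence "((\<lambda>m. ?f (m + 1)) has_sum (\<Prod>k<N. 1 - (- Q / z) * Q ^ k) * qpoch q (- z)) UNIV"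
    by (rule has_sum_reindex_bij_witness[THEN iffD1, rotated -1, of _ _ _ "\<lambda>m. m + 1" "\<lambda>m. m - 1"]) auto
  from has_sum_add[OF Suc has_sum_cmult_right[OF this, of "Q ^ Suc N / z"]]
  have "((\<lambda>m. ?f m + Q ^ Suc N / z * ?f (m + 1)) has_sum
        (\<Prod>k<Suc N. 1 - (- Q / z) * Q ^ k) * qpoch q (- z)) UNIV"
    by (simp add: algebra_simps)
  also have "(\<lambda>m. ?f m + Q ^ Suc N / z * ?f (m + 1)) =
     (\<lambda>m::int. rqfact (m + int (Suc N)) * (Q powi (m * (m - 1) div 2) * z powi m))"
  proof
    fix m :: int
    have 1: "Q powi ((m + 1) * (m + 1 - 1) div 2) = Q powi (m * (m - 1) div 2) * Q powi m"
      using tri_int_Suc[of m] by (simp add: power_int_add)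
    have 2: "rqfact (m + int (Suc N)) = rqfact (m + int N) + Q powi (m + int (Suc N)) * rqfact (m + int (Suc N))"
      using rqfact_rec[of "m + int N"] by (simp add: algebra_simps)
    have 3: "Q powi (m + int (Suc N)) = Q powi m * Q ^ Suc N"
      by (simp add: power_int_add power_int_of_nat del: of_nat_Suc power_Suc)
    have 4: "m + 1 + int N = m + int (Suc N)" by simp
    have 5: "z powi (m + 1) / z = z powi m" using z by (simp add: power_int_add)
    have "?f m + Q ^ Suc N / z * ?f (m + 1) = (rqfact (m + int N) + Q powi (m + int (Suc N)) * rqfact (m + int (Suc N))) *
       (Q powi (m * (m - 1) div 2) * z powi m)"
      unfolding 1 3 4 5[symmetric] by (simp add: algebra_simps)
    thus "?f m + Q ^ Suc N / z * ?f (m + 1) = rqfact (m + int (Suc N)) * (Q powi (m * (m - 1) div 2) * z powi m)"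
      unfolding 2[symmetric] .
  qed
  finally show ?case .
qed

text \<open>The coefficients 1 / (q; q)_(m + N) stay bounded and tend to 1 / (q; q)_\<infinity> as N
  grows, so the limit passes under the sum in \<open>finite_triple_product\<close>.\<close>

theorem jacobi_triple_product:
  assumes z: "z \<noteq> 0"
  shows "qtheta q z = qpoch q Q * qpoch q (- z) * qpoch q (- Q / z)"
proof -
  have "convergent (\<lambda>n. 1 / qfact n)"
    using tendsto_divide[OF tendsto_const qfact_tendsto] convergentI by fastforce
  then obtain B where B: "\<And>n. norm (1 / qfact n) \<le> B"
    using convergent_imp_Bseq BseqD by metis
  have B0: "B \<ge> 0" using B[of 0] by simp
  have bd: "norm (rqfact k) \<le> B" for k using B B0 by (simp add: rqfact_def)
  let ?g = "\<lambda>m::int. Q powi (m * (m - 1) div 2) * z powi m"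
  have lim: "(\<lambda>N. rqfact (m + int N)) \<longlonglongrightarrow> 1 / qpoch q Q" for m
  proof -
    have "filterlim (\<lambda>N. nat (m + int N)) at_top sequentially"
      by (rule filterlim_at_top_mono[OF filterlim_minus_const_nat_at_top[of "nat \<bar>m\<bar>"]])
        (auto intro!: always_eventually)
    hence "(\<lambda>N. 1 / qfact (nat (m + int N))) \<longlonglongrightarrow> 1 / qpoch q Q"
      by (intro tendsto_intros filterlim_compose[OF qfact_tendsto]) auto
    moreover have "eventually (\<lambda>N. rqfact (m + int N) = 1 / qfact (nat (m + int N))) sequentially"
      using eventually_ge_at_top[of "nat \<bar>m\<bar>"] by eventually_elim (auto simp: rqfact_def)
    ultimately show ?thesis using tendsto_cong by fast
  qed
  have gs: "(\<lambda>m. norm (?g m)) summable_on UNIV"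
  proof -
    have "(\<lambda>m. norm z powi m * q powi (m * (m - 1) div 2)) summable_on UNIV"
      using gauss_int[of "norm z"] z by simp
    thus ?thesis using q0 by (simp add: norm_mult norm_power_int mult_ac)
  qed
  have "(\<lambda>N. \<Sum>\<^sub>\<infinity>m. rqfact (m + int N) * ?g m) \<longlonglongrightarrow> (\<Sum>\<^sub>\<infinity>m. 1 / qpoch q Q * ?g m)"
  proof (rule tendsto_infsum_dominated)
    show "(\<lambda>N. rqfact (m + int N) * ?g m) \<longlonglongrightarrow> 1 / qpoch q Q * ?g m" for m
      by (intro tendsto_intros lim)
    show "norm (rqfact (m + int N) * ?g m) \<le> B * norm (?g m)" for m N
      unfolding norm_mult by (intro mult_right_mono bd[unfolded norm_mult]) auto
    show "(\<lambda>m. B * norm (?g m)) summable_on UNIV" by (intro summable_on_cmult_right gs)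
  qed auto
  also have "(\<lambda>N. \<Sum>\<^sub>\<infinity>m. rqfact (m + int N) * ?g m) = (\<lambda>N. (\<Prod>k<N. 1 - (- Q / z) * Q ^ k) * qpoch q (- z))"
    using infsumI[OF finite_triple_product[OF z]] by simp
  also have "(\<Sum>\<^sub>\<infinity>m. 1 / qpoch q Q * ?g m) = 1 / qpoch q Q * qtheta q z"
    unfolding qtheta_def by (intro infsum_cmult_right' )
  finally have "(\<lambda>N. (\<Prod>k<N. 1 - (- Q / z) * Q ^ k) * qpoch q (- z)) \<longlonglongrightarrow> 1 / qpoch q Q * qtheta q z" .
  moreover have "(\<lambda>N. (\<Prod>k<N. 1 - (- Q / z) * Q ^ k) * qpoch q (- z)) \<longlonglongrightarrow> qpoch q (- Q / z) * qpoch q (- z)"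
    by (intro tendsto_intros qpoch_tendsto)
  ultimately have "1 / qpoch q Q * qtheta q z = qpoch q (- Q / z) * qpoch q (- z)"
    using LIMSEQ_unique by blast
  thus ?thesis by (simp add: field_simps)
qed

lemma qtheta_neg: "x \<noteq> 0 \<Longrightarrow> qtheta q (- x) = qpoch q Q * qpoch q x * qpoch q (Q / x)"
  using jacobi_triple_product[of "- x"] by simp

lemma qspiral_iff: "x \<in> qspiral q a \<longleftrightarrow> (\<exists>k::int. x = a * Q powi k)"
  by (auto simp: qspiral_def)

lemma qtheta_neg_eq_0_iff:
  assumes x: "x \<noteq> 0"
  shows "qtheta q (- x) = 0 \<longleftrightarrow> (\<exists>k::int. x = Q powi k)"
proof
  assume "qtheta q (- x) = 0"
  hence "qpoch q x = 0 \<or> qpoch q (Q / x) = 0" using qtheta_neg[OF x] qpoch_Q_nz by simp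
  then consider n where "x * Q ^ n = 1" | n where "Q / x * Q ^ n = 1"
    unfolding qpoch_eq_0_iff by blast
  thus "\<exists>k::int. x = Q powi k"
  proof cases
    case 1 hence "x = Q powi (- int n)" by (simp add: power_int_minus field_simps)
    thus ?thesis by blast
  next
    case 2 hence "x = Q ^ Suc n" using x by (simp add: field_simps)
    hence "x = Q powi int (Suc n)" by (metis power_int_of_nat)
    thus ?thesis by blast
  qed
next
  assume "\<exists>k::int. x = Q powi k"
  then obtain k :: int where k: "x = Q powi k" ..
  show "qtheta q (- x) = 0"
  proof (cases "k \<ge> 1")
    case True
    hence "k = int (Suc (nat (k - 1)))" by simp
    then obtain n where "k = int (Suc n)" by blast
    hence "Q / x * Q ^ n = 1" using k by (simp add: power_int_of_nat del: of_nat_Suc)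
    thus ?thesis using x by (auto simp: qtheta_neg qpoch_eq_0_iff)
  next
    case False
    hence "k = - int (nat (- k))" by simp
    then obtain n where "k = - int n" by blast
    hence "x * Q ^ n = 1" using k by (simp add: power_int_minus)
    thus ?thesis using x by (auto simp: qtheta_neg qpoch_eq_0_iff)
  qed
qed

lemma qtheta_eq_0_iff: "a \<noteq> 0 \<Longrightarrow> x \<noteq> 0 \<Longrightarrow> qtheta q (- x / a) = 0 \<longleftrightarrow> x \<in> qspiral q a"
  using qtheta_neg_eq_0_iff[of "x / a"] by (simp add: qspiral_iff field_simps)

lemma qtheta_mult_eq_0_iff: "a \<noteq> 0 \<Longrightarrow> x \<noteq> 0 \<Longrightarrow> qtheta q (a * x) = 0 \<longleftrightarrow> x \<in> qspiral q (- 1 / a)"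
  using qtheta_eq_0_iff[of "-1 / a" x] by (simp add: mult.commute)

subsection \<open>Functions on the punctured plane with a quasi-period\<close>

text \<open>Isolates the one factor that vanishes at x = a q^k. The others have the value (q;
  q)_\<infinity> or are powers of nonzero numbers there, so the zeros of theta are simple.\<close>

lemma qtheta_neg_at_spiral:
  assumes a: "a \<noteq> 0" and x: "x \<noteq> 0"
  shows "qtheta q (- x / a) = Q powi (- (k * (k - 1) div 2)) * (- x / (a * Q powi k)) powi (- k) *
     (qpoch q Q * (1 - x / (a * Q powi k)) * qpoch q (Q * (x / (a * Q powi k))) * qpoch q (Q / (x / (a * Q powi k))))"
proof -
  let ?y = "x / (a * Q powi k)"
  have y: "?y \<noteq> 0" using a x by simp
  have "- x / a = (- ?y) * Q powi k" using a by simp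
  hence "qtheta q (- x / a) = Q powi (- (k * (k - 1) div 2)) * (- ?y) powi (- k) * qtheta q (- ?y)"
    using qtheta_powi[of "- ?y" k] y by simp
  also have "qtheta q (- ?y) = qpoch q Q * qpoch q ?y * qpoch q (Q / ?y)"
    using qtheta_neg[OF y] by simp
  also have "qpoch q ?y = (1 - ?y) * qpoch q (Q * ?y)" by (rule qpoch_rec)
  finally show ?thesis by (simp add: mult_ac)
qed

lemma countable_qspiral: "countable (qspiral q a)"
  unfolding qspiral_def by (intro countable_image) auto

lemma connected_punctured_plane [simp]: "connected (- {0::complex})"
  by (intro connected_punctured_universe) auto

text \<open>A spiral is the zero set of a theta function. By the dichotomy for meromorphic functions
  it is discrete in the punctured plane, unless theta vanishes off a sparse set, which would make
  the plane countable.\<close>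

lemma qspiral_cosparse:
  assumes a: "a \<noteq> 0"
  shows "\<forall>\<^sub>\<approx>z\<in>- {0}. z \<notin> qspiral q a"
proof -
  have h: "(\<lambda>y. qtheta q (- y / a)) holomorphic_on - {0}" using a by (intro holomorphic_intros) auto
  hence an: "(\<lambda>y. qtheta q (- y / a)) analytic_on - {0}" by (simp add: analytic_on_open open_Compl)
  have "eventually (\<lambda>z. qtheta q (- z / a) = 0) (cosparse (- {0})) \<or>
        eventually (\<lambda>z. qtheta q (- z / a) \<noteq> 0) (cosparse (- {0}))"
    by (rule meromorphic_imp_constant_or_avoid[OF analytic_on_imp_meromorphic_on[OF an]]) auto
  moreover have "\<not> eventually (\<lambda>z. qtheta q (- z / a) = 0) (cosparse (- {0}))"
  proof
    assume "eventually (\<lambda>z. qtheta q (- z / a) = 0) (cosparse (- {0}))"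
    moreover have "eventually (\<lambda>z::complex. z \<in> - {0}) (cosparse (- {0}))" by (intro eventually_in_cosparse) auto
    ultimately have "eventually (\<lambda>z. z \<in> qspiral q a) (cosparse (- {0}))"
      by eventually_elim (use qtheta_eq_0_iff[OF a] in auto)
    hence "{z. z \<notin> qspiral q a} sparse_in (- {0})" by (simp add: eventually_cosparse)
    hence "countable ((- {0}) \<inter> {z. z \<notin> qspiral q a})" by (intro sparse_imp_countable) auto
    hence "countable (((- {0}) \<inter> {z. z \<notin> qspiral q a}) \<union> (qspiral q a \<union> {0}))"
      by (intro countable_Un countable_qspiral) auto
    moreover have "((- {0}) \<inter> {z. z \<notin> qspiral q a}) \<union> (qspiral q a \<union> {0}) = UNIV" by auto
    ultimately have "countable (UNIV :: complex set)" by (simp only:)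
    thus False using uncountable_UNIV_complex by blast
  qed
  ultimately have "eventually (\<lambda>z. qtheta q (- z / a) \<noteq> 0) (cosparse (- {0}))" by blast
  moreover have "eventually (\<lambda>z::complex. z \<in> - {0}) (cosparse (- {0}))" by (intro eventually_in_cosparse) auto
  ultimately show ?thesis by eventually_elim (use qtheta_eq_0_iff[OF a] in auto)
qed

text \<open>Since the zeros of theta are simple, a zero of f at each of them makes all singularities
  of the quotient removable.\<close>

lemma theta_divides:
  assumes f: "f holomorphic_on - {0}" and a: "a \<noteq> 0" and z: "\<And>x. x \<in> qspiral q a \<Longrightarrow> f x = 0"
  obtains g where "g holomorphic_on - {0}" "\<And>x. x \<noteq> 0 \<Longrightarrow> f x = qtheta q (- x / a) * g x"
proof -
  define h where "h = (\<lambda>x. f x / qtheta q (- x / a))"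
  have fa: "f analytic_on - {0}" using f by (simp add: analytic_on_open open_Compl)
  have ta: "(\<lambda>x. qtheta q (- x / a)) analytic_on - {0}"
    by (intro analytic_intros) (use a in auto)
  have mero: "h meromorphic_on - {0}" unfolding h_def
    by (intro meromorphic_intros analytic_on_imp_meromorphic_on fa ta)
  have ana: "remove_sings h analytic_on {x}" if x: "x \<noteq> 0" for x
  proof (cases "x \<in> qspiral q a")
    case False
    hence "h analytic_on {x}" unfolding h_def
      using x a qtheta_eq_0_iff[OF a x]
      by (intro analytic_on_divide analytic_on_subset[OF fa] analytic_on_subset[OF ta]) auto
    thus ?thesis by (rule remove_sings_analytic_on)
  next
    case True
    then obtain k :: int where k: "x = a * Q powi k" by (auto simp: qspiral_iff)
    have iso: "isolated_singularity_at h x"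
      using mero x by (auto intro: meromorphic_on_isolated_singularity meromorphic_on_subset)
    have "f field_differentiable at x"
      using f x by (intro holomorphic_on_imp_differentiable_at[of f "- {0}"]) auto
    then obtain D where "(f has_field_derivative D) (at x)" by (auto simp: field_differentiable_def)
    hence D: "((\<lambda>y. (f y - f x) / (y - x)) \<longlongrightarrow> D) (at x)" by (simp add: has_field_derivative_iff)
    \<comment> \<open>The cofactor of 1 - y / x in theta. Near x the quotient h is, up to the factor
      - x, the difference quotient of f divided by u, hence has a finite limit.\<close>
    define u where "u = (\<lambda>y. Q powi (- (k * (k - 1) div 2)) * (- y / x) powi (- k) *
       (qpoch q Q * qpoch q (Q * (y / x)) * qpoch q (Q / (y / x))))"
    have "u holomorphic_on - {0}" unfolding u_def using x by (intro holomorphic_intros) auto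
    hence "isCont u x" using x
      by (intro continuous_on_interior[OF holomorphic_on_imp_continuous_on]) (auto simp: interior_open open_Compl)
    hence u: "(u \<longlongrightarrow> u x) (at x)" by (simp add: isCont_def)
    have u0: "u x \<noteq> 0" unfolding u_def using x qpoch_Q_nz by simp
    have "((\<lambda>y. - x * ((f y - f x) / (y - x)) / u y) \<longlongrightarrow> - x * D / u x) (at x)"
      by (intro tendsto_intros D u u0)
    moreover have "eventually (\<lambda>y. y \<in> - {0} - {x}) (at x)"
      using x by (intro eventually_at_in_open) auto
    hence "eventually (\<lambda>y. - x * ((f y - f x) / (y - x)) / u y = h y) (at x)"
    proof eventually_elim
      case (elim y)
      have "qtheta q (- y / a) = (1 - y / x) * u y"
        using qtheta_neg_at_spiral[OF a, of y k] elim unfolding u_def k[symmetric] by (simp add: mult_ac)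
      moreover have "f x = 0" using z True by simp
      moreover have "1 - y / x = - (y - x) / x" using x by (simp add: field_simps)
      moreover have "- x * (F / d) / U = F / (- d / x * U)" for F d U :: complex using x by (simp add: divide_simps)
      ultimately show ?case unfolding h_def by (metis diff_zero)
    qed
    ultimately have "(h \<longlongrightarrow> - x * D / u x) (at x)"
      using tendsto_cong by fast
    thus ?thesis by (rule remove_sings_analytic_at[OF iso])
  qed
  hence "remove_sings h analytic_on - {0}" by (subst analytic_on_analytic_at) auto
  hence "remove_sings h holomorphic_on - {0}" by (rule analytic_imp_holomorphic)
  moreover have "f x = qtheta q (- x / a) * remove_sings h x" if x: "x \<noteq> 0" for x
  proof (cases "x \<in> qspiral q a")
    case False
    hence "h analytic_on {x}" unfolding h_def
      using x a qtheta_eq_0_iff[OF a x]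
      by (intro analytic_on_divide analytic_on_subset[OF fa] analytic_on_subset[OF ta]) auto
    hence "remove_sings h x = h x" by simp
    thus ?thesis using False qtheta_eq_0_iff[OF a x] by (simp add: h_def)
  qed (use z qtheta_eq_0_iff[OF a x] in auto)
  ultimately show ?thesis using that by blast
qed

text \<open>The closed annulus between the radii q and 1 meets every orbit of multiplication by Q,
  so a bound on this compact set controls a quasi-periodic function near 0.\<close>

lemma annulus_scale:
  assumes x: "norm x \<le> 1" "x \<noteq> 0"
  obtains n w where "x = Q ^ n * w" "q \<le> norm w" "norm w \<le> 1" "norm x \<le> q ^ n"
proof -
  have "(\<lambda>n. q ^ n) \<longlonglongrightarrow> 0" by (rule LIMSEQ_realpow_zero) (use q0 q1 in auto)
  hence "eventually (\<lambda>n. q ^ n < norm x) sequentially" using x(2) by (intro order_tendstoD) auto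
  then obtain n0 where n0: "q ^ n0 < norm x" by (auto simp: eventually_sequentially)
  define n where "n = (LEAST n. q ^ n < norm x)"
  have n: "q ^ n < norm x" unfolding n_def using n0 by (rule LeastI)
  have "n \<noteq> 0" using n x by (cases n) auto
  then obtain k where k: "n = Suc k" by (cases n) auto
  have k2: "norm x \<le> q ^ k" using not_less_Least[of k "\<lambda>n. q ^ n < norm x"] k n_def by force
  show ?thesis
  proof (rule that[of k "x / Q ^ k"])
    show "q \<le> norm (x / Q ^ k)" using n k q0 by (simp add: norm_divide norm_power pos_le_divide_eq)
    show "norm (x / Q ^ k) \<le> 1" using k2 q0 by (simp add: norm_divide norm_power)
  qed (use k2 in auto)
qed

text \<open>Multiplication by x^k makes the multiplier contracting, so the singularity at 0 becomes
  removable. Comparing Taylor coefficients then allows a nonzero one only if the multiplier is a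
  power of Q.\<close>

lemma quasi_periodic_0:
  assumes f: "f holomorphic_on - {0}" and qp: "\<And>x. x \<noteq> 0 \<Longrightarrow> f (Q * x) = \<kappa> * f x"
    and \<kappa>: "\<And>k::int. \<kappa> \<noteq> Q powi k" and x: "x \<noteq> 0"
  shows "f x = 0"
proof -
  obtain k :: nat where k: "norm \<kappa> * q ^ k < 1"
  proof -
    have "(\<lambda>k. norm \<kappa> * q ^ k) \<longlonglongrightarrow> norm \<kappa> * 0"
      by (intro tendsto_intros LIMSEQ_realpow_zero) (use q0 q1 in auto)
    hence "eventually (\<lambda>k. norm \<kappa> * q ^ k < 1) sequentially" by (intro order_tendstoD) auto
    thus ?thesis using that by (auto simp: eventually_sequentially)
  qed
  define \<rho> where "\<rho> = \<kappa> * Q ^ k"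
  define g where "g = (\<lambda>x. x ^ k * f x)"
  have \<rho>: "norm \<rho> < 1" using k q0 by (simp add: \<rho>_def norm_mult norm_power)
  have gq: "g (Q ^ n * y) = \<rho> ^ n * g y" if "y \<noteq> 0" for n y
  proof (induction n)
    case (Suc n)
    have "g (Q ^ Suc n * y) = \<rho> * g (Q ^ n * y)"
      using qp[of "Q ^ n * y"] that by (simp add: g_def \<rho>_def power_mult_distrib mult_ac)
    thus ?case using Suc by simp
  qed auto
  have gh: "g holomorphic_on - {0}" unfolding g_def by (intro holomorphic_intros f)
  let ?K = "cball 0 1 - ball (0::complex) q"
  have "compact ?K" by (intro compact_diff) auto
  moreover have "continuous_on ?K g"
    by (rule holomorphic_on_imp_continuous_on[OF holomorphic_on_subset[OF gh]]) (use q0 in auto)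
  ultimately have "bounded (g ` ?K)" by (intro compact_imp_bounded compact_continuous_image)
  then obtain B where B: "B > 0" "\<And>w. w \<in> ?K \<Longrightarrow> norm (g w) \<le> B" by (auto simp: bounded_pos)
  have lim: "(g \<longlongrightarrow> 0) (at 0)"
  proof (rule tendstoI)
    fix e :: real assume e: "e > 0"
    have "(\<lambda>n. norm \<rho> ^ n) \<longlonglongrightarrow> 0" by (rule LIMSEQ_realpow_zero) (use \<rho> in auto)
    hence "eventually (\<lambda>n. norm \<rho> ^ n < e / B) sequentially" using e B by (intro order_tendstoD) auto
    then obtain N where N: "\<And>n. n \<ge> N \<Longrightarrow> norm \<rho> ^ n < e / B" by (auto simp: eventually_sequentially)
    have "eventually (\<lambda>x::complex. x \<in> ball 0 (q ^ Suc N) - {0}) (at 0)"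
      using q0 by (intro eventually_at_in_open) auto
    thus "eventually (\<lambda>x. dist (g x) 0 < e) (at 0)"
    proof eventually_elim
      case (elim x)
      hence x: "x \<noteq> 0" "norm x < q ^ Suc N" by auto
      have "q ^ Suc N \<le> 1" using q0 q1 by (intro power_le_one) auto
      then obtain n w where w: "x = Q ^ n * w" "q \<le> norm w" "norm w \<le> 1"
        using annulus_scale[of x] x by (metis less_le_trans less_imp_le)
      have "q ^ Suc n \<le> norm x" using w q0 by (simp add: norm_mult norm_power mult.commute)
      hence "q ^ Suc n < q ^ Suc N" using x by linarith
      hence "n \<ge> N" using q0 q1 power_decreasing[of "Suc n" "Suc N" q] by (metis Suc_le_mono less_le_not_le nat_le_linear less_imp_le)
      have "w \<noteq> 0" using w q0 by auto
      hence "norm (g x) = norm \<rho> ^ n * norm (g w)" using w gq by (simp add: norm_mult norm_power)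
      also have "\<dots> \<le> norm \<rho> ^ n * B" using B w by (intro mult_left_mono) auto
      also have "\<dots> < e / B * B" using N[OF \<open>n \<ge> N\<close>] B by (intro mult_strict_right_mono) auto
      finally show ?case using B by simp
    qed
  qed
  define G where "G = (\<lambda>x. if x = 0 then 0 else g x)"
  have G: "G holomorphic_on UNIV"
  proof (rule no_isolated_singularity[of _ _ "{0}"])
    show "G holomorphic_on UNIV - {0}"
      by (rule holomorphic_transform[OF holomorphic_on_subset[OF gh]]) (auto simp: G_def)
    have "eventually (\<lambda>x. g x = G x) (at 0)" by (auto simp: G_def eventually_at_filter)
    from Lim_transform_eventually[OF lim this] have "isCont G 0" by (simp add: isCont_def G_def)
    moreover have "isCont G x" if "x \<noteq> 0" for x
      using \<open>G holomorphic_on UNIV - {0}\<close> that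
      by (intro continuous_on_interior[OF holomorphic_on_imp_continuous_on]) (auto simp: interior_open open_Diff)
    ultimately show "continuous_on UNIV G" by (metis continuous_at_imp_continuous_on)
  qed auto
  have Gq: "G (Q * w) = \<rho> * G w" for w using gq[of w 1] by (auto simp: G_def)
  have d: "(deriv ^^ n) G 0 = 0" for n
  proof -
    have "(deriv ^^ n) (\<lambda>w. G (Q * w)) 0 = Q ^ n * (deriv ^^ n) G (Q * 0)"
      by (rule higher_deriv_compose_linear[OF G, of UNIV]) auto
    also have "(\<lambda>w. G (Q * w)) = (\<lambda>w. \<rho> * G w)" using Gq by auto
    also have "(deriv ^^ n) (\<lambda>w. \<rho> * G w) 0 = \<rho> * (deriv ^^ n) G 0"
      by (rule higher_deriv_cmult[OF G]) auto
    finally have "(\<rho> - Q ^ n) * (deriv ^^ n) G 0 = 0" by (simp add: algebra_simps)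
    moreover have "\<rho> \<noteq> Q ^ n"
    proof
      assume "\<rho> = Q ^ n"
      hence "\<kappa> = Q powi (int n - int k)" by (simp add: \<rho>_def power_int_diff field_simps)
      thus False using \<kappa> by blast
    qed
    ultimately show ?thesis by simp
  qed
  have "G x = 0" by (rule holomorphic_fun_eq_0_on_connected[OF G _ _ d]) auto
  thus ?thesis using x by (simp add: G_def g_def)
qed

text \<open>Up to a constant, the functions with this quasi-period and these zeros are x^k times the
  product of the \<theta>(- x / a_s), and their multiplier is q^k times the product of the - a_s.
  Excluding these values leaves 0. The induction divides by one theta function at a time, which
  lowers the degree by one and turns \<kappa> into - \<kappa> / a_s.\<close>

lemma quasi_periodic_zeros:
  assumes fin: "finite S" and f: "f holomorphic_on - {0}"
    and qp: "\<And>x. x \<noteq> 0 \<Longrightarrow> f (Q * x) * x ^ card S = \<kappa> * f x"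
    and a: "\<And>s. s \<in> S \<Longrightarrow> a s \<noteq> 0" "\<And>s. s \<in> S \<Longrightarrow> f (a s) = 0"
    and dist: "\<And>s t. s \<in> S \<Longrightarrow> t \<in> S \<Longrightarrow> s \<noteq> t \<Longrightarrow> a s \<notin> qspiral q (a t)"
    and \<kappa>: "\<And>k::int. \<kappa> \<noteq> Q powi k * (\<Prod>s\<in>S. - a s)" and x: "x \<noteq> 0"
  shows "f x = 0"
  using fin f qp a dist \<kappa> x
proof (induction S arbitrary: f \<kappa> x rule: finite_induct)
  case empty
  show ?case by (rule quasi_periodic_0[of f \<kappa>]) (use empty in auto)
next
  case (insert s S)
  note f = insert.prems(1) and qp = insert.prems(2)
  have as: "a s \<noteq> 0" using insert.prems by simp
  have z: "f (a s * Q powi k) = 0" for k :: int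
  proof -
    \<comment> \<open>Spreads the zero at \<open>a s\<close> over its whole spiral. For \<kappa> = 0
      the functional equation already makes f vanish everywhere.\<close>
    have step: "f (Q * y) = 0 \<longleftrightarrow> f y = 0" if y: "y \<noteq> 0" for y
    proof -
      have "\<kappa> \<noteq> 0 \<or> (\<forall>w. w \<noteq> 0 \<longrightarrow> f w = 0)"
      proof (cases "\<kappa> = 0")
        case True
        have "f w = 0" if "w \<noteq> 0" for w using qp[of "w / Q"] that True by simp
        thus ?thesis by blast
      qed auto
      thus ?thesis using qp[OF y] y by (metis mult_eq_0_iff power_eq_0_iff Q_nz)
    qed
    have p: "f (a s * Q ^ n) = 0" for n
    proof (induction n)
      case (Suc n) thus ?case using step[of "a s * Q ^ n"] as by (simp add: mult_ac)
    qed (use insert.prems in auto)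
    have m: "f (a s / Q ^ n) = 0" for n
    proof (induction n)
      case (Suc n) thus ?case using step[of "a s / Q ^ Suc n"] as by (simp add: field_simps)
    qed (use insert.prems in auto)
    show ?thesis
    proof (cases k rule: int_cases2)
      case (nonneg n) thus ?thesis using p[of n] by simp
    next
      case (nonpos n) thus ?thesis using m[of n] by (simp add: power_int_minus divide_inverse)
    qed
  qed
  obtain g where g: "g holomorphic_on - {0}" "\<And>x. x \<noteq> 0 \<Longrightarrow> f x = qtheta q (- x / a s) * g x"
    using theta_divides[OF f as] z by (auto simp: qspiral_iff)
  have "g x = 0"
  proof (rule insert.IH[OF g(1), of "- \<kappa> / a s"])
    \<comment> \<open>The equation for g arises by cancelling theta, hence first off its zeros;
      continuity of both sides extends it to the spiral.\<close>
    have off: "g (Q * x) * x ^ card S = - \<kappa> / a s * g x" if x: "x \<noteq> 0" "x \<notin> qspiral q (a s)" for x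
    proof -
      have t0: "qtheta q (- x / a s) \<noteq> 0" using qtheta_eq_0_iff[OF as x(1)] x(2) by simp
      have t: "qtheta q (- (Q * x) / a s) = qtheta q (- x / a s) / (- x / a s)"
        using qtheta_Q[of "- x / a s"] x as by (simp add: mult_ac)
      have "qtheta q (- (Q * x) / a s) * g (Q * x) * x ^ card (insert s S) = \<kappa> * (qtheta q (- x / a s) * g x)"
        using qp[OF x(1)] g(2)[of x] g(2)[of "Q * x"] x by simp
      hence "qtheta q (- x / a s) * (- a s * (g (Q * x) * x ^ card S)) = qtheta q (- x / a s) * (\<kappa> * g x)"
        unfolding t using x as insert.hyps by (simp add: field_simps)
      hence "- a s * (g (Q * x) * x ^ card S) = \<kappa> * g x" using t0 by (simp only: mult_left_cancel simp_thms)
      hence "g (Q * x) * x ^ card S = (\<kappa> * g x) / (- a s)"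
        using as by (subst nonzero_eq_divide_eq) (auto simp: mult.commute)
      thus ?thesis by simp
    qed
    show "g (Q * x) * x ^ card S = - \<kappa> / a s * g x" if x: "x \<noteq> 0" for x
    proof -
      let ?F = "\<lambda>x. g (Q * x) * x ^ card S - - \<kappa> / a s * g x"
      have "(\<lambda>x. Q * x) ` (- {0}) \<subseteq> - {0}" by auto
      moreover have "(\<lambda>x. Q * x) holomorphic_on - {0}" by (intro holomorphic_intros)
      ultimately have "(g \<circ> (\<lambda>x. Q * x)) holomorphic_on - {0}"
        using g(1) by (intro holomorphic_on_compose_gen)
      hence "(\<lambda>x. g (Q * x)) holomorphic_on - {0}" by (simp add: o_def)
      hence hol: "?F holomorphic_on - {0}" using g(1) as by (intro holomorphic_intros) auto
      have cont: "isCont ?F x"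
        using hol x by (intro continuous_on_interior[OF holomorphic_on_imp_continuous_on]) (auto simp: interior_open open_Compl)
      have "\<exists>\<^sub>F y in at x. ?F y = 0"
      proof -
        have "eventually (\<lambda>y. y \<notin> qspiral q (a s)) (at x)"
          using qspiral_cosparse[OF as] x by (auto simp: eventually_cosparse_open_eq open_Compl)
        moreover have "eventually (\<lambda>y. y \<in> - {0}) (at x)" using x by (intro eventually_at_in_open') auto
        ultimately have "eventually (\<lambda>y. ?F y = 0) (at x)"
        proof eventually_elim
          case (elim y)
          thus ?case using off[of y] by auto
        qed
        thus ?thesis by (rule eventually_frequently[rotated]) auto
      qed
      hence "?F x = 0"
      proof -
        assume fr: "\<exists>\<^sub>F y in at x. ?F y = 0"
        show ?thesis
        proof (rule ccontr)
          assume ne: "?F x \<noteq> 0"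
          have "(?F \<longlongrightarrow> ?F x) (at x)" using cont by (simp add: isCont_def)
          hence "eventually (\<lambda>y. ?F y \<noteq> 0) (at x)" using ne by (rule tendsto_imp_eventually_ne)
          thus False using fr by (simp add: frequently_def)
        qed
      qed
      thus ?thesis by (simp add: add_eq_0_iff2)
    qed
    show "g (a t) = 0" if t: "t \<in> S" for t
    proof -
      have "t \<noteq> s" using t insert.hyps by auto
      hence "a t \<noteq> 0" "f (a t) = 0" "a t \<notin> qspiral q (a s)"
        using insert.prems(3,4,5) t by auto
      thus ?thesis using g(2)[of "a t"] qtheta_eq_0_iff[OF as, of "a t"] by simp
    qed
    show "- \<kappa> / a s \<noteq> Q powi k * (\<Prod>s\<in>S. - a s)" for k :: int
    proof
      assume "- \<kappa> / a s = Q powi k * (\<Prod>s\<in>S. - a s)"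
      hence "- \<kappa> = a s * (Q powi k * (\<Prod>s\<in>S. - a s))" using as by (simp add: field_simps)
      hence "\<kappa> = - (a s * (Q powi k * (\<Prod>s\<in>S. - a s)))" by (metis minus_minus)
      hence "\<kappa> = Q powi k * (\<Prod>s\<in>insert s S. - a s)" using insert.hyps by (simp add: mult_ac)
      thus False using insert.prems(6) by blast
    qed
  qed (use insert.prems in auto)
  thus ?case using g(2)[OF insert.prems(7)] by simp
qed

end

section \<open>Identity principle for normalised meromorphic functions\<close>

lemma nicely_meromorphic_eqI:
  assumes f: "f nicely_meromorphic_on A" and g: "g nicely_meromorphic_on A" and A: "open A" "z \<in> A"
    and eq: "\<forall>\<^sub>\<approx>z\<in>A. f z = g z"
  shows "f z = g z"
proof -
  have ev: "eventually (\<lambda>w. f w = g w) (at z)"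
    using eq A by (auto simp: eventually_cosparse_open_eq)
  have iff: "is_pole f z \<longleftrightarrow> is_pole g z" by (rule is_pole_cong[OF ev refl])
  show ?thesis
  proof (cases "is_pole f z")
    case True
    \<comment> \<open>The normalisation assigns the value 0 to a pole and the limit to any other
      point, so the failure of the limit forces both values to be 0.\<close>
    hence "\<not> f \<midarrow>z\<rightarrow> f z" "\<not> g \<midarrow>z\<rightarrow> g z" using iff
      unfolding is_pole_def by (meson at_neq_bot not_tendsto_and_filterlim_at_infinity)+
    thus ?thesis using f g A unfolding nicely_meromorphic_on_def by metis
  next
    case False
    hence "f \<midarrow>z\<rightarrow> f z" "g \<midarrow>z\<rightarrow> g z" using f g A iff unfolding nicely_meromorphic_on_def by metis+
    moreover from this(1) have "g \<midarrow>z\<rightarrow> f z" using tendsto_cong[OF ev] by blast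
    ultimately show ?thesis using LIM_unique by blast
  qed
qed

context q_base
begin

subsection \<open>\<open>q\<close>-Borel sums\<close>

text \<open>
  The complement of a countable closed set \<open>P\<close> is connected, so \<open>g\<close> is an analytic continuation
  of the Borel transform as required in \<^const>\<open>has_qsum\<close>.
\<close>

definition borel_cont :: "complex \<Rightarrow> complex fps \<Rightarrow> (complex \<Rightarrow> complex) \<Rightarrow> bool" where
  "borel_cont l f g \<longleftrightarrow>
     (\<exists>P. closed P \<and> countable P \<and> 0 \<notin> P \<and> qspiral q l \<inter> P = {} \<and> g holomorphic_on - P) \<and>
     g has_fps_expansion qborel q f \<and>
     (\<exists>M K. 0 \<le> M \<and> 1 \<le> K \<and> (\<forall>m::int. norm (g (l * Q powi m)) \<le> M * K ^ nat (- m)))"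

lemma borel_cont_cmult:
  assumes "borel_cont l f g"
  shows "borel_cont l (fps_const c * f) (\<lambda>x. c * g x)"
proof -
  from assms obtain P M K where P: "closed P" "countable P" "0 \<notin> P" "qspiral q l \<inter> P = {}" "g holomorphic_on - P"
    and e: "g has_fps_expansion qborel q f" and M: "0 \<le> M" "1 \<le> K" "\<And>m::int. norm (g (l * Q powi m)) \<le> M * K ^ nat (- m)"
    unfolding borel_cont_def by blast
  have "qborel q (fps_const c * f) = fps_const c * qborel q f"
    by (rule fps_ext) (simp add: qborel_def)
  hence "(\<lambda>x. c * g x) has_fps_expansion qborel q (fps_const c * f)"
    using has_fps_expansion_cmult_left[OF e] by simp
  moreover have "norm (c * g (l * Q powi m)) \<le> (norm c * M) * K ^ nat (- m)" for m
    using mult_left_mono[OF M(3), of "norm c"] by (simp add: norm_mult mult.assoc)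
  moreover have "(\<lambda>x. c * g x) holomorphic_on - P" using P by (intro holomorphic_intros)
  moreover have "0 \<le> norm c * M" using M by simp
  ultimately show ?thesis unfolding borel_cont_def using P(1-4) M(2) by blast
qed

lemma borel_cont_add:
  assumes "borel_cont l f1 g1" "borel_cont l f2 g2"
  shows "borel_cont l (f1 + f2) (\<lambda>x. g1 x + g2 x)"
proof -
  from assms(1) obtain P1 M1 K1 where P1: "closed P1" "countable P1" "0 \<notin> P1" "qspiral q l \<inter> P1 = {}" "g1 holomorphic_on - P1"
    and e1: "g1 has_fps_expansion qborel q f1" and M1: "0 \<le> M1" "1 \<le> K1" "\<And>m::int. norm (g1 (l * Q powi m)) \<le> M1 * K1 ^ nat (- m)"
    unfolding borel_cont_def by blast
  from assms(2) obtain P2 M2 K2 where P2: "closed P2" "countable P2" "0 \<notin> P2" "qspiral q l \<inter> P2 = {}" "g2 holomorphic_on - P2"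
    and e2: "g2 has_fps_expansion qborel q f2" and M2: "0 \<le> M2" "1 \<le> K2" "\<And>m::int. norm (g2 (l * Q powi m)) \<le> M2 * K2 ^ nat (- m)"
    unfolding borel_cont_def by blast
  have "qborel q (f1 + f2) = qborel q f1 + qborel q f2"
    by (rule fps_ext) (simp add: qborel_def algebra_simps)
  hence "(\<lambda>x. g1 x + g2 x) has_fps_expansion qborel q (f1 + f2)"
    using has_fps_expansion_add[OF e1 e2] by simp
  moreover have "norm (g1 (l * Q powi m) + g2 (l * Q powi m)) \<le> (M1 + M2) * max K1 K2 ^ nat (- m)" for m
  proof -
    have "norm (g1 (l * Q powi m)) \<le> M1 * max K1 K2 ^ nat (- m)"
      using M1 by (intro order_trans[OF M1(3)] mult_left_mono power_mono) auto
    moreover have "norm (g2 (l * Q powi m)) \<le> M2 * max K1 K2 ^ nat (- m)"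
      using M2 by (intro order_trans[OF M2(3)] mult_left_mono power_mono) auto
    ultimately show ?thesis by (intro norm_triangle_le) (simp add: distrib_right)
  qed
  moreover have "(\<lambda>x. g1 x + g2 x) holomorphic_on - (P1 \<union> P2)"
    using P1 P2 by (intro holomorphic_intros) (auto elim: holomorphic_on_subset)
  moreover have "closed (P1 \<union> P2)" "countable (P1 \<union> P2)" "0 \<notin> P1 \<union> P2" "qspiral q l \<inter> (P1 \<union> P2) = {}"
    using P1 P2 by auto
  moreover have "0 \<le> M1 + M2" "1 \<le> max K1 K2" using M1 M2 by auto
  ultimately show ?thesis unfolding borel_cont_def by blast
qed

lemma borel_cont_0: "borel_cont l 0 (\<lambda>_. 0)"
proof -
  have "qborel q 0 = 0" by (rule fps_ext) (simp add: qborel_def)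
  hence "(\<lambda>_. 0) has_fps_expansion qborel q 0" by simp
  moreover have "closed {} \<and> countable {} \<and> 0 \<notin> {} \<and> qspiral q l \<inter> {} = {} \<and> (\<lambda>_. 0) holomorphic_on - {}" by simp
  moreover have "0 \<le> (0::real) \<and> 1 \<le> (1::real) \<and> (\<forall>m::int. norm ((\<lambda>_. 0::complex) (l * Q powi m)) \<le> 0 * 1 ^ nat (- m))"
    by simp
  ultimately show ?thesis unfolding borel_cont_def by blast
qed

lemma borel_cont_sum:
  assumes "finite I" "\<And>i. i \<in> I \<Longrightarrow> borel_cont l (f i) (g i)"
  shows "borel_cont l (\<Sum>i\<in>I. f i) (\<lambda>x. \<Sum>i\<in>I. g i x)"
  using assms
proof (induction I rule: finite_induct)
  case empty thus ?case using borel_cont_0 by simp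
next
  case (insert i I)
  thus ?case using borel_cont_add[of l "f i" "g i" "\<Sum>i\<in>I. f i" "\<lambda>x. \<Sum>i\<in>I. g i x"] by simp
qed

text \<open>\<open>has_qsum\<close> leaves the domain and the continuation open. Removing the
  countable closed set P from U keeps it connected, so every admissible continuation equals g0 on
  the spiral. Two sums then agree for large |z| off a spiral, and the identity principle does the
  rest.\<close>

lemma has_qsum_unique:
  assumes F: "has_qsum q l f F" and F': "has_qsum q l f F'" and l: "l \<noteq> 0"
    and P: "closed P" "countable P" "0 \<notin> P" "qspiral q l \<inter> P = {}" "g0 holomorphic_on - P"
    and e: "g0 has_fps_expansion qborel q f" and z: "z \<noteq> 0"
  shows "F z = F' z"
proof -
  have ex: "F nicely_meromorphic_on - {0} \<and> (\<exists>R. \<forall>z. norm z > R \<longrightarrow> z \<notin> qspiral q (- 1 / l) \<longrightarrow>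
         ((\<lambda>m::int. g0 (l * Q powi m) / qtheta q (l * Q powi m * z)) has_sum F z) UNIV)"
    if F: "has_qsum q l f F" for F
  proof -
    from F obtain U g L M R where U: "open U" "connected U" "0 \<in> U" "qspiral q l \<subseteq> U"
      and g: "g holomorphic_on U" "g has_fps_expansion qborel q f"
      and nm: "F nicely_meromorphic_on - {0}" 
      and sum: "\<And>z. norm z > R \<Longrightarrow> z \<notin> qspiral q (- 1 / l) \<Longrightarrow>
         ((\<lambda>m::int. g (l * Q powi m) / qtheta q (l * Q powi m * z)) has_sum F z) UNIV"
      unfolding has_qsum_def by blast
    have "eventually (\<lambda>z. eval_fps (qborel q f) z = g z) (nhds 0)" "eventually (\<lambda>z. eval_fps (qborel q f) z = g0 z) (nhds 0)"
      using e g(2) by (auto simp: has_fps_expansion_def)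
    moreover have "eventually (\<lambda>z. z \<in> U - P) (nhds 0)"
      using U P by (intro eventually_nhds_in_open) (auto intro: open_Diff)
    ultimately have "eventually (\<lambda>z. g z = g0 z \<and> z \<in> U - P) (nhds 0)"
      by eventually_elim auto
    then obtain V where V: "open V" "0 \<in> V" "\<And>z. z \<in> V \<Longrightarrow> g z = g0 z \<and> z \<in> U - P"
      unfolding eventually_nhds by blast
    have eq: "g w = g0 w" if w: "w \<in> qspiral q l" for w
    proof (rule analytic_continuation_open[of V "U - P" g g0])
      show "connected (U - P)" by (rule connected_open_diff_countable) (use U P in auto)
      show "g holomorphic_on U - P" "g0 holomorphic_on U - P"
        using g(1) P(5) by (auto elim: holomorphic_on_subset)
    qed (use U P V w in \<open>auto intro: open_Diff\<close>)
    have "((\<lambda>m::int. g0 (l * Q powi m) / qtheta q (l * Q powi m * z)) has_sum F z) UNIV"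
      if "norm z > R" "z \<notin> qspiral q (- 1 / l)" for z
    proof -
      have "g (l * Q powi m) = g0 (l * Q powi m)" for m by (rule eq) (auto simp: qspiral_iff)
      thus ?thesis using sum[OF that] by simp
    qed
    thus ?thesis using nm by blast
  qed
  from ex[OF F] ex[OF F'] obtain R R' where nm: "F nicely_meromorphic_on - {0}" "F' nicely_meromorphic_on - {0}" and
    R: "\<And>z. norm z > R \<Longrightarrow> z \<notin> qspiral q (- 1 / l) \<Longrightarrow>
         ((\<lambda>m::int. g0 (l * Q powi m) / qtheta q (l * Q powi m * z)) has_sum F z) UNIV" and
    R': "\<And>z. norm z > R' \<Longrightarrow> z \<notin> qspiral q (- 1 / l) \<Longrightarrow>
         ((\<lambda>m::int. g0 (l * Q powi m) / qtheta q (l * Q powi m * z)) has_sum F' z) UNIV"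
    by blast
  have eq: "F z = F' z" if "norm z > max R R'" "z \<notin> qspiral q (- 1 / l)" for z
    using R[of z] R'[of z] that has_sum_unique by fastforce
  have mero: "(\<lambda>z. F z - F' z) meromorphic_on - {0}"
    using nm unfolding nicely_meromorphic_on_def by (intro meromorphic_intros) auto
  have "eventually (\<lambda>z. F z - F' z = 0) (cosparse (- {0})) \<or> eventually (\<lambda>z. F z - F' z \<noteq> 0) (cosparse (- {0}))"
    by (rule meromorphic_imp_constant_or_avoid[OF mero]) auto
  moreover have "\<not> eventually (\<lambda>z. F z - F' z \<noteq> 0) (cosparse (- {0}))"
  proof
    assume "eventually (\<lambda>z. F z - F' z \<noteq> 0) (cosparse (- {0}))"
    moreover have "\<forall>\<^sub>\<approx>z\<in>- {0}. z \<notin> qspiral q (- 1 / l)" by (rule qspiral_cosparse) (use l in auto)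
    ultimately have ev: "\<forall>\<^sub>\<approx>z\<in>- {0}. F z \<noteq> F' z \<and> z \<notin> qspiral q (- 1 / l)" by eventually_elim auto
    \<comment> \<open>A point beyond both radii. Around it the two functions agree off the pole
      spiral, which contradicts that they differ off a discrete set.\<close>
    define z0 :: complex where "z0 = of_real (max 0 (max R R') + 1)"
    have nz0: "norm z0 = max 0 (max R R') + 1" unfolding z0_def by (subst norm_of_real) auto
    hence z0: "z0 \<noteq> 0" by auto
    have "eventually (\<lambda>z. F z \<noteq> F' z \<and> z \<notin> qspiral q (- 1 / l)) (at z0)"
      using ev z0 by (auto simp: eventually_cosparse_open_eq open_Compl)
    moreover have "eventually (\<lambda>z. z \<in> - cball 0 (max R R')) (at z0)"
      using nz0 by (intro eventually_at_in_open') auto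
    ultimately have "eventually (\<lambda>z. False) (at z0)"
      by eventually_elim (use eq in \<open>auto simp: not_le\<close>)
    thus False by simp
  qed
  ultimately have "\<forall>\<^sub>\<approx>z\<in>- {0}. F z = F' z" by simp
  thus ?thesis using nicely_meromorphic_eqI[OF nm] z by auto
qed

lemma qsum_eqI:
  assumes F: "has_qsum q l f F" and l: "l \<noteq> 0"
    and P: "closed P" "countable P" "0 \<notin> P" "qspiral q l \<inter> P = {}" "g0 holomorphic_on - P"
    and e: "g0 has_fps_expansion qborel q f" and z: "z \<noteq> 0"
  shows "qsum q l f z = F z"
proof (rule has_qsum_unique[OF _ F l P e z])
  show "has_qsum q l f (qsum q l f)" unfolding qsum_def using F by (rule someI[of "has_qsum q l f"])
qed

lemma inverse_theta:
  assumes "l \<noteq> 0" "z \<noteq> 0"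
  shows "1 / qtheta q (l * Q powi m * z) = Q powi (m * (m - 1) div 2) * (l * z) powi m / qtheta q (l * z)"
proof -
  have "l * Q powi m * z = (l * z) * Q powi m" by simp
  also have "qtheta q ((l * z) * Q powi m) = Q powi (- (m * (m - 1) div 2)) * (l * z) powi (- m) * qtheta q (l * z)"
    using assms by (intro qtheta_powi) auto
  finally have *: "qtheta q (l * Q powi m * z) = Q powi (- (m * (m - 1) div 2)) * (l * z) powi (- m) * qtheta q (l * z)" .
  show ?thesis unfolding * by (simp add: power_int_minus field_simps)
qed

text \<open>The q-Laplace sum over the common denominator \<theta>(l z), which
  \<open>inverse_theta\<close> provides. The numerator has the form treated in
  \<open>gauss_laurent\<close>.\<close>

definition bsum :: "(complex \<Rightarrow> complex) \<Rightarrow> complex \<Rightarrow> complex \<Rightarrow> complex" where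
  "bsum g l z = (\<Sum>\<^sub>\<infinity>m::int. (g (l * Q powi m) * l powi m) * Q powi (m * (m - 1) div 2) * z powi m) / qtheta q (l * z)"

lemma spiral_growth:
  assumes M: "0 \<le> M" "1 \<le> K" "\<And>m::int. norm (g (l * Q powi m)) \<le> M * K ^ nat (- m)" and l: "l \<noteq> 0"
  obtains M' K' where "K' > 0" "\<And>m::int. norm (g (l * Q powi m) * l powi m) \<le> M' * K' ^ nat \<bar>m\<bar>"
proof (rule that[of "K * max (norm l) (inverse (norm l))" M])
  let ?L = "max (norm l) (inverse (norm l))"
  have "0 < norm l" using l by simp
  hence L: "?L > 0" by (simp add: less_max_iff_disj)
  thus "0 < K * ?L" using M by simp
  fix m :: int
  have "norm (l powi m) \<le> ?L ^ nat \<bar>m\<bar>"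
    unfolding norm_power_int using l by (intro powi_abs_bound) auto
  moreover have "M * K ^ nat (- m) \<le> M * K ^ nat \<bar>m\<bar>"
    using M by (intro mult_left_mono power_increasing) auto
  ultimately have "norm (g (l * Q powi m)) * norm (l powi m) \<le> (M * K ^ nat \<bar>m\<bar>) * ?L ^ nat \<bar>m\<bar>"
    using M order_trans[OF M(3)] L by (intro mult_mono) auto
  thus "norm (g (l * Q powi m) * l powi m) \<le> M * (K * ?L) ^ nat \<bar>m\<bar>"
    by (simp add: norm_mult power_mult_distrib mult_ac)
qed

lemma bsum_has_sum:
  assumes b: "borel_cont l f g" and l: "l \<noteq> 0" and z: "z \<noteq> 0" 
  shows "((\<lambda>m::int. g (l * Q powi m) / qtheta q (l * Q powi m * z)) has_sum bsum g l z) UNIV"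
proof -
  from b obtain M K where M: "0 \<le> M" "1 \<le> K" "\<And>m::int. norm (g (l * Q powi m)) \<le> M * K ^ nat (- m)"
    unfolding borel_cont_def by blast
  obtain M' K' where "K' > 0" "\<And>m::int. norm (g (l * Q powi m) * l powi m) \<le> M' * K' ^ nat \<bar>m\<bar>"
    using spiral_growth[OF M l] by blast
  hence "(\<lambda>m::int. (g (l * Q powi m) * l powi m) * Q powi (m * (m - 1) div 2) * z powi m) summable_on UNIV"
    by (intro gauss_laurent_summable z)
  hence "((\<lambda>m::int. inverse (qtheta q (l * z)) * ((g (l * Q powi m) * l powi m) * Q powi (m * (m - 1) div 2) * z powi m)) has_sum
      inverse (qtheta q (l * z)) * (\<Sum>\<^sub>\<infinity>m::int. (g (l * Q powi m) * l powi m) * Q powi (m * (m - 1) div 2) * z powi m)) UNIV"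
    by (intro has_sum_cmult_right has_sum_infsum)
  moreover have eq: "inverse (qtheta q (l * z)) * ((g (l * Q powi m) * l powi m) * Q powi (m * (m - 1) div 2) * z powi m) =
      g (l * Q powi m) / qtheta q (l * Q powi m * z)" for m :: int
  proof -
    have "g (l * Q powi m) / qtheta q (l * Q powi m * z) = g (l * Q powi m) * (1 / qtheta q (l * Q powi m * z))" by simp
    also have "\<dots> = inverse (qtheta q (l * z)) * ((g (l * Q powi m) * l powi m) * Q powi (m * (m - 1) div 2) * z powi m)"
      unfolding inverse_theta[OF l z] by (simp add: divide_inverse power_int_mult_distrib mult_ac)
    finally show ?thesis by (rule sym)
  qed
  moreover have "bsum g l z = inverse (qtheta q (l * z)) *
      (\<Sum>\<^sub>\<infinity>m::int. (g (l * Q powi m) * l powi m) * Q powi (m * (m - 1) div 2) * z powi m)"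
    unfolding bsum_def by (simp only: divide_inverse mult.commute)
  ultimately show ?thesis by (simp only: eq)
qed

lemma bsum_analytic:
  assumes b: "borel_cont l f g" and l: "l \<noteq> 0"
  shows bsum_analytic_on: "bsum g l analytic_on - {0} - qspiral q (- 1 / l)"
    and bsum_meromorphic: "bsum g l meromorphic_on - {0}"
proof -
  from b obtain M K where M: "0 \<le> M" "1 \<le> K" "\<And>m::int. norm (g (l * Q powi m)) \<le> M * K ^ nat (- m)"
    unfolding borel_cont_def by blast
  obtain M' K' where "K' > 0" "\<And>m::int. norm (g (l * Q powi m) * l powi m) \<le> M' * K' ^ nat \<bar>m\<bar>"
    using spiral_growth[OF M l] by blast
  hence "(\<lambda>z. \<Sum>\<^sub>\<infinity>m::int. (g (l * Q powi m) * l powi m) * Q powi (m * (m - 1) div 2) * z powi m) holomorphic_on - {0}"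
    by (intro gauss_laurent_holomorphic)
  hence N: "(\<lambda>z. \<Sum>\<^sub>\<infinity>m::int. (g (l * Q powi m) * l powi m) * Q powi (m * (m - 1) div 2) * z powi m) analytic_on - {0}"
    by (simp add: analytic_on_open open_Compl)
  have T: "(\<lambda>z. qtheta q (l * z)) analytic_on - {0}" by (intro analytic_intros) (use l in auto)
  show "bsum g l meromorphic_on - {0}" unfolding bsum_def[abs_def]
    by (intro meromorphic_intros analytic_on_imp_meromorphic_on N T)
  show "bsum g l analytic_on - {0} - qspiral q (- 1 / l)" unfolding bsum_def[abs_def]
    by (intro analytic_on_divide analytic_on_subset[OF N] analytic_on_subset[OF T])
       (use qtheta_mult_eq_0_iff[OF l] in auto)
qed

text \<open>At a positive argument all terms of the theta series are positive, so theta dominates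
  each of them and each partial series.\<close>

lemma Re_qtheta:
  assumes x: "x > 0"
  shows "((\<lambda>m::int. q powi (m * (m - 1) div 2) * x powi m) has_sum Re (qtheta q (of_real x))) UNIV"
    and Re_qtheta_ge: "q powi (m * (m - 1) div 2) * x powi m \<le> Re (qtheta q (of_real x))"
proof -
  have "of_real x \<noteq> (0::complex)" using x by simp
  from has_sum_Re[OF qtheta_has_sum[OF this]]
  show *: "((\<lambda>m::int. q powi (m * (m - 1) div 2) * x powi m) has_sum Re (qtheta q (of_real x))) UNIV"
    by (simp flip: of_real_power_int of_real_mult)
  have "((\<lambda>m::int. q powi (m * (m - 1) div 2) * x powi m) has_sum q powi (m * (m - 1) div 2) * x powi m) {m}"
    by (rule has_sum_finiteI) auto
  from has_sum_mono2[OF this *] show "q powi (m * (m - 1) div 2) * x powi m \<le> Re (qtheta q (of_real x))"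
    using q0 x by simp
qed

lemma qsum_borel_cont:
  assumes b: "borel_cont l f g" and l: "l \<noteq> 0" and z: "z \<noteq> 0" "z \<notin> qspiral q (- 1 / l)"
  shows "qsum q l f z = bsum g l z"
proof -
  from b obtain P M K where P: "closed P" "countable P" "0 \<notin> P" "qspiral q l \<inter> P = {}" "g holomorphic_on - P"
    and e: "g has_fps_expansion qborel q f" and M: "0 \<le> M" "1 \<le> K" "\<And>m::int. norm (g (l * Q powi m)) \<le> M * K ^ nat (- m)"
    unfolding borel_cont_def by blast
  have an: "bsum g l analytic_on {w}" if "w \<noteq> 0" "w \<notin> qspiral q (- 1 / l)" for w
    by (rule analytic_on_subset[OF bsum_analytic_on[OF b l]]) (use that in auto)
  \<comment> \<open>From the geometric bound in \<open>borel_cont\<close> to the one in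
    \<open>has_qsum\<close>: with L = 1 / |l| the number L |\<xi>| is exactly q^m on the spiral, and
    \<theta>(q^m) = q^(- m (m - 1) / 2) \<theta>(1) dominates every geometric bound.\<close>
  have "\<exists>M' L. L > 0 \<and> M' > 0 \<and> (\<forall>\<xi>\<in>qspiral q l. norm (g \<xi>) \<le> M' * Re (qtheta q (of_real (L * norm \<xi>))))"
  proof -
    have s: "(\<lambda>m::int. K ^ nat \<bar>m\<bar> * q powi (m * (m - 1) div 2)) summable_on UNIV"
      using M(2) by (intro gauss_int_abs) auto
    define S where "S = (\<Sum>\<^sub>\<infinity>m::int. K ^ nat \<bar>m\<bar> * q powi (m * (m - 1) div 2))"
    have S: "K ^ nat \<bar>m\<bar> * q powi (m * (m - 1) div 2) \<le> S" for m
    proof -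
      have "((\<lambda>m::int. K ^ nat \<bar>m\<bar> * q powi (m * (m - 1) div 2)) has_sum K ^ nat \<bar>m\<bar> * q powi (m * (m - 1) div 2)) {m}"
        by (rule has_sum_finiteI) auto
      from has_sum_mono2[OF this has_sum_infsum[OF s]] show ?thesis using q0 M(2) by (simp add: S_def)
    qed
    have S1: "S \<ge> 1" using S[of 0] by simp
    define T where "T = Re (qtheta q 1)"
    have T1: "T \<ge> 1" using Re_qtheta_ge[of 1 0] by (simp add: T_def)
    have "norm (g \<xi>) \<le> ((M + 1) * S) * Re (qtheta q (of_real (inverse (norm l) * norm \<xi>)))" if "\<xi> \<in> qspiral q l" for \<xi>
    proof -
      from that obtain m :: int where m: "\<xi> = l * Q powi m" by (auto simp: qspiral_iff)
      have "inverse (norm l) * norm \<xi> = q powi m" using l q0 by (simp add: m norm_mult norm_power_int)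
      hence "qtheta q (of_real (inverse (norm l) * norm \<xi>)) = qtheta q (1 * Q powi m)" by (simp add: of_real_power_int)
      also have "\<dots> = Q powi (- (m * (m - 1) div 2)) * 1 powi (- m) * qtheta q 1" by (rule qtheta_powi) simp
      also have "\<dots> = of_real (q powi (- (m * (m - 1) div 2))) * qtheta q 1" by (simp add: of_real_power_int)
      finally have "Re (qtheta q (of_real (inverse (norm l) * norm \<xi>))) = q powi (- (m * (m - 1) div 2)) * T"
        by (simp only: times_complex.sel Re_complex_of_real Im_complex_of_real mult_zero_left diff_zero T_def)
      hence re: "Re (qtheta q (of_real (inverse (norm l) * norm \<xi>))) = inverse (q powi (m * (m - 1) div 2)) * T"
        by (simp add: power_int_minus)
      have "norm (g \<xi>) \<le> M * K ^ nat (- m)" unfolding m by (rule M(3))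
      also have "\<dots> \<le> M * K ^ nat \<bar>m\<bar>" using M by (intro mult_left_mono power_increasing) auto
      also have "\<dots> \<le> (M + 1) * (S * inverse (q powi (m * (m - 1) div 2)))"
        using S[of m] q0 M S1 by (intro mult_mono) (auto simp: field_simps)
      also have "\<dots> \<le> (M + 1) * S * (inverse (q powi (m * (m - 1) div 2)) * T)"
        using mult_left_mono[OF T1, of "(M + 1) * S * inverse (q powi (m * (m - 1) div 2))"] q0 M S1
        by (simp add: mult.assoc)
      finally show ?thesis unfolding re .
    qed
    thus ?thesis using l M S1 by (intro exI[of _ "(M + 1) * S"] exI[of _ "inverse (norm l)"]) auto
  qed
  then obtain M' L where LM: "0 < L" "0 < M'"
    "\<forall>\<xi>\<in>qspiral q l. norm (g \<xi>) \<le> M' * Re (qtheta q (of_real (L * norm \<xi>)))" by blast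
  have con: "connected (UNIV - P)" by (rule connected_open_diff_countable) (use P in auto)
  have sum: "\<forall>z. norm z > 1 \<longrightarrow> z \<notin> qspiral q (- 1 / l) \<longrightarrow>
           ((\<lambda>m::int. g (l * Q powi m) / qtheta q (l * Q powi m * z)) has_sum remove_sings (bsum g l) z) UNIV"
  proof (intro allI impI)
    fix w :: complex assume w: "norm w > 1" "w \<notin> qspiral q (- 1 / l)"
    hence w0: "w \<noteq> 0" by auto
    show "((\<lambda>m::int. g (l * Q powi m) / qtheta q (l * Q powi m * w)) has_sum remove_sings (bsum g l) w) UNIV"
      using bsum_has_sum[OF b l w0] remove_sings_at_analytic[OF an[OF w0 w(2)]] by simp
  qed
  \<comment> \<open>\<open>remove_sings\<close> supplies the normalisation that
    \<open>has_qsum\<close> demands; off the pole spiral it leaves \<open>bsum\<close>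
    unchanged.\<close>
  have "has_qsum q l f (remove_sings (bsum g l))"
    unfolding has_qsum_def
  proof (rule exI[of _ "- P"], rule exI[of _ g], rule exI[of _ L], rule exI[of _ M'],
      rule exI[of _ 1], intro conjI)
    show "open (- P)" "connected (- P)" "0 \<in> - P" "qspiral q l \<subseteq> - P" "g holomorphic_on - P"
      using P con by (auto simp: Compl_eq_Diff_UNIV)
    show "remove_sings (bsum g l) nicely_meromorphic_on - {0}"
      by (rule remove_sings_nicely_meromorphic[OF bsum_meromorphic[OF b l]])
    show "(0::real) < 1" by simp
  qed (fact e LM sum)+
  from qsum_eqI[OF this l P e z(1)] show ?thesis using an[OF z] by simp
qed

text \<open>Replacing z by z q^(-N) and m by m + N keeps the weights 1 / \<theta>(l q^m z) and moves
  the sample points of g to 0. The weights have sum 1 by the theta series, so the limit is g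
  0.\<close>

lemma bsum_tendsto:
  assumes b: "borel_cont l f g" and l: "l \<noteq> 0" and z: "z \<noteq> 0" "z \<notin> qspiral q (- 1 / l)"
  shows "(\<lambda>N. bsum g l (z / Q ^ N)) \<longlonglongrightarrow> fps_nth f 0"
proof -
  from b obtain P M K where P: "closed P" "countable P" "0 \<notin> P" "qspiral q l \<inter> P = {}" "g holomorphic_on - P"
    and e: "g has_fps_expansion qborel q f" and M: "0 \<le> M" "1 \<le> K" "\<And>m::int. norm (g (l * Q powi m)) \<le> M * K ^ nat (- m)"
    unfolding borel_cont_def by blast
  have g0: "g 0 = fps_nth f 0" using has_fps_expansion_imp_0_eq_fps_nth_0[OF e] by (simp add: qborel_def)
  have iz: "1 / qtheta q (l * Q powi m * z) = 1 * Q powi (m * (m - 1) div 2) * (l * z) powi m / qtheta q (l * z)" for m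
    using inverse_theta[OF l z(1)] by simp
  have th: "qtheta q (l * z) \<noteq> 0" using qtheta_mult_eq_0_iff[OF l z(1)] z(2) by simp
  have "((\<lambda>m::int. inverse (qtheta q (l * z)) * (Q powi (m * (m - 1) div 2) * (l * z) powi m)) has_sum
        inverse (qtheta q (l * z)) * qtheta q (l * z)) UNIV"
    by (intro has_sum_cmult_right qtheta_has_sum) (use l z in auto)
  hence one: "((\<lambda>m::int. 1 / qtheta q (l * Q powi m * z)) has_sum 1) UNIV"
    using th unfolding iz by (simp add: divide_inverse mult_ac)
  have *: "bsum g l (z / Q ^ N) = (\<Sum>\<^sub>\<infinity>m::int. g (l * Q powi (m + int N)) * (1 / qtheta q (l * Q powi m * z)))" for N
  proof -
    have zN: "z / Q ^ N \<noteq> 0" using z by simp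
    have "((\<lambda>m::int. g (l * Q powi (m + int N)) / qtheta q (l * Q powi (m + int N) * (z / Q ^ N))) has_sum bsum g l (z / Q ^ N)) UNIV"
      by (rule has_sum_reindex_bij_witness[THEN iffD1, OF _ _ _ _ _ _ bsum_has_sum[OF b l zN], of "\<lambda>m. m + int N" "\<lambda>m. m - int N"]) auto
    moreover have "l * Q powi (m + int N) * (z / Q ^ N) = l * Q powi m * z" for m by (simp add: power_int_add)
    ultimately show ?thesis using infsumI by fastforce
  qed
  have "(\<lambda>N. \<Sum>\<^sub>\<infinity>m::int. g (l * Q powi (m + int N)) * (1 / qtheta q (l * Q powi m * z))) \<longlonglongrightarrow>
         (\<Sum>\<^sub>\<infinity>m::int. g 0 * (1 / qtheta q (l * Q powi m * z)))"
  proof (rule tendsto_infsum_dominated)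
    fix m :: int
    have "(\<lambda>N. Q ^ N * (l * Q powi m)) \<longlonglongrightarrow> 0" by (rule tendsto_Q_pow)
    moreover have "Q ^ N * (l * Q powi m) = l * Q powi (m + int N)" for N by (simp add: power_int_add)
    ultimately have "(\<lambda>N. l * Q powi (m + int N)) \<longlonglongrightarrow> 0" by simp
    moreover have "isCont g 0" by (rule has_fps_expansion_imp_continuous[OF e])
    ultimately have "(\<lambda>N. g (l * Q powi (m + int N))) \<longlonglongrightarrow> g 0" by (rule isCont_tendsto_compose[rotated])
    thus "(\<lambda>N. g (l * Q powi (m + int N)) * (1 / qtheta q (l * Q powi m * z))) \<longlonglongrightarrow> g 0 * (1 / qtheta q (l * Q powi m * z))"
      by (intro tendsto_intros)
  next
    fix m :: int and N :: nat
    have "norm (g (l * Q powi (m + int N))) \<le> M * K ^ nat (- (m + int N))" by (rule M(3))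
    also have "\<dots> \<le> M * K ^ nat \<bar>m\<bar>" using M by (intro mult_left_mono power_increasing) auto
    finally show "norm (g (l * Q powi (m + int N)) * (1 / qtheta q (l * Q powi m * z))) \<le>
       M * K ^ nat \<bar>m\<bar> * norm (1 / qtheta q (l * Q powi m * z))"
      unfolding norm_mult by (rule mult_right_mono) auto
  next
    let ?L = "max (norm (l * z)) (inverse (norm (l * z)))"
    have "0 < norm (l * z)" using l z by simp
    hence L: "?L > 0" by (simp add: less_max_iff_disj)
    have "norm (M * K ^ nat \<bar>m\<bar> * norm (1 / qtheta q (l * Q powi m * z))) \<le>
       (M / norm (qtheta q (l * z))) * ((K * ?L) ^ nat \<bar>m\<bar> * q powi (m * (m - 1) div 2))" for m
    proof -
      have "norm ((l * z) powi m) \<le> ?L ^ nat \<bar>m\<bar>"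
        unfolding norm_power_int using l z by (intro powi_abs_bound) auto
      hence "M * K ^ nat \<bar>m\<bar> * (q powi (m * (m - 1) div 2) * norm ((l * z) powi m) / norm (qtheta q (l * z))) \<le>
             M * K ^ nat \<bar>m\<bar> * (q powi (m * (m - 1) div 2) * ?L ^ nat \<bar>m\<bar> / norm (qtheta q (l * z)))"
        using M q0 by (intro mult_left_mono divide_right_mono) auto
      thus ?thesis unfolding iz using M q0 by (simp add: norm_mult norm_divide norm_power_int power_mult_distrib mult_ac)
    qed
    moreover have "(\<lambda>m. (M / norm (qtheta q (l * z))) * ((K * ?L) ^ nat \<bar>m\<bar> * q powi (m * (m - 1) div 2))) summable_on UNIV"
      by (intro summable_on_cmult_right gauss_int_abs mult_pos_pos L) (use M in auto)
    ultimately have "(\<lambda>m. norm (M * K ^ nat \<bar>m\<bar> * norm (1 / qtheta q (l * Q powi m * z)))) summable_on UNIV"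
      using Infinite_Sum.abs_summable_on_comparison_test' by fast
    thus "(\<lambda>m. M * K ^ nat \<bar>m\<bar> * norm (1 / qtheta q (l * Q powi m * z))) summable_on UNIV"
      by (rule abs_summable_summable)
  qed auto
  moreover have "(\<Sum>\<^sub>\<infinity>m::int. g 0 * (1 / qtheta q (l * Q powi m * z))) = g 0"
    using infsumI[OF has_sum_cmult_right[OF one, of "g 0"]] by simp
  ultimately show ?thesis unfolding * g0 by simp
qed

text \<open>The Borel transform is entire. Expanding it inside the q-Laplace sum gives a double
  series whose inner sum over m is the term of f of order n, so the claim is an exchange of
  summation. F is given separately because f itself represents it only near infinity.\<close>

lemma qsum_convergent:
  assumes f: "\<And>n. norm (fps_nth f n) \<le> C * \<rho> ^ n" and \<rho>: "\<rho> > 0" and l: "l \<noteq> 0"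
    and F: "F meromorphic_on - {0}" "F analytic_on {z. norm z > R}"
    and sm: "\<And>z. norm z > R \<Longrightarrow> (\<lambda>n. fps_nth f n / z ^ n) sums F z" and R: "R > 0"
    and z: "z \<noteq> 0" "F analytic_on {z}"
  shows "qsum q l f z = F z"
proof -
  have C: "C \<ge> 0" using f[of 0] norm_ge_zero[of "fps_nth f 0"] by (simp del: norm_ge_zero)
  have nb: "norm (fps_nth (qborel q f) n) \<le> C * \<rho> ^ n * q ^ (n * (n - 1) div 2)" for n
    using mult_right_mono[OF f[of n], of "q ^ (n * (n - 1) div 2)"] q0
    by (simp add: qborel_def norm_mult norm_power mult_ac)
  have rad: "fps_conv_radius (qborel q f) = \<infinity>"
    by (rule gauss_fps_conv_radius[OF nb]) (use \<rho> in auto)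
  define g where "g = eval_fps (qborel q f)"
  have gh: "g holomorphic_on - {}" unfolding g_def by (rule holomorphic_on_eval_fps) (simp add: rad)
  have ge: "g has_fps_expansion qborel q f" unfolding g_def by (rule eval_fps_has_fps_expansion) (simp add: rad)
  \<comment> \<open>C + 1 instead of C, since C may be 0 and \<open>has_qsum\<close> asks for a
    positive constant.\<close>
  have growth: "norm (g \<xi>) \<le> (C + 1) * Re (qtheta q (of_real (\<rho> * norm \<xi>)))" if \<xi>: "\<xi> \<noteq> 0" for \<xi>
  proof -
    have x: "\<rho> * norm \<xi> > 0" using \<xi> \<rho> by simp
    let ?a = "\<lambda>m::int. q powi (m * (m - 1) div 2) * (\<rho> * norm \<xi>) powi m"
    have hs: "(?a has_sum Re (qtheta q (of_real (\<rho> * norm \<xi>)))) UNIV" by (rule Re_qtheta[OF x])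
    have Re0: "Re (qtheta q (of_real (\<rho> * norm \<xi>))) \<ge> 0"
      using Re_qtheta_ge[OF x, of 0] by simp
    have sl: "?a summable_on range int"
      by (rule summable_on_subset_banach[of _ UNIV]) (use hs in \<open>auto simp: summable_on_def\<close>)
    have "(\<Sum>\<^sub>\<infinity>m\<in>range int. ?a m) \<le> (\<Sum>\<^sub>\<infinity>m. ?a m)"
      by (rule infsum_mono2) (use sl hs q0 x in \<open>auto simp: summable_on_def\<close>)
    also have "\<dots> = Re (qtheta q (of_real (\<rho> * norm \<xi>)))" using hs by (rule infsumI)
    finally have 1: "(\<Sum>\<^sub>\<infinity>m\<in>range int. ?a m) \<le> Re (qtheta q (of_real (\<rho> * norm \<xi>)))" .
    have "(?a has_sum (\<Sum>\<^sub>\<infinity>m\<in>range int. ?a m)) (range int)" using sl by (rule has_sum_infsum)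
    hence "((?a \<circ> int) has_sum (\<Sum>\<^sub>\<infinity>m\<in>range int. ?a m)) UNIV"
      by (subst (asm) has_sum_reindex) (auto simp: inj_on_def)
    hence "(?a \<circ> int) sums (\<Sum>\<^sub>\<infinity>m\<in>range int. ?a m)" by (rule has_sum_imp_sums)
    hence s: "(\<lambda>n. C * (?a (int n))) sums (C * (\<Sum>\<^sub>\<infinity>m\<in>range int. ?a m))" by (intro sums_mult) (simp add: o_def)
    have "norm (fps_nth (qborel q f) n * \<xi> ^ n) \<le> C * ?a (int n)" for n
    proof -
      have "norm (fps_nth (qborel q f) n * \<xi> ^ n) \<le> (C * \<rho> ^ n * q ^ (n * (n - 1) div 2)) * norm \<xi> ^ n"
        unfolding norm_mult norm_power by (intro mult_right_mono nb) auto
      also have "\<dots> = C * ?a (int n)" unfolding tri_int_nat by (simp add: power_mult_distrib mult_ac)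
      finally show ?thesis .
    qed
    hence "norm (\<Sum>n. fps_nth (qborel q f) n * \<xi> ^ n) \<le> (\<Sum>n. C * ?a (int n))"
      using s by (intro norm_suminf_le) (auto simp: sums_iff)
    hence "norm (g \<xi>) \<le> C * (\<Sum>\<^sub>\<infinity>m\<in>range int. ?a m)"
      using s unfolding g_def eval_fps_def by (simp add: sums_iff)
    also have "\<dots> \<le> C * Re (qtheta q (of_real (\<rho> * norm \<xi>)))" using 1 C by (intro mult_left_mono) auto
    also have "\<dots> \<le> (C + 1) * Re (qtheta q (of_real (\<rho> * norm \<xi>)))" using Re0 by (intro mult_right_mono) auto
    finally show ?thesis .
  qed
  have sum: "\<forall>z. norm z > max R \<rho> \<longrightarrow> z \<notin> qspiral q (- 1 / l) \<longrightarrow>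
           ((\<lambda>m::int. g (l * Q powi m) / qtheta q (l * Q powi m * z)) has_sum remove_sings F z) UNIV"
  proof (intro allI impI)
    fix w :: complex assume w: "norm w > max R \<rho>" "w \<notin> qspiral q (- 1 / l)"
    hence w0: "w \<noteq> 0" using R by auto
    have th: "qtheta q (l * w) \<noteq> 0" using qtheta_mult_eq_0_iff[OF l w0] w by simp
    define a where "a = (\<lambda>(n::nat, m::int). fps_nth (qborel q f) n * (l * Q powi m) ^ n / qtheta q (l * Q powi m * w))"
    have trm: "a (n, m) = fps_nth (qborel q f) n * l ^ n / qtheta q (l * w) * (Q powi (m * (m - 1) div 2) * (Q ^ n * (l * w)) powi m)" for n m
    proof -
      have "(Q powi m) ^ n = (Q ^ n) powi m" by (simp add: power_int_power power_int_power' mult.commute)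
      hence "a (n, m) = fps_nth (qborel q f) n * l ^ n * (Q ^ n) powi m * (1 / qtheta q (l * Q powi m * w))"
        by (simp add: a_def power_mult_distrib)
      thus ?thesis unfolding inverse_theta[OF l w0] by (simp add: power_int_mult_distrib mult_ac)
    qed
    have Qn: "l * w * Q powi int n = Q ^ n * (l * w)" for n by simp
    have "qtheta q (Q ^ n * (l * w)) = Q powi (- (int n * (int n - 1) div 2)) * (l * w) powi (- int n) * qtheta q (l * w)" for n
      using qtheta_powi[of "l * w" "int n"] l w0 unfolding Qn by simp
    hence thn: "qtheta q (Q ^ n * (l * w)) = qtheta q (l * w) / (Q ^ (n * (n - 1) div 2) * (l * w) ^ n)" for n
      unfolding tri_int_nat by (simp add: power_int_minus divide_inverse mult_ac)
    have inner: "((\<lambda>m. a (n, m)) has_sum (fps_nth f n / w ^ n)) UNIV" for n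
    proof -
      have "((\<lambda>m. a (n, m)) has_sum (fps_nth (qborel q f) n * l ^ n / qtheta q (l * w) * qtheta q (Q ^ n * (l * w)))) UNIV"
        unfolding trm by (intro has_sum_cmult_right qtheta_has_sum) (use l w0 in auto)
      moreover have "fps_nth (qborel q f) n * l ^ n / qtheta q (l * w) * qtheta q (Q ^ n * (l * w)) = fps_nth f n / w ^ n"
        unfolding thn using l w0 th by (simp add: qborel_def power_mult_distrib)
      ultimately show ?thesis by simp
    qed
    have lw: "norm (l * w) > 0" using l w0 by simp
    \<comment> \<open>With absolute values the inner sum is a theta function at |l w| and has the
      same dependence on n, so the double series converges absolutely and may be rearranged.\<close>
    have inorm: "((\<lambda>m. norm (a (n, m))) has_sum (norm (fps_nth f n) / norm w ^ n * (Re (qtheta q (of_real (norm (l * w)))) / norm (qtheta q (l * w))))) UNIV" for n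
    proof -
      let ?x = "q ^ n * norm (l * w)"
      have x: "?x > 0" using q0 lw by simp
      let ?T = "Re (qtheta q (of_real (norm (l * w))))"
      have re: "Re (qtheta q (of_real ?x)) = ?T / (q ^ (n * (n - 1) div 2) * norm (l * w) ^ n)"
      proof -
        have "of_real (norm (l * w)) \<noteq> (0::complex)" using lw by simp
        from qtheta_powi[OF this, of "int n"]
        have "qtheta q (of_real ?x) = Q powi (- int (n * (n - 1) div 2)) * of_real (norm (l * w)) powi (- int n) * qtheta q (of_real (norm (l * w)))"
          unfolding tri_int_nat by (simp add: mult.commute)
        also have "\<dots> = of_real (inverse (q ^ (n * (n - 1) div 2) * norm (l * w) ^ n)) * qtheta q (of_real (norm (l * w)))"
          by (simp add: power_int_minus)
        finally have "Re (qtheta q (of_real ?x)) = inverse (q ^ (n * (n - 1) div 2) * norm (l * w) ^ n) * ?T"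
          by (simp only: Re_complex_of_real Im_complex_of_real times_complex.sel mult_zero_left diff_zero)
        thus ?thesis by (simp add: divide_inverse mult_ac)
      qed
      have "((\<lambda>m. norm (fps_nth (qborel q f) n * l ^ n / qtheta q (l * w)) * (q powi (m * (m - 1) div 2) * ?x powi m)) has_sum
          (norm (fps_nth (qborel q f) n * l ^ n / qtheta q (l * w)) * Re (qtheta q (of_real ?x)))) UNIV"
        by (intro has_sum_cmult_right Re_qtheta x)
      moreover have "norm (a (n, m)) = norm (fps_nth (qborel q f) n * l ^ n / qtheta q (l * w)) * (q powi (m * (m - 1) div 2) * ?x powi m)" for m
        unfolding trm norm_mult norm_power_int using q0 by (simp add: norm_mult norm_power)
      moreover have "norm (fps_nth (qborel q f) n * l ^ n / qtheta q (l * w)) * Re (qtheta q (of_real ?x)) =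
          norm (fps_nth f n) / norm w ^ n * (?T / norm (qtheta q (l * w)))"
        unfolding re using l w0 q0 by (simp add: qborel_def norm_mult norm_divide norm_power power_mult_distrib)
      ultimately show ?thesis by simp
    qed
    have "summable (\<lambda>n. norm (fps_nth f n) / norm w ^ n)"
    proof (rule summable_comparison_test[OF exI, OF allI, OF impI])
      have "norm (\<rho> / norm w) < 1" using w \<rho> w0 by (simp add: divide_less_eq)
      thus "summable (\<lambda>n. C * (\<rho> / norm w) ^ n)" by (intro summable_mult summable_geometric)
      show "norm (norm (fps_nth f n) / norm w ^ n) \<le> C * (\<rho> / norm w) ^ n" for n
        using divide_right_mono[OF f[of n], of "norm w ^ n"] by (simp add: power_divide)
    qed
    hence "summable (\<lambda>n. norm (norm (fps_nth f n) / norm w ^ n))" by simp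
    from norm_summable_imp_summable_on[OF this]
    have "(\<lambda>n. norm (fps_nth f n) / norm w ^ n) summable_on UNIV" .
    hence "(\<lambda>n. norm (fps_nth f n) / norm w ^ n * (Re (qtheta q (of_real (norm (l * w)))) / norm (qtheta q (l * w)))) summable_on UNIV"
      by (rule summable_on_cmult_left)
    hence "(\<lambda>n. \<Sum>\<^sub>\<infinity>m. norm (a (n, m))) summable_on UNIV" using infsumI[OF inorm] by simp
    moreover have nn: "(\<lambda>n. norm (\<Sum>\<^sub>\<infinity>m. norm (a (n, m)))) = (\<lambda>n. \<Sum>\<^sub>\<infinity>m. norm (a (n, m)))"
      by (rule ext) (simp add: infsum_nonneg)
    ultimately have "(\<lambda>x. norm (a x)) summable_on (UNIV \<times> UNIV)"
      using inorm by (subst Infinite_Sum.abs_summable_on_Sigma_iff) (auto simp: summable_on_def nn)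
    hence "a summable_on (UNIV \<times> UNIV)" by (rule abs_summable_summable)
    then obtain T where T: "(a has_sum T) (UNIV \<times> UNIV)" by (auto simp: summable_on_def)
    have "((\<lambda>n. fps_nth f n / w ^ n) has_sum T) UNIV"
      by (rule has_sum_SigmaD[OF T]) (use inner in auto)
    hence "(\<lambda>n. fps_nth f n / w ^ n) sums T" by (rule has_sum_imp_sums)
    hence TF: "T = F w" using sm[of w] w sums_unique2 by fastforce
    have "((\<lambda>(m, n). a (n, m)) has_sum T) (UNIV \<times> UNIV)"
      using T by (subst has_sum_swap[symmetric]) (simp add: case_prod_beta')
    hence "((\<lambda>m. g (l * Q powi m) / qtheta q (l * Q powi m * w)) has_sum T) UNIV"
    proof (rule has_sum_SigmaD)
      fix m :: int
      let ?x = "l * Q powi m"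
      have "(\<lambda>n. fps_nth (qborel q f) n * ?x ^ n) sums g ?x"
        unfolding g_def by (rule sums_eval_fps) (simp add: rad)
      moreover have "summable (\<lambda>n. norm (fps_nth (qborel q f) n * ?x ^ n))"
        by (rule norm_summable_fps) (simp add: rad)
      ultimately have "((\<lambda>n. fps_nth (qborel q f) n * ?x ^ n) has_sum g ?x) UNIV"
        by (intro norm_summable_imp_has_sum)
      from has_sum_cmult_left[OF this, of "inverse (qtheta q (?x * w))"]
      show "((\<lambda>n. case (m, n) of (m, n) \<Rightarrow> a (n, m)) has_sum g ?x / qtheta q (?x * w)) UNIV"
        by (simp add: a_def divide_inverse)
    qed
    moreover have "F analytic_on {w}" by (rule analytic_on_subset[OF F(2)]) (use w in auto)
    ultimately show "((\<lambda>m::int. g (l * Q powi m) / qtheta q (l * Q powi m * w)) has_sum remove_sings F w) UNIV"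
      using TF by simp
  qed
  have "has_qsum q l f (remove_sings F)"
    unfolding has_qsum_def
  proof (rule exI[of _ UNIV], rule exI[of _ g], rule exI[of _ \<rho>], rule exI[of _ "C + 1"],
      rule exI[of _ "max R \<rho>"], intro conjI)
    show "open (UNIV :: complex set)" "connected (UNIV :: complex set)" "0 \<in> (UNIV :: complex set)" "qspiral q l \<subseteq> UNIV"
      "g holomorphic_on UNIV" using gh by auto
    show "remove_sings F nicely_meromorphic_on - {0}"
      by (rule remove_sings_nicely_meromorphic[OF F(1)])
    show "\<forall>\<xi>\<in>qspiral q l. norm (g \<xi>) \<le> (C + 1) * Re (qtheta q (of_real (\<rho> * norm \<xi>)))"
      using growth l by (auto simp: qspiral_iff)
    show "0 < C + 1" using C by simp
    show "0 < max R \<rho>" using R by simp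
  qed (fact ge \<rho> sum)+
  from qsum_eqI[OF this l _ _ _ _ gh ge z(1)] show ?thesis using z(2) by simp
qed

lemma poch_fps_nz: "poch_fps a \<noteq> 0"
  using poch_fps_0[of a] by (metis fps_zero_nth zero_neq_one)

lemma fps_scale_mult: "fps_scale a (f * g) = fps_scale a f * fps_scale a g"
  by (rule fps_ext) (auto simp: fps_mult_nth sum_distrib_left power_add[symmetric] mult_ac intro!: sum.cong)

text \<open>Turns nonresonance into a uniform estimate: each denominator is nonzero, and the nonzero
  limit keeps them away from 0.\<close>

lemma inverse_bounded:
  assumes lim: "f \<longlonglongrightarrow> a" and a: "a \<noteq> 0" and f: "\<And>k::nat. f k \<noteq> (0::complex)"
  obtains D where "D > 0" "\<And>k. norm (1 / f k) \<le> D"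
proof -
  have "(\<lambda>k. 1 / f k) \<longlonglongrightarrow> 1 / a" by (intro tendsto_intros lim a)
  hence "Bseq (\<lambda>k. 1 / f k)" using convergentI convergent_imp_Bseq by blast
  thus ?thesis using that unfolding Bseq_def by blast
qed

end

text \<open>
  The system \<open>F(q z) = (B - (1 - q) z E) F(z)\<close> for an arrow matrix \<open>B\<close>: its leading \<open>N \<times> N\<close> block is
  \<open>diag (c 0, \<dots>, c (N-1))\<close>, its last column \<open>(\<beta>, b)\<close>, its last row \<open>(\<gamma>, b)\<close>, its
  eigenvalues \<open>t\<close>. Indices count from 0, so \<open>N\<close> is the last one. Then \<open>c i\<close> plays the role of
  \<open>q powr \<nu>\<^sub>i\<close>, \<open>t i\<close> that of \<open>q powr \<mu>\<^sub>i\<close>, and \<open>d\<close> that of \<open>q powr \<nu>\<^sub>n\<close>.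
\<close>

locale arrow = q_base q for q +
  fixes N :: nat and c \<beta> \<gamma> :: "nat \<Rightarrow> complex" and b :: complex and t :: "nat \<Rightarrow> complex"
  assumes c_nz: "\<And>i. i < N \<Longrightarrow> c i \<noteq> 0"
    and t_nz: "\<And>i. i \<le> N \<Longrightarrow> t i \<noteq> 0"
    and c_nonres: "\<And>i j. i < N \<Longrightarrow> j < N \<Longrightarrow> i \<noteq> j \<Longrightarrow> c i \<notin> qspiral q (c j)"
    and char: "\<And>x. (\<And>i. i < N \<Longrightarrow> x \<noteq> c i) \<Longrightarrow> (x - b) * (\<Prod>i<N. x - c i) - (\<Sum>i<N. \<gamma> i * \<beta> i * (\<Prod>k\<in>{..<N}-{i}. x - c k)) =
                  (\<Prod>l\<le>N. x - t l)"
begin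

definition d :: complex where "d = (\<Prod>l\<le>N. t l) / (\<Prod>i<N. c i)"

lemma d_nz: "d \<noteq> 0"
  using c_nz t_nz by (auto simp: d_def)

definition Bt :: "(nat \<Rightarrow> complex) \<Rightarrow> nat \<Rightarrow> complex" where
  "Bt y i = (if i < N then c i * y i + \<beta> i * y N else (\<Sum>k<N. \<gamma> k * y k) + b * y N)"

definition Bt_bound :: real where
  "Bt_bound = (\<Sum>i<N. norm (c i) + norm (\<beta> i) + norm (\<gamma> i)) + norm b"

lemma Bt_bound_nonneg: "Bt_bound \<ge> 0"
  unfolding Bt_bound_def by (intro add_nonneg_nonneg sum_nonneg) auto

lemma norm_Bt: "norm (Bt y i) \<le> Bt_bound * (\<Sum>k\<le>N. norm (y k))"
proof -
  let ?S = "\<Sum>k\<le>N. norm (y k)"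
  have y: "norm (y k) \<le> ?S" if "k \<le> N" for k by (rule member_le_sum) (use that in auto)
  have S: "?S \<ge> 0" by (rule sum_nonneg) auto
  show ?thesis
  proof (cases "i < N")
    case True
    have "norm (Bt y i) \<le> norm (c i) * norm (y i) + norm (\<beta> i) * norm (y N)"
      using True by (simp add: Bt_def norm_mult[symmetric] norm_triangle_ineq)
    also have "\<dots> \<le> norm (c i) * ?S + norm (\<beta> i) * ?S"
      using True by (intro add_mono mult_left_mono y) auto
    also have "\<dots> \<le> (norm (c i) + norm (\<beta> i) + norm (\<gamma> i)) * ?S" using S by (simp add: distrib_right)
    also have "\<dots> \<le> Bt_bound * ?S"
    proof (intro mult_right_mono S)
      have "norm (c i) + norm (\<beta> i) + norm (\<gamma> i) \<le> (\<Sum>i<N. norm (c i) + norm (\<beta> i) + norm (\<gamma> i))"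
        by (rule member_le_sum[of i _ "\<lambda>i. norm (c i) + norm (\<beta> i) + norm (\<gamma> i)"]) (use True in auto)
      thus "norm (c i) + norm (\<beta> i) + norm (\<gamma> i) \<le> Bt_bound" by (simp add: Bt_bound_def add_increasing2)
    qed
    finally show ?thesis .
  next
    case False
    have "norm (Bt y i) \<le> (\<Sum>k<N. norm (\<gamma> k) * norm (y k)) + norm b * norm (y N)"
      using False unfolding Bt_def
      by (auto intro!: norm_triangle_le add_mono norm_sum[THEN order_trans] sum_mono simp: norm_mult)
    also have "\<dots> \<le> (\<Sum>k<N. norm (\<gamma> k) * ?S) + norm b * ?S"
      by (intro add_mono mult_left_mono y sum_mono) auto
    also have "\<dots> = ((\<Sum>k<N. norm (\<gamma> k)) + norm b) * ?S" by (simp add: distrib_right sum_distrib_right)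
    also have "\<dots> \<le> Bt_bound * ?S"
      unfolding Bt_bound_def by (intro mult_right_mono S add_mono sum_mono) auto
    finally show ?thesis .
  qed
qed

lemma Bt_cmult: "Bt (\<lambda>i. a * y i) i = a * Bt y i"
  by (simp add: Bt_def sum_distrib_left algebra_simps)

lemma Bt_sums:
  assumes "\<And>i. i \<le> N \<Longrightarrow> (\<lambda>k. y k i * w ^ k) sums Y i"
  shows "(\<lambda>k. Bt (y k) i * w ^ k) sums Bt Y i"
proof (cases "i < N")
  case True
  have "(\<lambda>k. c i * (y k i * w ^ k) + \<beta> i * (y k N * w ^ k)) sums (c i * Y i + \<beta> i * Y N)"
    using True by (intro sums_add sums_mult assms) auto
  thus ?thesis using True by (simp add: Bt_def algebra_simps)
next
  case False
  have "(\<lambda>k. (\<Sum>l<N. \<gamma> l * (y k l * w ^ k)) + b * (y k N * w ^ k)) sums ((\<Sum>l<N. \<gamma> l * Y l) + b * Y N)"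
    by (intro sums_add sums_mult sums_sum assms) auto
  thus ?thesis using False by (simp add: Bt_def algebra_simps sum_distrib_left)
qed

definition BtF :: "(nat \<Rightarrow> complex fps) \<Rightarrow> nat \<Rightarrow> complex fps" where
  "BtF y i = Abs_fps (\<lambda>k. Bt (\<lambda>i. fps_nth (y i) k) i)"

lemma BtF_alt: "BtF y i = (if i < N then fps_const (c i) * y i + fps_const (\<beta> i) * y N
    else (\<Sum>k<N. fps_const (\<gamma> k) * y k) + fps_const b * y N)"
  by (rule fps_ext) (auto simp: BtF_def Bt_def fps_sum_nth)

lemma BtF_mult: "BtF (\<lambda>i. y i * p) i = BtF y i * p"
  unfolding BtF_alt by (auto simp: algebra_simps sum_distrib_left sum_distrib_right)

subsection \<open>The divergent columns\<close>

definition xi :: "nat \<Rightarrow> complex" where "xi j = - (1 - Q) / c j"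

lemma oneQ: "1 - Q \<noteq> 0" using one_minus_Q[of 0] by simp

lemma xi_nz: "j < N \<Longrightarrow> xi j \<noteq> 0"
  using c_nz oneQ by (auto simp: xi_def)

text \<open>These are the denominators of \<open>ycoef\<close>. For i \<noteq> j nonresonance
  applies; for i = j it is only that no positive power of q is 1.\<close>

lemma c_res: "i < N \<Longrightarrow> j < N \<Longrightarrow> 1 - Q ^ Suc k * c i / c j \<noteq> 0"
proof
  assume ij: "i < N" "j < N" and "1 - Q ^ Suc k * c i / c j = 0"
  hence *: "c j = Q ^ Suc k * c i" using c_nz[of j] by (simp add: field_simps)
  show False
  proof (cases "i = j")
    case True thus ?thesis using * c_nz[of j] ij one_minus_Q[of k] by simp
  next
    case False
    have "c j = c i * Q powi int (Suc k)" using * by (simp only: power_int_of_nat mult.commute)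
    thus ?thesis using c_nonres[OF ij(2,1)] False unfolding qspiral_iff by blast
  qed
qed

context
  fixes j :: nat assumes j: "j < N"
begin

text \<open>
  The Borel transform of the \<open>j\<close>-th column has its poles on the spiral of \<open>xi j\<close>. Multiplied by
  \<open>(w / xi j; q)\<^sub>\<infinity>\<close> it is an entire function \<open>Y\<close> with
  \<open>c j Y(w) = (1 - w / xi j) Bt (Y(q w))\<close> in the components below \<open>N\<close> and
  \<open>(1 - q) Y(w) = w Bt (Y(q w))\<close> in the last one; \<open>ycoef\<close> solves this recursion.
\<close>

primrec ycoef :: "nat \<Rightarrow> nat \<Rightarrow> complex" where
  "ycoef 0 = (\<lambda>i. if i = j then 1 else 0)"
| "ycoef (Suc k) = (\<lambda>i. let s = (\<lambda>i. Q ^ k * Bt (ycoef k) i / (1 - Q)) in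
      if i < N then (s i + Q ^ Suc k * \<beta> i / c j * s N) / (1 - Q ^ Suc k * c i / c j) else s N)"

lemma ycoef_0: "i < N \<Longrightarrow> ycoef 0 i = 1 / c j * Bt (ycoef 0) i"
  using j c_nz[of j] by (auto simp: Bt_def)

text \<open>The vector of index k + 1 occurs on both sides of this recursion. The definition is its
  solved form: the last component is explicit, and it enters the others through \<beta>.\<close>

lemma ycoef_Suc:
  "i < N \<Longrightarrow> ycoef (Suc k) i = Q ^ Suc k / c j * Bt (ycoef (Suc k)) i + Q ^ k / (1 - Q) * Bt (ycoef k) i"
proof -
  assume i: "i < N"
  have "ycoef (Suc k) i * (1 - Q ^ Suc k * c i / c j) =
      Q ^ k * Bt (ycoef k) i / (1 - Q) + Q ^ Suc k * \<beta> i / c j * ycoef (Suc k) N"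
    using i c_res[OF i j, of k] by (simp add: Let_def del: power_Suc)
  moreover have "Bt (ycoef (Suc k)) i = c i * ycoef (Suc k) i + \<beta> i * ycoef (Suc k) N"
    using i by (simp only: Bt_def if_True)
  ultimately show ?thesis by (simp add: algebra_simps del: ycoef.simps power_Suc)
qed

lemma ycoef_Suc_N: "ycoef (Suc k) N = Q ^ k / (1 - Q) * Bt (ycoef k) N"
  by (simp add: Let_def)

text \<open>The sum a of the absolute values of the components satisfies a (k + 1) \<le> K q^k a k.
  The constant combines the norm of the arrow matrix with bounds \<open>D i\<close> for the
  reciprocal denominators.\<close>

lemma ycoef_bound:
  obtains K where "K > 0" "\<And>k i. i \<le> N \<Longrightarrow> norm (ycoef k i) \<le> 1 * K ^ k * q ^ (k * (k - 1) div 2)"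
proof -
  have "\<exists>D. D > 0 \<and> (\<forall>k. norm (1 / (1 - Q ^ Suc k * c i / c j)) \<le> D)" if i: "i < N" for i
  proof -
    have "(\<lambda>k. 1 - Q ^ Suc k * (c i / c j)) \<longlonglongrightarrow> 1 - 0"
      by (intro tendsto_diff tendsto_const LIMSEQ_Suc tendsto_Q_pow)
    hence "(\<lambda>k. 1 - Q ^ Suc k * c i / c j) \<longlonglongrightarrow> 1" by simp
    from inverse_bounded[OF this _ c_res[OF i j]] show ?thesis by auto
  qed
  then obtain D where D: "\<And>i. i < N \<Longrightarrow> D i > 0" "\<And>i k. i < N \<Longrightarrow> norm (1 / (1 - Q ^ Suc k * c i / c j)) \<le> D i" by metis
  define a where "a = (\<lambda>k. \<Sum>i\<le>N. norm (ycoef k i))"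
  have a: "a k \<ge> 0" for k unfolding a_def by (rule sum_nonneg) auto
  define L where "L = Bt_bound / (1 - q)"
  have L: "L \<ge> 0" using Bt_bound_nonneg q1 by (simp add: L_def)
  define K where "K = (\<Sum>i<N. D i * ((1 + norm (\<beta> i / c j)) * L)) + L"
  have n1q: "norm (1 - Q) = 1 - q" using q1 by (metis abs_of_pos diff_gt_0_iff_gt norm_of_real of_real_1 of_real_diff)
  have s: "norm (Q ^ k * Bt (ycoef k) i / (1 - Q)) \<le> q ^ k * L * a k" for k i
  proof -
    have "q ^ k * norm (Bt (ycoef k) i) / (1 - q) \<le> q ^ k * (Bt_bound * a k) / (1 - q)"
      using q0 q1 norm_Bt[of "ycoef k" i] by (intro divide_right_mono mult_left_mono) (auto simp: a_def)
    thus ?thesis using n1q q0 by (simp add: norm_mult norm_divide norm_power L_def mult_ac)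
  qed
  have "a (Suc k) \<le> K * q ^ k * a k" for k
  proof -
    have 1: "norm (ycoef (Suc k) i) \<le> D i * ((1 + norm (\<beta> i / c j)) * L) * (q ^ k * a k)" if i: "i < N" for i
    proof -
      let ?s = "\<lambda>i. Q ^ k * Bt (ycoef k) i / (1 - Q)"
      have "norm (ycoef (Suc k) i) = norm (1 / (1 - Q ^ Suc k * c i / c j)) * norm (?s i + Q ^ Suc k * \<beta> i / c j * ?s N)"
        using i by (simp add: Let_def norm_divide del: power_Suc)
      also have "\<dots> \<le> D i * ((q ^ k * L * a k) + norm (\<beta> i / c j) * (q ^ k * L * a k))"
      proof (intro mult_mono D i)
        have "norm (Q ^ Suc k * \<beta> i / c j * ?s N) = q ^ Suc k * (norm (\<beta> i / c j) * norm (?s N))"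
          using q0 by (simp add: norm_mult norm_divide norm_power)
        also have "\<dots> \<le> 1 * (norm (\<beta> i / c j) * (q ^ k * L * a k))"
          using q0 q1 s[of k N] by (intro mult_mono power_le_one mult_left_mono) auto
        finally show "norm (?s i + Q ^ Suc k * \<beta> i / c j * ?s N) \<le> (q ^ k * L * a k) + norm (\<beta> i / c j) * (q ^ k * L * a k)"
          using s[of k i] by (intro norm_triangle_le add_mono) auto
      qed (use D(1)[OF i] in auto)
      finally show ?thesis by (simp add: algebra_simps)
    qed
    have 2: "norm (ycoef (Suc k) N) \<le> L * (q ^ k * a k)"
      using s[of k N] by (simp add: Let_def mult_ac)
    have "a (Suc k) = (\<Sum>i<N. norm (ycoef (Suc k) i)) + norm (ycoef (Suc k) N)"
      unfolding a_def by (simp only: lessThan_Suc_atMost[symmetric] sum.lessThan_Suc)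
    also have "\<dots> \<le> (\<Sum>i<N. D i * ((1 + norm (\<beta> i / c j)) * L) * (q ^ k * a k)) + L * (q ^ k * a k)"
      by (intro add_mono sum_mono 1 2) auto
    also have "\<dots> = K * q ^ k * a k" unfolding K_def by (simp only: distrib_right[of "sum _ _"] sum_distrib_right mult.assoc)
    finally show ?thesis .
  qed
  moreover have K: "K \<ge> 0" unfolding K_def using D(1) L
    by (intro add_nonneg_nonneg sum_nonneg mult_nonneg_nonneg) (auto simp: less_imp_le)
  ultimately have b: "a k \<le> a 0 * K ^ k * q ^ (k * (k - 1) div 2)" for k by (intro gauss_rec_bound) auto
  have "a 0 = (\<Sum>i\<le>N. if i = j then 1 else 0)" unfolding a_def by (intro sum.cong) auto
  hence a0: "a 0 = 1" using j by simp
  show ?thesis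
  proof (rule that[of "K + 1"])
    show "K + 1 > 0" using K by simp
    fix k i :: nat assume i: "i \<le> N"
    have "norm (ycoef k i) \<le> a k" unfolding a_def by (rule member_le_sum) (use i in auto)
    also have "\<dots> \<le> 1 * K ^ k * q ^ (k * (k - 1) div 2)" using b[of k] a0 by simp
    also have "\<dots> \<le> 1 * (K + 1) ^ k * q ^ (k * (k - 1) div 2)"
      using q0 K by (intro mult_right_mono mult_left_mono power_mono) auto
    finally show "norm (ycoef k i) \<le> 1 * (K + 1) ^ k * q ^ (k * (k - 1) div 2)" .
  qed
qed

definition Yfps :: "nat \<Rightarrow> complex fps" where "Yfps i = Abs_fps (\<lambda>k. ycoef k i)"

definition Y :: "nat \<Rightarrow> complex \<Rightarrow> complex" where "Y i = eval_fps (Yfps i)"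

lemma Yfps_conv: "i \<le> N \<Longrightarrow> fps_conv_radius (Yfps i) = \<infinity>"
proof -
  assume i: "i \<le> N"
  obtain K where "K > 0" "\<And>k i. i \<le> N \<Longrightarrow> norm (ycoef k i) \<le> 1 * K ^ k * q ^ (k * (k - 1) div 2)"
    by (rule ycoef_bound) blast
  thus ?thesis using i by (intro gauss_fps_conv_radius[of _ 1 K]) (auto simp: Yfps_def)
qed

lemma Y_sums: "i \<le> N \<Longrightarrow> (\<lambda>k. ycoef k i * w ^ k) sums Y i w"
  using sums_eval_fps[of w "Yfps i"] Yfps_conv[of i] by (simp add: Y_def Yfps_def)

lemma Y_holomorphic: "i \<le> N \<Longrightarrow> Y i holomorphic_on S"
  unfolding Y_def by (intro holomorphic_on_eval_fps) (auto simp: Yfps_conv)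

lemma Y_rec: "i < N \<Longrightarrow> Y i w = 1 / c j * (1 - w / xi j) * Bt (\<lambda>i. Y i (Q * w)) i"
proof -
  assume i: "i < N"
  have s: "(\<lambda>k. Bt (ycoef k) i * (Q * w) ^ k) sums Bt (\<lambda>i. Y i (Q * w)) i"
    by (rule Bt_sums) (rule Y_sums)
  let ?B = "Bt (\<lambda>i. Y i (Q * w)) i"
  have s1: "(\<lambda>k. 1 / c j * (Bt (ycoef (Suc k)) i * (Q * w) ^ Suc k)) sums (1 / c j * (?B - Bt (ycoef 0) i))"
    using s by (intro sums_mult) (subst sums_Suc_iff, simp)
  have s2: "(\<lambda>k. w / (1 - Q) * (Bt (ycoef k) i * (Q * w) ^ k)) sums (w / (1 - Q) * ?B)"
    by (intro sums_mult s)
  have "(\<lambda>k. ycoef (Suc k) i * w ^ Suc k) sums (1 / c j * (?B - Bt (ycoef 0) i) + w / (1 - Q) * ?B)"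
  proof (rule sums_cong[THEN iffD1, OF _ sums_add[OF s1 s2]])
    fix k
    show "1 / c j * (Bt (ycoef (Suc k)) i * (Q * w) ^ Suc k) + w / (1 - Q) * (Bt (ycoef k) i * (Q * w) ^ k) =
        ycoef (Suc k) i * w ^ Suc k"
      unfolding ycoef_Suc[OF i] power_mult_distrib by (simp add: algebra_simps del: ycoef.simps)
  qed
  moreover have "(\<lambda>k. ycoef (Suc k) i * w ^ Suc k) sums (Y i w - ycoef 0 i)"
    using Y_sums[of i w] i by (subst sums_Suc_iff) (simp del: ycoef.simps)
  ultimately have "Y i w - ycoef 0 i = 1 / c j * (?B - Bt (ycoef 0) i) + w / (1 - Q) * ?B"
    by (rule sums_unique2[rotated])
  hence "Y i w = 1 / c j * ?B + w / (1 - Q) * ?B"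
    unfolding ycoef_0[OF i] by (simp add: algebra_simps del: ycoef.simps)
  moreover have "1 / c j * (1 - w / xi j) = 1 / c j + w / (1 - Q)"
    using c_nz[OF j] oneQ by (simp add: xi_def field_simps)
  ultimately show ?thesis by (simp add: distrib_right)
qed

lemma Y_rec_N: "Y N w = w / (1 - Q) * Bt (\<lambda>i. Y i (Q * w)) N"
proof -
  have s: "(\<lambda>k. Bt (ycoef k) N * (Q * w) ^ k) sums Bt (\<lambda>i. Y i (Q * w)) N"
    by (rule Bt_sums) (rule Y_sums)
  have "(\<lambda>k. ycoef (Suc k) N * w ^ Suc k) sums (w / (1 - Q) * Bt (\<lambda>i. Y i (Q * w)) N)"
  proof (rule sums_cong[THEN iffD1, OF _ sums_mult[OF s]])
    fix k
    show "w / (1 - Q) * (Bt (ycoef k) N * (Q * w) ^ k) = ycoef (Suc k) N * w ^ Suc k"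
      unfolding ycoef_Suc_N power_mult_distrib by (simp add: algebra_simps del: ycoef.simps)
  qed
  moreover have "(\<lambda>k. ycoef (Suc k) N * w ^ Suc k) sums (Y N w - ycoef 0 N)"
    using Y_sums[of N w] by (subst sums_Suc_iff) (simp del: ycoef.simps)
  moreover have "ycoef 0 N = 0" using j by simp
  ultimately show ?thesis using sums_unique2 by fastforce
qed

text \<open>The Borel transform of column j as a power series, that is, the entire numerator divided
  by (w / \<open>xi j\<close>; q)_\<infinity>. The series \<open>xf\<close> below undoes the Borel
  transform.\<close>

definition xh :: "nat \<Rightarrow> complex fps" where
  "xh i = Yfps i * inverse (poch_fps (1 / xi j))"

definition xf :: "nat \<Rightarrow> complex fps" where
  "xf i = Abs_fps (\<lambda>m. fps_nth (xh i) m / Q ^ (m * (m - 1) div 2))"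

lemma qborel_xf: "qborel q (xf i) = xh i"
  by (rule fps_ext) (simp add: qborel_def xf_def)

lemma xh_mult: "xh i * poch_fps (1 / xi j) = Yfps i"
  unfolding xh_def by (simp add: mult.assoc inverse_mult_eq_1 )

text \<open>The Pochhammer series satisfies p(w) = (1 - w / \<open>xi j\<close>) p(q w). Dividing
  the recursion for Y by it therefore removes the factor 1 - w / \<open>xi j\<close> below N and
  creates it in the last component.\<close>

lemma xh_fps:
  shows "i < N \<Longrightarrow> fps_const (c j) * xh i = BtF (\<lambda>i. fps_scale Q (xh i)) i"
    and "(1 - fps_const (1 / xi j) * fps_X) * xh N = fps_const (1 / (1 - Q)) * fps_X * BtF (\<lambda>i. fps_scale Q (xh i)) N"
proof -
  let ?p = "poch_fps (1 / xi j)"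
  let ?u = "1 - fps_const (1 / xi j) * fps_X :: complex fps"
  have p: "?p = ?u * fps_scale Q ?p" by (rule poch_fps_rec)
  have sp: "fps_scale Q ?p \<noteq> 0" using poch_fps_0[of "1 / xi j"]
    by (metis fps_scale_nth fps_zero_nth power_0 mult_1 zero_neq_one)
  have u0: "?u \<noteq> 0"
    by (metis p poch_fps_nz mult_zero_left)
  have B: "BtF (\<lambda>i. fps_scale Q (Yfps i)) i = BtF (\<lambda>i. fps_scale Q (xh i)) i * fps_scale Q ?p" for i
    unfolding xh_mult[symmetric] fps_scale_mult BtF_mult ..
  have c: "(1 / c j) = - (1 / xi j) / ((c j) * (c j) / (1 - Q))" using c_nz[OF j] oneQ by (simp add: xi_def field_simps)
  {
    assume i: "i < N"
    have "fps_const (c j) * Yfps i = ?u * BtF (\<lambda>i. fps_scale Q (Yfps i)) i"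
    proof (rule fps_ext)
      fix n
      show "fps_nth (fps_const (c j) * Yfps i) n = fps_nth (?u * BtF (\<lambda>i. fps_scale Q (Yfps i)) i) n"
      proof (cases n)
        case 0
        have "c j * ycoef 0 i = Bt (ycoef 0) i" using ycoef_0[OF i] c_nz[OF j] by (simp del: ycoef.simps)
        thus ?thesis by (simp add: 0 Yfps_def BtF_def fps_mult_nth del: ycoef.simps)
      next
        case (Suc k)
        have "c j * ycoef (Suc k) i = Q ^ Suc k * Bt (ycoef (Suc k)) i - (1 / xi j) * (Q ^ k * Bt (ycoef k) i)"
          using c_nz[OF j] oneQ by (subst ycoef_Suc[OF i]) (simp add: xi_def field_simps del: ycoef.simps)
        moreover have "fps_nth (?u * F) (Suc k) = fps_nth F (Suc k) - (1 / xi j) * fps_nth F k" for F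
          by (simp add: left_diff_distrib mult.assoc)
        ultimately show ?thesis
          by (simp add: Suc Yfps_def BtF_def Bt_cmult del: ycoef.simps power_Suc)
      qed
    qed
    hence "fps_const (c j) * Yfps i = ?u * (BtF (\<lambda>i. fps_scale Q (xh i)) i * fps_scale Q ?p)"
      unfolding B .
    hence "(fps_const (c j) * xh i) * ?p = ?u * (BtF (\<lambda>i. fps_scale Q (xh i)) i * fps_scale Q ?p)"
      by (simp only: mult.assoc xh_mult)
    also have "\<dots> = BtF (\<lambda>i. fps_scale Q (xh i)) i * ?p" by (subst (2) p) (simp add: mult_ac)
    finally show "fps_const (c j) * xh i = BtF (\<lambda>i. fps_scale Q (xh i)) i"
      using poch_fps_nz by simp
  }
  have "Yfps N = fps_const (1 / (1 - Q)) * fps_X * BtF (\<lambda>i. fps_scale Q (Yfps i)) N"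
  proof (rule fps_ext)
    fix n
    show "fps_nth (Yfps N) n = fps_nth (fps_const (1 / (1 - Q)) * fps_X * BtF (\<lambda>i. fps_scale Q (Yfps i)) N) n"
    proof (cases n)
      case 0
      thus ?thesis using j by (simp add: Yfps_def fps_mult_nth)
    next
      case (Suc k)
      thus ?thesis using ycoef_Suc_N[of k]
        by (simp add: Yfps_def BtF_def Bt_cmult mult.assoc del: ycoef.simps)
    qed
  qed
  hence "xh N * (?u * fps_scale Q ?p) = fps_const (1 / (1 - Q)) * fps_X * (BtF (\<lambda>i. fps_scale Q (xh i)) N * fps_scale Q ?p)"
    unfolding B p[symmetric] xh_mult .
  hence "(?u * xh N) * fps_scale Q ?p = (fps_const (1 / (1 - Q)) * fps_X * BtF (\<lambda>i. fps_scale Q (xh i)) N) * fps_scale Q ?p"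
    by (simp only: mult_ac)
  thus "?u * xh N = fps_const (1 / (1 - Q)) * fps_X * BtF (\<lambda>i. fps_scale Q (xh i)) N"
    using sp by simp
qed

lemma xh_coef: "i < N \<Longrightarrow> c j * fps_nth (xh i) m = Q ^ m * Bt (\<lambda>i. fps_nth (xh i) m) i"
  using arg_cong[OF xh_fps(1), of i "\<lambda>f. fps_nth f m"] by (simp add: BtF_def Bt_cmult)

lemma xh_coef_N: "fps_nth (xh N) (Suc m) - 1 / xi j * fps_nth (xh N) m = Q ^ m / (1 - Q) * Bt (\<lambda>i. fps_nth (xh i) m) N"
proof -
  have "fps_nth ((1 - fps_const (1 / xi j) * fps_X) * xh N) (Suc m) = fps_nth (xh N) (Suc m) - (1 / xi j) * fps_nth (xh N) m"
    by (simp add: left_diff_distrib mult.assoc)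
  thus ?thesis unfolding xh_fps(2) by (simp add: BtF_def Bt_cmult mult.assoc)
qed

lemma xh_0: "i \<le> N \<Longrightarrow> fps_nth (xh i) 0 = (if i = j then 1 else 0)"
  by (simp add: xh_def Yfps_def fps_mult_nth)

lemma xf_0: "i \<le> N \<Longrightarrow> fps_nth (xf i) 0 = (if i = j then 1 else 0)"
  by (simp add: xf_def xh_0)

text \<open>Here c_j / q^m is the factor by which the power of z with exponent \<nu>_j - m changes
  under z \<mapsto> q z.\<close>

lemma xf_coef: "i < N \<Longrightarrow> c j / Q ^ m * fps_nth (xf i) m = Bt (\<lambda>i. fps_nth (xf i) m) i"
  using xh_coef[of i m] Bt_cmult[of "1 / Q ^ (m * (m - 1) div 2)" "\<lambda>i. fps_nth (xh i) m" i]
  by (simp add: xf_def field_simps)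

lemma xf_coef_N: "c j / Q ^ m * fps_nth (xf N) m = Bt (\<lambda>i. fps_nth (xf i) m) N - (1 - Q) * fps_nth (xf N) (Suc m)"
proof -
  let ?T = "Q ^ (m * (m - 1) div 2)"
  have B: "Bt (\<lambda>i. fps_nth (xf i) m) N = Bt (\<lambda>i. fps_nth (xh i) m) N / ?T"
    using Bt_cmult[of "1 / ?T" "\<lambda>i. fps_nth (xh i) m" N] by (simp add: xf_def)
  have S: "fps_nth (xf N) (Suc m) = fps_nth (xh N) (Suc m) / (?T * Q ^ m)"
    unfolding xf_def fps_nth_Abs_fps diff_Suc_1 tri_nat_Suc power_add by simp
  have x: "1 / xi j = - (c j / (1 - Q))"
    by (simp only: xi_def divide_divide_eq_right mult_1_left minus_divide_right)
  have "fps_nth (xh N) (Suc m) = Q ^ m / (1 - Q) * Bt (\<lambda>i. fps_nth (xh i) m) N - c j / (1 - Q) * fps_nth (xh N) m"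
    using xh_coef_N[of m] unfolding x by (simp add: algebra_simps)
  thus ?thesis unfolding B S using oneQ by (simp add: xf_def field_simps)
qed

definition gx :: "nat \<Rightarrow> complex \<Rightarrow> complex" where
  "gx i w = Y i w / qpoch q (w / xi j)"

lemma gx_rec: 
  assumes "qpoch q (w / xi j) \<noteq> 0"
  shows "i < N \<Longrightarrow> gx i w = 1 / c j * Bt (\<lambda>i. gx i (Q * w)) i"
    and "gx N w = w / (1 - Q) / (1 - w / xi j) * Bt (\<lambda>i. gx i (Q * w)) N"
proof -
  have p: "qpoch q (w / xi j) = (1 - w / xi j) * qpoch q (Q * w / xi j)"
    using qpoch_rec[of "w / xi j"] by simp
  define u where "u = 1 - w / xi j"
  have p: "qpoch q (w / xi j) = u * qpoch q (Q * w / xi j)" unfolding u_def by (rule p)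
  have nz: "u \<noteq> 0" "qpoch q (Q * w / xi j) \<noteq> 0" using assms unfolding p by auto
  have B: "Bt (\<lambda>i. gx i (Q * w)) i = Bt (\<lambda>i. Y i (Q * w)) i / qpoch q (Q * w / xi j)" for i
    using Bt_cmult[of "1 / qpoch q (Q * w / xi j)" "\<lambda>i. Y i (Q * w)" i] by (simp add: gx_def)
  show "gx i w = 1 / c j * Bt (\<lambda>i. gx i (Q * w)) i" if "i < N"
    unfolding B unfolding gx_def p Y_rec[OF that] u_def[symmetric] using nz by simp
  show "gx N w = w / (1 - Q) / (1 - w / xi j) * Bt (\<lambda>i. gx i (Q * w)) N"
    unfolding B unfolding gx_def p u_def[symmetric] using nz by (subst Y_rec_N) simp
qed

text \<open>The poles are zeros of (w / \<open>xi j\<close>; q)_\<infinity> and so avoid the spiral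
  of l. Outward along that spiral \<open>gx_rec\<close> has bounded coefficients, since w / ((1 -
  q)(1 - w / \<open>xi j\<close>)) = 1 / ((1 - q) / w + c_j) tends to 1 / c_j; this gives geometric
  growth. Inward the values are bounded by continuity at 0.\<close>

lemma gx_borel_cont:
  assumes i: "i \<le> N" and l: "l \<noteq> 0" "l \<notin> qspiral q (xi j)"
  shows "borel_cont l (xf i) (gx i)"
proof -
  define P where "P = {w. qpoch q (w / xi j) = 0}"
  note x0 = xi_nz[OF j]
  have Psub: "P \<subseteq> qspiral q (xi j)"
  proof
    fix w assume "w \<in> P"
    then obtain n where "w / xi j * Q ^ n = 1" by (auto simp: P_def qpoch_eq_0_iff)
    hence "w = xi j * Q powi (- int n)" using x0 by (simp add: power_int_minus field_simps)
    thus "w \<in> qspiral q (xi j)" by (auto simp: qspiral_iff)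
  qed
  have lP: "l * Q powi m \<notin> qspiral q (xi j)" for m
  proof
    assume "l * Q powi m \<in> qspiral q (xi j)"
    then obtain k where "l * Q powi m = xi j * Q powi k" by (auto simp: qspiral_iff)
    hence "l = xi j * Q powi (k - m)" by (simp add: power_int_diff field_simps)
    thus False using l by (auto simp: qspiral_iff)
  qed
  have hp: "(\<lambda>w. qpoch q (w / xi j)) holomorphic_on UNIV" by (intro holomorphic_intros) (use x0 in auto)
  have "closed ((\<lambda>w. qpoch q (w / xi j)) -` {0})"
    by (intro closed_vimage holomorphic_on_imp_continuous_on hp closed_singleton)
  hence cl: "closed P" by (simp add: P_def vimage_def)
  have 1: "closed P \<and> countable P \<and> 0 \<notin> P \<and> qspiral q l \<inter> P = {} \<and> gx i holomorphic_on - P"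
  proof (intro conjI cl)
    show "countable P" by (rule countable_subset[OF Psub countable_qspiral])
    show "0 \<notin> P" by (simp add: P_def)
    have "l * Q powi m \<notin> P" for m using Psub lP by blast
    thus "qspiral q l \<inter> P = {}" unfolding qspiral_def by auto
    have "gx i = (\<lambda>w. Y i w / qpoch q (w / xi j))" by (rule ext) (simp add: gx_def)
    thus "gx i holomorphic_on - P"
      using x0 by (auto simp: P_def intro!: holomorphic_intros Y_holomorphic i)
  qed
  have 2: "gx i has_fps_expansion qborel q (xf i)"
  proof -
    have "eval_fps (poch_fps (1 / xi j)) has_fps_expansion poch_fps (1 / xi j)"
      by (rule eval_fps_has_fps_expansion) simp
    moreover have "Y i has_fps_expansion Yfps i" unfolding Y_def
      by (rule eval_fps_has_fps_expansion) (simp add: Yfps_conv i)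
    ultimately have "(\<lambda>w. Y i w * inverse (eval_fps (poch_fps (1 / xi j)) w)) has_fps_expansion xh i"
      unfolding xh_def by (intro has_fps_expansion_mult has_fps_expansion_inverse) auto
    moreover have "(\<lambda>w. Y i w * inverse (eval_fps (poch_fps (1 / xi j)) w)) = gx i"
      by (rule ext) (simp add: gx_def qpoch_eval[symmetric] divide_inverse mult.commute)
    ultimately show ?thesis by (simp add: qborel_xf)
  qed
  have nz: "qpoch q (l * Q powi m / xi j) \<noteq> 0" for m using lP[of m] Psub by (auto simp: P_def)
  define a where "a = (\<lambda>k. \<Sum>i\<le>N. norm (gx i (l / Q ^ k)))"
  have a: "a k \<ge> 0" for k unfolding a_def by (rule sum_nonneg) auto
  have "(\<lambda>k. Q ^ Suc k * ((1 - Q) / l) + c j) \<longlonglongrightarrow> 0 + c j"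
    by (intro tendsto_add tendsto_const LIMSEQ_Suc tendsto_Q_pow)
  hence lim: "(\<lambda>k. Q ^ Suc k * ((1 - Q) / l) + c j) \<longlonglongrightarrow> c j" by simp
  have key: "Q ^ k * ((1 - Q) / l) + c j = (1 - l / Q ^ k / xi j) * ((1 - Q) / (l / Q ^ k))" for k
    using c_nz[OF j] oneQ l by (simp add: xi_def field_simps)
  have nz1: "1 - l / Q ^ k / xi j \<noteq> 0" for k
    using nz[of "- int k"] qpoch_rec[of "l / Q ^ k / xi j"] by (auto simp: power_int_minus divide_inverse)
  have nz2: "Q ^ Suc k * ((1 - Q) / l) + c j \<noteq> 0" for k
    unfolding key using nz1[of "Suc k"] l oneQ by simp
  obtain D where D: "D > 0" "\<And>k. norm (1 / (Q ^ Suc k * ((1 - Q) / l) + c j)) \<le> D"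
    using inverse_bounded[OF lim c_nz[OF j] nz2] by blast
  define L where "L = (real N * norm (1 / c j) + D) * Bt_bound"
  have L: "L \<ge> 0" unfolding L_def using D Bt_bound_nonneg by (intro mult_nonneg_nonneg add_nonneg_nonneg) auto
  have step: "a (Suc k) \<le> L * a k" for k
  proof -
    let ?w = "l / Q ^ Suc k"
    have Qw: "Q * ?w = l / Q ^ k" by simp
    have nzw: "qpoch q (?w / xi j) \<noteq> 0" using nz[of "- int (Suc k)"] 
      by (simp add: power_int_minus divide_inverse del: of_nat_Suc power_Suc)
    have B: "norm (Bt (\<lambda>i. gx i (Q * ?w)) i) \<le> Bt_bound * a k" for i
      unfolding Qw a_def by (rule norm_Bt)
    have 1: "norm (gx i ?w) \<le> norm (1 / c j) * (Bt_bound * a k)" if "i < N" for i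
      using mult_left_mono[OF B[of i], of "norm (1 / c j)"] gx_rec(1)[OF nzw that] by (simp add: norm_mult norm_divide)
    have "?w / (1 - Q) / (1 - ?w / xi j) = 1 / (Q ^ Suc k * ((1 - Q) / l) + c j)"
      unfolding key[of "Suc k"] by simp
    hence "norm (gx N ?w) = norm (1 / (Q ^ Suc k * ((1 - Q) / l) + c j)) * norm (Bt (\<lambda>i. gx i (Q * ?w)) N)"
      using gx_rec(2)[OF nzw] by (simp only: norm_mult)
    also have "\<dots> \<le> D * (Bt_bound * a k)"
      by (intro mult_mono D B) (use D in auto)
    finally have 2: "norm (gx N ?w) \<le> D * (Bt_bound * a k)" .
    have "a (Suc k) = (\<Sum>i<N. norm (gx i ?w)) + norm (gx N ?w)"
      unfolding a_def by (simp only: lessThan_Suc_atMost[symmetric] sum.lessThan_Suc)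
    also have "\<dots> \<le> (\<Sum>i<N. norm (1 / c j) * (Bt_bound * a k)) + D * (Bt_bound * a k)"
      by (intro add_mono sum_mono 1 2) auto
    also have "\<dots> = L * a k" by (simp add: L_def algebra_simps)
    finally show ?thesis .
  qed
  have ak: "a k \<le> a 0 * max 1 L ^ k" for k
  proof (induction k)
    case (Suc k)
    have "a (Suc k) \<le> max 1 L * a k" using step[of k] mult_right_mono[of L "max 1 L" "a k"] a[of k] by simp
    also have "\<dots> \<le> max 1 L * (a 0 * max 1 L ^ k)" using Suc by (intro mult_left_mono) auto
    finally show ?case by (simp add: mult_ac)
  qed auto
  have "(\<lambda>k. Q ^ k * l) \<longlonglongrightarrow> 0" by (rule tendsto_Q_pow)
  moreover have "isCont (gx i) 0" by (rule has_fps_expansion_imp_continuous[OF 2])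
  ultimately have "(\<lambda>k. gx i (Q ^ k * l)) \<longlonglongrightarrow> gx i 0" by (rule isCont_tendsto_compose[rotated])
  hence "Bseq (\<lambda>k. gx i (Q ^ k * l))" by (intro convergent_imp_Bseq convergentI)
  then obtain M where M: "M > 0" "\<And>k. norm (gx i (Q ^ k * l)) \<le> M"
    unfolding Bseq_def by blast
  have 3: "norm (gx i (l * Q powi m)) \<le> (M + a 0) * max 1 L ^ nat (- m)" for m
  proof (cases m rule: int_cases2)
    case (nonneg n)
    thus ?thesis using M(2)[of n] a[of 0] by (simp add: mult.commute)
  next
    case (nonpos n)
    have "norm (gx i (l / Q ^ n)) \<le> a n" unfolding a_def by (rule member_le_sum) (use i in auto)
    also have "\<dots> \<le> a 0 * max 1 L ^ n" by (rule ak)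
    also have "\<dots> \<le> (M + a 0) * max 1 L ^ n" using M by (intro mult_right_mono) auto
    finally show ?thesis using nonpos by (simp add: power_int_minus divide_inverse)
  qed
  have "0 \<le> M + a 0" "1 \<le> max 1 L" using M a[of 0] by auto
  thus ?thesis unfolding borel_cont_def using 1 2 3 by blast
qed

end

end

section \<open>Growth of entire functions along spirals\<close>

context q_base
begin

text \<open>The power series is majorised by the nonnegative half of a theta series, and the
  quasi-period of theta gives the rate q^(- k (k - 1) / 2) for k \<le> 0. This rate has to be
  compared with the Gaussian factors in \<open>Phi_term\<close>.\<close>

lemma gauss_eval_bound:
  assumes f: "\<And>n. norm (fps_nth f n) \<le> M * K ^ n * q ^ (n * (n - 1) div 2)" and K: "K > 0" and r: "r > 0"
  obtains T L where "T > 0" "L \<ge> 1"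
    "\<And>x k. norm x \<le> r \<Longrightarrow> k \<ge> 0 \<Longrightarrow> norm (eval_fps f (x * Q powi k)) \<le> T"
    "\<And>x k. norm x \<le> r \<Longrightarrow> k \<le> 0 \<Longrightarrow>
       norm (eval_fps f (x * Q powi k)) \<le> T * L ^ nat \<bar>k\<bar> * q powi (- (k * (k - 1) div 2))"
proof -
  have M: "M \<ge> 0" using f[of 0] norm_ge_zero[of "fps_nth f 0"] by (simp del: norm_ge_zero)
  have b: "norm (eval_fps f x) \<le> M * Re (qtheta q (of_real (K * y)))" if x: "norm x \<le> y" and y: "y > 0" for x y
  proof -
    have xK: "K * y > 0" using y K by simp
    let ?a = "\<lambda>m::int. q powi (m * (m - 1) div 2) * (K * y) powi m"
    have hs: "(?a has_sum Re (qtheta q (of_real (K * y)))) UNIV" by (rule Re_qtheta[OF xK])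
    have sl: "?a summable_on range int"
      by (rule summable_on_subset_banach[of _ UNIV]) (use hs in \<open>auto simp: summable_on_def\<close>)
    have "(\<Sum>\<^sub>\<infinity>m\<in>range int. ?a m) \<le> (\<Sum>\<^sub>\<infinity>m. ?a m)"
      by (rule infsum_mono2) (use sl hs q0 xK in \<open>auto simp: summable_on_def\<close>)
    also have "\<dots> = Re (qtheta q (of_real (K * y)))" using hs by (rule infsumI)
    finally have 1: "(\<Sum>\<^sub>\<infinity>m\<in>range int. ?a m) \<le> Re (qtheta q (of_real (K * y)))" .
    have "(?a has_sum (\<Sum>\<^sub>\<infinity>m\<in>range int. ?a m)) (range int)" using sl by (rule has_sum_infsum)
    hence "((?a \<circ> int) has_sum (\<Sum>\<^sub>\<infinity>m\<in>range int. ?a m)) UNIV"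
      by (subst (asm) has_sum_reindex) (auto simp: inj_on_def)
    hence "(?a \<circ> int) sums (\<Sum>\<^sub>\<infinity>m\<in>range int. ?a m)" by (rule has_sum_imp_sums)
    hence s: "(\<lambda>n. M * (?a (int n))) sums (M * (\<Sum>\<^sub>\<infinity>m\<in>range int. ?a m))" by (intro sums_mult) (simp add: o_def)
    have "norm (fps_nth f n * x ^ n) \<le> M * ?a (int n)" for n
    proof -
      have "norm (fps_nth f n * x ^ n) \<le> (M * K ^ n * q ^ (n * (n - 1) div 2)) * y ^ n"
        unfolding norm_mult norm_power using K q0 x M by (intro mult_mono f power_mono) auto
      also have "\<dots> = M * ?a (int n)" unfolding tri_int_nat by (simp add: power_mult_distrib mult_ac)
      finally show ?thesis .
    qed
    hence "norm (\<Sum>n. fps_nth f n * x ^ n) \<le> (\<Sum>n. M * ?a (int n))"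
      using s by (intro norm_suminf_le) (auto simp: sums_iff)
    hence "norm (eval_fps f x) \<le> M * (\<Sum>\<^sub>\<infinity>m\<in>range int. ?a m)"
      using s unfolding eval_fps_def by (simp add: sums_iff)
    also have "\<dots> \<le> M * Re (qtheta q (of_real (K * y)))" using 1 M by (intro mult_left_mono) auto
    finally show ?thesis .
  qed
  define T where "T = M * Re (qtheta q (of_real (K * r)))"
  have Kr: "K * r > 0" using K r by simp
  have Re0: "Re (qtheta q (of_real (K * r))) \<ge> 0" using Re_qtheta_ge[OF Kr, of 0] by simp
  have T: "T \<ge> 0" unfolding T_def using M Re0 by simp
  show ?thesis
  proof (rule that[of "T + 1" "max 1 (K * r)"])
    show "T + 1 > 0" "1 \<le> max 1 (K * r)" using T by auto
    fix x :: complex and k :: int assume x: "norm x \<le> r"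
    {
      assume "k \<ge> 0"
      then obtain n where k: "k = int n" using nonneg_int_cases by blast
      have "norm x * q ^ n \<le> r * 1" using x q0 q1 r by (intro mult_mono power_le_one) auto
      hence "norm (x * Q powi k) \<le> r" using q0 unfolding k by (simp add: norm_mult norm_power)
      from b[OF this r] show "norm (eval_fps f (x * Q powi k)) \<le> T + 1" by (simp add: T_def)
    }
    {
      assume "k \<le> 0"
      hence "k = - int (nat (- k))" by simp
      then obtain n where k: "k = - int n" by blast
      have "norm (x * Q powi k) \<le> r * q powi k"
        unfolding norm_mult norm_power_int normQ using x q0 by (intro mult_right_mono) auto
      hence "norm (eval_fps f (x * Q powi k)) \<le> M * Re (qtheta q (of_real (K * (r * q powi k))))"
        using r q0 by (intro b) auto
      also have "qtheta q (of_real (K * (r * q powi k))) = of_real (q powi (- (k * (k - 1) div 2)) * (K * r) powi (- k)) * qtheta q (of_real (K * r))"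
      proof -
        have "of_real (K * r) \<noteq> (0::complex)" using K r by simp
        moreover have "of_real (K * (r * q powi k)) = of_real (K * r) * Q powi k" by (simp add: of_real_power_int)
        ultimately show ?thesis using qtheta_powi[of "of_real (K * r)" k] by (simp add: of_real_power_int mult.assoc)
      qed
      also have "Re (of_real (q powi (- (k * (k - 1) div 2)) * (K * r) powi (- k)) * qtheta q (of_real (K * r))) =
          q powi (- (k * (k - 1) div 2)) * (K * r) powi (- k) * Re (qtheta q (of_real (K * r)))"
        by (simp only: times_complex.sel Re_complex_of_real Im_complex_of_real mult_zero_left diff_zero)
      also have "M * \<dots> = T * (K * r) ^ n * q powi (- (k * (k - 1) div 2))" by (simp add: T_def k)
      also have "\<dots> \<le> (T + 1) * max 1 (K * r) ^ nat \<bar>k\<bar> * q powi (- (k * (k - 1) div 2))"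
        using T Kr q0 by (intro mult_right_mono mult_mono power_mono) (auto simp: k power_mono)
      finally show "norm (eval_fps f (x * Q powi k)) \<le> (T + 1) * max 1 (K * r) ^ nat \<bar>k\<bar> * q powi (- (k * (k - 1) div 2))" .
    }
  qed
qed

text \<open>The summand 1 keeps the base positive also for a = 0, as \<open>gauss_eval_bound\<close>
  requires.\<close>

lemma poch_fps_bound: "norm (fps_nth (poch_fps a) n) \<le> 1 * (norm a / (1 - q) + 1) ^ n * q ^ (n * (n - 1) div 2)"
proof -
  let ?p = "\<lambda>n. norm (fps_nth (poch_fps a) n)"
  have "?p (Suc n) \<le> (norm a / (1 - q) + 1) * q ^ n * ?p n" for n
  proof -
    have "?p (Suc n) * (1 - q) \<le> ?p (Suc n) * norm (1 - Q ^ Suc n)"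
      by (intro mult_left_mono norm_one_minus_Q) auto
    also have "\<dots> = norm a * q ^ n * ?p n"
      unfolding norm_mult[symmetric] poch_fps_Suc using q0 by (simp add: norm_mult norm_power)
    also have "norm a \<le> (norm a / (1 - q) + 1) * (1 - q)" using q1 by (simp add: distrib_right)
    hence "norm a * q ^ n * ?p n \<le> ((norm a / (1 - q) + 1) * (1 - q)) * q ^ n * ?p n"
      using q0 by (intro mult_right_mono) auto
    finally show ?thesis using q1 by (simp add: mult.commute mult.left_commute)
  qed
  from gauss_rec_bound[of ?p, OF this] show ?thesis using q1 by simp
qed

lemma qfact_qpoch: "qpoch q (Q * Q ^ n) = qpoch q Q / qfact n"
proof (induction n)
  case (Suc n)
  have "qpoch q (Q * Q ^ n) = (1 - Q ^ Suc n) * qpoch q (Q * Q ^ Suc n)"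
    using qpoch_rec[of "Q * Q ^ n"] by simp
  thus ?case using Suc one_minus_Q[of n] by (simp add: field_simps del: one_minus_Q)
qed simp

end

context arrow
begin

lemma Bt_cong: "(\<And>k. k \<le> N \<Longrightarrow> y k = y' k) \<Longrightarrow> i \<le> N \<Longrightarrow> Bt y i = Bt y' i"
  by (auto simp: Bt_def intro!: sum.cong)

subsection \<open>The convergent column\<close>

text \<open>
  The last column is \<open>R(1 / z) / (q a / z; q)\<^sub>\<infinity>\<close> with \<open>a = d / (1 - q)\<close>; the numerator is a power
  series in \<open>1 / z\<close> with coefficients \<open>vcoef\<close>.
\<close>

primrec vcoef :: "nat \<Rightarrow> nat \<Rightarrow> complex" where
  "vcoef 0 = (\<lambda>i. if i = N then 1 else 0)"
| "vcoef (Suc k) = (\<lambda>i. - (Q ^ Suc k) * Bt (vcoef k) i / ((1 - Q) * (if i = N then 1 - Q ^ Suc k else 1)))"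

lemma norm_oneQ: "norm (1 - Q) = 1 - q"
  using q1 by (metis abs_of_pos diff_gt_0_iff_gt norm_of_real of_real_1 of_real_diff)

definition Rfps :: "nat \<Rightarrow> complex fps" where "Rfps i = Abs_fps (\<lambda>k. vcoef k i)"

definition R :: "nat \<Rightarrow> complex \<Rightarrow> complex" where "R i = eval_fps (Rfps i)"

lemma Rfps_conv: "i \<le> N \<Longrightarrow> fps_conv_radius (Rfps i) = \<infinity>"
proof -
  assume i: "i \<le> N"
  define a where "a = (\<lambda>k. \<Sum>i\<le>N. norm (vcoef k i))"
  have a: "a k \<ge> 0" for k unfolding a_def by (rule sum_nonneg) auto
  define L where "L = Bt_bound / ((1 - q) * (1 - q))"
  have L: "L \<ge> 0" using Bt_bound_nonneg q1 by (simp add: L_def)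
  have "norm (vcoef (Suc k) i) \<le> L * (q ^ k * a k)" for k i
  proof -
    let ?D = "norm ((1 - Q) * (if i = N then 1 - Q ^ Suc k else 1))"
    have D: "?D \<ge> (1 - q) * (1 - q)"
      unfolding norm_mult norm_oneQ using norm_one_minus_Q[of k] q0 q1 by (intro mult_left_mono) auto
    have D0: "(1 - q) * (1 - q) > 0" using q1 by simp
    have "norm (vcoef (Suc k) i) = q ^ Suc k * norm (Bt (vcoef k) i) / ?D"
      using q0 by (simp add: norm_mult norm_divide norm_power)
    also have "\<dots> \<le> q ^ k * (Bt_bound * a k) / ((1 - q) * (1 - q))"
    proof (intro frac_le mult_mono D D0)
      show "q ^ Suc k \<le> q ^ k" using q0 q1 by (intro power_decreasing) auto
      show "norm (Bt (vcoef k) i) \<le> Bt_bound * a k" unfolding a_def by (rule norm_Bt)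
    qed (use q0 Bt_bound_nonneg a in auto)
    also have "\<dots> = L * (q ^ k * a k)" by (simp add: L_def)
    finally show ?thesis .
  qed
  hence "(\<Sum>i\<le>N. norm (vcoef (Suc k) i)) \<le> (\<Sum>i\<le>N. L * (q ^ k * a k))" for k
    by (intro sum_mono)
  moreover have "a (Suc k) = (\<Sum>i\<le>N. norm (vcoef (Suc k) i))" for k by (simp only: a_def)
  ultimately have "a (Suc k) \<le> (\<Sum>i\<le>N. L * (q ^ k * a k))" for k by metis
  hence "a (Suc k) \<le> (real (Suc N) * L) * q ^ k * a k" for k by (simp add: mult.assoc)
  hence b: "a k \<le> a 0 * (real (Suc N) * L) ^ k * q ^ (k * (k - 1) div 2)" for k
    using L by (intro gauss_rec_bound) auto
  show ?thesis
  proof (rule gauss_fps_conv_radius)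
    fix k
    have "norm (fps_nth (Rfps i) k) \<le> a k" unfolding a_def Rfps_def fps_nth_Abs_fps
      by (rule member_le_sum) (use i in auto)
    also note b
    finally show "norm (fps_nth (Rfps i) k) \<le> a 0 * (real (Suc N) * L) ^ k * q ^ (k * (k - 1) div 2)" .
  qed (use L in auto)
qed

lemma R_sums: "i \<le> N \<Longrightarrow> (\<lambda>k. vcoef k i * w ^ k) sums R i w"
  using sums_eval_fps[of w "Rfps i"] Rfps_conv[of i] by (simp add: R_def Rfps_def)

lemma R_holomorphic: "i \<le> N \<Longrightarrow> R i holomorphic_on S"
  unfolding R_def by (intro holomorphic_on_eval_fps) (auto simp: Rfps_conv)

definition aa :: complex where "aa = d / (1 - Q)"

lemma aa_nz: "aa \<noteq> 0" using d_nz oneQ by (simp add: aa_def)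

definition hf :: "nat \<Rightarrow> complex fps" where "hf i = Rfps i * inverse (poch_fps (Q * aa))"

lemma hf_mult: "hf i * poch_fps (Q * aa) = Rfps i"
  unfolding hf_def by (simp add: mult.assoc inverse_mult_eq_1)

lemma hf_0: "fps_nth (hf i) 0 = (if i = N then 1 else 0)"
  by (simp add: hf_def Rfps_def fps_mult_nth)

text \<open>The equation for the last column divided by - (1 - q) z and written in X = 1 / z, where
  \<open>fps_scale (1 / Q)\<close> is the substitution z \<mapsto> q z.\<close>

lemma hf_fps:
  assumes i: "i \<le> N"
  shows "(1 - fps_const aa * fps_X) * fps_scale (1 / Q) (hf i) =
     (if i = N then hf i else 0) - fps_const (1 / (1 - Q)) * fps_X * BtF hf i"
proof -
  let ?p = "poch_fps (Q * aa)"
  have p: "fps_scale (1 / Q) ?p = (1 - fps_const aa * fps_X) * ?p"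
  proof -
    have "(- (Q * aa)) ^ n = Q ^ n * (- aa) ^ n" for n by (metis mult_minus_right power_mult_distrib)
    hence 1: "fps_scale Q (poch_fps aa) = ?p"
      by (intro fps_ext) (simp add: poch_fps_def)
    have "fps_scale (1 / Q) ?p = poch_fps aa"
      unfolding 1[symmetric] by (rule fps_ext) (simp add: power_divide)
    also have "\<dots> = (1 - fps_const aa * fps_X) * ?p" by (subst poch_fps_rec) (simp only: 1)
    finally show ?thesis .
  qed
  have "fps_scale (1 / Q) (Rfps i) = (if i = N then Rfps i else 0) - fps_const (1 / (1 - Q)) * fps_X * BtF Rfps i"
  proof (rule fps_ext)
    fix n
    show "fps_nth (fps_scale (1 / Q) (Rfps i)) n = fps_nth ((if i = N then Rfps i else 0) - fps_const (1 / (1 - Q)) * fps_X * BtF Rfps i) n"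
    proof (cases n)
      case 0 thus ?thesis by (simp add: Rfps_def mult.assoc)
    next
      case (Suc k)
      have e: "(1 / Q) ^ Suc k * vcoef (Suc k) i = (if i = N then vcoef (Suc k) i else 0) - 1 / (1 - Q) * Bt (vcoef k) i"
      proof (cases "i = N")
        case True
        have "vcoef (Suc k) N * (1 - Q ^ Suc k) = - (Q ^ Suc k) * Bt (vcoef k) N / (1 - Q)"
          using one_minus_Q[of k] oneQ by (simp del: power_Suc one_minus_Q)
        hence "vcoef (Suc k) N = Q ^ Suc k * (vcoef (Suc k) N - 1 / (1 - Q) * Bt (vcoef k) N)"
          by (simp add: algebra_simps del: power_Suc vcoef.simps)
        hence "(1 / Q) ^ Suc k * vcoef (Suc k) N = (1 / Q) ^ Suc k * (Q ^ Suc k * (vcoef (Suc k) N - 1 / (1 - Q) * Bt (vcoef k) N))"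
          by (rule arg_cong)
        also have "\<dots> = vcoef (Suc k) N - 1 / (1 - Q) * Bt (vcoef k) N"
          by (simp add: power_divide del: power_Suc vcoef.simps)
        finally show ?thesis using True by simp
      next
        case False
        thus ?thesis by (simp add: power_divide)
      qed
      have "fps_nth ((if i = N then Rfps i else 0) - fps_const (1 / (1 - Q)) * fps_X * BtF Rfps i) (Suc k) =
         (if i = N then vcoef (Suc k) i else 0) - 1 / (1 - Q) * Bt (vcoef k) i"
        by (simp add: Rfps_def BtF_def mult.assoc del: vcoef.simps)
      thus ?thesis unfolding Suc fps_scale_nth e[symmetric] by (simp add: Rfps_def del: vcoef.simps power_Suc)
    qed
  qed
  moreover have "BtF Rfps i = BtF hf i * ?p" unfolding BtF_mult[symmetric] hf_mult ..
  moreover have "fps_scale (1 / Q) (Rfps i) = fps_scale (1 / Q) (hf i) * ((1 - fps_const aa * fps_X) * ?p)"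
    unfolding hf_mult[symmetric] p[symmetric] by (rule fps_scale_mult)
  moreover have "(if i = N then Rfps i else 0) = (if i = N then hf i else 0) * ?p" by (simp add: hf_mult)
  ultimately have "((1 - fps_const aa * fps_X) * fps_scale (1 / Q) (hf i)) * ?p =
     ((if i = N then hf i else 0) - fps_const (1 / (1 - Q)) * fps_X * BtF hf i) * ?p"
    by (simp add: algebra_simps)
  thus ?thesis using poch_fps_nz by simp
qed

lemma hf_coef:
  assumes i: "i \<le> N"
  shows "fps_nth (hf i) (Suc m) / Q ^ Suc m - aa * (fps_nth (hf i) m / Q ^ m) =
     (if i = N then fps_nth (hf i) (Suc m) else 0) - 1 / (1 - Q) * Bt (\<lambda>i. fps_nth (hf i) m) i"
  using arg_cong[OF hf_fps[OF i], of "\<lambda>f. fps_nth f (Suc m)"]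
  by (simp add: left_diff_distrib mult.assoc BtF_def power_divide del: power_Suc)

text \<open>Stated for linear combinations because the entries of the last column of
  \<open>formal_H\<close> are such combinations and \<open>qsum\<close> is a choice, whose
  additivity is thereby avoided.\<close>

lemma qsum_hf:
  assumes l: "l \<noteq> 0" and z: "z \<noteq> 0" "qpoch q (Q * aa / z) \<noteq> 0"
  shows "qsum q l (\<Sum>i\<le>N. fps_const (a i) * hf i) z = (\<Sum>i\<le>N. a i * R i (1 / z)) / qpoch q (Q * aa / z)"
proof -
  define hc where "hc = (\<Sum>i\<le>N. fps_const (a i) * hf i)"
  define Rc where "Rc = (\<lambda>x. \<Sum>i\<le>N. a i * R i x)"
  define F where "F = (\<lambda>x. Rc x * inverse (qpoch q (Q * aa * x)))"
  have Rch: "Rc holomorphic_on S" for S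
    unfolding Rc_def by (intro holomorphic_intros R_holomorphic) auto
  have nz: "qpoch q (Q * aa * x) \<noteq> 0" if "norm x < 1 / norm aa" for x
  proof
    assume "qpoch q (Q * aa * x) = 0"
    then obtain n where "Q * aa * x * Q ^ n = 1" by (auto simp: qpoch_eq_0_iff)
    hence "norm (Q * aa * x * Q ^ n) = 1" by simp
    hence "q ^ Suc n * (norm aa * norm x) = 1" using q0 by (simp add: norm_mult norm_power mult_ac)
    moreover have "q ^ Suc n * (norm aa * norm x) \<le> 1 * (norm aa * norm x)"
      using q0 q1 by (intro mult_right_mono power_le_one) auto
    moreover have "norm aa * norm x < 1" using that aa_nz by (simp add: field_simps)
    ultimately show False by linarith
  qed
  have Fh: "F holomorphic_on eball 0 (ereal (1 / norm aa))"
    unfolding F_def by (intro holomorphic_intros Rch) (use nz in auto)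
  have Fe: "F has_fps_expansion hc"
  proof -
    have "eval_fps (poch_fps (Q * aa)) has_fps_expansion poch_fps (Q * aa)"
      by (rule eval_fps_has_fps_expansion) simp
    moreover have "R i has_fps_expansion Rfps i" if "i \<in> {..N}" for i unfolding R_def
      by (rule eval_fps_has_fps_expansion) (use that in \<open>simp add: Rfps_conv\<close>)
    hence "Rc has_fps_expansion (\<Sum>i\<le>N. fps_const (a i) * Rfps i)" unfolding Rc_def
      by (intro has_fps_expansion_sum has_fps_expansion_cmult_left)
    ultimately have "(\<lambda>w. Rc w * inverse (eval_fps (poch_fps (Q * aa)) w)) has_fps_expansion
        (\<Sum>i\<le>N. fps_const (a i) * Rfps i) * inverse (poch_fps (Q * aa))"
      by (intro has_fps_expansion_mult has_fps_expansion_inverse) auto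
    thus ?thesis unfolding F_def qpoch_eval[symmetric] hc_def hf_def sum_distrib_right mult.assoc .
  qed
  have sms: "(\<lambda>n. fps_nth hc n * x ^ n) sums F x" if "norm x < 1 / norm aa" for x
    by (rule has_fps_expansion_imp_sums_complex[OF Fe Fh]) (use that in simp)
  \<comment> \<open>Half the radius of a disc free of poles. The terms of the convergent series at r
    are bounded, which yields geometric growth of the coefficients.\<close>
  define r where "r = 1 / (2 * norm aa)"
  have r: "r > 0" "r < 1 / norm aa" using aa_nz by (auto simp: r_def field_simps)
  have "summable (\<lambda>n. fps_nth hc n * of_real r ^ n)"
    using sms[of "of_real r"] r by (auto simp: sums_iff)
  hence "Bseq (\<lambda>n. fps_nth hc n * of_real r ^ n)"
    using summable_LIMSEQ_zero convergentI convergent_imp_Bseq by blast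
  then obtain C where C: "C > 0" "\<And>n. norm (fps_nth hc n * of_real r ^ n) \<le> C"
    unfolding Bseq_def by blast
  have f: "norm (fps_nth hc n) \<le> C * (1 / r) ^ n" for n
    using C(2)[of n] r by (simp add: norm_mult norm_power power_divide field_simps)
  have mq: "(\<lambda>z. qpoch q (Q * aa * (1 / z))) analytic_on - {0}"
    by (intro analytic_intros) auto
  have "Rc analytic_on UNIV" using Rch[of UNIV] by (simp add: analytic_on_open)
  moreover have "(\<lambda>z::complex. 1 / z) analytic_on - {0}" by (intro analytic_intros) auto
  ultimately have mR: "(\<lambda>z. Rc (1 / z)) analytic_on - {0}"
    using analytic_on_compose_gen[of "\<lambda>z. 1 / z" "- {0}" Rc UNIV] by (simp add: o_def)
  have an: "(\<lambda>z. F (1 / z)) analytic_on A" if "A \<subseteq> - {0}" "\<And>z. z \<in> A \<Longrightarrow> qpoch q (Q * aa * (1 / z)) \<noteq> 0" for A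
    unfolding F_def using that by (intro analytic_on_mult analytic_on_inverse analytic_on_subset[OF mR] analytic_on_subset[OF mq]) auto
  have "qsum q l hc z = (\<lambda>z. F (1 / z)) z"
  proof (rule qsum_convergent[OF f _ l])
    show "1 / r > 0" using r by simp
    show "(\<lambda>z. F (1 / z)) meromorphic_on - {0}"
      unfolding F_def by (intro meromorphic_intros analytic_on_imp_meromorphic_on mR mq)
    have small: "norm (1 / z) < 1 / norm aa \<and> z \<noteq> 0" if "norm z > norm aa" for z :: complex
    proof -
      have "norm z > 0" using that by (meson le_less_trans norm_ge_zero)
      thus ?thesis using that aa_nz by (auto simp: norm_divide field_simps)
    qed
    show "(\<lambda>z. F (1 / z)) analytic_on {z. norm aa < norm z}"
    proof (rule an)
      show "{z. norm aa < norm z} \<subseteq> - {0}" using small by auto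
      fix z :: complex assume "z \<in> {z. norm aa < norm z}"
      thus "qpoch q (Q * aa * (1 / z)) \<noteq> 0" using nz[of "1 / z"] small[of z] by blast
    qed
    show "(\<lambda>n. fps_nth hc n / w ^ n) sums F (1 / w)" if "norm aa < norm w" for w
      using sms[of "1 / w"] small[OF that] by (simp add: power_divide)
    show "0 < norm aa" using aa_nz by simp
    show "(\<lambda>z. F (1 / z)) analytic_on {z}" by (rule an) (use z in auto)
  qed (use z in auto)
  thus ?thesis by (simp add: F_def Rc_def hc_def divide_inverse)
qed

subsection \<open>The residue of the Borel transform\<close>

context
  fixes j :: nat assumes j: "j < N"
begin

text \<open>The infinite product of the ratios in \<open>xh_ratio\<close> over m \<ge> 1, freed from
  the factor 1 / (q; q)_\<infinity> that the index i = j contributes.\<close>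

definition G :: complex where
  "G = (\<Prod>l\<le>N. qpoch q (Q * t l / c j)) / (\<Prod>i\<in>{..<N}-{j}. qpoch q (Q * c i / c j))"

text \<open>With x = c_j / q^m the first N rows express the other components as \<beta>_i w / (x -
  c_i), where w is the last one. Inserted into the last row this produces the characteristic
  polynomial divided by the product of the x - c_i. So the last component has basic hypergeometric
  coefficients. For m = 0 the division by x - c_j would fail.\<close>

lemma xh_ratio:
  assumes m: "m \<ge> 1"
  shows "fps_nth (xh j N) (Suc m) * xi j = fps_nth (xh j N) m *
     ((\<Prod>l\<le>N. 1 - t l / c j * Q ^ m) / (\<Prod>i<N. 1 - c i / c j * Q ^ m))"
proof -
  note cj = c_nz[OF j]
  define x where "x = c j / Q ^ m"
  have x0: "x \<noteq> 0" using cj by (simp add: x_def)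
  have xx: "c j = x * Q ^ m" by (simp add: x_def)
  let ?w = "fps_nth (xh j N) m"
  obtain m' where m': "m = Suc m'" using m by (cases m) auto
  have nz: "x - c i \<noteq> 0" if "i < N" for i
    using c_res[OF that j, of m'] cj unfolding x_def m'[symmetric] by (auto simp: field_simps)
  define P where "P = (\<Prod>i<N. x - c i)"
  have P: "P \<noteq> 0" using nz by (auto simp: P_def)
  have u: "fps_nth (xh j i) m = \<beta> i * ?w / (x - c i)" if i: "i < N" for i
  proof -
    have "Q ^ m * (x * fps_nth (xh j i) m) = Q ^ m * (c i * fps_nth (xh j i) m + \<beta> i * ?w)"
      using xh_coef[OF j i, of m] i unfolding Bt_def xx by (simp add: mult_ac)
    hence "x * fps_nth (xh j i) m = c i * fps_nth (xh j i) m + \<beta> i * ?w" by simp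
    hence "fps_nth (xh j i) m * (x - c i) = \<beta> i * ?w" by (simp add: algebra_simps)
    thus ?thesis using nz[OF i] by (simp add: nonzero_eq_divide_eq)
  qed
  have "(\<Sum>i<N. \<gamma> i * fps_nth (xh j i) m) = (\<Sum>i<N. \<gamma> i * \<beta> i / (x - c i)) * ?w"
    unfolding sum_distrib_right by (intro sum.cong) (auto simp: u)
  hence "Bt (\<lambda>i. fps_nth (xh j i) m) N = ((\<Sum>i<N. \<gamma> i * \<beta> i / (x - c i)) + b) * ?w"
    by (simp add: Bt_def distrib_right)
  also have "(\<Sum>i<N. \<gamma> i * \<beta> i / (x - c i)) = (\<Sum>i<N. \<gamma> i * \<beta> i * (\<Prod>k\<in>{..<N}-{i}. x - c k)) / P"
    unfolding sum_divide_distrib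
  proof (rule sum.cong)
    fix i assume i: "i \<in> {..<N}"
    have "P = (x - c i) * (\<Prod>k\<in>{..<N}-{i}. x - c k)" unfolding P_def using i by (simp add: prod.remove)
    moreover from this have "(\<Prod>k\<in>{..<N}-{i}. x - c k) \<noteq> 0" using P by auto
    ultimately show "\<gamma> i * \<beta> i / (x - c i) = \<gamma> i * \<beta> i * (\<Prod>k\<in>{..<N}-{i}. x - c k) / P"
      by simp
  qed simp
  also have "(\<Sum>i<N. \<gamma> i * \<beta> i * (\<Prod>k\<in>{..<N}-{i}. x - c k)) = (x - b) * P - (\<Prod>l\<le>N. x - t l)"
    using char[of x] nz unfolding P_def by (simp add: algebra_simps)
  finally have B: "Bt (\<lambda>i. fps_nth (xh j i) m) N = (x - (\<Prod>l\<le>N. x - t l) / P) * ?w"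
    using P by (simp add: diff_divide_distrib)
  have x1: "1 / xi j = - (x * Q ^ m / (1 - Q))"
    by (simp only: xi_def divide_divide_eq_right mult_1_left minus_divide_right xx)
  have "fps_nth (xh j N) (Suc m) = 1 / xi j * ?w + Q ^ m / (1 - Q) * ((x - (\<Prod>l\<le>N. x - t l) / P) * ?w)"
    using xh_coef_N[OF j, of m] unfolding B by (simp add: algebra_simps)
  also have "\<dots> = - (Q ^ m / (1 - Q) * ((\<Prod>l\<le>N. x - t l) / P) * ?w)" unfolding x1 by (simp add: algebra_simps)
  finally have fin: "fps_nth (xh j N) (Suc m) = - (Q ^ m / (1 - Q) * ((\<Prod>l\<le>N. x - t l) / P) * ?w)" .
  have gen: "- (A / u * (T / p) * w) * (- u / (y * A)) = w * (T / (y * p))" if "u \<noteq> 0" "A \<noteq> 0" "p \<noteq> 0" "y \<noteq> 0" for A u T p w y :: complex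
    using that by (simp add: field_simps)
  have "fps_nth (xh j N) (Suc m) * xi j = ?w * ((\<Prod>l\<le>N. x - t l) / (x * P))"
    unfolding fin xi_def xx by (rule gen) (use oneQ x0 P in auto)
  moreover have f: "x - a = x * (1 - a / c j * Q ^ m)" for a using x0 unfolding xx by (simp add: field_simps)
  have "(\<Prod>l\<le>N. x - t l) = x ^ Suc N * (\<Prod>l\<le>N. 1 - t l / c j * Q ^ m)"
    unfolding f[of "t _"] by (simp add: prod.distrib)
  moreover have "P = x ^ N * (\<Prod>i<N. 1 - c i / c j * Q ^ m)"
    unfolding P_def f[of "c _"] by (simp add: prod.distrib)
  ultimately show ?thesis using x0 by simp
qed

text \<open>The limit of the coefficients of \<open>xh\<close> times \<open>xi j\<close>^n is found
  twice. By \<open>xh_ratio\<close> it is an infinite product. It is also A (\<open>xi j\<close>),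
  where A is \<open>gx\<close> times 1 - w / \<open>xi j\<close>: the partial sums of A at that
  point telescope to the rescaled coefficients, and A is holomorphic up to the next pole
  \<open>xi j\<close> / q.\<close>

lemma Y_at_xi: "Y j N (xi j) = \<gamma> j / (1 - Q) * xi j * G"
proof -
  let ?x = "xi j"
  note x0 = xi_nz[OF j] and cj = c_nz[OF j]
  let ?r = "\<lambda>m. (\<Prod>l\<le>N. 1 - t l / c j * Q ^ m) / (\<Prod>i<N. 1 - c i / c j * Q ^ m)"
  have w1: "fps_nth (xh j N) 1 = \<gamma> j / (1 - Q)"
  proof -
    have "Bt (\<lambda>i. fps_nth (xh j i) 0) N = Bt (\<lambda>i. if i = j then 1 else 0) N"
      by (rule Bt_cong) (auto simp: xh_0[OF j])
    also have "\<dots> = \<gamma> j" using j by (simp add: Bt_def if_distrib[of "\<lambda>x. _ * x"] cong: if_cong)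
    finally show ?thesis using xh_coef_N[OF j, of 0] j by (simp add: xh_0[OF j])
  qed
  have wn: "fps_nth (xh j N) (Suc n) * ?x ^ Suc n = \<gamma> j / (1 - Q) * ?x * (\<Prod>k<n. ?r (Suc k))" for n
  proof (induction n)
    case 0 thus ?case using w1 by simp
  next
    case (Suc n)
    have "fps_nth (xh j N) (Suc (Suc n)) * ?x ^ Suc (Suc n) = (fps_nth (xh j N) (Suc (Suc n)) * ?x) * ?x ^ Suc n"
      by simp
    also have "\<dots> = (fps_nth (xh j N) (Suc n) * ?x ^ Suc n) * ?r (Suc n)"
      by (subst xh_ratio) (auto simp: mult_ac)
    finally show ?case unfolding Suc by (simp add: mult_ac)
  qed
  have pr: "(\<Prod>k<n. ?r (Suc k)) = (\<Prod>l\<le>N. \<Prod>k<n. 1 - Q * t l / c j * Q ^ k) / (\<Prod>i<N. \<Prod>k<n. 1 - Q * c i / c j * Q ^ k)" for n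
    unfolding prod_dividef by (subst (1 2) prod.swap) (simp add: mult_ac)
  have dnz: "qpoch q (Q * c i / c j) \<noteq> 0" if i: "i < N" for i
  proof
    assume "qpoch q (Q * c i / c j) = 0"
    then obtain n where "Q * c i / c j * Q ^ n = 1" by (auto simp: qpoch_eq_0_iff)
    thus False using c_res[OF i j, of n] by (simp add: mult_ac)
  qed
  have "(\<lambda>n. fps_nth (xh j N) (Suc n) * ?x ^ Suc n) \<longlonglongrightarrow>
      \<gamma> j / (1 - Q) * ?x * ((\<Prod>l\<le>N. qpoch q (Q * t l / c j)) / (\<Prod>i<N. qpoch q (Q * c i / c j)))"
    unfolding wn pr by (intro tendsto_intros tendsto_prod qpoch_tendsto) (use dnz in auto)
  moreover have "(\<Prod>i<N. qpoch q (Q * c i / c j)) = qpoch q Q * (\<Prod>i\<in>{..<N}-{j}. qpoch q (Q * c i / c j))"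
    using j cj by (subst prod.remove[of _ j]) auto
  ultimately have L1: "(\<lambda>n. fps_nth (xh j N) (Suc n) * ?x ^ Suc n) \<longlonglongrightarrow> \<gamma> j / (1 - Q) * ?x * G / qpoch q Q"
    by (simp add: G_def mult_ac)
  define A where "A = (\<lambda>w. Y j N w / qpoch q (Q * (w / ?x)))"
  have qnz: "qpoch q (Q * (w / ?x)) \<noteq> 0" if "norm w < norm ?x / q" for w
  proof
    assume "qpoch q (Q * (w / ?x)) = 0"
    then obtain n where "Q * (w / ?x) * Q ^ n = 1" by (auto simp: qpoch_eq_0_iff)
    hence "norm (Q * (w / ?x) * Q ^ n) = 1" by simp
    moreover have "norm (Q * (w / ?x) * Q ^ n) = q ^ n * (q * norm w / norm ?x)"
      using q0 by (simp add: norm_mult norm_divide norm_power)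
    ultimately have e: "q ^ n * (q * norm w / norm ?x) = 1" by metis
    have "norm w * q < norm ?x" using that q0 by (simp add: pos_less_divide_eq)
    hence "q * norm w / norm ?x < 1" using x0 by (simp add: divide_less_eq mult.commute)
    moreover have "q ^ n * (q * norm w / norm ?x) \<le> 1 * (q * norm w / norm ?x)"
      using q0 q1 by (intro mult_right_mono power_le_one) auto
    ultimately show False using e by linarith
  qed
  have Ah: "A holomorphic_on eball 0 (ereal (norm ?x / q))"
    unfolding A_def by (intro holomorphic_intros Y_holomorphic[OF j]) (use qnz x0 in auto)
  define H where "H = (1 - fps_const (1 / ?x) * fps_X) * xh j N"
  have Ae: "A has_fps_expansion H"
  proof -
    have "eval_fps (poch_fps (1 / xi j)) has_fps_expansion poch_fps (1 / xi j)"
      by (rule eval_fps_has_fps_expansion) simp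
    moreover have "Y j N has_fps_expansion Yfps j N" unfolding Y_def[OF j]
      by (rule eval_fps_has_fps_expansion) (simp add: Yfps_conv[OF j])
    ultimately have "(\<lambda>w. (1 - 1 / ?x * w) * (Y j N w * inverse (eval_fps (poch_fps (1 / xi j)) w))) has_fps_expansion H"
      unfolding H_def xh_def[OF j]
      by (intro has_fps_expansion_mult has_fps_expansion_inverse has_fps_expansion_diff fps_expansion_intros) auto
    moreover have "eventually (\<lambda>w. (1 - 1 / ?x * w) * (Y j N w * inverse (eval_fps (poch_fps (1 / xi j)) w)) = A w) (nhds 0)"
    proof -
      have "eventually (\<lambda>w. w \<in> ball 0 (norm ?x)) (nhds 0)" using x0 by (intro eventually_nhds_in_open) auto
      thus ?thesis
      proof eventually_elim
        case (elim w)
        hence "w \<noteq> ?x" by auto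
        hence nz: "1 - w / ?x \<noteq> 0" using x0 by (simp add: field_simps)
        have "qpoch q (1 / ?x * w) = (1 - w / ?x) * qpoch q (Q * (w / ?x))"
          using qpoch_rec[of "1 / ?x * w"] by simp
        thus ?case unfolding qpoch_eval[symmetric] A_def using nz by (simp add: divide_inverse mult.commute)
      qed
    qed
    ultimately show ?thesis using has_fps_expansion_cong[OF _ refl] by fast
  qed
  have "(\<lambda>n. fps_nth H n * ?x ^ n) sums A ?x"
    by (rule has_fps_expansion_imp_sums_complex[OF Ae Ah]) (use x0 q0 q1 in \<open>simp add: field_simps\<close>)
  hence "(\<lambda>m. \<Sum>n<m. fps_nth H n * ?x ^ n) \<longlonglongrightarrow> A ?x" by (simp add: sums_def)
  hence "(\<lambda>m. \<Sum>n<Suc (Suc m). fps_nth H n * ?x ^ n) \<longlonglongrightarrow> A ?x" by (intro LIMSEQ_Suc)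
  moreover have "(\<Sum>n<Suc m. fps_nth H n * ?x ^ n) = fps_nth (xh j N) m * ?x ^ m" for m
  proof (induction m)
    case 0 thus ?case using j by (simp add: H_def xh_0[OF j] fps_mult_nth)
  next
    case (Suc m)
    have "fps_nth H (Suc m) = fps_nth (xh j N) (Suc m) - 1 / ?x * fps_nth (xh j N) m"
      unfolding H_def by (simp add: left_diff_distrib mult.assoc)
    hence "fps_nth H (Suc m) * ?x ^ Suc m = fps_nth (xh j N) (Suc m) * ?x ^ Suc m - fps_nth (xh j N) m * ?x ^ m"
      using x0 by (simp add: left_diff_distrib)
    thus ?case using Suc by simp
  qed
  ultimately have "(\<lambda>n. fps_nth (xh j N) (Suc n) * ?x ^ Suc n) \<longlonglongrightarrow> A ?x" by (simp only:)
  with L1 have "A ?x = \<gamma> j / (1 - Q) * ?x * G / qpoch q Q" using LIMSEQ_unique by blast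
  moreover have "A ?x = Y j N ?x / qpoch q Q" using x0 by (simp add: A_def)
  ultimately show ?thesis using qpoch_Q_nz by (metis divide_cancel_right)
qed

end

section \<open>Dependence of the sums on the direction\<close>

context
  fixes j :: nat assumes j: "j < N"
begin

text \<open>At w = \<open>xi j\<close> the factor 1 - w / \<open>xi j\<close> annihilates all
  components but the last, which leaves a multiple of \<open>vcoef 0\<close>. From then on the
  recursion of Y from q w to w is, up to a scalar, that of \<open>vcoef\<close>; the scalars
  accumulate to the stated factor.\<close>

lemma Y_residues:
  assumes i: "i \<le> N"
  shows "Y j i (xi j / Q ^ n) = Y j N (xi j) * qfact n * (- xi j) ^ n / Q ^ (n * (n + 1)) * vcoef n i"
  using i
proof (induction n arbitrary: i)
  case 0
  thus ?case using Y_rec[OF j, of i "xi j"] xi_nz[OF j] by (cases "i = N") auto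
next
  case (Suc n)
  define C where "C = (\<lambda>n. Y j N (xi j) * qfact n * (- xi j) ^ n / Q ^ (n * (n + 1)))"
  have C: "C (Suc n) = C n * (1 - Q ^ Suc n) * (- xi j) / (Q ^ Suc n * Q ^ Suc n)"
  proof -
    have "Q ^ (Suc n * (Suc n + 1)) = Q ^ (n * (n + 1)) * (Q ^ Suc n * Q ^ Suc n)"
      unfolding power_add[symmetric] by (rule arg_cong[of _ _ "\<lambda>k. Q ^ k"]) simp
    thus ?thesis unfolding C_def by (simp only: qfact.simps power_Suc[of "- xi j"] times_divide_eq_left times_divide_eq_right divide_divide_eq_left mult_ac)
  qed
  let ?w = "xi j / Q ^ Suc n"
  have B: "Bt (\<lambda>i. Y j i (Q * ?w)) i = C n * Bt (vcoef n) i" if "i \<le> N" for i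
  proof -
    have "Bt (\<lambda>i. Y j i (Q * ?w)) i = Bt (\<lambda>i. C n * vcoef n i) i"
      by (rule Bt_cong[OF _ that]) (use Suc.IH in \<open>simp add: C_def\<close>)
    thus ?thesis by (simp add: Bt_cmult)
  qed
  have c: "c j = - (1 - Q) / xi j" using c_nz[OF j] oneQ by (simp add: xi_def)
  have nQ: "1 - Q ^ Suc n \<noteq> 0" "Q ^ Suc n \<noteq> 0" by (rule one_minus_Q) simp
  note x0 = xi_nz[OF j]
  have gen: "1 / (- u / x) * (- v / W) * (C' * B') = C' * v * (- x) / (W * W) * (- W * B' / u)"
    if "u \<noteq> 0" "x \<noteq> 0" "W \<noteq> 0" for u v W x C' B' :: complex using that by (simp add: field_simps)
  have "Y j i ?w = C (Suc n) * vcoef (Suc n) i"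
  proof (cases "i < N")
    case True
    have "1 - ?w / xi j = - (1 - Q ^ Suc n) / Q ^ Suc n" using x0 by (simp add: field_simps)
    hence "Y j i ?w = 1 / c j * (- (1 - Q ^ Suc n) / Q ^ Suc n) * (C n * Bt (vcoef n) i)"
      using Y_rec[OF j True, of ?w] B[OF Suc.prems] by (simp only:)
    moreover have "vcoef (Suc n) i = - (Q ^ Suc n) * Bt (vcoef n) i / (1 - Q)" using True by simp
    ultimately show ?thesis unfolding C c using gen[OF oneQ x0 nQ(2)] by (simp only:)
  next
    case False
    hence i: "i = N" using Suc.prems by simp
    have "Y j N ?w = ?w / (1 - Q) * (C n * Bt (vcoef n) N)"
      using Y_rec_N[OF j, of ?w] B[of N] by (simp only: order_refl)
    moreover have "vcoef (Suc n) N = - (Q ^ Suc n) * Bt (vcoef n) N / ((1 - Q) * (1 - Q ^ Suc n))" by simp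
    ultimately show ?thesis unfolding C i using x0 oneQ nQ by (simp del: power_Suc vcoef.simps)
  qed
  thus ?case by (simp only: C_def)
qed

text \<open>By the triple product, \<theta>(- \<mu> q^k / \<open>xi j\<close>) / (\<mu> q^k /
  \<open>xi j\<close>; q)_\<infinity> is the pair of Pochhammer symbols written here, so the poles
  in \<mu> cancel term by term. The exponent k (k - 1) is twice the Gaussian one: one half comes
  from the q-Laplace kernel, the other from moving \<theta>(- \<mu> / \<open>xi j\<close>) along the
  spiral.\<close>

definition Phi_term :: "nat \<Rightarrow> complex \<Rightarrow> int \<Rightarrow> complex \<Rightarrow> complex" where
  "Phi_term i z k \<mu> = Y j i (\<mu> * Q powi k) * (qpoch q Q * qpoch q (xi j / \<mu> * Q powi (1 - k))) *
     Q powi (k * (k - 1)) * (- (\<mu> ^ 2) * z / xi j) powi k"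

text \<open>
  As a function of the direction \<open>\<mu>\<close>, the sum of the column \<open>j\<close> times
  \<open>\<theta>(\<mu> z) \<theta>(- \<mu> / xi j)\<close> extends holomorphically to the punctured plane.
\<close>

definition Phi :: "nat \<Rightarrow> complex \<Rightarrow> complex \<Rightarrow> complex" where
  "Phi i z \<mu> = (\<Sum>\<^sub>\<infinity>k. Phi_term i z k \<mu>)"

text \<open>Y consumes a Gaussian factor only for k \<rightarrow> -\<infinity> and the Pochhammer
  symbol only for k \<rightarrow> \<infinity>. Of the two factors in \<open>Phi_term\<close> one
  always survives and gives a majorant.\<close>

lemma Phi_holomorphic:
  assumes i: "i \<le> N" and z: "z \<noteq> 0"
  shows "Phi i z holomorphic_on - {0}"
  unfolding Phi_def[abs_def]
proof (rule holomorphic_on_infsum)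
  note x0 = xi_nz[OF j]
  show "open (- {0::complex})" by auto
  show "Phi_term i z k holomorphic_on - {0}" for k
  proof -
    have "(\<lambda>\<mu>. Y j i (\<mu> * Q powi k)) holomorphic_on - {0}"
    proof -
      have "(\<lambda>\<mu>. \<mu> * Q powi k) holomorphic_on - {0}" by (intro holomorphic_intros)
      from holomorphic_on_compose_gen[OF this Y_holomorphic[OF j i, of UNIV]] show ?thesis by (simp add: o_def)
    qed
    thus ?thesis unfolding Phi_term_def[abs_def] using x0 z by (intro holomorphic_intros) auto
  qed
  fix w :: complex assume "w \<in> - {0}"
  hence w: "w \<noteq> 0" by simp
  define r where "r = norm w / 2"
  have r: "r > 0" using w by (simp add: r_def)
  have zr: "r \<le> norm x \<and> norm x \<le> 3 * r" if "x \<in> cball w r" for x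
  proof -
    have "norm (w - x) \<le> r" using that by (simp add: dist_norm)
    thus ?thesis using norm_triangle_ineq2[of w x] norm_triangle_ineq2[of x w]
      by (simp add: r_def norm_minus_commute)
  qed
  obtain K where K: "K > 0" "\<And>k i. i \<le> N \<Longrightarrow> norm (ycoef j k i) \<le> 1 * K ^ k * q ^ (k * (k - 1) div 2)"
    using ycoef_bound[OF j] by blast
  have r3: "3 * r > 0" using r by simp
  have Kf: "norm (fps_nth (Yfps j i) n) \<le> 1 * K ^ n * q ^ (n * (n - 1) div 2)" for n
    using K(2)[OF i, of n] by (simp add: Yfps_def[OF j])
  obtain T L where T: "T > 0" "L \<ge> 1"
    and T1: "\<And>x k. norm x \<le> 3 * r \<Longrightarrow> k \<ge> 0 \<Longrightarrow> norm (eval_fps (Yfps j i) (x * Q powi k)) \<le> T"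
    and T2: "\<And>x k. norm x \<le> 3 * r \<Longrightarrow> k \<le> 0 \<Longrightarrow>
       norm (eval_fps (Yfps j i) (x * Q powi k)) \<le> T * L ^ nat \<bar>k\<bar> * q powi (- (k * (k - 1) div 2))"
    using gauss_eval_bound[OF Kf K(1) r3] by blast
  have K1: "norm (1::complex) / (1 - q) + 1 > 0" using q1 by (simp add: add_pos_pos)
  have rx: "norm (xi j) / r > 0" using x0 r by simp
  obtain T' L' where T': "T' > 0" "L' \<ge> 1"
    and T1': "\<And>x k. norm x \<le> norm (xi j) / r \<Longrightarrow> k \<ge> 0 \<Longrightarrow> norm (eval_fps (poch_fps 1) (x * Q powi k)) \<le> T'"
    and T2': "\<And>x k. norm x \<le> norm (xi j) / r \<Longrightarrow> k \<le> 0 \<Longrightarrow>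
       norm (eval_fps (poch_fps 1) (x * Q powi k)) \<le> T' * L' ^ nat \<bar>k\<bar> * q powi (- (k * (k - 1) div 2))"
    using gauss_eval_bound[OF poch_fps_bound K1 rx] by blast
  define B where "B = max (9 * r ^ 2 * norm z / norm (xi j)) (norm (xi j) / (r ^ 2 * norm z))"
  have B0: "B > 0" using r z x0 by (simp add: B_def less_max_iff_disj)
  define M where "M = (\<lambda>k::int. (T * T' * norm (qpoch q Q) * L') * ((L * L' * B) ^ nat \<bar>k\<bar> * q powi (k * (k - 1) div 2)))"
  have "norm (Phi_term i z k x) \<le> M k" if x: "x \<in> cball w r" for k x
  proof -
    let ?tr = "k * (k - 1) div 2"
    have xp: "norm x > 0" using zr[OF x] r by linarith
    have n1: "norm x \<le> 3 * r" using zr[OF x] by simp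
    have n2: "norm (xi j / x) \<le> norm (xi j) / r" using zr[OF x] r by (simp add: norm_divide frac_le)
    have q2: "q powi (k * (k - 1)) = q powi ?tr * q powi ?tr"
      using q0 tri_int_double[of k] by (subst power_int_add[symmetric]) auto
    have qi: "q powi (- ?tr) * q powi ?tr = 1" using q0 by (simp add: power_int_minus)
    have trk: "(1 - k) * (1 - k - 1) div 2 = ?tr"
      by (rule arg_cong[of _ _ "\<lambda>x. x div 2"]) (simp add: algebra_simps)
    have Lk: "1 \<le> L ^ nat \<bar>k\<bar>" "1 \<le> L' ^ nat \<bar>k\<bar>" using T T' by (simp_all add: one_le_power)
    \<comment> \<open>The exponents k and 1 - k are never both negative, and the Gaussian exponent
      is invariant under k \<mapsto> 1 - k. So one estimate holds for both signs.\<close>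
    have prod: "norm (Y j i (x * Q powi k)) * norm (qpoch q (xi j / x * Q powi (1 - k))) \<le>
        (T * T' * L') * ((L * L') ^ nat \<bar>k\<bar>) * q powi (- ?tr)"
    proof (cases "k \<ge> 1")
      case True
      have "norm (Y j i (x * Q powi k)) \<le> T" unfolding Y_def[OF j] using True by (intro T1 n1) auto
      moreover have "norm (qpoch q (xi j / x * Q powi (1 - k))) \<le> T' * L' ^ nat \<bar>1 - k\<bar> * q powi (- ?tr)"
        unfolding qpoch_eval1 using T2'[OF n2, of "1 - k"] True unfolding trk by simp
      moreover have "L' ^ nat \<bar>1 - k\<bar> \<le> L' ^ Suc (nat \<bar>k\<bar>)" using T' True by (intro power_increasing) auto
      hence "T' * L' ^ nat \<bar>1 - k\<bar> * q powi (- ?tr) \<le> T' * (L ^ nat \<bar>k\<bar> * L' ^ Suc (nat \<bar>k\<bar>)) * q powi (- ?tr)"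
        using T T' q0 Lk mult_mono[of 1 "L ^ nat \<bar>k\<bar>" "L' ^ nat \<bar>1 - k\<bar>" "L' ^ Suc (nat \<bar>k\<bar>)"]
        by (intro mult_right_mono mult_left_mono) auto
      ultimately have "norm (Y j i (x * Q powi k)) * norm (qpoch q (xi j / x * Q powi (1 - k))) \<le>
          T * (T' * (L ^ nat \<bar>k\<bar> * L' ^ Suc (nat \<bar>k\<bar>)) * q powi (- ?tr))"
        using T by (intro mult_mono) auto
      thus ?thesis by (simp add: power_mult_distrib mult_ac)
    next
      case False
      have a: "norm (Y j i (x * Q powi k)) \<le> T * L ^ nat \<bar>k\<bar> * q powi (- ?tr)"
        unfolding Y_def[OF j] using False by (intro T2 n1) auto
      have b: "norm (qpoch q (xi j / x * Q powi (1 - k))) \<le> T'"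
        unfolding qpoch_eval1 using False by (intro T1' n2) auto
      have "1 \<le> L' * L' ^ nat \<bar>k\<bar>" using T' Lk mult_mono[of 1 L' 1 "L' ^ nat \<bar>k\<bar>"] by auto
      hence "T' \<le> T' * (L' * L' ^ nat \<bar>k\<bar>)" using T' by simp
      with b have "norm (qpoch q (xi j / x * Q powi (1 - k))) \<le> T' * (L' * L' ^ nat \<bar>k\<bar>)" by linarith
      with a have "norm (Y j i (x * Q powi k)) * norm (qpoch q (xi j / x * Q powi (1 - k))) \<le>
          (T * L ^ nat \<bar>k\<bar> * q powi (- ?tr)) * (T' * (L' * L' ^ nat \<bar>k\<bar>))"
        using T T' q0 by (intro mult_mono) auto
      thus ?thesis by (simp add: power_mult_distrib mult_ac)
    qed
    have "norm ((- (x ^ 2) * z / xi j) powi k) \<le> B ^ nat \<bar>k\<bar>"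
      unfolding norm_power_int
    proof (rule powi_abs_bound)
      have e: "norm (- (x ^ 2) * z / xi j) = norm x ^ 2 * norm z / norm (xi j)"
        by (simp add: norm_mult norm_divide norm_power)
      show "0 < norm (- (x ^ 2) * z / xi j)" unfolding e using xp z x0 by simp
      have "norm x ^ 2 \<le> (3 * r) ^ 2" using n1 by (intro power_mono) auto
      hence "norm x ^ 2 * norm z / norm (xi j) \<le> (9 * r ^ 2) * norm z / norm (xi j)"
        by (intro divide_right_mono mult_right_mono) (auto simp: power_mult_distrib)
      thus "norm (- (x ^ 2) * z / xi j) \<le> B" unfolding e B_def by simp
      have "r ^ 2 \<le> norm x ^ 2" using zr[OF x] r by (intro power_mono) auto
      hence "norm (xi j) / (norm x ^ 2 * norm z) \<le> norm (xi j) / (r ^ 2 * norm z)"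
        using r z by (intro divide_left_mono mult_right_mono mult_pos_pos) (use xp in auto)
      thus "inverse (norm (- (x ^ 2) * z / xi j)) \<le> B" unfolding e B_def by (simp add: inverse_eq_divide)
    qed
    hence "norm (Phi_term i z k x) \<le> ((T * T' * L') * ((L * L') ^ nat \<bar>k\<bar>) * q powi (- ?tr)) * norm (qpoch q Q) *
        (q powi ?tr * q powi ?tr) * B ^ nat \<bar>k\<bar>"
    proof -
      assume pb: "norm ((- (x ^ 2) * z / xi j) powi k) \<le> B ^ nat \<bar>k\<bar>"
      have "norm (Phi_term i z k x) = (norm (Y j i (x * Q powi k)) * norm (qpoch q (xi j / x * Q powi (1 - k)))) *
          norm (qpoch q Q) * q powi (k * (k - 1)) * norm ((- (x ^ 2) * z / xi j) powi k)"
        unfolding Phi_term_def by (simp only: norm_mult norm_power_int[of Q] normQ mult_ac)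
      also have "\<dots> \<le> ((T * T' * L') * ((L * L') ^ nat \<bar>k\<bar>) * q powi (- ?tr)) * norm (qpoch q Q) * q powi (k * (k - 1)) * B ^ nat \<bar>k\<bar>"
        using T T' q0 by (intro mult_mono prod pb mult_right_mono mult_nonneg_nonneg) auto
      finally show ?thesis unfolding q2 .
    qed
    also have "\<dots> = M k * (q powi (- ?tr) * q powi ?tr)"
      unfolding M_def power_mult_distrib[of "L * L'" B] by (simp only: mult_ac)
    finally show ?thesis unfolding qi by simp
  qed
  moreover have "M summable_on UNIV"
    unfolding M_def by (intro summable_on_cmult_right gauss_int_abs mult_pos_pos B0) (use T T' in auto)
  moreover have "cball w r \<subseteq> - {0}" using zr[of 0] r by auto
  ultimately show "\<exists>r M. r > 0 \<and> cball w r \<subseteq> - {0} \<and> M summable_on UNIV \<and>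
               (\<forall>k. \<forall>x\<in>cball w r. norm (Phi_term i z k x) \<le> M k)"
    using r by blast
qed

text \<open>The substitution \<mu> \<mapsto> q \<mu> shifts k by one. The exponent 2 of \<mu> is the
  degree of a product of two theta functions, so \<open>quasi_periodic_zeros\<close> will need two
  zeros.\<close>

lemma Phi_Q:
  assumes m: "\<mu> \<noteq> 0" and z: "z \<noteq> 0"
  shows "Phi i z (Q * \<mu>) * \<mu> ^ 2 = - xi j / z * Phi i z \<mu>"
proof -
  note x0 = xi_nz[OF j]
  have "Phi_term i z k (Q * \<mu>) = (- xi j / (z * \<mu> ^ 2)) * Phi_term i z (k + 1) \<mu>" for k
  proof -
    let ?u = "- (\<mu> ^ 2) * z / xi j"
    have u0: "?u \<noteq> 0" using m z x0 by simp
    have 1: "Q * \<mu> * Q powi k = \<mu> * Q powi (k + 1)" by (simp add: power_int_add)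
    have 2: "xi j / (Q * \<mu>) * Q powi (1 - k) = xi j / \<mu> * Q powi (1 - (k + 1))"
      by (simp add: power_int_diff power_int_minus divide_inverse)
    have 3: "(- ((Q * \<mu>) ^ 2) * z / xi j) powi k = Q powi (2 * k) * ?u powi k"
    proof -
      have "- ((Q * \<mu>) ^ 2) * z / xi j = Q ^ 2 * ?u" by (simp add: power_mult_distrib)
      hence "(- ((Q * \<mu>) ^ 2) * z / xi j) powi k = (Q ^ 2) powi k * ?u powi k" by (simp only: power_int_mult_distrib)
      moreover have "(Q ^ 2) powi k = Q powi (2 * k)" by (simp add: power_int_mult)
      ultimately show ?thesis by simp
    qed
    have 4: "Q powi ((k + 1) * (k + 1 - 1)) = Q powi (k * (k - 1)) * Q powi (2 * k)"
      by (subst power_int_add[symmetric]) (auto simp: algebra_simps)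
    have 5: "?u powi (k + 1) = ?u powi k * ?u" by (rule power_int_add_1) (use u0 in simp)
    have 6: "(- xi j / (z * \<mu> ^ 2)) * ?u = 1" using m z x0 by simp
    have "(- xi j / (z * \<mu> ^ 2)) * Phi_term i z (k + 1) \<mu> = Phi_term i z k (Q * \<mu>) * ((- xi j / (z * \<mu> ^ 2)) * ?u)"
      unfolding Phi_term_def 1 2 3 4 5 by (simp only: mult_ac)
    thus ?thesis unfolding 6 by simp
  qed
  hence "Phi i z (Q * \<mu>) = (\<Sum>\<^sub>\<infinity>k. (- xi j / (z * \<mu> ^ 2)) * Phi_term i z (k + 1) \<mu>)" by (simp add: Phi_def)
  also have "\<dots> = (- xi j / (z * \<mu> ^ 2)) * (\<Sum>\<^sub>\<infinity>k. Phi_term i z (k + 1) \<mu>)" by (rule infsum_cmult_right')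
  also have "(\<Sum>\<^sub>\<infinity>k. Phi_term i z (k + 1) \<mu>) = Phi i z \<mu>"
    unfolding Phi_def by (rule infsum_reindex_bij_betw[of "\<lambda>k. k + 1"]) (rule bij_betwI[of _ _ _ "\<lambda>k. k - 1"], auto)
  finally show ?thesis using m z by (simp add: field_simps)
qed

lemma Phi_eq:
  assumes m: "\<mu> \<noteq> 0" "\<mu> \<notin> qspiral q (xi j)" and z: "z \<noteq> 0" "z \<notin> qspiral q (- 1 / \<mu>)"
  shows "Phi i z \<mu> = qtheta q (\<mu> * z) * qtheta q (- \<mu> / xi j) * bsum (gx j i) \<mu> z"
proof -
  note x0 = xi_nz[OF j]
  have th: "qtheta q (\<mu> * z) \<noteq> 0" using qtheta_mult_eq_0_iff[OF m(1) z(1)] z by simp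
  have tx: "qtheta q (- \<mu> / xi j) \<noteq> 0" using qtheta_eq_0_iff[OF x0 m(1)] m by simp
  have "Phi_term i z k \<mu> = qtheta q (- \<mu> / xi j) * ((gx j i (\<mu> * Q powi k) * \<mu> powi k) * Q powi (k * (k - 1) div 2) * z powi k)" for k
  proof -
    let ?y = "\<mu> * Q powi k / xi j"
    have y0: "?y \<noteq> 0" using m x0 by simp
    have "- ?y = (- \<mu> / xi j) * Q powi k" by simp
    hence t1: "qtheta q (- ?y) = Q powi (- (k * (k - 1) div 2)) * (- \<mu> / xi j) powi (- k) * qtheta q (- \<mu> / xi j)"
      using qtheta_powi[of "- \<mu> / xi j" k] m x0 by simp
    have Qy: "Q / ?y = xi j / \<mu> * Q powi (1 - k)" by (simp add: power_int_diff)
    have t2: "qtheta q (- ?y) = qpoch q Q * qpoch q ?y * qpoch q (xi j / \<mu> * Q powi (1 - k))"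
      unfolding qtheta_neg[OF y0] Qy ..
    have "qtheta q (- ?y) \<noteq> 0" unfolding t1 using m x0 tx by simp
    hence py: "qpoch q ?y \<noteq> 0" unfolding t2 by auto
    have t3: "qpoch q Q * qpoch q (xi j / \<mu> * Q powi (1 - k)) =
        Q powi (- (k * (k - 1) div 2)) * (- \<mu> / xi j) powi (- k) * qtheta q (- \<mu> / xi j) / qpoch q ?y"
      using t1 t2 py by (simp add: field_simps)
    have u: "(- (\<mu> ^ 2) * z / xi j) powi k = (- \<mu> / xi j) powi k * (\<mu> powi k * z powi k)"
    proof -
      have "- (\<mu> ^ 2) * z / xi j = (- \<mu> / xi j) * (\<mu> * z)" by (simp add: power2_eq_square)
      thus ?thesis by (simp only: power_int_mult_distrib)
    qed
    have Q2: "Q powi (k * (k - 1)) = Q powi (k * (k - 1) div 2) * Q powi (k * (k - 1) div 2)"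
      using tri_int_double[of k] by (subst power_int_add[symmetric]) auto
    have c1: "Q powi (- (k * (k - 1) div 2)) * Q powi (k * (k - 1) div 2) = 1" by (simp add: power_int_minus)
    have c2: "(- \<mu> / xi j) powi (- k) * (- \<mu> / xi j) powi k = 1"
      using m x0 by (simp add: power_int_minus)
    have "Phi_term i z k \<mu> = gx j i (\<mu> * Q powi k) * qtheta q (- \<mu> / xi j) * \<mu> powi k * z powi k * Q powi (k * (k - 1) div 2) *
       (Q powi (- (k * (k - 1) div 2)) * Q powi (k * (k - 1) div 2)) * ((- \<mu> / xi j) powi (- k) * (- \<mu> / xi j) powi k)"
      unfolding Phi_term_def t3 u Q2 gx_def[OF j] by (simp only: divide_inverse mult_ac)
    thus ?thesis unfolding c1 c2 by (simp only: mult_ac mult_1_left mult_1_right)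
  qed
  hence "Phi i z \<mu> = qtheta q (- \<mu> / xi j) * (\<Sum>\<^sub>\<infinity>k. (gx j i (\<mu> * Q powi k) * \<mu> powi k) * Q powi (k * (k - 1) div 2) * z powi k)"
    unfolding Phi_def by (simp only: infsum_cmult_right')
  thus ?thesis unfolding bsum_def using th by simp
qed

text \<open>At \<mu> = \<open>xi j\<close> the symbol (q^(1 - k); q)_\<infinity> kills all k \<ge>
  1. For k = - n, \<open>Y_residues\<close> turns the term into a constant times
  \<open>vcoef n i\<close> / z^n, which sums to the numerator of the last column.\<close>

lemma Phi_xi:
  assumes i: "i \<le> N" and z: "z \<noteq> 0"
  shows "Phi i z (xi j) = qpoch q Q ^ 2 * Y j N (xi j) * R i (1 / z)"
proof -
  note x0 = xi_nz[OF j]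
  have zero: "Phi_term i z k (xi j) = 0" if "k \<ge> 1" for k
  proof -
    have "xi j / xi j * Q powi (1 - k) * Q ^ nat (k - 1) = 1"
    proof -
      have "Q ^ nat (k - 1) = Q powi (k - 1)" using that by (metis diff_ge_0_iff_ge int_nat_eq power_int_of_nat)
      thus ?thesis using x0 by (simp flip: power_int_add)
    qed
    hence "qpoch q (xi j / xi j * Q powi (1 - k)) = 0" using qpoch_eq_0_iff by blast
    thus ?thesis by (simp add: Phi_term_def)
  qed
  have val: "Phi_term i z (- int n) (xi j) = qpoch q Q ^ 2 * Y j N (xi j) * (vcoef n i * (1 / z) ^ n)" for n
  proof -
    have a: "xi j * Q powi (- int n) = xi j / Q ^ n" by (simp add: power_int_minus divide_inverse)
    have "Q powi (1 - - int n) = Q * Q ^ n" by (simp add: power_int_add)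
    hence b: "qpoch q (xi j / xi j * Q powi (1 - - int n)) = qpoch q Q / qfact n"
      using x0 by (simp add: qfact_qpoch)
    have c: "Q powi (- int n * (- int n - 1)) = Q ^ (n * (n + 1))"
    proof -
      have "- int n * (- int n - 1) = int (n * (n + 1))" by (simp add: algebra_simps)
      thus ?thesis by (simp only: power_int_of_nat)
    qed
    have "- (xi j ^ 2) * z / xi j = - xi j * z" using x0 by (simp add: power2_eq_square)
    hence e: "(- (xi j ^ 2) * z / xi j) powi (- int n) = 1 / ((- xi j) ^ n * z ^ n)"
      by (simp only: power_int_minus power_int_of_nat power_mult_distrib inverse_eq_divide)
    have x1: "- xi j \<noteq> 0" using x0 by simp
    show ?thesis unfolding Phi_term_def a b c e Y_residues[OF i]
      using x1 z by (simp add: power2_eq_square power_divide del: neg_equal_0_iff_equal)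
  qed
  have s: "(\<lambda>n. vcoef n i * (1 / z) ^ n) sums R i (1 / z)" by (rule R_sums[OF i])
  have "summable (\<lambda>n. norm (vcoef n i * (1 / z) ^ n))"
    using norm_summable_fps[of "1 / z" "Rfps i"] Rfps_conv[OF i] by (simp add: Rfps_def)
  from norm_summable_imp_has_sum[OF this s]
  have "((\<lambda>n. qpoch q Q ^ 2 * Y j N (xi j) * (vcoef n i * (1 / z) ^ n)) has_sum (qpoch q Q ^ 2 * Y j N (xi j) * R i (1 / z))) UNIV"
    by (rule has_sum_cmult_right)
  hence "((\<lambda>n. Phi_term i z (- int n) (xi j)) has_sum (qpoch q Q ^ 2 * Y j N (xi j) * R i (1 / z))) UNIV"
    unfolding val .
  hence "((\<lambda>k. Phi_term i z k (xi j)) has_sum (qpoch q Q ^ 2 * Y j N (xi j) * R i (1 / z))) (range (\<lambda>n. - int n))"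
    by (subst has_sum_reindex) (auto simp: inj_on_def o_def)
  hence "((\<lambda>k. Phi_term i z k (xi j)) has_sum (qpoch q Q ^ 2 * Y j N (xi j) * R i (1 / z))) UNIV"
  proof (rule has_sum_cong_neutral[THEN iffD1, rotated -1])
    fix k assume "k \<in> UNIV - range (\<lambda>n. - int n)"
    hence "k \<noteq> - int (nat (- k))" by blast
    hence "k \<ge> 1" by (auto split: if_splits)
    thus "Phi_term i z k (xi j) = 0" by (rule zero)
  qed auto
  thus ?thesis unfolding Phi_def by (rule infsumI)
qed

theorem bsum_difference:
  assumes i: "i \<le> N" and l: "l \<noteq> 0" "l \<notin> qspiral q (xi j)" and m: "m \<noteq> 0" "m \<notin> qspiral q (xi j)"
    and z: "z \<noteq> 0" "z \<notin> qspiral q (- 1 / l)" "z \<notin> qspiral q (- 1 / m)"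
  shows "bsum (gx j i) m z - bsum (gx j i) l z =
     qpoch q Q ^ 2 * Y j N (xi j) * R i (1 / z) * qtheta q (- m / l) * qtheta q (l * z * m / xi j) /
     (qtheta q (- xi j / l) * qtheta q (l * z) * qtheta q (m * z) * qtheta q (- m / xi j))"
proof -
  note x0 = xi_nz[OF j]
  have nl: "xi j \<notin> qspiral q l"
  proof
    assume "xi j \<in> qspiral q l"
    then obtain k where "xi j = l * Q powi k" by (auto simp: qspiral_iff)
    hence "l = xi j * Q powi (- k)" by (simp add: power_int_minus)
    thus False using l by (auto simp: qspiral_iff)
  qed
  have t1: "qtheta q (- xi j / l) \<noteq> 0" using qtheta_eq_0_iff[OF l(1) x0] nl by simp
  have t2: "qtheta q (l * z) \<noteq> 0" using qtheta_mult_eq_0_iff[OF l(1) z(1)] z by simp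
  have t3: "qtheta q (m * z) \<noteq> 0" using qtheta_mult_eq_0_iff[OF m(1) z(1)] z by simp
  have t4: "qtheta q (- m / xi j) \<noteq> 0" using qtheta_eq_0_iff[OF x0 m(1)] m by simp
  define C where "C = Phi i z (xi j) / (qtheta q (- xi j / l) * qtheta q (l * z))"
  \<comment> \<open>All three terms have the multiplier - \<open>xi j\<close> / z and degree 2. At l
    the first two cancel and the third vanishes; C is chosen such that f vanishes at
    \<open>xi j\<close>. The multiplier excluded in \<open>quasi_periodic_zeros\<close> would put z
    on the pole spiral of l.\<close>
  define f where "f = (\<lambda>x. Phi i z x - qtheta q (x * z) * qtheta q (- x / xi j) * bsum (gx j i) l z
      - C * (qtheta q (- x / l) * qtheta q (l * z * x / xi j)))"
  define a where "a = (\<lambda>s::bool. if s then l else xi j)"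
  have "f m = 0"
  proof (rule quasi_periodic_zeros[of "UNIV :: bool set" f "- xi j / z" a])
    show "f holomorphic_on - {0}" unfolding f_def using l x0 z
      by (intro holomorphic_intros Phi_holomorphic i) auto
    show "f (Q * x) * x ^ card (UNIV :: bool set) = - xi j / z * f x" if x: "x \<noteq> 0" for x
    proof -
      have tQ: "qtheta q (Q * w) = qtheta q w / w" if "w \<noteq> 0" for w using qtheta_Q[OF that] .
      have e1: "qtheta q (Q * x * z) * qtheta q (- (Q * x) / xi j) * x ^ 2 = - xi j / z * (qtheta q (x * z) * qtheta q (- x / xi j))"
        using tQ[of "x * z"] tQ[of "- x / xi j"] x z x0 by (simp add: mult.assoc power2_eq_square)
      have e2: "qtheta q (- (Q * x) / l) * qtheta q (l * z * (Q * x) / xi j) * x ^ 2 = - xi j / z * (qtheta q (- x / l) * qtheta q (l * z * x / xi j))"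
        using tQ[of "- x / l"] tQ[of "l * z * x / xi j"] x z x0 l by (simp add: mult_ac power2_eq_square)
      have "f (Q * x) * x ^ 2 = Phi i z (Q * x) * x ^ 2 - (qtheta q (Q * x * z) * qtheta q (- (Q * x) / xi j) * x ^ 2) * bsum (gx j i) l z
         - C * (qtheta q (- (Q * x) / l) * qtheta q (l * z * (Q * x) / xi j) * x ^ 2)"
        unfolding f_def by (simp add: algebra_simps)
      also have "\<dots> = - xi j / z * f x"
        unfolding e1 e2 Phi_Q[OF x z(1)] f_def by (simp only: right_diff_distrib mult_ac)
      finally show ?thesis by simp
    qed
    show "f (a s) = 0" for s
    proof (cases s)
      case True
      have "qtheta q (- l / l) = 0" using qtheta_eq_0_iff[OF l(1,1)] by (auto simp: qspiral_iff intro: exI[of _ 0])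
      thus ?thesis using True Phi_eq[OF l z(1,2)] by (simp add: f_def a_def)
    next
      case False
      have "qtheta q (- xi j / xi j) = 0" using qtheta_eq_0_iff[OF x0 x0] by (auto simp: qspiral_iff intro: exI[of _ 0])
      thus ?thesis using False t1 t2 x0 by (simp add: f_def a_def C_def)
    qed
    show "a s \<noteq> 0" for s using l x0 by (simp add: a_def)
    show "a s \<notin> qspiral q (a t)" if "s \<noteq> t" for s t using that l nl by (auto simp: a_def)
    show "- xi j / z \<noteq> Q powi k * (\<Prod>s\<in>UNIV. - a s)" for k
    proof
      assume "- xi j / z = Q powi k * (\<Prod>s\<in>UNIV. - a s)"
      hence "- xi j / z = Q powi k * (xi j * l)" by (simp add: UNIV_bool a_def)
      hence "- xi j = xi j * (Q powi k * l * z)" using z by (simp add: field_simps)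
      hence "- 1 = Q powi k * l * z" using x0 by (metis mult_cancel_left mult_minus1_right)
      hence "z = (- 1 / l) * Q powi (- k)" using l z by (simp add: power_int_minus field_simps)
      thus False using z by (auto simp: qspiral_iff)
    qed
  qed (use m in auto)
  hence "qtheta q (m * z) * qtheta q (- m / xi j) * (bsum (gx j i) m z - bsum (gx j i) l z) =
       C * (qtheta q (- m / l) * qtheta q (l * z * m / xi j))"
    unfolding f_def Phi_eq[OF m z(1,3)] by (simp add: algebra_simps)
  hence "bsum (gx j i) m z - bsum (gx j i) l z =
       C * (qtheta q (- m / l) * qtheta q (l * z * m / xi j)) / (qtheta q (m * z) * qtheta q (- m / xi j))"
    using t3 t4 by (subst nonzero_eq_divide_eq) (simp_all add: mult.commute)
  thus ?thesis unfolding C_def Phi_xi[OF i z(1)] by (simp add: mult_ac)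
qed

end

end

section \<open>The sum over s as an interpolation by theta functions\<close>

context q_base
begin

lemma qtheta_Q_inverse: "z \<noteq> 0 \<Longrightarrow> qtheta q (z / Q) = z / Q * qtheta q z"
  using qtheta_Q[of "z / Q"] by (simp add: field_simps)

end

context arrow
begin

text \<open>The inner sum of \<open>stokes_b\<close> in terms of t, c and d, with indices from 0 and
  with the power of z split off.\<close>

definition stokes_sum :: "nat \<Rightarrow> complex \<Rightarrow> complex \<Rightarrow> complex \<Rightarrow> complex" where
  "stokes_sum j l m z = (\<Sum>s\<le>N.
      ((\<Prod>i<N. qpoch q (Q * t s / c i)) / (\<Prod>i\<in>{..N}-{s}. qpoch q (Q * t s / t i)))
    * ((\<Prod>i\<in>{..N}-{s}. qtheta q ((1 - Q) * (Q / t i) / l)) / (\<Prod>i<N. qtheta q ((1 - Q) * (Q / c i) / l)))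
    * (qtheta q (t s / d * l * z) / qtheta q (l * z))
    * (((\<Prod>i\<in>{..N}-{s}. qpoch q (Q * t i / c j)) * (\<Prod>i\<in>{..<N}-{j}. qpoch q (c i / t s)))
       / ((\<Prod>i\<in>{..<N}-{j}. qpoch q (Q * c i / c j)) * (\<Prod>i\<in>{..N}-{s}. qpoch q (t i / t s))))
    * (qtheta q (c j / (t s * Q) * m * z) / qtheta q (m * z))
    * (qtheta q (t s * m / (1 - Q)) / qtheta q (c j / Q * m / (1 - Q))))"

context
  fixes j :: nat
  assumes j: "j < N" and t_nonres: "\<And>r s. r \<le> N \<Longrightarrow> s \<le> N \<Longrightarrow> r \<noteq> s \<Longrightarrow> t r \<notin> qspiral q (t s)"
begin

lemma theta_t_nz: "r \<le> N \<Longrightarrow> s \<le> N \<Longrightarrow> r \<noteq> s \<Longrightarrow> qtheta q (- t r / t s) \<noteq> 0"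
  using qtheta_eq_0_iff[of "t s" "t r"] t_nz t_nonres by blast

text \<open>A Lagrange coefficient: the right-hand side of \<open>theta_interpolation\<close>
  without \<theta>(- z / \<open>aa\<close>), evaluated at the node - (1 - q) / t_s and divided by
  the product of theta values that belongs to this node.\<close>

definition Chat :: "complex \<Rightarrow> complex \<Rightarrow> nat \<Rightarrow> complex" where
  "Chat m z s = (\<Prod>i\<in>{..<N}-{j}. qtheta q (- c i / t s)) / (\<Prod>l\<in>{..N}-{s}. qtheta q (- t l / t s))
     * qtheta q (c j / (t s * Q) * m * z) * qtheta q (t s * m / (1 - Q))"

text \<open>
  Both sides are theta functions of degree \<open>N + 1\<close> in \<open>x\<close> with the same multiplier, and they
  agree at the \<open>N + 1\<close> points \<open>- (1 - Q) / t s\<close>.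
\<close>

lemma theta_interpolation:
  assumes m: "m \<noteq> 0" and z: "z \<noteq> 0" "z \<notin> qspiral q aa" and x: "x \<noteq> 0"
  shows "(\<Sum>s\<le>N. Chat m z s * ((\<Prod>l\<in>{..N}-{s}. qtheta q (t l * x / (1 - Q))) * qtheta q (t s / d * x * z))) =
    qtheta q (- z / aa) * ((\<Prod>i\<in>{..<N}-{j}. qtheta q (c i * x / (1 - Q))) *
      (qtheta q (- (c j * m * x * z / (Q * (1 - Q)))) * qtheta q (- m / x)))"
proof -
  define A where "A = (\<lambda>s x. (\<Prod>l\<in>{..N}-{s}. qtheta q (t l * x / (1 - Q))) * qtheta q (t s / d * x * z))"
  define B where "B = (\<lambda>x. (\<Prod>i\<in>{..<N}-{j}. qtheta q (c i * x / (1 - Q))) *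
      (qtheta q (- (c j * m * x * z / (Q * (1 - Q)))) * qtheta q (- m / x)))"
  define f where "f = (\<lambda>x. (\<Sum>s\<le>N. Chat m z s * A s x) - qtheta q (- z / aa) * B x)"
  \<comment> \<open>The common multiplier. The factors 1 / t_l for l \<noteq> s together with d /
    t_s do not depend on s, and by the definition of d they reduce to the reciprocal product of the
    c_i.\<close>
  define \<kappa> where "\<kappa> = (1 - Q) ^ N / (z * (\<Prod>i<N. c i))"
  define a where "a = (\<lambda>s. - (1 - Q) / t s)"
  note nz = oneQ d_nz
  have tQ: "qtheta q (Q * w) = qtheta q w / w" if "w \<noteq> 0" for w using qtheta_Q[OF that] .
  have N1: "card ({..N} - {s}) = N" if "s \<le> N" for s using that by simp
  have N2: "card ({..<N} - {j}) = N - 1" using j by simp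
  have tp: "(\<Prod>l\<le>N. t l) \<noteq> 0" "(\<Prod>i<N. c i) \<noteq> 0" using t_nz c_nz by auto
  have AQ: "A s (Q * x) * x ^ Suc N = \<kappa> * A s x" if s: "s \<le> N" and x: "x \<noteq> 0" for s x
  proof -
    have "(\<Prod>l\<in>{..N}-{s}. qtheta q (t l * (Q * x) / (1 - Q))) = (\<Prod>l\<in>{..N}-{s}. qtheta q (t l * x / (1 - Q)) * ((1 - Q) / x) / t l)"
    proof (rule prod.cong)
      fix i assume "i \<in> {..N}-{s}"
      thus "qtheta q (t i * (Q * x) / (1 - Q)) = qtheta q (t i * x / (1 - Q)) * ((1 - Q) / x) / t i"
        using tQ[of "t i * x / (1 - Q)"] t_nz[of i] x nz by (simp add: mult_ac)
    qed simp
    also have "\<dots> = (\<Prod>l\<in>{..N}-{s}. qtheta q (t l * x / (1 - Q))) * ((1 - Q) / x) ^ N / (\<Prod>l\<in>{..N}-{s}. t l)"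
      using N1[OF s] by (simp add: prod_dividef prod.distrib power_divide)
    also have "(\<Prod>l\<in>{..N}-{s}. t l) = (\<Prod>l\<le>N. t l) / t s"
      using s t_nz[of s] by (simp add: prod.remove[of "{..N}" s])
    finally have 1: "(\<Prod>l\<in>{..N}-{s}. qtheta q (t l * (Q * x) / (1 - Q))) =
       (\<Prod>l\<in>{..N}-{s}. qtheta q (t l * x / (1 - Q))) * ((1 - Q) / x) ^ N / ((\<Prod>l\<le>N. t l) / t s)" .
    have 2: "qtheta q (t s / d * (Q * x) * z) = qtheta q (t s / d * x * z) / (t s / d * x * z)"
      using tQ[of "t s / d * x * z"] t_nz[OF s] x z nz by (simp add: mult_ac)
    have "A s (Q * x) = A s x * (((1 - Q) / x) ^ N / ((\<Prod>l\<le>N. t l) / t s) / (t s / d * x * z))"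
      unfolding A_def 1 2 by simp
    also have "((1 - Q) / x) ^ N / ((\<Prod>l\<le>N. t l) / t s) / (t s / d * x * z) = \<kappa> / x ^ Suc N"
      unfolding \<kappa>_def d_def using tp t_nz[OF s] x z by (simp add: power_divide)
    finally show ?thesis using x by simp
  qed
  have BQ: "B (Q * x) * x ^ Suc N = \<kappa> * B x" if x: "x \<noteq> 0" for x
  proof -
    have "(\<Prod>i\<in>{..<N}-{j}. qtheta q (c i * (Q * x) / (1 - Q))) = (\<Prod>i\<in>{..<N}-{j}. qtheta q (c i * x / (1 - Q)) * ((1 - Q) / x) / c i)"
    proof (rule prod.cong)
      fix i assume "i \<in> {..<N}-{j}"
      thus "qtheta q (c i * (Q * x) / (1 - Q)) = qtheta q (c i * x / (1 - Q)) * ((1 - Q) / x) / c i"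
        using tQ[of "c i * x / (1 - Q)"] c_nz[of i] x nz by (simp add: mult_ac)
    qed simp
    also have "\<dots> = (\<Prod>i\<in>{..<N}-{j}. qtheta q (c i * x / (1 - Q))) * ((1 - Q) / x) ^ (N - 1) / (\<Prod>i\<in>{..<N}-{j}. c i)"
      using N2 by (simp add: prod_dividef prod.distrib power_divide)
    also have "(\<Prod>i\<in>{..<N}-{j}. c i) = (\<Prod>i<N. c i) / c j"
      using j c_nz[of j] by (simp add: prod.remove[of "{..<N}" j])
    finally have 1: "(\<Prod>i\<in>{..<N}-{j}. qtheta q (c i * (Q * x) / (1 - Q))) =
       (\<Prod>i\<in>{..<N}-{j}. qtheta q (c i * x / (1 - Q))) * ((1 - Q) / x) ^ (N - 1) / ((\<Prod>i<N. c i) / c j)" .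
    have 2: "qtheta q (- (c j * m * (Q * x) * z / (Q * (1 - Q)))) = qtheta q (- (c j * m * x * z / (Q * (1 - Q)))) / (- (c j * m * x * z / (Q * (1 - Q))))"
      using tQ[of "- (c j * m * x * z / (Q * (1 - Q)))"] c_nz[OF j] m x z nz by (simp add: mult_ac)
    have 3: "qtheta q (- m / (Q * x)) = - m / (Q * x) * qtheta q (- m / x)"
      using qtheta_Q_inverse[of "- m / x"] m x by (simp add: mult_ac)
    have "B (Q * x) = B x * (((1 - Q) / x) ^ (N - 1) / ((\<Prod>i<N. c i) / c j) / (- (c j * m * x * z / (Q * (1 - Q)))) * (- m / (Q * x)))"
    proof -
      have "X * a / b * (Y / r * (s * W)) = X * (Y * W) * (a / b / r * s)" for X Y W a b r s :: complex
        by (simp add: divide_inverse mult_ac)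
      thus ?thesis unfolding B_def 1 2 3 .
    qed
    also have "((1 - Q) / x) ^ (N - 1) / ((\<Prod>i<N. c i) / c j) / (- (c j * m * x * z / (Q * (1 - Q)))) * (- m / (Q * x)) =
       ((1 - Q) / x) ^ (N - 1) * ((1 - Q) / x) / (z * (\<Prod>i<N. c i) * x)"
      using tp c_nz[OF j] m x z nz by (simp add: field_simps)
    also have "((1 - Q) / x) ^ (N - 1) * ((1 - Q) / x) = ((1 - Q) / x) ^ N" using j by (cases N) auto
    also have "((1 - Q) / x) ^ N / (z * (\<Prod>i<N. c i) * x) = \<kappa> / x ^ Suc N"
      unfolding \<kappa>_def by (simp add: power_divide mult_ac)
    finally show ?thesis using x by simp
  qed
  have "f x = 0"
  proof (rule quasi_periodic_zeros[of "{..N}" f \<kappa> a])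
    show "f holomorphic_on - {0}" unfolding f_def A_def B_def
      using t_nz c_nz j m z nz by (intro holomorphic_intros) auto
    show "f (Q * x) * x ^ card {..N} = \<kappa> * f x" if x: "x \<noteq> 0" for x
    proof -
      have "f (Q * x) * x ^ Suc N = (\<Sum>s\<le>N. Chat m z s * (A s (Q * x) * x ^ Suc N)) - qtheta q (- z / aa) * (B (Q * x) * x ^ Suc N)"
        unfolding f_def left_diff_distrib sum_distrib_right by (simp only: mult.assoc)
      also have "(\<Sum>s\<le>N. Chat m z s * (A s (Q * x) * x ^ Suc N)) = (\<Sum>s\<le>N. Chat m z s * (\<kappa> * A s x))"
        by (intro sum.cong refl) (use AQ x in auto)
      also have "\<dots> = \<kappa> * (\<Sum>s\<le>N. Chat m z s * A s x)" by (simp add: sum_distrib_left mult_ac)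
      finally show ?thesis unfolding BQ[OF x] by (simp add: f_def right_diff_distrib mult_ac)
    qed
    show "a s \<noteq> 0" if "s \<in> {..N}" for s using that t_nz nz by (auto simp: a_def)
    show "f (a s) = 0" if s: "s \<in> {..N}" for s
    proof -
      have ts: "t s \<noteq> 0" "s \<le> N" using s t_nz by auto
      have ta: "w * a s / (1 - Q) = - w / t s" for w
      proof -
        have "w * (- b / y) / b = - w / y" if "b \<noteq> 0" for b y :: complex using that by simp
        from this[OF oneQ] show ?thesis unfolding a_def by simp
      qed
      have one: "qtheta q (- 1) = 0" using qtheta_neg_eq_0_iff[of 1] by (auto intro: exI[of _ 0])
      \<comment> \<open>For r \<noteq> s the product contains the factor with index s, which at this
        node is \<theta>(-1) = 0. Only the term r = s remains.\<close>
      have A0: "A r (a s) = 0" if "r \<in> {..N} - {s}" for r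
      proof -
        have "qtheta q (t s * a s / (1 - Q)) = 0" unfolding ta using ts one by simp
        moreover have "s \<in> {..N} - {r}" using that ts by auto
        ultimately have "(\<Prod>l\<in>{..N}-{r}. qtheta q (t l * a s / (1 - Q))) = 0" by (intro prod_zero) auto
        thus ?thesis by (simp add: A_def)
      qed
      have "(\<Sum>r\<le>N. Chat m z r * A r (a s)) = Chat m z s * A s (a s)"
        using s A0 by (subst sum.remove[of _ s]) auto
      also have "A s (a s) = (\<Prod>l\<in>{..N}-{s}. qtheta q (- t l / t s)) * qtheta q (- z / aa)"
      proof -
        have "u / v * (- w / u) * z = - z / (v / w)" if "u \<noteq> 0" for u v w :: complex using that by simp
        hence "t s / d * a s * z = - z / aa" unfolding a_def aa_def using ts(1) by (simp only: mult.assoc)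
        thus ?thesis unfolding A_def ta by (simp only:)
      qed
      also have "Chat m z s * \<dots> = qtheta q (- z / aa) * ((\<Prod>i\<in>{..<N}-{j}. qtheta q (- c i / t s)) *
          (qtheta q (c j / (t s * Q) * m * z) * qtheta q (t s * m / (1 - Q))))"
      proof -
        have "(\<Prod>l\<in>{..N}-{s}. qtheta q (- t l / t s)) \<noteq> 0" using theta_t_nz ts by auto
        thus ?thesis unfolding Chat_def by simp
      qed
      also have "(\<Prod>i\<in>{..<N}-{j}. qtheta q (- c i / t s)) = (\<Prod>i\<in>{..<N}-{j}. qtheta q (c i * a s / (1 - Q)))"
        unfolding ta ..
      also have "qtheta q (c j / (t s * Q) * m * z) = qtheta q (- (c j * m * a s * z / (Q * (1 - Q))))"
      proof -
        have "x / (u * p) * m * z = - (x * m * (- w / u) * z / (p * w))" if "w \<noteq> 0" "u \<noteq> 0" "p \<noteq> 0" for x u p w :: complex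
          using that by (simp add: field_simps)
        from this[OF oneQ ts(1)] show ?thesis unfolding a_def by simp
      qed
      also have "qtheta q (t s * m / (1 - Q)) = qtheta q (- m / a s)"
      proof -
        have "- m / (- w / u) = u * m / w" if "w \<noteq> 0" "u \<noteq> 0" for u w :: complex
          using that by (simp add: field_simps)
        from this[OF oneQ ts(1)] have "- m / a s = t s * m / (1 - Q)" unfolding a_def by simp
        thus ?thesis by simp
      qed
      finally show ?thesis by (simp add: f_def B_def)
    qed
    show "a r \<notin> qspiral q (a s)" if "r \<in> {..N}" "s \<in> {..N}" "r \<noteq> s" for r s
    proof
      assume "a r \<in> qspiral q (a s)"
      then obtain k where k: "a r = a s * Q powi k" by (auto simp: qspiral_iff)
      have n: "t r \<noteq> 0" "t s \<noteq> 0" using that t_nz by auto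
      have "v = u * K" if "- w / u = - w / v * K" "w \<noteq> 0" "u \<noteq> 0" "v \<noteq> 0" for u v w K :: complex
        using that by (simp add: field_simps)
      from this[OF k[unfolded a_def] oneQ n] have "t s = t r * Q powi k" .
      thus False using t_nonres[of s r] that by (auto simp: qspiral_iff)
    qed
    \<comment> \<open>A multiplier of the excluded form means precisely that z lies on the spiral of
      \<open>aa\<close>.\<close>
    show "\<kappa> \<noteq> Q powi k * (\<Prod>s\<in>{..N}. - a s)" for k
    proof
      assume k: "\<kappa> = Q powi k * (\<Prod>s\<in>{..N}. - a s)"
      have "(\<Prod>s\<in>{..N}. - a s) = (1 - Q) ^ Suc N / (\<Prod>l\<le>N. t l)"
      proof -
        have "- a s = (1 - Q) / t s" for s by (simp add: a_def minus_divide_left)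
        hence "(\<Prod>s\<in>{..N}. - a s) = (\<Prod>s\<le>N. (1 - Q) / t s)" by (simp only:)
        also have "\<dots> = (1 - Q) ^ Suc N / (\<Prod>l\<le>N. t l)" unfolding prod_dividef prod_constant by simp
        finally show ?thesis .
      qed
      hence e: "(1 - Q) ^ N / (z * (\<Prod>i<N. c i)) = Q powi k * ((1 - Q) ^ Suc N / (\<Prod>l\<le>N. t l))"
        using k by (simp add: \<kappa>_def)
      have g: "x = P / C / w * inverse K"
        if "w ^ N / (x * C) = K * (w ^ Suc N / P)" "w \<noteq> 0" "x \<noteq> 0" "C \<noteq> 0" "P \<noteq> 0" "K \<noteq> 0" for w x C P K :: complex
      proof -
        have "w ^ N * (1 / (x * C)) = w ^ N * (K * w / P)" using that(1) by simp
        hence "1 / (x * C) = K * w / P" using that(2) by (simp only: mult_cancel_left power_eq_0_iff) simp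
        thus ?thesis using that by (simp add: field_simps)
      qed
      have "Q powi k \<noteq> 0" by simp
      from g[OF e oneQ z(1) tp(2,1) this] have "z = aa * Q powi (- k)"
        unfolding aa_def d_def power_int_minus .
      thus False using z by (auto simp: qspiral_iff)
    qed
  qed (use x in auto)
  thus ?thesis by (simp add: f_def A_def B_def)
qed

text \<open>By the triple product the Pochhammer symbols in c_i / t_s and in t_i / t_s pair with
  their reflected ones to the theta values of \<open>Chat\<close>; N - 1 pairs in the numerator and
  N in the denominator leave one factor (q; q)_\<infinity>. The symbol for c_j completes the product
  over t_i to G, which is independent of s. The rest is \<open>theta_interpolation\<close> at x =
  l.\<close>

lemma stokes_sum_eq:
  assumes l: "l \<noteq> 0" "\<And>i. i < N \<Longrightarrow> l \<notin> qspiral q (xi i)" and m: "m \<noteq> 0"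
    and z: "z \<noteq> 0" "z \<notin> qspiral q aa"
  shows "stokes_sum j l m z = qpoch q Q * G j * qtheta q (- z / aa) * (- l * z) *
     qtheta q (l * z * m / xi j) * qtheta q (- m / l) /
     (qtheta q (- l / xi j) * qtheta q (l * z) * qtheta q (m * z) * qtheta q (- m / xi j))"
proof -
  note nz = oneQ d_nz qpoch_Q_nz
  define D where "D = (\<Prod>i<N. qtheta q (c i * l / (1 - Q))) * qtheta q (l * z) * qtheta q (m * z) * qtheta q (c j / Q * m / (1 - Q))"
  have refl: "qtheta q ((1 - Q) * (Q / w) / l) = qtheta q (w * l / (1 - Q))" if "w \<noteq> 0" for w
  proof -
    have "(1 - Q) * (Q / w) / l = Q / (w * l / (1 - Q))" using that l nz by (simp add: field_simps)
    thus ?thesis using qtheta_refl[of "w * l / (1 - Q)"] that l nz by (simp add: mult.commute)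
  qed
  have Hnz: "(\<Prod>i\<in>{..<N}-{j}. qpoch q (Q * c i / c j)) \<noteq> 0"
  proof -
    have "qpoch q (Q * c i / c j) \<noteq> 0" if i: "i < N" for i
    proof
      assume "qpoch q (Q * c i / c j) = 0"
      then obtain n where "Q * c i / c j * Q ^ n = 1" by (auto simp: qpoch_eq_0_iff)
      thus False using c_res[OF i j, of n] by (simp add: mult_ac)
    qed
    thus ?thesis by auto
  qed
  have trm: "((\<Prod>i<N. qpoch q (Q * t s / c i)) / (\<Prod>i\<in>{..N}-{s}. qpoch q (Q * t s / t i)))
    * ((\<Prod>i\<in>{..N}-{s}. qtheta q ((1 - Q) * (Q / t i) / l)) / (\<Prod>i<N. qtheta q ((1 - Q) * (Q / c i) / l)))
    * (qtheta q (t s / d * l * z) / qtheta q (l * z))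
    * (((\<Prod>i\<in>{..N}-{s}. qpoch q (Q * t i / c j)) * (\<Prod>i\<in>{..<N}-{j}. qpoch q (c i / t s)))
       / ((\<Prod>i\<in>{..<N}-{j}. qpoch q (Q * c i / c j)) * (\<Prod>i\<in>{..N}-{s}. qpoch q (t i / t s))))
    * (qtheta q (c j / (t s * Q) * m * z) / qtheta q (m * z))
    * (qtheta q (t s * m / (1 - Q)) / qtheta q (c j / Q * m / (1 - Q))) =
    qpoch q Q * G j / D * (Chat m z s * ((\<Prod>l'\<in>{..N}-{s}. qtheta q (t l' * l / (1 - Q))) * qtheta q (t s / d * l * z)))"
    if s: "s \<le> N" for s
  proof -
    have ts: "t s \<noteq> 0" using t_nz s by simp
    define A0 A1 B1 D1 E1 F1 H where "A0 = qpoch q (Q * t s / c j)"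
      and "A1 = (\<Prod>i\<in>{..<N}-{j}. qpoch q (Q * t s / c i))"
      and "B1 = (\<Prod>i\<in>{..N}-{s}. qpoch q (Q * t s / t i))"
      and "D1 = (\<Prod>i\<in>{..<N}-{j}. qpoch q (c i / t s))"
      and "E1 = (\<Prod>i\<in>{..N}-{s}. qpoch q (t i / t s))"
      and "F1 = (\<Prod>i\<in>{..N}-{s}. qpoch q (Q * t i / c j))"
      and "H = (\<Prod>i\<in>{..<N}-{j}. qpoch q (Q * c i / c j))"
    have a: "(\<Prod>i<N. qpoch q (Q * t s / c i)) = A0 * A1"
      unfolding A0_def A1_def using j by (simp add: prod.remove[of _ j])
    have b: "(\<Prod>i\<in>{..<N}-{j}. qtheta q (- c i / t s)) = qpoch q Q ^ (N - 1) * D1 * A1"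
    proof -
      have "(\<Prod>i\<in>{..<N}-{j}. qtheta q (- c i / t s)) = (\<Prod>i\<in>{..<N}-{j}. qpoch q Q * qpoch q (c i / t s) * qpoch q (Q * t s / c i))"
        by (intro prod.cong refl) (use qtheta_neg[of "c _ / t s"] c_nz ts in auto)
      thus ?thesis unfolding D1_def A1_def using j by (simp add: prod.distrib)
    qed
    have e: "(\<Prod>i\<in>{..N}-{s}. qtheta q (- t i / t s)) = qpoch q Q ^ N * E1 * B1"
    proof -
      have "(\<Prod>i\<in>{..N}-{s}. qtheta q (- t i / t s)) = (\<Prod>i\<in>{..N}-{s}. qpoch q Q * qpoch q (t i / t s) * qpoch q (Q * t s / t i))"
        by (intro prod.cong refl) (use qtheta_neg[of "t _ / t s"] t_nz ts in auto)
      thus ?thesis unfolding E1_def B1_def using s by (simp add: prod.distrib)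
    qed
    have "(\<Prod>i\<in>{..N}-{s}. qtheta q (- t i / t s)) \<noteq> 0" using theta_t_nz s by auto
    hence EB: "E1 \<noteq> 0" "B1 \<noteq> 0" unfolding e by auto
    have g: "A0 * F1 = G j * H"
    proof -
      have "A0 * F1 = (\<Prod>l\<le>N. qpoch q (Q * t l / c j))"
        unfolding A0_def F1_def using s by (simp add: prod.remove[of _ s])
      thus ?thesis using Hnz by (simp add: G_def[OF j] H_def)
    qed
    have H: "H \<noteq> 0" using Hnz by (simp add: H_def)
    have qN: "qpoch q Q ^ N = qpoch q Q ^ (N - 1) * qpoch q Q" using j by (cases N) auto
    have th1: "(\<Prod>i\<in>{..N}-{s}. qtheta q ((1 - Q) * (Q / t i) / l)) = (\<Prod>i\<in>{..N}-{s}. qtheta q (t i * l / (1 - Q)))"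
      by (intro prod.cong refl refl) (use t_nz in auto)
    have th2: "(\<Prod>i<N. qtheta q ((1 - Q) * (Q / c i) / l)) = (\<Prod>i<N. qtheta q (c i * l / (1 - Q)))"
      by (intro prod.cong refl refl) (use c_nz in auto)
    have pochs: "A0 * A1 / B1 * (F1 * D1 / (H * E1)) = qpoch q Q * G j * (qpoch q Q ^ (N - 1) * D1 * A1 / (qpoch q Q ^ N * E1 * B1))"
    proof -
      have "A0 * A1 / B1 * (F1 * D1 / (H * E1)) = (A0 * F1) * (A1 * D1) / (B1 * H * E1)" by (simp only: times_divide_times_eq mult_ac divide_divide_eq_left times_divide_eq_left times_divide_eq_right)
      also have "\<dots> = G j * (A1 * D1) / (B1 * E1)" unfolding g using H by simp
      finally show ?thesis unfolding qN using nz by (simp add: mult_ac)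
    qed
    have "((A0 * A1) / B1)
      * ((\<Prod>i\<in>{..N}-{s}. qtheta q (t i * l / (1 - Q))) / (\<Prod>i<N. qtheta q (c i * l / (1 - Q))))
      * (qtheta q (t s / d * l * z) / qtheta q (l * z))
      * ((F1 * D1) / (H * E1))
      * (qtheta q (c j / (t s * Q) * m * z) / qtheta q (m * z))
      * (qtheta q (t s * m / (1 - Q)) / qtheta q (c j / Q * m / (1 - Q))) =
      (A0 * A1 / B1 * (F1 * D1 / (H * E1))) / D * (qtheta q (c j / (t s * Q) * m * z) * qtheta q (t s * m / (1 - Q)) *
        ((\<Prod>l'\<in>{..N}-{s}. qtheta q (t l' * l / (1 - Q))) * qtheta q (t s / d * l * z)))"
      unfolding D_def by (simp only: times_divide_eq_left times_divide_eq_right divide_divide_eq_left mult_ac)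
    also have "\<dots> = qpoch q Q * G j / D * (Chat m z s * ((\<Prod>l'\<in>{..N}-{s}. qtheta q (t l' * l / (1 - Q))) * qtheta q (t s / d * l * z)))"
      unfolding pochs Chat_def b e by (simp only: times_divide_eq_left times_divide_eq_right divide_divide_eq_left mult_ac)
    finally show ?thesis unfolding a th1 th2 A1_def[symmetric] B1_def[symmetric] D1_def[symmetric] E1_def[symmetric] F1_def[symmetric] H_def[symmetric] .
  qed
  have "stokes_sum j l m z = (\<Sum>s\<le>N. qpoch q Q * G j / D * (Chat m z s * ((\<Prod>l'\<in>{..N}-{s}. qtheta q (t l' * l / (1 - Q))) * qtheta q (t s / d * l * z))))"
    unfolding stokes_sum_def by (intro sum.cong refl) (use trm in auto)
  also have "\<dots> = qpoch q Q * G j / D * (qtheta q (- z / aa) * ((\<Prod>i\<in>{..<N}-{j}. qtheta q (c i * l / (1 - Q))) *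
      (qtheta q (- (c j * m * l * z / (Q * (1 - Q)))) * qtheta q (- m / l))))"
    unfolding sum_distrib_left[symmetric] theta_interpolation[OF m z l(1)] ..
  finally have S: "stokes_sum j l m z = qpoch q Q * G j / D * (qtheta q (- z / aa) * ((\<Prod>i\<in>{..<N}-{j}. qtheta q (c i * l / (1 - Q))) *
      (qtheta q (- (c j * m * l * z / (Q * (1 - Q)))) * qtheta q (- m / l))))" .
  have cx: "c i = - (1 - Q) / xi i" if "i < N" for i using c_nz[OF that] nz by (simp add: xi_def)
  have thc: "qtheta q (c i * l / (1 - Q)) = qtheta q (- l / xi i)" if "i < N" for i
  proof -
    have "- a / x * l / a = - l / x" if "a \<noteq> 0" for a x :: complex using that by simp
    from this[OF oneQ] show ?thesis unfolding cx[OF that] by simp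
  qed
  define P where "P = (\<Prod>i\<in>{..<N}-{j}. qtheta q (c i * l / (1 - Q)))"
  have "qtheta q (- l / xi i) \<noteq> 0" if "i < N" for i
    using qtheta_eq_0_iff[OF xi_nz[OF that] l(1)] l(2)[OF that] by simp
  hence P: "P \<noteq> 0" unfolding P_def using thc by auto
  have PP: "(\<Prod>i<N. qtheta q (c i * l / (1 - Q))) = qtheta q (- l / xi j) * P"
    unfolding P_def using j thc[OF j] by (simp add: prod.remove[of _ j])
  note x0 = xi_nz[OF j]
  have t1: "qtheta q (- (c j * m * l * z / (Q * (1 - Q)))) = (l * z * m / xi j) / Q * qtheta q (l * z * m / xi j)"
  proof -
    have "- (c j * m * l * z / (Q * (1 - Q))) = (l * z * m / xi j) / Q" unfolding cx[OF j] using nz x0 by (simp add: field_simps)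
    thus ?thesis using qtheta_Q_inverse[of "l * z * m / xi j"] l m z x0 by simp
  qed
  have t2: "qtheta q (c j / Q * m / (1 - Q)) = (- m / xi j) / Q * qtheta q (- m / xi j)"
  proof -
    have "c j / Q * m / (1 - Q) = (- m / xi j) / Q" unfolding cx[OF j] using nz x0 by (simp add: field_simps)
    thus ?thesis using qtheta_Q_inverse[of "- m / xi j"] m x0 by simp
  qed
  have "stokes_sum j l m z = qpoch q Q * G j * qtheta q (- z / aa) * (((l * z * m / xi j) / Q) / ((- m / xi j) / Q)) *
     qtheta q (l * z * m / xi j) * qtheta q (- m / l) /
     (qtheta q (- l / xi j) * qtheta q (l * z) * qtheta q (m * z) * qtheta q (- m / xi j))"
    unfolding S D_def PP P_def[symmetric] t1 t2 using P by simp
  also have "((l * z * m / xi j) / Q) / ((- m / xi j) / Q) = - l * z" using m x0 by simp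
  finally show ?thesis .
qed

text \<open>The triple product splits \<theta>(- z / \<open>aa\<close>) from
  \<open>stokes_sum_eq\<close> into (q; q), the denominator (q \<open>aa\<close> / z; q) of the last
  column and (z / \<open>aa\<close>; q), the reciprocal of the q-exponential. This is why the
  quotient is grouped as it is.\<close>

theorem bsum_difference_stokes:
  assumes i: "i \<le> N" and l: "l \<noteq> 0" "\<And>i. i < N \<Longrightarrow> l \<notin> qspiral q (xi i)" and m: "m \<noteq> 0" "m \<notin> qspiral q (xi j)"
    and z: "z \<noteq> 0" "z \<notin> qspiral q (- 1 / l)" "z \<notin> qspiral q (- 1 / m)" "z \<notin> qspiral q aa"
  shows "bsum (gx j i) m z - bsum (gx j i) l z =
     R i (1 / z) / qpoch q (Q * aa / z) * (\<gamma> j / (1 - Q) * stokes_sum j l m z / z / qpoch q (z / aa))"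
proof -
  note x0 = xi_nz[OF j]
  have zaa: "z / aa \<noteq> 0" using z aa_nz by simp
  have "Q / (z / aa) = Q * aa / z" by simp
  hence tz: "qtheta q (- z / aa) = qpoch q Q * qpoch q (z / aa) * qpoch q (Q * aa / z)"
    using qtheta_neg[OF zaa] by simp
  have "qtheta q (- z / aa) \<noteq> 0" using qtheta_eq_0_iff[OF aa_nz z(1)] z by simp
  hence pz: "qpoch q (z / aa) \<noteq> 0" "qpoch q (Q * aa / z) \<noteq> 0" unfolding tz by auto
  have ti: "qtheta q (- xi j / l) = qtheta q (- l / xi j) / (- l / xi j)"
    using qtheta_inverse[of "- l / xi j"] x0 l by simp
  have D: "bsum (gx j i) m z - bsum (gx j i) l z =
     qpoch q Q ^ 2 * (\<gamma> j / (1 - Q) * xi j * G j) * R i (1 / z) * qtheta q (- m / l) * qtheta q (l * z * m / xi j) /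
     (qtheta q (- l / xi j) / (- l / xi j) * qtheta q (l * z) * qtheta q (m * z) * qtheta q (- m / xi j))"
    using bsum_difference[OF j i l(1) l(2)[OF j] m z(1,2,3)] unfolding Y_at_xi[OF j] ti .
  define T where "T = qtheta q (- m / l) * qtheta q (l * z * m / xi j) /
    (qtheta q (- l / xi j) * qtheta q (l * z) * qtheta q (m * z) * qtheta q (- m / xi j))"
  have "bsum (gx j i) m z - bsum (gx j i) l z =
     qpoch q Q ^ 2 * (\<gamma> j / (1 - Q) * xi j * G j) * R i (1 / z) * (- l / xi j) * T"
  proof -
    have "X * a * b / (u / y * v * w * r) = X * y * (a * b / (u * v * w * r))" for X a b u v w r y :: complex
      by (simp add: divide_inverse mult_ac)
    thus ?thesis unfolding D T_def .
  qed
  also have "\<dots> = qpoch q Q ^ 2 * (\<gamma> j / (1 - Q) * G j) * R i (1 / z) * (- l) * T" using x0 by simp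
  finally have 1: "bsum (gx j i) m z - bsum (gx j i) l z = qpoch q Q ^ 2 * (\<gamma> j / (1 - Q) * G j) * R i (1 / z) * (- l) * T" .
  have 2: "stokes_sum j l m z = qpoch q Q * G j * qtheta q (- z / aa) * (- l * z) * T"
  proof -
    have "K * (- (l * z)) * a * b / c = K * (- l * z) * (b * a / c)" for K a b c :: complex by simp
    thus ?thesis using stokes_sum_eq[OF l m(1) z(1,4)] unfolding T_def by simp
  qed
  show ?thesis unfolding 1 2 tz using pz z by (simp add: power2_eq_square)
qed

end

end

subsection \<open>Determinants and minors\<close>

lemma sum_mult_swap:
  fixes f :: "'a \<Rightarrow> 'b \<Rightarrow> 'c :: semiring_0"
  shows "(\<Sum>k\<in>K. (\<Sum>r\<in>R. a r * f r k) * h k) = (\<Sum>r\<in>R. a r * (\<Sum>k\<in>K. f r k * h k))"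
  unfolding sum_distrib_left sum_distrib_right mult.assoc by (rule sum.swap)

lemma mat_mult_entry:
  assumes "A \<in> carrier_mat n m" "B \<in> carrier_mat m k" "i < n" "j < k"
  shows "(A * B) $$ (i, j) = (\<Sum>r<m. A $$ (i, r) * B $$ (r, j))"
  using assms by (simp add: scalar_prod_def atLeast0LessThan)

lemma tendsto_det:
  fixes f :: "'a \<Rightarrow> nat \<Rightarrow> nat \<Rightarrow> complex"
  assumes "\<And>i j. i < n \<Longrightarrow> j < n \<Longrightarrow> ((\<lambda>x. f x i j) \<longlongrightarrow> g i j) F"
  shows "((\<lambda>x. det (mat n n (\<lambda>(i, j). f x i j))) \<longlongrightarrow> det (mat n n (\<lambda>(i, j). g i j))) F"
proof -
  have eq: "det (mat n n (\<lambda>(i, j). h i j)) = (\<Sum>p\<in>{p. p permutes {0..<n}}. signof p * (\<Prod>i = 0..<n. h i (p i)))" for h :: "nat \<Rightarrow> nat \<Rightarrow> complex"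
    by (subst det_def'[of _ n]) (auto intro!: sum.cong prod.cong simp: permutes_in_image)
  show ?thesis unfolding eq
    by (intro tendsto_sum tendsto_mult tendsto_const tendsto_prod assms) (auto simp: permutes_in_image)
qed

lemma meromorphic_on_det:
  assumes "\<And>i j. i < n \<Longrightarrow> j < n \<Longrightarrow> (\<lambda>x. f x i j) meromorphic_on S"
  shows "(\<lambda>x. det (mat n n (\<lambda>(i, j). f x i j))) meromorphic_on S"
proof -
  have eq: "det (mat n n (\<lambda>(i, j). h i j)) = (\<Sum>p\<in>{p. p permutes {0..<n}}. signof p * (\<Prod>i = 0..<n. h i (p i)))" for h :: "nat \<Rightarrow> nat \<Rightarrow> complex"
    by (subst det_def'[of _ n]) (auto intro!: sum.cong prod.cong simp: permutes_in_image)
  show ?thesis unfolding eq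
    by (intro meromorphic_on_sum meromorphic_on_mult meromorphic_on_const meromorphic_on_prod assms) (auto simp: permutes_in_image)
qed

lemma det_minus_scalar:
  fixes M :: "complex mat"
  assumes M: "M \<in> carrier_mat k k" and cp: "char_poly M = (\<Prod>i=1..k. [:- lam i, 1:])"
  shows "det (M - x \<cdot>\<^sub>m 1\<^sub>m k) = (\<Prod>i<k. lam (Suc i) - x)"
proof -
  have "M - x \<cdot>\<^sub>m 1\<^sub>m k = (-1) \<cdot>\<^sub>m (- char_matrix M x)"
    using M by (intro eq_matI) (auto simp: char_matrix_def)
  hence "det (M - x \<cdot>\<^sub>m 1\<^sub>m k) = (-1) ^ k * poly (char_poly M) x"
    unfolding char_poly_matrix[OF M] using M by (simp add: char_matrix_def)
  also have "poly (char_poly M) x = (\<Prod>i=1..k. x - lam i)" unfolding cp poly_prod by simp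
  also have "(\<Prod>i=1..k. x - lam i) = (\<Prod>i<k. x - lam (Suc i))"
    by (rule prod.reindex_bij_witness[of _ Suc "\<lambda>i. i - 1"]) auto
  also have "(-1) ^ k * (\<Prod>i<k. x - lam (Suc i)) = (\<Prod>i<k. (-1) * (x - lam (Suc i)))"
    unfolding prod.distrib by simp
  finally show ?thesis by simp
qed

text \<open>The column N + 1 is absent, so x does not occur in the row N + 1. The submatrix is the
  leading block with its last row exchanged, and the expansion along that row uses the cofactors of
  the original block.\<close>

lemma minor_last_row:
  fixes A :: "complex mat"
  assumes A: "A \<in> carrier_mat (Suc N) (Suc N)" and N: "N \<ge> 1"
  shows "minor ({1..N-1} \<union> {Suc N}) {1..N} (A - x \<cdot>\<^sub>m 1\<^sub>m (Suc N)) =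
     (\<Sum>i<N. A $$ (N, i) * cofactor (leading N A - x \<cdot>\<^sub>m 1\<^sub>m N) (N - 1) i)"
proof -
  let ?M = "A - x \<cdot>\<^sub>m 1\<^sub>m (Suc N)" and ?B = "leading N A - x \<cdot>\<^sub>m 1\<^sub>m N"
  have I: "{i. Suc i \<in> {1..N-1} \<union> {Suc N}} = {..<N-1} \<union> {N}" (is "_ = ?I") using N by auto
  have J: "{j. Suc j \<in> {1..N}} = {..<N}" by auto
  have cI: "{i. i < dim_row ?M \<and> i \<in> ?I} = ?I" using A N by auto
  have cJ: "{i. i < dim_col ?M \<and> i \<in> {..<N}} = {..<N}" using A by auto
  have pI: "pick ?I a = (if a < N - 1 then a else N)" if a: "a < N" for a
  proof -
    let ?i = "if a < N - 1 then a else N"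
    have "{b \<in> ?I. b < ?i} = {..<a}" using a by auto
    hence "card {b \<in> ?I. b < ?i} = a" by simp
    moreover have "?i \<in> ?I" by auto
    ultimately show ?thesis using pick_card_in_set[of "?i" ?I] by simp
  qed
  have pJ: "pick {..<N} a = a" if a: "a < N" for a
  proof -
    have "{b \<in> {..<N}. b < a} = {..<a}" using a by auto
    hence "card {b \<in> {..<N}. b < a} = a" by simp
    thus ?thesis using pick_card_in_set[of a "{..<N}"] a by simp
  qed
  define S where "S = mat N N (\<lambda>(a, b). ?M $$ (if a < N - 1 then a else N, b))"
  have "card ?I = N" using N by simp
  hence "submatrix ?M {i. Suc i \<in> {1..N-1} \<union> {Suc N}} {j. Suc j \<in> {1..N}} = S"
    unfolding submatrix_def I J cI cJ S_def using pI pJ by (intro eq_matI) auto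
  hence "minor ({1..N-1} \<union> {Suc N}) {1..N} ?M = det S" by (simp only: minor_def)
  also have "\<dots> = (\<Sum>i<N. S $$ (N - 1, i) * cofactor S (N - 1) i)"
    by (rule laplace_expansion_row) (use N in \<open>auto simp: S_def\<close>)
  also have "\<dots> = (\<Sum>i<N. A $$ (N, i) * cofactor ?B (N - 1) i)"
  proof (rule sum.cong)
    fix i assume i: "i \<in> {..<N}"
    have "S $$ (N - 1, i) = A $$ (N, i)" using i A N by (simp add: S_def)
    moreover have "mat_delete S (N - 1) i = mat_delete ?B (N - 1) i"
      using A N i by (intro eq_matI) (auto simp: mat_delete_def S_def leading_def)
    ultimately show "S $$ (N - 1, i) * cofactor S (N - 1) i = A $$ (N, i) * cofactor ?B (N - 1) i"
      by (simp add: cofactor_def)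
  qed simp
  finally show ?thesis .
qed

lemma minor_delete:
  fixes A :: "complex mat"
  assumes A: "A \<in> carrier_mat (Suc N) (Suc N)" and k: "k < N"
  shows "minor ({1..N} - {Suc k}) {1..N-1} (A - x \<cdot>\<^sub>m 1\<^sub>m (Suc N)) =
     det (mat_delete (leading N A - x \<cdot>\<^sub>m 1\<^sub>m N) k (N - 1))"
proof -
  let ?M = "A - x \<cdot>\<^sub>m 1\<^sub>m (Suc N)" and ?B = "leading N A - x \<cdot>\<^sub>m 1\<^sub>m N"
  have I: "{i. Suc i \<in> {1..N} - {Suc k}} = {..<N} - {k}" by auto
  have J: "{j. Suc j \<in> {1..N-1}} = {..<N-1}" using k by auto
  have cI: "{i. i < dim_row ?M \<and> i \<in> {..<N} - {k}} = {..<N} - {k}" using A by auto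
  have cJ: "{i. i < dim_col ?M \<and> i \<in> {..<N-1}} = {..<N-1}" using A by auto
  have pI: "pick ({..<N} - {k}) a = (if a < k then a else Suc a)" if a: "a < N - 1" for a
  proof -
    let ?i = "if a < k then a else Suc a"
    have "card {b \<in> {..<N} - {k}. b < ?i} = a"
    proof (cases "a < k")
      case True
      hence "{b \<in> {..<N} - {k}. b < ?i} = {..<a}" using a by auto
      thus ?thesis by simp
    next
      case False
      hence "{b \<in> {..<N} - {k}. b < ?i} = {..a} - {k}" using a by auto
      thus ?thesis using False by simp
    qed
    moreover have "?i \<in> {..<N} - {k}" using a by auto
    ultimately show ?thesis using pick_card_in_set[of "?i" "{..<N} - {k}"] by simp
  qed
  have pJ: "pick {..<N-1} a = a" if a: "a < N - 1" for a
  proof -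
    have "{b \<in> {..<N-1}. b < a} = {..<a}" using a by auto
    hence "card {b \<in> {..<N-1}. b < a} = a" by simp
    thus ?thesis using pick_card_in_set[of a "{..<N-1}"] a by simp
  qed
  have cN: "card ({..<N} - {k}) = N - 1" using k by simp
  have "submatrix ?M {i. Suc i \<in> {1..N} - {Suc k}} {j. Suc j \<in> {1..N-1}} = mat_delete ?B k (N - 1)"
    unfolding submatrix_def I J cI cJ cN using pI pJ A k
    by (intro eq_matI) (auto simp: mat_delete_def leading_def)
  thus ?thesis by (simp only: minor_def)
qed

subsection \<open>Eigenvectors from the adjugate\<close>

lemma adj_entry: "M \<in> carrier_mat N N \<Longrightarrow> i < N \<Longrightarrow> j < N \<Longrightarrow> adj_mat M $$ (i, j) = cofactor M j i"
  by (simp add: adj_mat_def)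

text \<open>Where M - x_j is singular, its product with the adjugate is 0 in both orders, so columns
  of the adjugate are right eigenvectors and rows are left ones. Left and right vectors for
  different eigenvalues are orthogonal; the normalising constant D is the remaining point. The
  corner entry being nonzero keeps D away from 0.\<close>

lemma adjugate_spectral:
  fixes M :: "complex mat" and x :: "nat \<Rightarrow> complex" and N :: nat
  defines "K \<equiv> \<lambda>y. M - y \<cdot>\<^sub>m 1\<^sub>m N"
  defines "P \<equiv> \<lambda>i j. adj_mat (K (x j)) $$ (i, N - 1)"
  defines "y \<equiv> \<lambda>j k. adj_mat (K (x j)) $$ (N - 1, k)"
  defines "D \<equiv> \<lambda>j. (\<Prod>l\<in>{..<N}-{j}. x l - x j) * adj_mat (K (x j)) $$ (N - 1, N - 1)"
  assumes M: "M \<in> carrier_mat N N" and N: "N \<ge> 1"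
    and det: "\<And>y. det (K y) = (\<Prod>i<N. x i - y)"
    and dist: "\<And>i j. i < N \<Longrightarrow> j < N \<Longrightarrow> i \<noteq> j \<Longrightarrow> x i \<noteq> x j"
    and nz: "\<And>j. j < N \<Longrightarrow> adj_mat (K (x j)) $$ (N - 1, N - 1) \<noteq> 0"
  shows "\<And>i j. i < N \<Longrightarrow> j < N \<Longrightarrow> (\<Sum>k<N. M $$ (i, k) * P k j) = x j * P i j"
    and "\<And>i j. i < N \<Longrightarrow> j < N \<Longrightarrow> (\<Sum>k<N. y j k * M $$ (k, i)) = x j * y j i"
    and "\<And>i j. i < N \<Longrightarrow> j < N \<Longrightarrow> (\<Sum>k<N. y i k / D i * P k j) = (if i = j then 1 else 0)"
    and "\<And>i j. i < N \<Longrightarrow> j < N \<Longrightarrow> (\<Sum>k<N. P i k * (y k j / D k)) = (if i = j then 1 else 0)"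
proof -
  have Kc: "K y \<in> carrier_mat N N" for y using M by (auto simp: K_def)
  have ac: "adj_mat (K y) \<in> carrier_mat N N" for y by (rule adj_mat(1)[OF Kc])
  have det0: "det (K (x j)) = 0" if "j < N" for j
    unfolding det using that by (intro prod_zero) auto
  have Ke: "K y $$ (i, k) = M $$ (i, k) - (if i = k then y else 0)" if "i < N" "k < N" for y i k
    using that M by (simp add: K_def)
  show S1: "(\<Sum>k<N. M $$ (i, k) * P k j) = x j * P i j" if "i < N" "j < N" for i j
  proof -
    have "(K (x j) * adj_mat (K (x j))) $$ (i, N - 1) = 0"
      unfolding adj_mat(2)[OF Kc] det0[OF that(2)] using that by auto
    hence "(\<Sum>k<N. K (x j) $$ (i, k) * P k j) = 0"
      using mat_mult_entry[OF Kc ac, of i "N - 1"] that N by (simp add: P_def)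
    also have "(\<Sum>k<N. K (x j) $$ (i, k) * P k j) = (\<Sum>k<N. M $$ (i, k) * P k j - (if i = k then x j * P k j else 0))"
      by (intro sum.cong) (use that in \<open>auto simp: Ke left_diff_distrib\<close>)
    also have "\<dots> = (\<Sum>k<N. M $$ (i, k) * P k j) - x j * P i j"
      unfolding sum_subtractf using that by simp
    finally show ?thesis by simp
  qed
  show S2: "(\<Sum>k<N. y j k * M $$ (k, i)) = x j * y j i" if "i < N" "j < N" for i j
  proof -
    have "(adj_mat (K (x j)) * K (x j)) $$ (N - 1, i) = 0"
      unfolding adj_mat(3)[OF Kc] det0[OF that(2)] using that by auto
    hence "(\<Sum>k<N. y j k * K (x j) $$ (k, i)) = 0"
      using mat_mult_entry[OF ac Kc, of "N - 1" i] that N by (simp add: y_def)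
    also have "(\<Sum>k<N. y j k * K (x j) $$ (k, i)) = (\<Sum>k<N. y j k * M $$ (k, i) - (if k = i then x j * y j k else 0))"
      by (intro sum.cong) (use that in \<open>auto simp: Ke right_diff_distrib\<close>)
    also have "\<dots> = (\<Sum>k<N. y j k * M $$ (k, i)) - x j * y j i"
      unfolding sum_subtractf using that by simp
    finally show ?thesis by simp
  qed
  have off: "(\<Sum>k<N. y i k * P k j) = 0" if "i < N" "j < N" "i \<noteq> j" for i j
  proof -
    have "x i * (\<Sum>k<N. y i k * P k j) = (\<Sum>k<N. (\<Sum>r<N. y i r * M $$ (r, k)) * P k j)"
      unfolding sum_distrib_left using that by (intro sum.cong refl) (simp only: S2 lessThan_iff mult.assoc)
    also have "\<dots> = (\<Sum>r<N. y i r * (\<Sum>k<N. M $$ (r, k) * P k j))"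
      by (rule sum_mult_swap)
    also have "\<dots> = (\<Sum>r<N. y i r * (x j * P r j))"
      using that by (intro sum.cong refl) (simp only: S1 lessThan_iff)
    also have "\<dots> = x j * (\<Sum>k<N. y i k * P k j)"
      unfolding sum_distrib_left by (simp only: mult.left_commute)
    finally show ?thesis using dist[OF that] by simp
  qed
  have ker: "(\<Sum>k<N. y j k * adj_mat (K w) $$ (k, N - 1)) = (\<Prod>l\<in>{..<N}-{j}. x l - w) * y j (N - 1)"
    if j: "j < N" and w: "w \<noteq> x j" for j w
  proof -
    have "(\<Sum>r<N. (\<Sum>k<N. y j k * K w $$ (k, r)) * adj_mat (K w) $$ (r, N - 1)) =
        (\<Sum>k<N. y j k * (\<Sum>r<N. K w $$ (k, r) * adj_mat (K w) $$ (r, N - 1)))"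
      by (rule sum_mult_swap)
    also have "\<dots> = (\<Sum>k<N. y j k * (if k = N - 1 then det (K w) else 0))"
    proof (rule sum.cong)
      fix k assume "k \<in> {..<N}"
      hence "(\<Sum>r<N. K w $$ (k, r) * adj_mat (K w) $$ (r, N - 1)) = (K w * adj_mat (K w)) $$ (k, N - 1)"
        using mat_mult_entry[OF Kc ac, of k "N - 1" w w] N by simp
      also have "\<dots> = (if k = N - 1 then det (K w) else 0)"
        unfolding adj_mat(2)[OF Kc] using N \<open>k \<in> {..<N}\<close> by auto
      finally show "y j k * (\<Sum>r<N. K w $$ (k, r) * adj_mat (K w) $$ (r, N - 1)) = y j k * (if k = N - 1 then det (K w) else 0)" by simp
    qed simp
    also have "\<dots> = det (K w) * y j (N - 1)" using N by (simp add: if_distrib[of "\<lambda>a. _ * a"] cong: if_cong)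
    also have "(\<Sum>r<N. (\<Sum>k<N. y j k * K w $$ (k, r)) * adj_mat (K w) $$ (r, N - 1)) =
        (x j - w) * (\<Sum>r<N. y j r * adj_mat (K w) $$ (r, N - 1))"
      unfolding sum_distrib_left
    proof (rule sum.cong)
      fix r assume r: "r \<in> {..<N}"
      have "(\<Sum>k<N. y j k * K w $$ (k, r)) = (\<Sum>k<N. y j k * M $$ (k, r) - (if k = r then w * y j k else 0))"
        by (intro sum.cong) (use r in \<open>auto simp: Ke right_diff_distrib\<close>)
      also have "\<dots> = x j * y j r - w * y j r" using r unfolding sum_subtractf S2[OF _ j, of r, OF r[unfolded lessThan_iff]]
        by (simp only: sum.delta[OF finite_lessThan] if_True)
      finally have "(\<Sum>k<N. y j k * K w $$ (k, r)) = x j * y j r - w * y j r" .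
      thus "(\<Sum>k<N. y j k * K w $$ (k, r)) * adj_mat (K w) $$ (r, N - 1) = (x j - w) * (y j r * adj_mat (K w) $$ (r, N - 1))"
        by (simp only: left_diff_distrib mult.assoc)
    qed simp
    also have "det (K w) = (x j - w) * (\<Prod>l\<in>{..<N}-{j}. x l - w)"
      unfolding det using j by (simp add: prod.remove[of _ j])
    finally show ?thesis using w by simp
  qed
  \<comment> \<open>For w \<noteq> x_j, \<open>ker\<close> follows from cancelling x_j - w. At w =
    x_j that factor is 0, so the pairing is computed as a limit, using that cofactors are continuous
    in w.\<close>
  have diag: "(\<Sum>k<N. y j k * P k j) = D j" if j: "j < N" for j
  proof -
    have cont: "((\<lambda>w. adj_mat (K w) $$ (k, N - 1)) \<longlongrightarrow> adj_mat (K (x j)) $$ (k, N - 1)) (at (x j))" if k: "k < N" for k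
    proof -
      let ?f = "\<lambda>w a b. K w $$ (if a < N - 1 then a else Suc a, if b < k then b else Suc b)"
      have eq: "adj_mat (K w) $$ (k, N - 1) = (-1) ^ (N - 1 + k) * det (mat (N - 1) (N - 1) (\<lambda>(a, b). ?f w a b))" for w
        unfolding adj_entry[OF Kc k, of "N - 1"] using N
        by (subst adj_entry[OF Kc k]) (use Kc[of w] in \<open>auto simp: cofactor_def mat_delete_def\<close>)
      have ent: "((\<lambda>w. K w $$ (a, b)) \<longlongrightarrow> K (x j) $$ (a, b)) (at (x j))" if ab: "a < N" "b < N" for a b
        unfolding Ke[OF ab] by (auto intro!: tendsto_intros)
      show ?thesis unfolding eq
        by (intro tendsto_mult tendsto_const tendsto_det ent) auto
    qed
    have "((\<lambda>w. \<Sum>k<N. y j k * adj_mat (K w) $$ (k, N - 1)) \<longlongrightarrow> (\<Sum>k<N. y j k * P k j)) (at (x j))"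
      unfolding P_def by (intro tendsto_sum tendsto_mult tendsto_const cont) auto
    moreover have "eventually (\<lambda>w. (\<Sum>k<N. y j k * adj_mat (K w) $$ (k, N - 1)) = (\<Prod>l\<in>{..<N}-{j}. x l - w) * y j (N - 1)) (at (x j))"
      using ker[OF j] by (auto simp: eventually_at_filter)
    ultimately have "((\<lambda>w. (\<Prod>l\<in>{..<N}-{j}. x l - w) * y j (N - 1)) \<longlongrightarrow> (\<Sum>k<N. y j k * P k j)) (at (x j))"
      using tendsto_cong by fast
    moreover have "((\<lambda>w. (\<Prod>l\<in>{..<N}-{j}. x l - w) * y j (N - 1)) \<longlongrightarrow> (\<Prod>l\<in>{..<N}-{j}. x l - x j) * y j (N - 1)) (at (x j))"
      by (intro tendsto_intros)
    ultimately have "(\<Sum>k<N. y j k * P k j) = (\<Prod>l\<in>{..<N}-{j}. x l - x j) * y j (N - 1)"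
      using tendsto_unique[OF at_neq_bot] by blast
    thus ?thesis by (simp add: D_def y_def)
  qed
  have Dnz: "D j \<noteq> 0" if "j < N" for j
    unfolding D_def using nz[OF that] dist that by auto
  show S3: "(\<Sum>k<N. y i k / D i * P k j) = (if i = j then 1 else 0)" if "i < N" "j < N" for i j
  proof -
    have "(\<Sum>k<N. y i k / D i * P k j) = (\<Sum>k<N. y i k * P k j) / D i"
      by (simp add: sum_divide_distrib)
    thus ?thesis using diag[of j] off[of i j] Dnz[of j] that by auto
  qed
  show "(\<Sum>k<N. P i k * (y k j / D k)) = (if i = j then 1 else 0)" if "i < N" "j < N" for i j
  proof -
    define PM where "PM = mat N N (\<lambda>(i, j). P i j)"
    define WM where "WM = mat N N (\<lambda>(i, j). y i j / D i)"
    have c: "PM \<in> carrier_mat N N" "WM \<in> carrier_mat N N" by (auto simp: PM_def WM_def)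
    have "WM * PM = 1\<^sub>m N"
    proof (rule eq_matI)
      fix a b assume "a < dim_row (1\<^sub>m N)" "b < dim_col (1\<^sub>m N)"
      hence ab: "a < N" "b < N" by auto
      show "(WM * PM) $$ (a, b) = 1\<^sub>m N $$ (a, b)"
        unfolding mat_mult_entry[OF c(2,1) ab] using ab S3[OF ab] by (simp add: PM_def WM_def)
    qed (use c in auto)
    hence "PM * WM = 1\<^sub>m N" by (rule mat_mult_left_right_inverse[OF c(2,1)])
    hence "(PM * WM) $$ (i, j) = (if i = j then 1 else 0)" using that by simp
    thus ?thesis unfolding mat_mult_entry[OF c that] using that by (simp add: PM_def WM_def)
  qed
qed

subsection \<open>Exponential and logarithm of a diagonalised matrix\<close>

definition sandwich :: "nat \<Rightarrow> (nat \<Rightarrow> nat \<Rightarrow> complex) \<Rightarrow> (nat \<Rightarrow> complex) \<Rightarrow> (nat \<Rightarrow> nat \<Rightarrow> complex) \<Rightarrow> complex mat" where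
  "sandwich n V a W = mat n n (\<lambda>(i, j). \<Sum>r<n. V i r * a r * W r j)"

lemma sandwich_carrier [simp]: "sandwich n V a W \<in> carrier_mat n n"
  by (simp add: sandwich_def)

lemma sandwich_dim [simp]: "dim_row (sandwich n V a W) = n" "dim_col (sandwich n V a W) = n"
  by (simp_all add: sandwich_def)

lemma smult_sandwich: "x \<cdot>\<^sub>m sandwich n V a W = sandwich n V (\<lambda>r. x * a r) W"
  by (intro eq_matI) (auto simp: sandwich_def sum_distrib_left mult_ac)

lemma sandwich_cong: "(\<And>r. r < n \<Longrightarrow> a r = b r) \<Longrightarrow> sandwich n V a W = sandwich n V b W"
  by (intro eq_matI) (auto simp: sandwich_def intro!: sum.cong)

locale inverse_pair =
  fixes n :: nat and V W :: "nat \<Rightarrow> nat \<Rightarrow> complex"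
  assumes WV: "\<And>i j. i < n \<Longrightarrow> j < n \<Longrightarrow> (\<Sum>k<n. W i k * V k j) = (if i = j then 1 else 0)"
    and VW: "\<And>i j. i < n \<Longrightarrow> j < n \<Longrightarrow> (\<Sum>k<n. V i k * W k j) = (if i = j then 1 else 0)"
begin

lemma W_collapse: "j < n \<Longrightarrow> (\<Sum>k<n. W j k * (\<Sum>r<n. V k r * f r)) = f j"
proof -
  assume j: "j < n"
  have "(\<Sum>k<n. W j k * (\<Sum>r<n. V k r * f r)) = (\<Sum>r<n. (\<Sum>k<n. W j k * V k r) * f r)"
    unfolding sum_distrib_left sum_distrib_right by (subst sum.swap) (simp add: mult_ac)
  also have "\<dots> = (\<Sum>r<n. (if j = r then 1 else 0) * f r)" by (intro sum.cong) (use WV j in auto)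
  finally show ?thesis using j by (simp add: if_distrib[of "\<lambda>x. x * _"] cong: if_cong)
qed

lemma V_collapse: "i < n \<Longrightarrow> (\<Sum>k<n. V i k * (\<Sum>r<n. W k r * f r)) = f i"
proof -
  assume j: "i < n"
  have "(\<Sum>k<n. V i k * (\<Sum>r<n. W k r * f r)) = (\<Sum>r<n. (\<Sum>k<n. V i k * W k r) * f r)"
    unfolding sum_distrib_left sum_distrib_right by (subst sum.swap) (simp add: mult_ac)
  also have "\<dots> = (\<Sum>r<n. (if i = r then 1 else 0) * f r)" by (intro sum.cong) (use VW j in auto)
  finally show ?thesis using j by (simp add: if_distrib[of "\<lambda>x. x * _"] cong: if_cong)
qed

lemma sandwich_mult: "sandwich n V a W * sandwich n V b W = sandwich n V (\<lambda>r. a r * b r) W"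
proof (rule eq_matI)
  fix i j assume "i < dim_row (sandwich n V (\<lambda>r. a r * b r) W)" "j < dim_col (sandwich n V (\<lambda>r. a r * b r) W)"
  hence ij: "i < n" "j < n" by auto
  have "(sandwich n V a W * sandwich n V b W) $$ (i, j) = (\<Sum>k<n. (\<Sum>r<n. V i r * a r * W r k) * (\<Sum>s<n. V k s * (b s * W s j)))"
    unfolding mat_mult_entry[OF sandwich_carrier sandwich_carrier ij] using ij
    by (intro sum.cong) (auto simp: sandwich_def mult_ac)
  also have "\<dots> = (\<Sum>r<n. V i r * a r * (\<Sum>k<n. W r k * (\<Sum>s<n. V k s * (b s * W s j))))"
    by (rule sum_mult_swap)
  also have "\<dots> = (\<Sum>r<n. V i r * a r * (b r * W r j))" by (intro sum.cong) (use W_collapse in auto)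
  finally show "(sandwich n V a W * sandwich n V b W) $$ (i, j) = sandwich n V (\<lambda>r. a r * b r) W $$ (i, j)"
    using ij by (simp add: sandwich_def mult_ac)
qed auto

lemma sandwich_one: "sandwich n V (\<lambda>_. 1) W = 1\<^sub>m n"
  by (intro eq_matI) (auto simp: sandwich_def VW)

lemma sandwich_power: "sandwich n V a W ^\<^sub>m k = sandwich n V (\<lambda>r. a r ^ k) W"
  by (induction k) (simp_all add: sandwich_one sandwich_mult mult.commute)

lemma mat_exp_sandwich: "mat_exp (sandwich n V a W) = sandwich n V (\<lambda>r. exp (a r)) W"
proof (rule eq_matI)
  fix i j assume "i < dim_row (sandwich n V (\<lambda>r. exp (a r)) W)" "j < dim_col (sandwich n V (\<lambda>r. exp (a r)) W)"
  hence ij: "i < n" "j < n" by auto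
  have e: "(\<lambda>k. a r ^ k / fact k) sums exp (a r)" for r
    using exp_converges[of "a r"] by (simp add: scaleR_conv_of_real divide_inverse mult.commute)
  have "(\<lambda>k. \<Sum>r<n. V i r * (a r ^ k / fact k) * W r j) sums (\<Sum>r<n. V i r * exp (a r) * W r j)"
    by (intro sums_sum sums_mult sums_mult2 e)
  moreover have "(\<Sum>r<n. V i r * (a r ^ k / fact k) * W r j) = (sandwich n V a W ^\<^sub>m k) $$ (i, j) / fact k" for k
    unfolding sandwich_power using ij by (simp add: sandwich_def sum_divide_distrib)
  ultimately show "mat_exp (sandwich n V a W) $$ (i, j) = sandwich n V (\<lambda>r. exp (a r)) W $$ (i, j)"
    unfolding mat_exp_def using ij by (simp add: sums_iff sandwich_def)
qed (auto simp: mat_exp_def)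

lemma sandwich_eigenvalue:
  assumes "eigenvalue (sandwich n V a W) x"
  obtains r where "r < n" "x = a r"
proof -
  from assms obtain v where v: "v \<in> carrier_vec n" "v \<noteq> 0\<^sub>v n" "sandwich n V a W *\<^sub>v v = x \<cdot>\<^sub>v v"
    unfolding eigenvalue_def eigenvector_def by auto
  define f where "f = (\<lambda>r. \<Sum>k<n. W r k * v $ k)"
  have fv: "v $ i = (\<Sum>r<n. V i r * f r)" if "i < n" for i
    unfolding f_def by (rule V_collapse[symmetric, OF that])
  have eq: "(\<Sum>r<n. V i r * (a r * f r)) = (\<Sum>r<n. V i r * (x * f r))" if i: "i < n" for i
  proof -
    have "(sandwich n V a W *\<^sub>v v) $ i = (\<Sum>k<n. (\<Sum>r<n. V i r * a r * W r k) * v $ k)"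
      using i v(1) by (simp add: scalar_prod_def sandwich_def atLeast0LessThan)
    also have "\<dots> = (\<Sum>r<n. V i r * (a r * f r))"
      unfolding f_def sum_distrib_left sum_distrib_right by (subst sum.swap) (simp add: mult_ac)
    finally have "(\<Sum>r<n. V i r * (a r * f r)) = x * v $ i" unfolding v(3) using i v(1) by simp
    also have "\<dots> = (\<Sum>r<n. V i r * (x * f r))" unfolding fv[OF i] by (simp add: sum_distrib_left mult_ac)
    finally show ?thesis .
  qed
  have af: "a r * f r = x * f r" if r: "r < n" for r
  proof -
    have "(\<Sum>k<n. W r k * (\<Sum>s<n. V k s * (a s * f s))) = (\<Sum>k<n. W r k * (\<Sum>s<n. V k s * (x * f s)))"
      by (intro sum.cong) (use eq in auto)
    thus ?thesis unfolding W_collapse[OF r] .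
  qed
  have "\<exists>r<n. f r \<noteq> 0"
  proof (rule ccontr)
    assume "\<not> ?thesis"
    hence "v $ i = 0" if "i < n" for i using fv[OF that] by simp
    hence "v = 0\<^sub>v n" using v(1) by (intro eq_vecI) auto
    thus False using v by simp
  qed
  then obtain r where "r < n" "f r \<noteq> 0" by blast
  thus ?thesis using af[of r] that by auto
qed

lemma eigenvalue_sandwich: "r < n \<Longrightarrow> eigenvalue (sandwich n V a W) (a r)"
  unfolding eigenvalue_def eigenvector_def
proof (intro exI conjI)
  assume r: "r < n"
  let ?v = "vec n (\<lambda>i. V i r)"
  show "?v \<in> carrier_vec (dim_row (sandwich n V a W))" by simp
  show "?v \<noteq> 0\<^sub>v (dim_row (sandwich n V a W))"
  proof
    assume "?v = 0\<^sub>v (dim_row (sandwich n V a W))"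
    hence v: "V i r = 0" if "i < n" for i using that by (metis index_vec index_zero_vec(1) sandwich_dim(1))
    have "(\<Sum>k<n. W r k * V k r) = 0" using v by simp
    thus False using WV[OF r r] by simp
  qed
  show "sandwich n V a W *\<^sub>v ?v = a r \<cdot>\<^sub>v ?v"
  proof (rule eq_vecI)
    fix i assume "i < dim_vec (a r \<cdot>\<^sub>v ?v)"
    hence i: "i < n" by simp
    have "(sandwich n V a W *\<^sub>v ?v) $ i = (\<Sum>k<n. (\<Sum>s<n. V i s * a s * W s k) * V k r)"
      using i by (simp add: scalar_prod_def sandwich_def atLeast0LessThan)
    also have "\<dots> = (\<Sum>s<n. V i s * a s * (\<Sum>k<n. W s k * V k r))"
      unfolding sum_distrib_left sum_distrib_right by (subst sum.swap) (simp add: mult_ac)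
    also have "\<dots> = (\<Sum>s<n. V i s * a s * (if s = r then 1 else 0))" by (intro sum.cong) (use WV r in auto)
    finally show "(sandwich n V a W *\<^sub>v ?v) $ i = (a r \<cdot>\<^sub>v ?v) $ i"
      using i r by (simp add: if_distrib[of "\<lambda>x. _ * x"] mult.commute cong: if_cong)
  qed simp
qed

text \<open>The sum of the absolute values of all entries is submultiplicative. This gives
  convergence of the exponential series for an arbitrary L, as needed for a logarithm not yet known
  to be diagonal.\<close>

lemma mat_power_entry_bound:
  fixes L :: "complex mat"
  assumes L: "L \<in> carrier_mat n n" and ij: "i < n" "j < n"
  shows "norm ((L ^\<^sub>m k) $$ (i, j)) \<le> (\<Sum>r<n. \<Sum>s<n. norm (L $$ (r, s))) ^ k"
  using ij
proof (induction k arbitrary: i j)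
  case (Suc k)
  let ?s = "\<Sum>r<n. \<Sum>s<n. norm (L $$ (r, s))"
  have stokes_entry: "?s \<ge> 0" by (intro sum_nonneg) auto
  have "norm ((L ^\<^sub>m Suc k) $$ (i, j)) = norm (\<Sum>r<n. (L ^\<^sub>m k) $$ (i, r) * L $$ (r, j))"
    using mat_mult_entry[OF pow_carrier_mat[OF L, of k] L Suc.prems] by simp
  also have "\<dots> \<le> (\<Sum>r<n. ?s ^ k * norm (L $$ (r, j)))"
    by (intro norm_sum[THEN order_trans] sum_mono) (auto simp: norm_mult intro!: mult_right_mono Suc)
  also have "\<dots> = ?s ^ k * (\<Sum>r<n. norm (L $$ (r, j)))" by (simp add: sum_distrib_left)
  also have "\<dots> \<le> ?s ^ k * ?s"
    by (intro mult_left_mono sum_mono member_le_sum[of j _ "\<lambda>s. norm (L $$ (_, s))"]) (use Suc.prems stokes_entry in auto)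
  finally show ?case by (simp add: mult.commute)
qed (use L in auto)

lemma mat_exp_commute:
  fixes L :: "complex mat"
  assumes L: "L \<in> carrier_mat n n"
  shows "L * mat_exp L = mat_exp L * L"
proof -
  have E: "mat_exp L \<in> carrier_mat n n" using L by (simp add: mat_exp_def)
  have s: "(\<lambda>k. (L ^\<^sub>m k) $$ (i, j) / fact k) sums (mat_exp L $$ (i, j))" if ij: "i < n" "j < n" for i j
  proof -
    let ?s = "\<Sum>r<n. \<Sum>s<n. norm (L $$ (r, s))"
    have s1: "summable (\<lambda>k. ?s ^ k / fact k)"
      using summable_exp[of ?s] by (simp only: divide_inverse mult.commute)
    have "norm ((L ^\<^sub>m k) $$ (i, j) / fact k) \<le> ?s ^ k / fact k" for k
      unfolding norm_divide norm_fact by (intro divide_right_mono mat_power_entry_bound[OF L ij]) simp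
    hence "summable (\<lambda>k. (L ^\<^sub>m k) $$ (i, j) / fact k)"
      by (rule summable_comparison_test'[OF s1])
    moreover have "mat_exp L $$ (i, j) = (\<Sum>k. (L ^\<^sub>m k) $$ (i, j) / fact k)" using L ij by (simp add: mat_exp_def)
    ultimately show ?thesis by (simp only: summable_sums)
  qed
  have com: "L * L ^\<^sub>m k = L ^\<^sub>m k * L" for k
  proof (induction k)
    case (Suc k)
    have "L * L ^\<^sub>m Suc k = (L * L ^\<^sub>m k) * L"
      using assoc_mult_mat[OF L pow_carrier_mat[OF L, of k] L] by simp
    thus ?case unfolding Suc by simp
  qed (use L in simp)
  show ?thesis
  proof (rule eq_matI)
    fix i j assume "i < dim_row (mat_exp L * L)" "j < dim_col (mat_exp L * L)"
    hence ij: "i < n" "j < n" using L E by auto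
    have 1: "(\<lambda>k. \<Sum>r<n. L $$ (i, r) * ((L ^\<^sub>m k) $$ (r, j) / fact k)) sums (\<Sum>r<n. L $$ (i, r) * mat_exp L $$ (r, j))"
      by (intro sums_sum sums_mult s) (use ij in auto)
    have 2: "(\<lambda>k. \<Sum>r<n. (L ^\<^sub>m k) $$ (i, r) / fact k * L $$ (r, j)) sums (\<Sum>r<n. mat_exp L $$ (i, r) * L $$ (r, j))"
      by (intro sums_sum sums_mult2 s) (use ij in auto)
    have "(\<Sum>r<n. L $$ (i, r) * ((L ^\<^sub>m k) $$ (r, j) / fact k)) = (\<Sum>r<n. (L ^\<^sub>m k) $$ (i, r) / fact k * L $$ (r, j))" for k
    proof -
      have "(\<Sum>r<n. L $$ (i, r) * ((L ^\<^sub>m k) $$ (r, j) / fact k)) = (L * L ^\<^sub>m k) $$ (i, j) / fact k"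
        unfolding mat_mult_entry[OF L pow_carrier_mat[OF L] ij] by (simp add: sum_divide_distrib)
      also have "\<dots> = (\<Sum>r<n. (L ^\<^sub>m k) $$ (i, r) / fact k * L $$ (r, j))"
        unfolding com mat_mult_entry[OF pow_carrier_mat[OF L] L ij] by (simp add: sum_divide_distrib)
      finally show ?thesis .
    qed
    hence "(\<Sum>r<n. L $$ (i, r) * mat_exp L $$ (r, j)) = (\<Sum>r<n. mat_exp L $$ (i, r) * L $$ (r, j))"
      using 1 2 by (simp only: sums_unique2)
    thus "(L * mat_exp L) $$ (i, j) = (mat_exp L * L) $$ (i, j)"
      unfolding mat_mult_entry[OF L E ij] mat_mult_entry[OF E L ij] .
  qed (use L E in auto)
qed

text \<open>Any L with this exponential commutes with it. The exponential has distinct eigenvalues,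
  so L is diagonal in the same basis, and the strip for the imaginary parts of its eigenvalues
  leaves only the principal logarithms.\<close>

lemma mat_Ln_sandwich:
  assumes dist: "\<And>i j. i < n \<Longrightarrow> j < n \<Longrightarrow> i \<noteq> j \<Longrightarrow> c i \<noteq> c j" and nz: "\<And>i. i < n \<Longrightarrow> c i \<noteq> 0"
  shows "mat_Ln (sandwich n V c W) = sandwich n V (\<lambda>r. Ln (c r)) W"
  unfolding mat_Ln_def sandwich_dim
proof (rule the_equality)
  let ?S = "sandwich n V (\<lambda>r. Ln (c r)) W"
  have "mat_exp (sandwich n V (\<lambda>r. Ln (c r)) W) = sandwich n V (\<lambda>r. exp (Ln (c r))) W"
    by (rule mat_exp_sandwich)
  also have "\<dots> = sandwich n V c W" by (rule sandwich_cong) (simp add: nz)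
  finally have e: "mat_exp ?S = sandwich n V c W" .
  have "- pi < Im x \<and> Im x \<le> pi" if "eigenvalue ?S x" for x
  proof -
    from that obtain r where r: "r < n" "x = Ln (c r)" by (rule sandwich_eigenvalue)
    thus ?thesis using nz[of r] mpi_less_Im_Ln Im_Ln_le_pi by auto
  qed
  thus "?S \<in> carrier_mat n n \<and> mat_exp ?S = sandwich n V c W \<and> (\<forall>x. eigenvalue ?S x \<longrightarrow> - pi < Im x \<and> Im x \<le> pi)"
    using e sandwich_carrier by blast
next
  fix L assume "L \<in> carrier_mat n n \<and> mat_exp L = sandwich n V c W \<and> (\<forall>x. eigenvalue L x \<longrightarrow> - pi < Im x \<and> Im x \<le> pi)"
  hence L: "L \<in> carrier_mat n n" and eL: "mat_exp L = sandwich n V c W"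
    and ev: "\<And>x. eigenvalue L x \<Longrightarrow> - pi < Im x \<and> Im x \<le> pi" by auto
  \<comment> \<open>The matrix W L V, that is, L in the eigenbasis. Commutation makes it
    diagonal.\<close>
  define T where "T = (\<lambda>a b. \<Sum>i<n. W a i * (\<Sum>j<n. L $$ (i, j) * V j b))"
  have VT: "(\<Sum>j<n. L $$ (i, j) * V j b) = (\<Sum>a<n. V i a * T a b)" if "i < n" for i b
    unfolding T_def by (rule V_collapse[symmetric, OF that])
  have com: "(\<Sum>k<n. L $$ (i, k) * sandwich n V c W $$ (k, j)) = (\<Sum>k<n. sandwich n V c W $$ (i, k) * L $$ (k, j))"
    if ij: "i < n" "j < n" for i j
    using mat_exp_commute[OF L] mat_mult_entry[OF L sandwich_carrier ij] mat_mult_entry[OF sandwich_carrier L ij]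
    unfolding eL by metis
  have MV: "(\<Sum>j<n. sandwich n V c W $$ (k, j) * V j b) = V k b * c b" if kb: "k < n" "b < n" for k b
  proof -
    have "(\<Sum>j<n. sandwich n V c W $$ (k, j) * V j b) = (\<Sum>j<n. (\<Sum>r<n. V k r * c r * W r j) * V j b)"
      using kb by (intro sum.cong) (auto simp: sandwich_def)
    also have "\<dots> = (\<Sum>r<n. V k r * c r * (\<Sum>j<n. W r j * V j b))"
      unfolding sum_distrib_left sum_distrib_right by (subst sum.swap) (simp add: mult_ac)
    also have "\<dots> = (\<Sum>r<n. V k r * c r * (if r = b then 1 else 0))" by (intro sum.cong) (use WV kb in auto)
    finally show ?thesis using kb by (simp add: if_distrib[of "\<lambda>x. _ * x"] cong: if_cong)
  qed
  have WM: "(\<Sum>i<n. W a i * sandwich n V c W $$ (i, k)) = c a * W a k" if ak: "a < n" "k < n" for a k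
  proof -
    have "(\<Sum>i<n. W a i * sandwich n V c W $$ (i, k)) = (\<Sum>i<n. W a i * (\<Sum>r<n. V i r * (c r * W r k)))"
      using ak by (intro sum.cong) (auto simp: sandwich_def mult_ac)
    thus ?thesis unfolding W_collapse[OF ak(1)] .
  qed
  have T: "c a * T a b = T a b * c b" if ab: "a < n" "b < n" for a b
  proof -
    have "T a b * c b = (\<Sum>i<n. W a i * (\<Sum>k<n. L $$ (i, k) * (V k b * c b)))"
      unfolding T_def sum_distrib_right by (simp add: mult_ac sum_distrib_left sum_distrib_right)
    also have "\<dots> = (\<Sum>i<n. W a i * (\<Sum>k<n. L $$ (i, k) * (\<Sum>j<n. sandwich n V c W $$ (k, j) * V j b)))"
      by (rule sum.cong[OF refl], rule arg_cong2[of _ _ _ _ times, OF refl], rule sum.cong[OF refl]) (simp only: MV[OF _ ab(2)] lessThan_iff)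
    also have "\<dots> = (\<Sum>i<n. W a i * (\<Sum>j<n. (\<Sum>k<n. L $$ (i, k) * sandwich n V c W $$ (k, j)) * V j b))"
    proof (rule sum.cong[OF refl], rule arg_cong2[of _ _ _ _ times, OF refl])
      fix i
      show "(\<Sum>k<n. L $$ (i, k) * (\<Sum>j<n. sandwich n V c W $$ (k, j) * V j b)) =
            (\<Sum>j<n. (\<Sum>k<n. L $$ (i, k) * sandwich n V c W $$ (k, j)) * V j b)"
        by (rule sum_mult_swap[symmetric])
    qed
    also have "\<dots> = (\<Sum>i<n. W a i * (\<Sum>j<n. (\<Sum>k<n. sandwich n V c W $$ (i, k) * L $$ (k, j)) * V j b))"
      by (rule sum.cong[OF refl], rule arg_cong2[of _ _ _ _ times, OF refl], rule sum.cong[OF refl]) (simp only: com lessThan_iff)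
    also have "\<dots> = (\<Sum>i<n. W a i * (\<Sum>k<n. sandwich n V c W $$ (i, k) * (\<Sum>j<n. L $$ (k, j) * V j b)))"
    proof (rule sum.cong[OF refl], rule arg_cong2[of _ _ _ _ times, OF refl])
      fix i
      show "(\<Sum>j<n. (\<Sum>k<n. sandwich n V c W $$ (i, k) * L $$ (k, j)) * V j b) =
            (\<Sum>k<n. sandwich n V c W $$ (i, k) * (\<Sum>j<n. L $$ (k, j) * V j b))"
        by (rule sum_mult_swap)
    qed
    also have "\<dots> = (\<Sum>k<n. (\<Sum>i<n. W a i * sandwich n V c W $$ (i, k)) * (\<Sum>j<n. L $$ (k, j) * V j b))"
      by (rule sum_mult_swap[symmetric])
    also have "\<dots> = (\<Sum>k<n. c a * W a k * (\<Sum>j<n. L $$ (k, j) * V j b))"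
      by (rule sum.cong[OF refl]) (simp only: WM[OF ab(1)] lessThan_iff)
    also have "\<dots> = c a * T a b" by (simp add: T_def sum_distrib_left mult_ac)
    finally show ?thesis by (rule sym)
  qed
  have T0: "T a b = 0" if "a < n" "b < n" "a \<noteq> b" for a b using T[OF that(1,2)] dist[OF that] by auto
  have LS: "L = sandwich n V (\<lambda>r. T r r) W"
  proof (rule eq_matI)
    fix i j assume "i < dim_row (sandwich n V (\<lambda>r. T r r) W)" "j < dim_col (sandwich n V (\<lambda>r. T r r) W)"
    hence ij: "i < n" "j < n" by auto
    have "L $$ (i, j) = (\<Sum>k<n. L $$ (i, k) * (\<Sum>b<n. V k b * W b j))"
    proof -
      have "(\<Sum>k<n. L $$ (i, k) * (\<Sum>b<n. V k b * W b j)) = (\<Sum>k<n. L $$ (i, k) * (if k = j then 1 else 0))"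
        by (rule sum.cong[OF refl]) (simp only: VW ij lessThan_iff)
      thus ?thesis using ij by (simp add: if_distrib[of "\<lambda>x. _ * x"] cong: if_cong)
    qed
    also have "\<dots> = (\<Sum>b<n. (\<Sum>k<n. L $$ (i, k) * V k b) * W b j)"
      by (rule sum_mult_swap[symmetric])
    also have "\<dots> = (\<Sum>b<n. (\<Sum>a<n. V i a * T a b) * W b j)" by (simp only: VT[OF ij(1)])
    also have "\<dots> = (\<Sum>b<n. V i b * T b b * W b j)"
    proof (intro sum.cong refl arg_cong2[of _ _ _ _ times])
      fix b assume b: "b \<in> {..<n}"
      have "(\<Sum>a<n. V i a * T a b) = (\<Sum>a<n. if a = b then V i b * T b b else 0)"
        by (intro sum.cong) (use T0 b in auto)
      thus "(\<Sum>a<n. V i a * T a b) = V i b * T b b" using b by simp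
    qed
    finally show "L $$ (i, j) = sandwich n V (\<lambda>r. T r r) W $$ (i, j)" using ij by (simp add: sandwich_def)
  qed (use L in auto)
  have eT: "exp (T r r) = c r" if r: "r < n" for r
  proof -
    have E: "sandwich n V (\<lambda>r. exp (T r r)) W = sandwich n V c W"
      using eL unfolding LS mat_exp_sandwich .
    have K: "(\<Sum>i<n. W r i * (\<Sum>j<n. sandwich n V a W $$ (i, j) * V j r)) = a r" for a
    proof -
      have "(\<Sum>j<n. sandwich n V a W $$ (i, j) * V j r) = (\<Sum>s<n. V i s * (a s * (if s = r then 1 else 0)))" if i: "i < n" for i
      proof -
        have "(\<Sum>j<n. sandwich n V a W $$ (i, j) * V j r) = (\<Sum>j<n. (\<Sum>s<n. V i s * a s * W s j) * V j r)"
          using i by (intro sum.cong) (auto simp: sandwich_def)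
        also have "\<dots> = (\<Sum>s<n. V i s * (a s * (\<Sum>j<n. W s j * V j r)))"
          unfolding sum_distrib_left sum_distrib_right by (subst sum.swap) (simp add: mult_ac)
        finally show ?thesis using WV r by simp
      qed
      hence "(\<Sum>i<n. W r i * (\<Sum>j<n. sandwich n V a W $$ (i, j) * V j r)) =
          (\<Sum>i<n. W r i * (\<Sum>s<n. V i s * (a s * (if s = r then 1 else 0))))" by simp
      thus ?thesis unfolding W_collapse[OF r] by simp
    qed
    show ?thesis using K[of "\<lambda>r. exp (T r r)"] unfolding E K by (rule sym)
  qed
  have "T r r = Ln (c r)" if r: "r < n" for r
  proof -
    have "eigenvalue L (T r r)" using eigenvalue_sandwich[OF r, of "\<lambda>r. T r r"] unfolding LS[symmetric] .
    hence "Ln (exp (T r r)) = T r r" using ev by (intro Ln_exp) auto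
    thus ?thesis using eT[OF r] by simp
  qed
  thus "L = sandwich n V (\<lambda>r. Ln (c r)) W" by (subst LS) (rule sandwich_cong)
qed

end

lemma sum_logq_eigenvalues_eq:
  assumes "char_poly (leading k A) = (\<Prod>i=1..k. [:- lam i, 1:])"
  shows "sum_logq_eigenvalues q k A = (\<Sum>i=1..k. logq q (1 - (1 - of_real q) * lam i))"
proof -
  have "proots (\<Prod>i=1..k. [:- lam i, 1:]) = (\<Sum>i=1..k. proots [:- lam i, 1:])"
    by (rule proots_prod) auto
  also have "\<dots> = (\<Sum>i=1..k. {#lam i#})" by simp
  finally have "proots (char_poly (leading k A)) = (\<Sum>i=1..k. {#lam i#})" unfolding assms .
  moreover have "(\<Sum>x\<in>#(\<Sum>i\<in>I. {#lam i#}). f x) = (\<Sum>i\<in>I. f (lam i))" if "finite I" for I :: "nat set" and f :: "complex \<Rightarrow> complex"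
    using that by (induction I rule: finite_induct) auto
  ultimately show ?thesis unfolding sum_logq_eigenvalues_def by simp
qed

context inverse_pair
begin

lemma W_sandwich:
  assumes "a < n" "k < n"
  shows "(\<Sum>i<n. W a i * sandwich n V c W $$ (i, k)) = c a * W a k"
proof -
  have "(\<Sum>i<n. W a i * sandwich n V c W $$ (i, k)) = (\<Sum>i<n. W a i * (\<Sum>r<n. V i r * (c r * W r k)))"
    using assms by (intro sum.cong) (auto simp: sandwich_def mult_ac)
  thus ?thesis unfolding W_collapse[OF assms(1)] .
qed

end

subsection \<open>The formal fundamental solution\<close>

text \<open>
  \<open>P\<close> diagonalises the leading block of \<open>B = 1 - (1 - q) A\<close>, and conjugation with \<open>diag (P, 1)\<close>
  turns \<open>B\<close> into the arrow matrix. Here \<open>\<nu> r\<close> is \<open>\<nu>\<close> with the index shifted by one.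
\<close>

locale stokes_system = arrow q N c \<beta> \<gamma> b t + block: inverse_pair N P W
  for q N c \<beta> \<gamma> b t P W +
  fixes n :: nat and A :: "complex mat" and \<nu> :: "nat \<Rightarrow> complex"
    and B :: "nat \<Rightarrow> nat \<Rightarrow> complex" and Ve We :: "nat \<Rightarrow> nat \<Rightarrow> complex"
  assumes n: "n = Suc N" and N1: "N \<ge> 1" and A: "A \<in> carrier_mat n n"
    and B: "\<And>i k. B i k = (if i = k then 1 else 0) - (1 - Q) * A $$ (i, k)"
    and Ve: "\<And>i r. Ve i r = (if i < N \<and> r < N then P i r else if i = r then 1 else 0)"
    and We: "\<And>i r. We i r = (if i < N \<and> r < N then W i r else if i = r then 1 else 0)"
    and BP: "\<And>i j. i < N \<Longrightarrow> j < N \<Longrightarrow> (\<Sum>k<N. B i k * P k j) = c j * P i j"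
    and \<beta>: "\<And>i. i < N \<Longrightarrow> \<beta> i = (\<Sum>k<N. W i k * B k N)"
    and \<gamma>: "\<And>j. j < N \<Longrightarrow> \<gamma> j = (\<Sum>k<N. B N k * P k j)"
    and b: "b = B N N"
    and t_nonres: "\<And>r s. r \<le> N \<Longrightarrow> s \<le> N \<Longrightarrow> r \<noteq> s \<Longrightarrow> t r \<notin> qspiral q (t s)"
    and \<nu>: "\<And>r. r < N \<Longrightarrow> exp (of_real (ln q) * \<nu> r) = c r" "exp (of_real (ln q) * \<nu> N) = d"
    and nu_last: "nu_last q A = \<nu> N"
    and delta: "delta q A = sandwich n Ve \<nu> We"
begin

lemma sum_n: "(\<Sum>r<n. f r) = (\<Sum>r<N. f r) + f N" for f :: "nat \<Rightarrow> 'b :: comm_monoid_add"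
  by (simp add: n)

lemma less_n: "r < n \<longleftrightarrow> r < N \<or> r = N"
  by (auto simp: n)

sublocale ext: inverse_pair n Ve We
proof
  show "(\<Sum>k<n. We i k * Ve k j) = (if i = j then 1 else 0)" if "i < n" "j < n" for i j
    using that block.WV[of i j] unfolding sum_n less_n by (auto simp: Ve We)
  show "(\<Sum>k<n. Ve i k * We k j) = (if i = j then 1 else 0)" if "i < n" "j < n" for i j
    using that block.VW[of i j] unfolding sum_n less_n by (auto simp: Ve We)
qed

lemma Ve_sum: "r \<le> N \<Longrightarrow> (\<Sum>s<n. Ve r s * y s) = (if r < N then (\<Sum>s<N. P r s * y s) else y N)"
  unfolding sum_n by (auto simp: Ve)

lemma We_sum: "k \<le> N \<Longrightarrow> (\<Sum>r<n. We r k * y r) = (if k < N then (\<Sum>r<N. W r k * y r) else y N)"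
  unfolding sum_n by (auto simp: We)

lemma B_Ve:
  assumes i: "i \<le> N"
  shows "(\<Sum>r<n. B i r * (\<Sum>s<n. Ve r s * y s)) = (\<Sum>s<n. Ve i s * Bt y s)"
proof -
  have L: "(\<Sum>r<n. B i r * (\<Sum>s<n. Ve r s * y s)) = (\<Sum>s<N. (\<Sum>r<N. B i r * P r s) * y s) + B i N * y N"
    unfolding sum_n[of "\<lambda>r. B i r * _ r"] by (simp add: Ve_sum sum_mult_swap)
  show ?thesis
  proof (cases "i < N")
    case True
    have "(\<Sum>s<N. (\<Sum>r<N. B i r * P r s) * y s) = (\<Sum>s<N. P i s * (c s * y s))"
      by (intro sum.cong) (simp_all add: BP True)
    moreover have "B i N = (\<Sum>s<N. P i s * \<beta> s)"
      using block.V_collapse[OF True, of "\<lambda>k. B k N"] by (simp add: \<beta>)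
    ultimately have "(\<Sum>r<n. B i r * (\<Sum>s<n. Ve r s * y s)) = (\<Sum>s<N. P i s * (c s * y s)) + (\<Sum>s<N. P i s * \<beta> s) * y N"
      unfolding L by simp
    also have "\<dots> = (\<Sum>s<N. P i s * (c s * y s + \<beta> s * y N))"
      unfolding distrib_left sum.distrib sum_distrib_right mult.assoc ..
    also have "\<dots> = (\<Sum>s<n. Ve i s * Bt y s)"
      using True by (simp add: Ve_sum Bt_def)
    finally show ?thesis .
  next
    case False
    hence "i = N" using i by simp
    thus ?thesis unfolding L by (simp add: Ve_sum Bt_def \<gamma> flip: b)
  qed
qed

text \<open>\<open>formal_eq h\<close>: comparison of the coefficients of \<open>z\<^sup>-\<^sup>m\<close> in the equation for the series
  with coefficient matrices \<open>h m\<close>, multiplied by \<open>(q - 1) z\<close>.\<close>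

definition formal_eq :: "(nat \<Rightarrow> nat \<Rightarrow> nat \<Rightarrow> complex) \<Rightarrow> bool" where
  "formal_eq h \<longleftrightarrow> (\<forall>m i k. i < n \<longrightarrow> k < n \<longrightarrow>
     (\<Sum>r<n. h m i r * mat_cpow (of_real (ln q)) (delta q A) $$ (r, k)) / Q ^ m
        - (if k = N then (1 - Q) * (h (Suc m) i N / Q ^ Suc m) else 0) =
     (\<Sum>r<n. B i r * h m r k) - (if i = N then (1 - Q) * h (Suc m) N k else 0))"

definition ev :: "nat \<Rightarrow> complex" where "ev r = (if r < N then c r else d)"

lemma q_delta: "mat_cpow (of_real (ln q)) (delta q A) = sandwich n Ve ev We"
  unfolding mat_cpow_def delta smult_sandwich ext.mat_exp_sandwich
  by (rule sandwich_cong) (auto simp: less_n ev_def \<nu>)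

lemma We_q_delta: "a < n \<Longrightarrow> k < n \<Longrightarrow> (\<Sum>r<n. We a r * mat_cpow (of_real (ln q)) (delta q A) $$ (r, k)) = ev a * We a k"
  unfolding q_delta by (rule ext.W_sandwich)

lemma q_delta_entry:
  assumes "r < n" "k < n"
  shows "mat_cpow (of_real (ln q)) (delta q A) $$ (r, k) =
    (if r < N \<and> k < N then (\<Sum>j<N. P r j * c j * W j k) else if r = k then d else 0)"
  using assms unfolding q_delta sandwich_def by (auto simp: sum_n less_n Ve We ev_def)

text \<open>The first index is the column of the solution in the eigenbasis, the second its
  component.\<close>

definition E :: "nat \<Rightarrow> nat \<Rightarrow> complex fps" where
  "E r s = (if r < N then xf r s else hf s)"

lemma E_0: "r < n \<Longrightarrow> s < n \<Longrightarrow> fps_nth (E r s) 0 = (if r = s then 1 else 0)"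
  using xf_0[of r s] by (auto simp: E_def less_n hf_0)

lemma E_eq:
  assumes r: "r < n" and s: "s < n"
  shows "ev r * fps_nth (E r s) m / Q ^ m - (if r = N then (1 - Q) * (fps_nth (E r s) (Suc m) / Q ^ Suc m) else 0) =
     Bt (\<lambda>s. fps_nth (E r s) m) s - (if s = N then (1 - Q) * fps_nth (E r N) (Suc m) else 0)"
proof (cases "r < N")
  case True
  thus ?thesis using xf_coef[OF True, of s m] xf_coef_N[OF True, of m] s
    by (auto simp: E_def ev_def less_n)
next
  case False
  have s': "s \<le> N" using s by (auto simp: n)
  define y1 y0 Y where "y1 = fps_nth (hf s) (Suc m) / Q ^ Suc m" and "y0 = fps_nth (hf s) m / Q ^ m"
    and "Y = (if s = N then fps_nth (hf s) (Suc m) else 0)"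
  have "y1 - d / (1 - Q) * y0 = Y - 1 / (1 - Q) * Bt (\<lambda>i. fps_nth (hf i) m) s"
    using hf_coef[OF s', of m] by (simp only: y1_def y0_def Y_def aa_def)
  moreover have "x * y0' - w * y1' = B' - w * Y'" if "y1' - x / w * y0' = Y' - 1 / w * B'" "w \<noteq> 0" for x w y0' y1' B' Y' :: complex
  proof -
    have "w * (y1' - x / w * y0') = w * (Y' - 1 / w * B')" using that(1) by simp
    thus ?thesis using that(2) by (simp add: right_diff_distrib) (metis minus_diff_eq)
  qed
  ultimately have "d * y0 - (1 - Q) * y1 = Bt (\<lambda>i. fps_nth (hf i) m) s - (1 - Q) * Y" using oneQ by blast
  moreover have "(if s = N then (1 - Q) * fps_nth (hf N) (Suc m) else 0) = (1 - Q) * Y" by (auto simp: Y_def)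
  ultimately show ?thesis using False r by (simp add: E_def ev_def less_n y0_def y1_def Y_def)
qed

text \<open>V times the transpose of \<open>E\<close> times W: the same pair diagonalises \<delta>,
  so this conjugation returns to the form that \<open>formal_H\<close> requires.\<close>

definition H_entry :: "nat \<Rightarrow> nat \<Rightarrow> complex fps" where
  "H_entry i k = (\<Sum>r<n. fps_const (We r k) * (\<Sum>s<n. fps_const (Ve i s) * E r s))"

lemma H_entry_nth: "fps_nth (H_entry i k) m = (\<Sum>r<n. We r k * (\<Sum>s<n. Ve i s * fps_nth (E r s) m))"
  by (simp add: H_entry_def fps_sum_nth)

lemma H_entry_0: "i < n \<Longrightarrow> k < n \<Longrightarrow> fps_nth (H_entry i k) 0 = (if i = k then 1 else 0)"
proof -
  assume ik: "i < n" "k < n"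
  have "fps_nth (H_entry i k) 0 = (\<Sum>r<n. We r k * (\<Sum>s<n. if s = r then Ve i s else 0))"
    unfolding H_entry_nth by (intro sum.cong arg_cong2[of _ _ _ _ times] refl) (auto simp: E_0)
  also have "\<dots> = (\<Sum>r<n. Ve i r * We r k)" by (intro sum.cong) (auto simp: mult.commute)
  finally show ?thesis using ext.VW[OF ik] by simp
qed

lemma formal_eq_H_entry: "formal_eq (\<lambda>m i k. fps_nth (H_entry i k) m)"
  unfolding formal_eq_def
proof (intro allI impI)
  fix m i k assume i: "i < n" and k: "k < n"
  let ?D = "mat_cpow (of_real (ln q)) (delta q A)"
  define f where "f = (\<lambda>m r. \<Sum>s<n. Ve i s * fps_nth (E r s) m)"
  have 1: "(\<Sum>r<n. fps_nth (H_entry i r) m * ?D $$ (r, k)) = (\<Sum>r<n. We r k * (ev r * f m r))"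
  proof -
    have "(\<Sum>r<n. fps_nth (H_entry i r) m * ?D $$ (r, k)) = (\<Sum>r<n. (\<Sum>a<n. f m a * We a r) * ?D $$ (r, k))"
      by (simp add: H_entry_nth f_def mult.commute)
    also have "\<dots> = (\<Sum>a<n. f m a * (\<Sum>r<n. We a r * ?D $$ (r, k)))" by (rule sum_mult_swap)
    also have "\<dots> = (\<Sum>a<n. f m a * (ev a * We a k))"
      using k by (intro sum.cong) (auto simp: We_q_delta)
    finally show ?thesis by (simp add: mult_ac)
  qed
  have 2: "(if k = N then (1 - Q) * (fps_nth (H_entry i N) (Suc m) / Q ^ Suc m) else 0) =
      (\<Sum>r<n. We r k * (if r = N then (1 - Q) * (f (Suc m) r / Q ^ Suc m) else 0))"
  proof -
    have "fps_nth (H_entry i N) (Suc m) = f (Suc m) N"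
      by (simp add: H_entry_nth f_def We_sum)
    thus ?thesis using k unfolding sum_n less_n by (auto simp: We)
  qed
  have 3: "(\<Sum>r<n. B i r * fps_nth (H_entry r k) m) = (\<Sum>a<n. We a k * (\<Sum>s<n. Ve i s * Bt (\<lambda>s. fps_nth (E a s) m) s))"
  proof -
    have "(\<Sum>r<n. B i r * fps_nth (H_entry r k) m) = (\<Sum>r<n. B i r * (\<Sum>a<n. (\<Sum>s<n. Ve r s * fps_nth (E a s) m) * We a k))"
      by (simp add: H_entry_nth mult.commute)
    also have "\<dots> = (\<Sum>a<n. (\<Sum>r<n. B i r * (\<Sum>s<n. Ve r s * fps_nth (E a s) m)) * We a k)"
      by (rule sum_mult_swap[symmetric])
    also have "\<dots> = (\<Sum>a<n. We a k * (\<Sum>s<n. Ve i s * Bt (\<lambda>s. fps_nth (E a s) m) s))"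
      using i by (intro sum.cong) (auto simp: B_Ve less_n mult.commute)
    finally show ?thesis .
  qed
  have 4: "(if i = N then (1 - Q) * fps_nth (H_entry N k) (Suc m) else 0) =
      (\<Sum>a<n. We a k * (\<Sum>s<n. Ve i s * (if s = N then (1 - Q) * fps_nth (E a N) (Suc m) else 0)))"
  proof -
    have "(\<Sum>s<n. Ve i s * (if s = N then (1 - Q) * fps_nth (E a N) (Suc m) else 0)) =
        (if i = N then (1 - Q) * fps_nth (E a N) (Suc m) else 0)" for a
      using i unfolding sum_n less_n by (auto simp: Ve)
    moreover have "fps_nth (H_entry N k) (Suc m) = (\<Sum>a<n. We a k * fps_nth (E a N) (Suc m))"
      unfolding H_entry_nth by (simp add: Ve_sum)
    ultimately show ?thesis by (auto simp: sum_distrib_left mult_ac)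
  qed
  have "f m r * ev r / Q ^ m - (if r = N then (1 - Q) * (f (Suc m) r / Q ^ Suc m) else 0) =
      (\<Sum>s<n. Ve i s * Bt (\<lambda>s. fps_nth (E r s) m) s) -
      (\<Sum>s<n. Ve i s * (if s = N then (1 - Q) * fps_nth (E r N) (Suc m) else 0))" if r: "r < n" for r
  proof -
    have "(\<Sum>s<n. Ve i s * Bt (\<lambda>s. fps_nth (E r s) m) s) -
      (\<Sum>s<n. Ve i s * (if s = N then (1 - Q) * fps_nth (E r N) (Suc m) else 0)) =
      (\<Sum>s<n. Ve i s * (ev r * fps_nth (E r s) m / Q ^ m - (if r = N then (1 - Q) * (fps_nth (E r s) (Suc m) / Q ^ Suc m) else 0)))"
      unfolding sum_subtractf[symmetric] right_diff_distrib[symmetric]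
      by (rule sum.cong[OF refl]) (simp only: E_eq[OF r] lessThan_iff)
    also have "\<dots> = (\<Sum>s<n. Ve i s * fps_nth (E r s) m * (ev r / Q ^ m) -
        Ve i s * fps_nth (E r s) (Suc m) * (if r = N then (1 - Q) / Q ^ Suc m else 0))"
    proof -
      have "v * (a * e / p - (if r = N then w * (e' / p') else 0)) = v * e * (a / p) - v * e' * (if r = N then w / p' else 0)"
        for v a e p w e' p' :: complex by (simp add: right_diff_distrib mult_ac)
      thus ?thesis by (intro sum.cong refl)
    qed
    also have "\<dots> = f m r * (ev r / Q ^ m) - f (Suc m) r * (if r = N then (1 - Q) / Q ^ Suc m else 0)"
      unfolding sum_subtractf sum_distrib_right[symmetric] f_def ..
    finally show ?thesis by auto
  qed
  hence "(\<Sum>r<n. We r k * (f m r * ev r / Q ^ m - (if r = N then (1 - Q) * (f (Suc m) r / Q ^ Suc m) else 0))) =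
     (\<Sum>r<n. We r k * ((\<Sum>s<n. Ve i s * Bt (\<lambda>s. fps_nth (E r s) m) s) -
      (\<Sum>s<n. Ve i s * (if s = N then (1 - Q) * fps_nth (E r N) (Suc m) else 0))))"
    by (intro sum.cong refl arg_cong2[of _ _ _ _ times]) simp
  thus "(\<Sum>r<n. fps_nth (H_entry i r) m * ?D $$ (r, k)) / Q ^ m
        - (if k = N then (1 - Q) * (fps_nth (H_entry i N) (Suc m) / Q ^ Suc m) else 0) =
     (\<Sum>r<n. B i r * fps_nth (H_entry r k) m) - (if i = N then (1 - Q) * fps_nth (H_entry N k) (Suc m) else 0)"
    unfolding 1 2 3 4 right_diff_distrib sum_subtractf by (simp add: sum_divide_distrib mult_ac)
qed

lemma Q_pow_neq_1: "Q ^ Suc m \<noteq> 1"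
proof
  assume "Q ^ Suc m = 1"
  hence "q ^ Suc m = 1" by (metis of_real_eq_1_iff of_real_power)
  thus False using power_Suc_less_one[OF q0 q1, of m] by simp
qed

text \<open>Let u be the difference of two solutions, zero up to order m. The equation of order m
  determines the last row and column of order m + 1: they vanish because the corner would have to be
  fixed by the factor q^(m + 1). The equation of order m + 1 is then a Sylvester equation for the
  leading block, with spectra c_b / q^(m + 1) and c_a, disjoint by nonresonance.\<close>

lemma formal_eq_unique:
  assumes h: "formal_eq h" and h': "formal_eq h'"
    and 0: "\<And>i k. i < n \<Longrightarrow> k < n \<Longrightarrow> h 0 i k = h' 0 i k"
  shows "i < n \<Longrightarrow> k < n \<Longrightarrow> h m i k = h' m i k"
proof (induction m arbitrary: i k)
  case 0 thus ?case using assms(3) by simp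
next
  case (Suc m)
  let ?D = "\<lambda>r k. mat_cpow (of_real (ln q)) (delta q A) $$ (r, k)"
  define u where "u = (\<lambda>m i k. h m i k - h' m i k)"
  have eq: "(\<Sum>r<n. u m i r * ?D r k) / Q ^ m - (if k = N then (1 - Q) * (u (Suc m) i N / Q ^ Suc m) else 0) =
     (\<Sum>r<n. B i r * u m r k) - (if i = N then (1 - Q) * u (Suc m) N k else 0)" if "i < n" "k < n" for m i k
  proof -
    have e: "(\<Sum>r<n. u m i r * ?D r k) = (\<Sum>r<n. h m i r * ?D r k) - (\<Sum>r<n. h' m i r * ?D r k)"
       "(\<Sum>r<n. B i r * u m r k) = (\<Sum>r<n. B i r * h m r k) - (\<Sum>r<n. B i r * h' m r k)"
      by (simp_all add: u_def left_diff_distrib right_diff_distrib sum_subtractf)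
    have f: "(if k = N then (1 - Q) * (u (Suc m) i N / Q ^ Suc m) else 0) =
        (if k = N then (1 - Q) * (h (Suc m) i N / Q ^ Suc m) else 0) - (if k = N then (1 - Q) * (h' (Suc m) i N / Q ^ Suc m) else 0)"
      "(if i = N then (1 - Q) * u (Suc m) N k else 0) =
        (if i = N then (1 - Q) * h (Suc m) N k else 0) - (if i = N then (1 - Q) * h' (Suc m) N k else 0)"
      by (simp_all add: u_def diff_divide_distrib right_diff_distrib)
    have g: "(a - a') / p - (x - x') = (s - s') - (y - y')" if "a / p - x = s - y" "a' / p - x' = s' - y'" for a a' p x x' s s' y y' :: complex
      using that by (simp add: diff_divide_distrib algebra_simps)
    show ?thesis unfolding e f
      by (rule g) (use h h' that in \<open>unfold formal_eq_def, blast+\<close>)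
  qed
  have um: "u m i k = 0" if "i < n" "k < n" for i k using Suc.IH[OF that] by (simp add: u_def)
  have z: "(if k = N then (1 - Q) * (u (Suc m) i N / Q ^ Suc m) else 0) = (if i = N then (1 - Q) * u (Suc m) N k else 0)"
    if "i < n" "k < n" for i k
    using eq[OF that, of m] that by (simp add: um cong: sum.cong_simp)
  have zN: "u (Suc m) i N = 0" if "i < N" for i
    using z[of i N] that oneQ by (simp add: n)
  have zk: "u (Suc m) N k = 0" if "k < N" for k
    using z[of N k] that oneQ by (simp add: n)
  have zNN: "u (Suc m) N N = 0"
  proof -
    have "(1 - Q) * (u (Suc m) N N / Q ^ Suc m) = (1 - Q) * u (Suc m) N N"
      using z[of N N] by (simp add: n)
    hence "u (Suc m) N N = Q ^ Suc m * u (Suc m) N N"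
      using oneQ by (simp add: nonzero_divide_eq_eq mult.commute)
    thus ?thesis using Q_pow_neq_1[of m] by (metis mult_cancel_right1)
  qed
  have blk: "u (Suc m) i k = 0" if ik: "i < N" "k < N" for i k
  proof -
    define T where "T = (\<lambda>a b. \<Sum>i<N. W a i * (\<Sum>r<N. u (Suc m) i r * P r b))"
    have e: "(\<Sum>r<N. u (Suc m) i r * (\<Sum>j<N. P r j * (c j * W j k))) / Q ^ Suc m = (\<Sum>r<N. B i r * u (Suc m) r k)"
      if "i < N" "k < N" for i k
    proof -
      have "(\<Sum>r<N. u (Suc m) i r * ?D r k) = (\<Sum>r<N. u (Suc m) i r * (\<Sum>j<N. P r j * (c j * W j k)))"
        using that by (intro sum.cong) (auto simp: q_delta_entry less_n mult.assoc)
      moreover have "?D N k = 0" using that by (auto simp: q_delta_entry less_n)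
      moreover have "i < n" "k < n" using that by (auto simp: less_n)
      ultimately show ?thesis using eq[of i k "Suc m"] zN[OF that(1)] zk[OF that(2)] that
        unfolding sum_n[of "\<lambda>r. u (Suc m) i r * ?D r k"] sum_n[of "\<lambda>r. B i r * u (Suc m) r k"] by simp
    qed
    have T0: "T a b = 0" if ab: "a < N" "b < N" for a b
    proof -
      have "c b / Q ^ Suc m * (\<Sum>r<N. u (Suc m) i r * P r b) = (\<Sum>r<N. B i r * (\<Sum>k<N. u (Suc m) r k * P k b))"
        if i: "i < N" for i
      proof -
        have "(\<Sum>r<N. B i r * (\<Sum>k<N. u (Suc m) r k * P k b)) = (\<Sum>k<N. (\<Sum>r<N. B i r * u (Suc m) r k) * P k b)"
          by (rule sum_mult_swap[symmetric])
        also have "\<dots> = (\<Sum>k<N. ((\<Sum>r<N. u (Suc m) i r * (\<Sum>j<N. P r j * (c j * W j k))) / Q ^ Suc m) * P k b)"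
          by (rule sum.cong[OF refl]) (simp only: e[OF i] lessThan_iff)
        also have "\<dots> = (\<Sum>k<N. (\<Sum>r<N. u (Suc m) i r * (\<Sum>j<N. P r j * (c j * W j k))) * P k b) / Q ^ Suc m"
        proof -
          have "(\<Sum>k<N. S k / p * v k) = (\<Sum>k<N. S k * v k) / p" for S v and p :: complex
            by (simp add: sum_divide_distrib)
          thus ?thesis .
        qed
        also have "(\<Sum>k<N. (\<Sum>r<N. u (Suc m) i r * (\<Sum>j<N. P r j * (c j * W j k))) * P k b) =
            (\<Sum>r<N. u (Suc m) i r * (\<Sum>k<N. (\<Sum>j<N. P r j * (c j * W j k)) * P k b))" by (rule sum_mult_swap)
        also have "\<dots> = (\<Sum>r<N. u (Suc m) i r * (\<Sum>j<N. P r j * (\<Sum>k<N. c j * W j k * P k b)))"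
          by (simp only: sum_mult_swap)
        also have "\<dots> = (\<Sum>r<N. u (Suc m) i r * (\<Sum>j<N. P r j * (c j * (if j = b then 1 else 0))))"
        proof -
          have "(\<Sum>k<N. c j * W j k * P k b) = c j * (if j = b then 1 else 0)" if "j < N" for j
            using block.WV[OF that ab(2)] by (simp only: mult.assoc sum_distrib_left[symmetric])
          thus ?thesis by (intro sum.cong refl arg_cong2[of _ _ _ _ times]) auto
        qed
        also have "\<dots> = (\<Sum>r<N. u (Suc m) i r * (P r b * c b))"
          using ab by (simp add: if_distrib[of "\<lambda>x. _ * x"] cong: if_cong)
        also have "\<dots> = c b * (\<Sum>r<N. u (Suc m) i r * P r b)" by (simp add: sum_distrib_left mult_ac)
        finally show ?thesis by simp
      qed
      hence "(\<Sum>i<N. W a i * (c b / Q ^ Suc m * (\<Sum>r<N. u (Suc m) i r * P r b))) =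
          (\<Sum>i<N. W a i * (\<Sum>r<N. B i r * (\<Sum>k<N. u (Suc m) r k * P k b)))"
        by (intro sum.cong refl arg_cong2[of _ _ _ _ times]) auto
      also have "(\<Sum>i<N. W a i * (c b / Q ^ Suc m * (\<Sum>r<N. u (Suc m) i r * P r b))) = c b / Q ^ Suc m * T a b"
      proof -
        have "(\<Sum>i<N. W a i * (x * y i)) = x * (\<Sum>i<N. W a i * y i)" for x y
          by (simp add: sum_distrib_left mult.left_commute)
        thus ?thesis unfolding T_def .
      qed
      also have "(\<Sum>i<N. W a i * (\<Sum>r<N. B i r * (\<Sum>k<N. u (Suc m) r k * P k b))) = c a * T a b"
      proof -
        define y where "y = (\<lambda>r. \<Sum>k<N. u (Suc m) r k * P k b)"
        have BY: "(\<Sum>r<N. B i r * y r) = (\<Sum>s<N. P i s * (c s * (\<Sum>r<N. W s r * y r)))" if i: "i < N" for i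
        proof -
          have "(\<Sum>r<N. B i r * y r) = (\<Sum>r<N. B i r * (\<Sum>s<N. P r s * (\<Sum>k<N. W s k * y k)))"
            by (rule sum.cong[OF refl]) (simp only: block.V_collapse lessThan_iff)
          also have "\<dots> = (\<Sum>s<N. (\<Sum>r<N. B i r * P r s) * (\<Sum>k<N. W s k * y k))"
            by (rule sum_mult_swap[symmetric])
          also have "\<dots> = (\<Sum>s<N. c s * P i s * (\<Sum>k<N. W s k * y k))"
            by (rule sum.cong[OF refl]) (simp only: BP[OF i] lessThan_iff)
          finally show ?thesis by (simp only: mult.assoc mult.left_commute[of _ "c _"])
        qed
        have "(\<Sum>i<N. W a i * (\<Sum>r<N. B i r * y r)) = (\<Sum>i<N. W a i * (\<Sum>s<N. P i s * (c s * (\<Sum>r<N. W s r * y r))))"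
          by (rule sum.cong[OF refl]) (simp only: BY lessThan_iff)
        also have "\<dots> = c a * (\<Sum>r<N. W a r * y r)" by (rule block.W_collapse[OF ab(1)])
        finally show ?thesis by (simp only: y_def T_def)
      qed
      finally have "c b / Q ^ Suc m * T a b = c a * T a b" .
      moreover have "c b / Q ^ Suc m \<noteq> c a"
        using c_res[OF ab, of m] c_nz[OF ab(2)] by (auto simp: field_simps)
      ultimately show ?thesis by (metis mult_cancel_right)
    qed
    have V: "(\<Sum>r<N. u (Suc m) i r * P r b) = 0" if "b < N" for b
    proof -
      have "(\<Sum>k<N. P i k * T k b) = (\<Sum>r<N. u (Suc m) i r * P r b)"
        unfolding T_def by (rule block.V_collapse[OF ik(1)])
      thus ?thesis using T0[OF _ that] by simp
    qed
    have "u (Suc m) i k = (\<Sum>r<N. u (Suc m) i r * (\<Sum>b<N. P r b * W b k))"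
      using ik by (simp add: block.VW if_distrib[of "\<lambda>x. _ * x"] cong: if_cong)
    also have "\<dots> = (\<Sum>b<N. (\<Sum>r<N. u (Suc m) i r * P r b) * W b k)" by (rule sum_mult_swap[symmetric])
    finally show ?thesis by (simp add: V)
  qed
  have "u (Suc m) i k = 0" using Suc.prems zN zk zNN blk unfolding less_n by blast
  thus ?case by (simp add: u_def)
qed

lemma formal_qshift_nth:
  "fls_nth (formal_qshift q (fps_to_fls f)) k = (if k < 0 then 0 else fps_nth f (nat k) / Q ^ nat k)"
proof -
  have "fps_const (1 / Q) * fps_X \<noteq> 0" "fps_nth (fps_const (1 / Q) * fps_X) 0 = 0"
    by (auto simp: fps_eq_iff)
  hence "formal_qshift q (fps_to_fls f) = fps_to_fls (Abs_fps (\<lambda>n. (1 / Q) ^ n * fps_nth f n))"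
    unfolding formal_qshift_def by (subst fls_compose_fps_to_fls) (simp_all add: fps_compose_linear)
  thus ?thesis by (simp add: power_divide)
qed

lemma d_powr: "Q powr (- nu_last q A) * d = 1"
proof -
  have "Q powr (- nu_last q A) = exp (- (of_real (ln q) * \<nu> N))"
    using q0 by (simp add: powr_def nu_last Ln_of_real mult.commute)
  thus ?thesis unfolding exp_minus \<nu>(2) using d_nz by simp
qed

lemma formal_J_entry:
  assumes "r < n" "k < n"
  shows "formal_J q A $$ (r, k) = fls_const (mat_cpow (of_real (ln q)) (delta q A) $$ (r, k)) *
     (if k = N then 1 - fls_const ((1 - Q) * Q powr (- nu_last q A)) * fls_X_inv else 1)"
proof -
  let ?M = "map_mat fls_const (mat_cpow (of_real (ln q)) (delta q A))"
  let ?w = "1 - fls_const ((1 - Q) * Q powr (- nu_last q A)) * fls_X_inv :: complex fls"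
  have M: "?M \<in> carrier_mat n n" unfolding q_delta by simp
  have d: "dim_row A = n" using A by simp
  have "formal_J q A $$ (r, k) = (?M * diag_last n ?w) $$ (r, k)" by (simp only: formal_J_def d)
  also have "\<dots> = ?M $$ (r, k) * (if k = n - 1 then ?w else 1)"
    using assms M unfolding diag_last_def
    by (simp add: mat_diag_mult_right[OF M])
  finally show ?thesis using assms M by (simp add: n)
qed

text \<open>Multiplication by K = (q - 1) z removes the denominator of the q-derivative and the
  terms H on both sides cancel. What remains is compared coefficientwise.\<close>

lemma formal_equation_iff:
  fixes H :: "complex fps mat"
  assumes H: "H \<in> carrier_mat n n" and H0: "map_mat (\<lambda>f. fps_nth f 0) H = 1\<^sub>m n"
  defines "H' \<equiv> map_mat fps_to_fls H"
  shows "formal_qderiv q A H' = (E_last n + (1 / fls_X_inv) \<cdot>\<^sub>m map_mat fls_const A) * H' \<longleftrightarrow>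
     formal_eq (\<lambda>m i k. fps_nth (H $$ (i, k)) m)"
proof -
  let ?D = "mat_cpow (of_real (ln q)) (delta q A)"
  let ?L = "formal_qderiv q A H'" and ?R = "(E_last n + (1 / fls_X_inv) \<cdot>\<^sub>m map_mat fls_const A) * H'"
  let ?w = "fls_const ((1 - Q) * Q powr (- nu_last q A))"
  let ?S = "\<lambda>i k. formal_qshift q (fps_to_fls (H $$ (i, k)))"
  let ?h = "\<lambda>i k. fps_to_fls (H $$ (i, k))"
  have dA: "dim_row A = n" using A by simp
  have D: "?D \<in> carrier_mat n n" unfolding q_delta by simp
  have J: "formal_J q A \<in> carrier_mat n n"
    using D unfolding formal_J_def diag_last_def dA by (auto simp: mat_diag_def)
  have H': "H' \<in> carrier_mat n n" using H by (simp add: H'_def)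
  have SH: "map_mat (formal_qshift q) H' \<in> carrier_mat n n" using H' by simp
  have El: "E_last n + (1 / fls_X_inv) \<cdot>\<^sub>m map_mat fls_const A \<in> carrier_mat n n"
    using A by (auto simp: E_last_def mat_diag_def)
  have Lc: "?L \<in> carrier_mat n n" "?R \<in> carrier_mat n n"
    using SH J H' El unfolding formal_qderiv_def by (auto intro!: mult_carrier_mat)
  define K :: "complex fls" where "K = fls_const Q * fls_X_inv - fls_X_inv"
  have K: "K = fls_const (Q - 1) * fls_X_inv"
    by (simp add: K_def left_diff_distrib flip: fls_minus_const)
  have X: "fls_X * fls_X_inv = (1 :: complex fls)" by (simp add: fls_X_inv_times_conv_shift)
  have "fls_nth K (-1) = Q - 1" unfolding K by simp
  hence Knz: "K \<noteq> 0" using oneQ by (metis diff_eq_diff_eq eq_iff_diff_eq_0 fls_zero_nth)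
  define lhs where "lhs = (\<lambda>i k. (\<Sum>r<n. ?S i r * fls_const (?D $$ (r, k))) -
     (if k = N then fls_const (1 - Q) * (fls_X_inv * ?S i N) else 0))"
  define rhs where "rhs = (\<lambda>i k. (\<Sum>r<n. fls_const (B i r) * ?h r k) -
     (if i = N then fls_const (1 - Q) * (fls_X_inv * ?h N k) else 0))"
  have entry: "?L $$ (i, k) = ?R $$ (i, k) \<longleftrightarrow> lhs i k = rhs i k" if i: "i < n" and k: "k < n" for i k
  proof -
    have s1: "(map_mat (formal_qshift q) H' * formal_J q A) $$ (i, k) =
        (\<Sum>r<n. ?S i r * fls_const (?D $$ (r, k))) * (if k = N then 1 - ?w * fls_X_inv else 1)"
    proof -
      have "(map_mat (formal_qshift q) H' * formal_J q A) $$ (i, k) = (\<Sum>r<n. map_mat (formal_qshift q) H' $$ (i, r) * formal_J q A $$ (r, k))"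
        by (rule mat_mult_entry[OF SH J i k])
      also have "\<dots> = (\<Sum>r<n. (?S i r * fls_const (?D $$ (r, k))) * (if k = N then 1 - ?w * fls_X_inv else 1))"
        by (rule sum.cong) (use i k H in \<open>simp_all add: formal_J_entry H'_def mult.assoc\<close>)
      finally show ?thesis by (simp add: sum_distrib_right)
    qed
    also have "\<dots> = lhs i k"
    proof (cases "k = N")
      case True
      have "(\<Sum>r<n. ?S i r * fls_const (?D $$ (r, N))) = ?S i N * fls_const d"
        unfolding sum_n by (simp add: q_delta_entry less_n)
      moreover have "fls_const d * (?w * fls_X_inv) = fls_const (1 - Q) * fls_X_inv"
      proof -
        have "d * ((1 - Q) * Q powr (- nu_last q A)) = (1 - Q) * (Q powr (- nu_last q A) * d)" by (simp only: mult_ac)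
        hence "d * ((1 - Q) * Q powr (- nu_last q A)) = 1 - Q" unfolding d_powr by simp
        hence "fls_const d * ?w = fls_const (1 - Q)" by (simp only: fls_const_mult_const)
        thus ?thesis by (metis mult.assoc)
      qed
      ultimately show ?thesis using True by (simp add: lhs_def right_diff_distrib mult.assoc)
    qed (simp add: lhs_def)
    finally have L: "?L $$ (i, k) = 1 / K * (lhs i k - ?h i k)"
      using i k SH J H' H unfolding formal_qderiv_def K_def[symmetric] by (simp add: H'_def)
    have "?R $$ (i, k) = (\<Sum>r<n. (E_last n + (1 / fls_X_inv) \<cdot>\<^sub>m map_mat fls_const A) $$ (i, r) * H' $$ (r, k))"
      by (rule mat_mult_entry[OF El H' i k])
    also have "\<dots> = (\<Sum>r<n. ((if i = r \<and> r = N then 1 else 0) + fls_X * fls_const (A $$ (i, r))) * ?h r k)"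
    proof (rule sum.cong[OF refl])
      fix r assume r: "r \<in> {..<n}"
      have "1 / fls_X_inv = (fls_X :: complex fls)" by (simp add: divide_inverse fls_inverse_X_inv)
      thus "(E_last n + (1 / fls_X_inv) \<cdot>\<^sub>m map_mat fls_const A) $$ (i, r) * H' $$ (r, k) =
         ((if i = r \<and> r = N then 1 else 0) + fls_X * fls_const (A $$ (i, r))) * ?h r k"
        using i k r A H by (auto simp: E_last_def H'_def mat_diag_def n)
    qed
    also have "\<dots> = (if i = N then ?h N k else 0) + fls_X * (\<Sum>r<n. fls_const (A $$ (i, r)) * ?h r k)"
    proof -
      have "(\<Sum>r<n. (if i = r \<and> r = N then 1 else 0) * ?h r k) = (if i = N then ?h N k else 0)"
        unfolding sum_n by auto
      thus ?thesis unfolding distrib_right sum.distrib sum_distrib_left mult.assoc by simp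
    qed
    finally have R: "?R $$ (i, k) = (if i = N then ?h N k else 0) + fls_X * (\<Sum>r<n. fls_const (A $$ (i, r)) * ?h r k)" .
    have KR: "K * ?R $$ (i, k) = rhs i k - ?h i k"
    proof -
      have "rhs i k = (\<Sum>r<n. ((if i = r then 1 else 0) - fls_const (1 - Q) * fls_const (A $$ (i, r))) * ?h r k) -
         (if i = N then fls_const (1 - Q) * (fls_X_inv * ?h N k) else 0)"
      proof -
        have "fls_const (B i r) = (if i = r then 1 else 0) - fls_const (1 - Q) * fls_const (A $$ (i, r))" for r
          by (rule fls_eqI) (simp add: B)
        thus ?thesis by (simp only: rhs_def)
      qed
      also have "\<dots> = ?h i k - fls_const (1 - Q) * (\<Sum>r<n. fls_const (A $$ (i, r)) * ?h r k)
          - (if i = N then fls_const (1 - Q) * (fls_X_inv * ?h N k) else 0)"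
      proof -
        have "(\<Sum>r<n. (if i = r then 1 else 0) * ?h r k) = ?h i k"
          using i by (simp add: if_distrib[of "\<lambda>x. x * _"] cong: if_cong)
        thus ?thesis unfolding left_diff_distrib sum_subtractf sum_distrib_left mult.assoc by simp
      qed
      finally have 1: "rhs i k = ?h i k - fls_const (1 - Q) * (\<Sum>r<n. fls_const (A $$ (i, r)) * ?h r k)
          - (if i = N then fls_const (1 - Q) * (fls_X_inv * ?h N k) else 0)" .
      have K': "K = - (fls_const (1 - Q) * fls_X_inv)" unfolding K
        by (metis fls_const_uminus minus_diff_eq mult_minus_left)
      have KX: "K * (fls_X * y) = - (fls_const (1 - Q) * y)" for y
      proof -
        have "K * (fls_X * y) = - (fls_const (1 - Q) * ((fls_X * fls_X_inv) * y))"
          unfolding K' by (simp only: mult_ac mult_minus_left mult_minus_right)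
        thus ?thesis unfolding X by simp
      qed
      show ?thesis unfolding 1 R distrib_left KX by (simp add: K' mult.assoc)
    qed
    have "?L $$ (i, k) = ?R $$ (i, k) \<longleftrightarrow> K * ?L $$ (i, k) = K * ?R $$ (i, k)" using Knz by simp
    also have "K * ?L $$ (i, k) = lhs i k - ?h i k" unfolding L using Knz by simp
    finally show ?thesis unfolding KR by simp
  qed
  have h0: "fps_nth (H $$ (i, k)) 0 = (if i = k then 1 else 0)" if "i < n" "k < n" for i k
    using arg_cong[OF H0, of "\<lambda>M. M $$ (i, k)"] that H by auto
  have nonneg: "fls_nth (lhs i k) (int m) = (\<Sum>r<n. fps_nth (H $$ (i, r)) m * ?D $$ (r, k)) / Q ^ m
        - (if k = N then (1 - Q) * (fps_nth (H $$ (i, N)) (Suc m) / Q ^ Suc m) else 0)"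
    "fls_nth (rhs i k) (int m) = (\<Sum>r<n. B i r * fps_nth (H $$ (r, k)) m) -
        (if i = N then (1 - Q) * fps_nth (H $$ (N, k)) (Suc m) else 0)" for i k m
    by (simp_all add: lhs_def rhs_def fls_nth_sum formal_qshift_nth fls_X_inv_times_conv_shift
        nat_add_distrib sum_divide_distrib)
  \<comment> \<open>Among the positive powers of z only the first can occur. Its coefficients agree
    because the constant term of H is the identity.\<close>
  have neg: "fls_nth (lhs i k) a = fls_nth (rhs i k) a" if a: "a < 0" and ik: "i < n" "k < n" for a i k
  proof -
    have "N < n" by (simp add: n)
    thus ?thesis using a ik
      by (cases "a = -1") (auto simp: lhs_def rhs_def fls_nth_sum formal_qshift_nth fls_X_inv_times_conv_shift h0)
  qed
  have "?L = ?R \<longleftrightarrow> (\<forall>i<n. \<forall>k<n. ?L $$ (i, k) = ?R $$ (i, k))"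
  proof -
    have "M = M' \<longleftrightarrow> (\<forall>i<n. \<forall>k<n. M $$ (i, k) = M' $$ (i, k))"
      if "M \<in> carrier_mat n n" "M' \<in> carrier_mat n n" for M M' :: "complex fls mat"
      using that by (auto intro!: eq_matI)
    thus ?thesis using Lc by blast
  qed
  also have "\<dots> \<longleftrightarrow> (\<forall>i<n. \<forall>k<n. \<forall>m. fls_nth (lhs i k) (int m) = fls_nth (rhs i k) (int m))"
  proof -
    have "lhs i k = rhs i k \<longleftrightarrow> (\<forall>m. fls_nth (lhs i k) (int m) = fls_nth (rhs i k) (int m))" if "i < n" "k < n" for i k
    proof
      assume e: "\<forall>m. fls_nth (lhs i k) (int m) = fls_nth (rhs i k) (int m)"
      show "lhs i k = rhs i k"
      proof (rule fls_eqI)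
        fix a show "fls_nth (lhs i k) a = fls_nth (rhs i k) a"
          using e[rule_format, of "nat a"] neg[OF _ that] by (cases "a < 0") auto
      qed
    qed simp
    thus ?thesis using entry by auto
  qed
  also have "\<dots> \<longleftrightarrow> formal_eq (\<lambda>m i k. fps_nth (H $$ (i, k)) m)"
    unfolding nonneg formal_eq_def by blast
  finally show ?thesis .
qed

theorem formal_H_eq: "formal_H q A = mat n n (\<lambda>(i, k). H_entry i k)"
proof -
  let ?H = "mat n n (\<lambda>(i, k). H_entry i k)"
  have d: "dim_row A = n" using A by simp
  have H0: "map_mat (\<lambda>f. fps_nth f 0) ?H = 1\<^sub>m n" by (intro eq_matI) (auto simp: H_entry_0)
  have ex: "formal_eq (\<lambda>m i k. fps_nth (?H $$ (i, k)) m)"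
  proof -
    have "formal_eq h = formal_eq h'" if "\<And>m i k. i < n \<Longrightarrow> k < n \<Longrightarrow> h m i k = h' m i k" for h h'
    proof -
      have "N < n" by (simp add: n)
      thus ?thesis unfolding formal_eq_def using that by (simp cong: sum.cong_simp)
    qed
    from this[of "\<lambda>m i k. fps_nth (?H $$ (i, k)) m" "\<lambda>m i k. fps_nth (H_entry i k) m"] formal_eq_H_entry show ?thesis by simp
  qed
  show ?thesis unfolding formal_H_def Let_def d
  proof (rule the_equality)
    show "?H \<in> carrier_mat n n \<and> map_mat (\<lambda>f. fps_nth f 0) ?H = 1\<^sub>m n \<and>
      formal_qderiv q A (map_mat fps_to_fls ?H) = (E_last n + (1 / fls_X_inv) \<cdot>\<^sub>m map_mat fls_const A) * map_mat fps_to_fls ?H"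
      using H0 ex formal_equation_iff[OF _ H0] by simp
  next
    fix H assume "H \<in> carrier_mat n n \<and> map_mat (\<lambda>f. fps_nth f 0) H = 1\<^sub>m n \<and>
      formal_qderiv q A (map_mat fps_to_fls H) = (E_last n + (1 / fls_X_inv) \<cdot>\<^sub>m map_mat fls_const A) * map_mat fps_to_fls H"
    hence H: "H \<in> carrier_mat n n" and HI: "map_mat (\<lambda>f. fps_nth f 0) H = 1\<^sub>m n"
      and e: "formal_eq (\<lambda>m i k. fps_nth (H $$ (i, k)) m)"
      using formal_equation_iff by auto
    have h0: "fps_nth (H $$ (i, k)) 0 = (if i = k then 1 else 0)" if "i < n" "k < n" for i k
      using arg_cong[OF HI, of "\<lambda>M. M $$ (i, k)"] that H by auto
    have "fps_nth (H $$ (i, k)) m = fps_nth (?H $$ (i, k)) m" if "i < n" "k < n" for i k m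
      by (rule formal_eq_unique[OF e ex _ that]) (simp add: h0 H_entry_0)
    thus "H = ?H" using H by (intro eq_matI) (auto intro!: fps_ext)
  qed
qed

end

section \<open>Linearity of the sums and cancellation of invertible matrices\<close>

context q_base
begin

lemma bsum_cmult:
  assumes "borel_cont l f g" "l \<noteq> 0" "z \<noteq> 0"
  shows "bsum (\<lambda>x. a * g x) l z = a * bsum g l z"
proof -
  have "((\<lambda>m::int. a * (g (l * Q powi m) / qtheta q (l * Q powi m * z))) has_sum a * bsum g l z) UNIV"
    by (rule has_sum_cmult_right[OF bsum_has_sum[OF assms]])
  moreover have "((\<lambda>m::int. (a * g (l * Q powi m)) / qtheta q (l * Q powi m * z)) has_sum bsum (\<lambda>x. a * g x) l z) UNIV"
    using bsum_has_sum[OF borel_cont_cmult[OF assms(1)] assms(2,3)] .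
  ultimately show ?thesis using has_sum_unique by fastforce
qed

lemma bsum_sum:
  assumes "finite I" "\<And>i. i \<in> I \<Longrightarrow> borel_cont l (f i) (g i)" "l \<noteq> 0" "z \<noteq> 0"
  shows "bsum (\<lambda>x. \<Sum>i\<in>I. g i x) l z = (\<Sum>i\<in>I. bsum (g i) l z)"
  using assms(1,2)
proof (induction I rule: finite_induct)
  case empty thus ?case by (simp add: bsum_def)
next
  case (insert i I)
  have "((\<lambda>m::int. g i (l * Q powi m) / qtheta q (l * Q powi m * z) + (\<Sum>i\<in>I. g i (l * Q powi m)) / qtheta q (l * Q powi m * z))
      has_sum bsum (g i) l z + bsum (\<lambda>x. \<Sum>i\<in>I. g i x) l z) UNIV"
    by (intro has_sum_add bsum_has_sum[of l "f i"] bsum_has_sum[of l "\<Sum>i\<in>I. f i" "\<lambda>x. \<Sum>i\<in>I. g i x"] borel_cont_sum insert assms) auto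
  moreover have "((\<lambda>m::int. (\<Sum>i\<in>insert i I. g i (l * Q powi m)) / qtheta q (l * Q powi m * z)) has_sum bsum (\<lambda>x. \<Sum>i\<in>insert i I. g i x) l z) UNIV"
    by (rule bsum_has_sum[OF borel_cont_sum assms(3,4)]) (use insert in auto)
  hence "((\<lambda>m::int. g i (l * Q powi m) / qtheta q (l * Q powi m * z) + (\<Sum>i\<in>I. g i (l * Q powi m)) / qtheta q (l * Q powi m * z))
      has_sum bsum (\<lambda>x. \<Sum>i\<in>insert i I. g i x) l z) UNIV"
    using insert(1,2) by (simp add: add_divide_distrib)
  ultimately have "bsum (\<lambda>x. \<Sum>i\<in>insert i I. g i x) l z = bsum (g i) l z + bsum (\<lambda>x. \<Sum>i\<in>I. g i x) l z"
    using has_sum_unique by blast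
  thus ?case using insert by simp
qed

end

lemma mat_left_cancel:
  fixes F S T :: "complex mat"
  assumes F: "F \<in> carrier_mat n n" and S: "S \<in> carrier_mat n n" and T: "T \<in> carrier_mat n n"
    and det: "det F \<noteq> 0" and eq: "F * S = F * T"
  shows "S = T"
proof -
  have ad: "adj_mat F \<in> carrier_mat n n" by (rule adj_mat(1)[OF F])
  have "det F \<cdot>\<^sub>m X = adj_mat F * (F * X)" if X: "X \<in> carrier_mat n n" for X
  proof -
    have "adj_mat F * (F * X) = (det F \<cdot>\<^sub>m 1\<^sub>m n) * X"
      unfolding assoc_mult_mat[OF ad F X, symmetric] adj_mat(3)[OF F] ..
    also have "\<dots> = det F \<cdot>\<^sub>m X" using X by (simp add: mult_smult_assoc_mat[of _ n n])
    finally show ?thesis by (rule sym)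
  qed
  hence e: "det F \<cdot>\<^sub>m S = det F \<cdot>\<^sub>m T" using S T eq by metis
  show ?thesis
  proof (rule eq_matI)
    fix i j assume "i < dim_row T" "j < dim_col T"
    thus "S $$ (i, j) = T $$ (i, j)" using arg_cong[OF e, of "\<lambda>M. M $$ (i, j)"] S T det by auto
  qed (use S T in auto)
qed

context stokes_system
begin

subsection \<open>The resummed solutions\<close>

text \<open>The resummed counterpart of \<open>E\<close>, with the same order of indices.\<close>

definition X :: "complex \<Rightarrow> complex \<Rightarrow> nat \<Rightarrow> nat \<Rightarrow> complex" where
  "X l z r s = (if r < N then bsum (gx r s) l z else R s (1 / z) / qpoch q (Q * aa / z))"

definition resum_H :: "complex \<Rightarrow> complex \<Rightarrow> nat \<Rightarrow> nat \<Rightarrow> complex" where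
  "resum_H l z i k = (\<Sum>r<n. We r k * (\<Sum>s<n. Ve i s * X l z r s))"

lemma qpoch_generic:
  assumes "z \<noteq> 0" "z \<notin> qspiral q aa"
  shows "qpoch q (z / aa) \<noteq> 0" "qpoch q (Q * aa / z) \<noteq> 0"
proof -
  have zaa: "z / aa \<noteq> 0" using assms aa_nz by simp
  have "Q / (z / aa) = Q * aa / z" by simp
  hence "qtheta q (- z / aa) = qpoch q Q * qpoch q (z / aa) * qpoch q (Q * aa / z)"
    using qtheta_neg[OF zaa] by simp
  moreover have "qtheta q (- z / aa) \<noteq> 0" using qtheta_eq_0_iff[OF aa_nz assms(1)] assms by simp
  ultimately show "qpoch q (z / aa) \<noteq> 0" "qpoch q (Q * aa / z) \<noteq> 0" by auto
qed

text \<open>Since W is extended block diagonally, an entry of H combines either only divergent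
  columns, k < N, or only the convergent one, k = N. The two ways of computing \<open>qsum\<close>
  never meet within one entry.\<close>

lemma qsum_H_entry:
  assumes i: "i < n" and k: "k < n" and l: "l \<noteq> 0" "\<forall>r<N. l \<notin> qspiral q (xi r)"
    and z: "z \<noteq> 0" "z \<notin> qspiral q (- 1 / l)" "z \<notin> qspiral q aa"
  shows "qsum q l (H_entry i k) z = resum_H l z i k"
proof (cases "k < N")
  case True
  have H: "H_entry i k = (\<Sum>r<N. fps_const (W r k) * (\<Sum>s<n. fps_const (Ve i s) * xf r s))"
    unfolding H_entry_def sum_n[of "\<lambda>r. fps_const (We r k) * _ r"] using True by (simp add: We E_def)
  have b1: "borel_cont l (xf r s) (gx r s)" if "r < N" "s < n" for r s
    using that l by (intro gx_borel_cont) (auto simp: n)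
  have b2: "borel_cont l (fps_const (Ve i s) * xf r s) (\<lambda>x. Ve i s * gx r s x)" if "r < N" "s < n" for r s
    by (intro borel_cont_cmult b1 that)
  have b3: "borel_cont l (\<Sum>s<n. fps_const (Ve i s) * xf r s) (\<lambda>x. \<Sum>s<n. Ve i s * gx r s x)" if "r < N" for r
    by (intro borel_cont_sum b2 that) auto
  have b4: "borel_cont l (fps_const (W r k) * (\<Sum>s<n. fps_const (Ve i s) * xf r s)) (\<lambda>x. W r k * (\<Sum>s<n. Ve i s * gx r s x))" if "r < N" for r
    by (intro borel_cont_cmult b3 that)
  have "borel_cont l (H_entry i k) (\<lambda>x. \<Sum>r<N. W r k * (\<Sum>s<n. Ve i s * gx r s x))"
    unfolding H by (intro borel_cont_sum b4) auto
  hence "qsum q l (H_entry i k) z = bsum (\<lambda>x. \<Sum>r<N. W r k * (\<Sum>s<n. Ve i s * gx r s x)) l z"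
    by (rule qsum_borel_cont[OF _ l(1) z(1,2)])
  also have "\<dots> = (\<Sum>r<N. bsum (\<lambda>x. W r k * (\<Sum>s<n. Ve i s * gx r s x)) l z)"
    by (rule bsum_sum[OF _ _ l(1) z(1)]) (use b4 in auto)
  also have "\<dots> = (\<Sum>r<N. W r k * bsum (\<lambda>x. \<Sum>s<n. Ve i s * gx r s x) l z)"
    by (rule sum.cong[OF refl]) (use b3 bsum_cmult[OF _ l(1) z(1)] in auto)
  also have "\<dots> = (\<Sum>r<N. W r k * (\<Sum>s<n. bsum (\<lambda>x. Ve i s * gx r s x) l z))"
  proof (rule sum.cong[OF refl], rule arg_cong2[of _ _ _ _ times, OF refl])
    fix r assume "r \<in> {..<N}"
    thus "bsum (\<lambda>x. \<Sum>s<n. Ve i s * gx r s x) l z = (\<Sum>s<n. bsum (\<lambda>x. Ve i s * gx r s x) l z)"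
      by (intro bsum_sum[OF _ _ l(1) z(1)]) (use b2 in auto)
  qed
  also have "\<dots> = (\<Sum>r<N. W r k * (\<Sum>s<n. Ve i s * bsum (gx r s) l z))"
  proof (rule sum.cong[OF refl], rule arg_cong2[of _ _ _ _ times, OF refl], rule sum.cong[OF refl])
    fix r s assume "r \<in> {..<N}" "s \<in> {..<n}"
    thus "bsum (\<lambda>x. Ve i s * gx r s x) l z = Ve i s * bsum (gx r s) l z"
      by (intro bsum_cmult[OF _ l(1) z(1)]) (use b1 in auto)
  qed
  also have "\<dots> = resum_H l z i k"
    unfolding resum_H_def sum_n[of "\<lambda>r. We r k * _ r"] using True by (simp add: We X_def)
  finally show ?thesis .
next
  case False
  hence kN: "k = N" using k by (simp add: n)
  have le: "{..<n} = {..N}" by (auto simp: n)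
  have "H_entry i k = (\<Sum>s\<le>N. fps_const (Ve i s) * hf s)"
    unfolding H_entry_def kN le[symmetric] sum_n[of "\<lambda>r. fps_const (We r N) * _ r"] by (simp add: We E_def)
  hence "qsum q l (H_entry i k) z = (\<Sum>s\<le>N. Ve i s * R s (1 / z)) / qpoch q (Q * aa / z)"
    using qsum_hf[OF l(1) z(1) qpoch_generic(2)[OF z(1,3)]] by simp
  also have "\<dots> = resum_H l z i k"
    unfolding resum_H_def kN le[symmetric] sum_n[of "\<lambda>r. We r N * _ r"] by (simp add: We X_def sum_divide_distrib)
  finally show ?thesis .
qed

definition p :: "complex \<Rightarrow> complex \<Rightarrow> nat \<Rightarrow> complex" where
  "p L z r = exp (L * \<nu> r) * (if r = N then 1 / qpoch q (z / aa) else 1)"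

lemma qexp_eq: "qexp q (Q powr (- nu_last q A) * z) = 1 / qpoch q (z / aa)"
proof -
  have "Q powr (- nu_last q A) = 1 / d" using d_powr d_nz by (simp add: nonzero_eq_divide_eq)
  hence "(1 - Q) * (Q powr (- nu_last q A) * z) = z / aa" using d_nz oneQ by (simp add: aa_def)
  thus ?thesis by (simp only: qexp_def)
qed

lemma fund_sol_eq:
  assumes l: "l \<noteq> 0" "\<forall>r<N. l \<notin> qspiral q (xi r)"
    and z: "z \<noteq> 0" "z \<notin> qspiral q (- 1 / l)" "z \<notin> qspiral q aa"
  shows "fund_sol q Log A l z = mat n n (\<lambda>(i, k). resum_H l z i k) * sandwich n Ve (\<lambda>r. exp (Log z * \<nu> r)) We *
     mat_diag n (\<lambda>i. if i = n - 1 then 1 / qpoch q (z / aa) else 1)"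
proof -
  have d: "dim_row A = n" using A by simp
  have "map_mat (\<lambda>f. qsum q l f z) (formal_H q A) = mat n n (\<lambda>(i, k). resum_H l z i k)"
    unfolding formal_H_eq by (rule eq_matI) (auto simp: qsum_H_entry[OF _ _ l z])
  thus ?thesis unfolding fund_sol_def d qexp_eq diag_last_def mat_cpow_def delta smult_sandwich ext.mat_exp_sandwich
    by simp
qed

lemma fund_sol_carrier:
  "fund_sol q Log A l z \<in> carrier_mat n n"
proof -
  have d: "dim_row A = n" using A by simp
  show ?thesis unfolding fund_sol_def diag_last_def d mat_cpow_def delta smult_sandwich ext.mat_exp_sandwich formal_H_eq
    by (intro mult_carrier_mat[of _ n n _ n]) simp_all
qed

lemma fund_sol_entry:
  assumes l: "l \<noteq> 0" "\<forall>r<N. l \<notin> qspiral q (xi r)"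
    and z: "z \<noteq> 0" "z \<notin> qspiral q (- 1 / l)" "z \<notin> qspiral q aa" and i: "i < n" and k: "k < n"
  shows "fund_sol q Log A l z $$ (i, k) = (\<Sum>r<n. (\<Sum>s<n. Ve i s * X l z r s) * (p (Log z) z r * We r k))"
proof -
  let ?H = "mat n n (\<lambda>(i, k). resum_H l z i k)" and ?S = "sandwich n Ve (\<lambda>r. exp (Log z * \<nu> r)) We"
  let ?e = "if k = n - 1 then 1 / qpoch q (z / aa) else 1"
  have H: "?H \<in> carrier_mat n n" by simp
  have HS: "?H * ?S \<in> carrier_mat n n" by (rule mult_carrier_mat[OF H sandwich_carrier])
  have "(M * mat_diag n f) $$ (i, k) = M $$ (i, k) * f k" if "M \<in> carrier_mat n n" for M :: "complex mat" and f
    using i k by (simp add: mat_diag_mult_right[OF that])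
  from this[OF HS] have "fund_sol q Log A l z $$ (i, k) = (?H * ?S) $$ (i, k) * ?e"
    unfolding fund_sol_eq[OF l z] .
  also have "(?H * ?S) $$ (i, k) = (\<Sum>k'<n. resum_H l z i k' * ?S $$ (k', k))"
    unfolding mat_mult_entry[OF H sandwich_carrier i k] using i by (intro sum.cong) auto
  also have "\<dots> = (\<Sum>k'<n. (\<Sum>r<n. (\<Sum>s<n. Ve i s * X l z r s) * We r k') * ?S $$ (k', k))"
    unfolding resum_H_def by (simp only: mult.commute)
  also have "\<dots> = (\<Sum>r<n. (\<Sum>s<n. Ve i s * X l z r s) * (\<Sum>k'<n. We r k' * ?S $$ (k', k)))"
    by (rule sum_mult_swap)
  also have "\<dots> = (\<Sum>r<n. (\<Sum>s<n. Ve i s * X l z r s) * (exp (Log z * \<nu> r) * We r k))"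
    by (rule sum.cong[OF refl]) (simp only: ext.W_sandwich[OF _ k] lessThan_iff)
  also have "\<dots> * ?e = (\<Sum>r<n. (\<Sum>s<n. Ve i s * X l z r s) * (p (Log z) z r * We r k))"
    unfolding sum_distrib_right[of _ _ ?e]
  proof (rule sum.cong[OF refl])
    fix r assume r: "r \<in> {..<n}"
    \<comment> \<open>\<open>We\<close> has no entries linking N to the other indices, so the
      q-exponential may be attached to r instead of k.\<close>
    have "We r k * ?e = (if r = N then 1 / qpoch q (z / aa) else 1) * We r k"
      using r k by (auto simp: We n)
    hence "exp (Log z * \<nu> r) * We r k * ?e = p (Log z) z r * We r k"
      unfolding p_def by (simp only: mult.assoc)
    thus "(\<Sum>s<n. Ve i s * X l z r s) * (exp (Log z * \<nu> r) * We r k) * ?e = (\<Sum>s<n. Ve i s * X l z r s) * (p (Log z) z r * We r k)"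
      by (simp only: mult.assoc)
  qed
  finally show ?thesis .
qed

definition stokes_row :: "complex \<Rightarrow> complex \<Rightarrow> complex \<Rightarrow> complex \<Rightarrow> nat \<Rightarrow> complex" where
  "stokes_row l m L z k = (\<Sum>r<N. W r k * (\<gamma> r / (1 - Q) * stokes_sum r l m z / z * exp (L * (\<nu> r - \<nu> N))))"

definition stokes_entry :: "complex \<Rightarrow> complex \<Rightarrow> complex \<Rightarrow> complex \<Rightarrow> nat \<Rightarrow> nat \<Rightarrow> complex" where
  "stokes_entry l m L z i k = (if i = N \<and> k < N then stokes_row l m L z k else if i = k then 1 else 0)"

text \<open>By \<open>bsum_difference_stokes\<close> a change of direction adds to each column r <
  N, taken in the eigenbasis, a multiple of the last column, which does not depend on the direction.
  The change has rank one: the last column of the fundamental solution times a row.\<close>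

lemma fund_sol_stokes:
  assumes l: "l \<noteq> 0" "\<forall>r<N. l \<notin> qspiral q (xi r)" and m: "m \<noteq> 0" "\<forall>r<N. m \<notin> qspiral q (xi r)"
    and z: "z \<noteq> 0" "z \<notin> qspiral q (- 1 / l)" "z \<notin> qspiral q (- 1 / m)" "z \<notin> qspiral q aa"
  shows "fund_sol q Log A m z = fund_sol q Log A l z * mat n n (\<lambda>(i, k). stokes_entry l m (Log z) z i k)"
proof (rule eq_matI)
  let ?S = "mat n n (\<lambda>(i, k). stokes_entry l m (Log z) z i k)"
  let ?F = "fund_sol q Log A l z"
  have S: "?S \<in> carrier_mat n n" by simp
  note Fe = fund_sol_entry[OF l z(1,2,4), where Log = Log] and Fe' = fund_sol_entry[OF m z(1,3,4), where Log = Log]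
  fix i k assume "i < dim_row (?F * ?S)" "k < dim_col (?F * ?S)"
  hence ik: "i < n" "k < n" using fund_sol_carrier[of Log l z] by auto
  define x where "x = (\<Sum>s<n. Ve i s * X l z N s)"
  define K where "K = (\<lambda>r. \<gamma> r / (1 - Q) * stokes_sum r l m z / z)"
  have FN: "?F $$ (i, N) = x * p (Log z) z N"
    using Fe[OF ik(1), of N] unfolding sum_n[of "\<lambda>r. _ r * (p (Log z) z r * We r N)"] by (simp add: less_n We x_def)
  have dX: "(\<Sum>s<n. Ve i s * X m z r s) - (\<Sum>s<n. Ve i s * X l z r s) = x * (K r / qpoch q (z / aa))" if r: "r < N" for r
  proof -
    have "(\<Sum>s<n. Ve i s * X m z r s) - (\<Sum>s<n. Ve i s * X l z r s) = (\<Sum>s<n. Ve i s * (X m z r s - X l z r s))"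
      by (simp add: right_diff_distrib sum_subtractf)
    also have "\<dots> = (\<Sum>s<n. Ve i s * (X l z N s * (K r / qpoch q (z / aa))))"
    proof (rule sum.cong[OF refl], rule arg_cong2[of _ _ _ _ times, OF refl])
      fix s assume "s \<in> {..<n}"
      hence s: "s \<le> N" by (auto simp: n)
      show "X m z r s - X l z r s = X l z N s * (K r / qpoch q (z / aa))"
      proof -
        have "bsum (gx r s) m z - bsum (gx r s) l z =
            R s (1 / z) / qpoch q (Q * aa / z) * (\<gamma> r / (1 - Q) * stokes_sum r l m z / z / qpoch q (z / aa))"
          using l m z r s t_nonres by (intro bsum_difference_stokes) auto
        thus ?thesis using r by (simp add: X_def K_def)
      qed
    qed
    finally show ?thesis by (simp only: x_def sum_distrib_right mult.assoc)
  qed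
  have "fund_sol q Log A m z $$ (i, k) - ?F $$ (i, k) =
      (\<Sum>r<n. ((\<Sum>s<n. Ve i s * X m z r s) - (\<Sum>s<n. Ve i s * X l z r s)) * (p (Log z) z r * We r k))"
    unfolding Fe[OF ik] Fe'[OF ik] by (simp add: left_diff_distrib sum_subtractf)
  also have "\<dots> = (\<Sum>r<N. x * (K r / qpoch q (z / aa)) * (p (Log z) z r * We r k))"
    unfolding sum_n[of "\<lambda>r. _ r * (p (Log z) z r * We r k)"]
    by (simp add: X_def[of _ _ N] dX)
  also have "\<dots> = x * p (Log z) z N * (if k < N then stokes_row l m (Log z) z k else 0)"
  proof (cases "k < N")
    case True
    have "K r / qpoch q (z / aa) * (p (Log z) z r * We r k) = p (Log z) z N * (W r k * (K r * exp (Log z * (\<nu> r - \<nu> N))))" if "r < N" for r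
    proof -
      have "exp (Log z * \<nu> r) = exp (Log z * \<nu> N) * exp (Log z * (\<nu> r - \<nu> N))"
        by (simp flip: exp_add add: algebra_simps)
      thus ?thesis using that True by (simp add: p_def We mult_ac)
    qed
    hence "x * (K r / qpoch q (z / aa)) * (p (Log z) z r * We r k) = x * p (Log z) z N * (W r k * (K r * exp (Log z * (\<nu> r - \<nu> N))))" if "r < N" for r
      using that by (simp only: mult.assoc)
    moreover have "stokes_row l m (Log z) z k = (\<Sum>r<N. W r k * (K r * exp (Log z * (\<nu> r - \<nu> N))))"
      by (simp only: stokes_row_def K_def)
    ultimately show ?thesis using True by (simp add: sum_distrib_left)
  next
    case False
    thus ?thesis using ik by (simp add: We)
  qed
  finally have D: "fund_sol q Log A m z $$ (i, k) - ?F $$ (i, k) = ?F $$ (i, N) * (if k < N then stokes_row l m (Log z) z k else 0)"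
    unfolding FN .
  have "(?F * ?S) $$ (i, k) = (\<Sum>r<n. ?F $$ (i, r) * stokes_entry l m (Log z) z r k)"
    unfolding mat_mult_entry[OF fund_sol_carrier S ik] using ik by (intro sum.cong) auto
  also have "\<dots> = ?F $$ (i, k) + ?F $$ (i, N) * (if k < N then stokes_row l m (Log z) z k else 0)"
    unfolding sum_n using ik
    by (auto simp: stokes_entry_def less_n if_distrib[of "\<lambda>x. _ * x"] cong: if_cong)
  finally have e: "(?F * ?S) $$ (i, k) = ?F $$ (i, k) + ?F $$ (i, N) * (if k < N then stokes_row l m (Log z) z k else 0)" .
  show "fund_sol q Log A m z $$ (i, k) = (?F * ?S) $$ (i, k)"
    unfolding e using D unfolding diff_eq_eq by (simp only: add.commute)
qed (use fund_sol_carrier[of Log l z] fund_sol_carrier[of Log m z] in auto)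

lemma R_0: "s \<le> N \<Longrightarrow> R s 0 = (if s = N then 1 else 0)"
  using arg_cong[OF hf_mult[of s], of "\<lambda>f. fps_nth f 0"] by (simp add: R_def eval_fps_at_0 hf_0)

lemma X_tendsto:
  assumes l: "l \<noteq> 0" "\<forall>r<N. l \<notin> qspiral q (xi r)" and w: "w \<noteq> 0" "w \<notin> qspiral q (- 1 / l)"
    and rs: "r < n" "s < n"
  shows "(\<lambda>k. X l (w / Q ^ k) r s) \<longlonglongrightarrow> (if r = s then 1 else 0)"
proof (cases "r < N")
  case True
  have s: "s \<le> N" using rs by (simp add: n)
  have "borel_cont l (xf r s) (gx r s)" using True s l by (intro gx_borel_cont) auto
  from bsum_tendsto[OF this l(1) w] show ?thesis using True s by (simp add: X_def xf_0 eq_commute)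
next
  case False
  have s: "s \<le> N" and r: "r = N" using rs False by (auto simp: n)
  have q: "(\<lambda>k. Q ^ k) \<longlonglongrightarrow> 0" using q0 q1 by (intro LIMSEQ_power_zero) simp
  have 1: "(\<lambda>k. Q ^ k / w) \<longlonglongrightarrow> 0" by (rule tendsto_divide_zero[OF q])
  have "continuous_on UNIV (R s)" by (intro holomorphic_on_imp_continuous_on R_holomorphic s)
  hence "isCont (R s) 0" by (simp add: continuous_on_eq_continuous_at)
  hence R: "(\<lambda>k. R s (Q ^ k / w)) \<longlonglongrightarrow> R s 0" by (rule isCont_tendsto_compose[OF _ 1])
  have 2: "(\<lambda>k. Q * aa * (Q ^ k / w)) \<longlonglongrightarrow> 0" by (rule tendsto_mult_right_zero[OF 1])
  have "(\<lambda>k. qpoch q (Q * aa * (Q ^ k / w))) \<longlonglongrightarrow> qpoch q 0"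
    by (rule isCont_tendsto_compose[OF qpoch_isCont 2])
  hence "(\<lambda>k. R s (Q ^ k / w) / qpoch q (Q * aa * (Q ^ k / w))) \<longlonglongrightarrow> R s 0 / qpoch q 0"
    by (intro tendsto_divide R) auto
  thus ?thesis using r by (auto simp: X_def R_0[OF s])
qed

lemma X_meromorphic:
  assumes l: "l \<noteq> 0" "\<forall>r<N. l \<notin> qspiral q (xi r)" and rs: "r < n" "s < n"
  shows "(\<lambda>z. X l z r s) meromorphic_on - {0}"
proof (cases "r < N")
  case True
  have "borel_cont l (xf r s) (gx r s)" using True rs l by (intro gx_borel_cont) (auto simp: n)
  from bsum_meromorphic[OF this l(1)] True show ?thesis by (simp add: X_def)
next
  case False
  have s: "s \<le> N" using rs by (auto simp: n)
  have mq: "(\<lambda>z. qpoch q (Q * aa / z)) analytic_on - {0}"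
    by (intro analytic_intros) auto
  have "R s analytic_on UNIV" using R_holomorphic[OF s, of UNIV] by (simp add: analytic_on_open)
  moreover have "(\<lambda>z::complex. 1 / z) analytic_on - {0}" by (intro analytic_intros) auto
  ultimately have mR: "(\<lambda>z. R s (1 / z)) analytic_on - {0}"
    using analytic_on_compose_gen[of "\<lambda>z. 1 / z" "- {0}" "R s" UNIV] by (simp add: o_def)
  show ?thesis unfolding X_def using False
    by (simp, intro meromorphic_intros analytic_on_imp_meromorphic_on mR mq)
qed

text \<open>The determinant is meromorphic, so it is nonzero off a discrete set unless it vanishes
  off one. The second case is refuted by the limit 1 along a suitable sequence w / q^k.\<close>

lemma det_resum_H:
  assumes l: "l \<noteq> 0" "\<forall>r<N. l \<notin> qspiral q (xi r)"
  shows "\<forall>\<^sub>\<approx>z\<in>- {0}. det (mat n n (\<lambda>(i, k). resum_H l z i k)) \<noteq> 0"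
proof (rule ccontr)
  let ?d = "\<lambda>z. det (mat n n (\<lambda>(i, k). resum_H l z i k))"
  assume "\<not> (\<forall>\<^sub>\<approx>z\<in>- {0}. ?d z \<noteq> 0)"
  moreover have "?d meromorphic_on - {0}"
    unfolding resum_H_def
    by (intro meromorphic_on_det meromorphic_on_sum meromorphic_on_mult meromorphic_on_const X_meromorphic l) auto
  ultimately have "\<forall>\<^sub>\<approx>z\<in>- {0}. ?d z = 0"
    using meromorphic_imp_constant_or_avoid[of ?d "- {0}" 0] by (auto simp: open_Compl)
  define Z where "Z = - {0} \<inter> {z. ?d z \<noteq> 0}"
  have "countable Z"
  proof -
    have "{z. ?d z \<noteq> 0} sparse_in - {0}" using \<open>\<forall>\<^sub>\<approx>z\<in>- {0}. ?d z = 0\<close> by (simp add: eventually_cosparse)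
    thus ?thesis unfolding Z_def by (intro sparse_imp_countable) (auto simp: open_Compl)
  qed
  hence cnt: "countable ((\<Union>k::nat. (\<lambda>z. z * Q ^ k) ` Z) \<union> qspiral q (- 1 / l) \<union> {0})"
    by (intro countable_Un countable_qspiral countable_UN countable_image) auto
  \<comment> \<open>Only countably many w are excluded: those for which some w / q^k is an
    exceptional point of the determinant, and the pole spiral.\<close>
  then obtain w where w: "w \<notin> (\<Union>k::nat. (\<lambda>z. z * Q ^ k) ` Z)" "w \<notin> qspiral q (- 1 / l)" "w \<noteq> 0"
  proof -
    have "(\<Union>k::nat. (\<lambda>z. z * Q ^ k) ` Z) \<union> qspiral q (- 1 / l) \<union> {0} \<noteq> UNIV"
      using cnt uncountable_UNIV_complex by metis
    thus ?thesis using that by blast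
  qed
  have "?d (w / Q ^ k) = 0" for k
  proof (rule ccontr)
    assume "?d (w / Q ^ k) \<noteq> 0"
    hence "w / Q ^ k \<in> Z" using w by (simp add: Z_def)
    moreover have "w = w / Q ^ k * Q ^ k" by simp
    ultimately show False using w(1) by blast
  qed
  moreover have "(\<lambda>k. ?d (w / Q ^ k)) \<longlonglongrightarrow> 1"
  proof -
    have "(\<lambda>k. resum_H l (w / Q ^ k) i j) \<longlonglongrightarrow> (if i = j then 1 else 0)" if ij: "i < n" "j < n" for i j
    proof -
      have "(\<lambda>k. resum_H l (w / Q ^ k) i j) \<longlonglongrightarrow> (\<Sum>r<n. We r j * (\<Sum>s<n. Ve i s * (if r = s then 1 else 0)))"
        unfolding resum_H_def by (intro tendsto_sum tendsto_mult tendsto_const X_tendsto l w) auto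
      also have "(\<Sum>r<n. We r j * (\<Sum>s<n. Ve i s * (if r = s then 1 else 0))) = (\<Sum>r<n. Ve i r * We r j)"
        by (intro sum.cong) (simp_all add: if_distrib[of "\<lambda>x. _ * x"] cong: if_cong)
      finally show ?thesis unfolding ext.VW[OF ij] .
    qed
    hence "(\<lambda>k. ?d (w / Q ^ k)) \<longlonglongrightarrow> det (mat n n (\<lambda>(i, j). if i = j then 1 else 0))"
      by (intro tendsto_det) auto
    also have "mat n n (\<lambda>(i, j). if i = j then 1 else 0) = (1\<^sub>m n :: complex mat)" by (rule eq_matI) auto
    finally show ?thesis by simp
  qed
  ultimately have "(\<lambda>k::nat. 0 :: complex) \<longlonglongrightarrow> 1" by simp
  thus False using LIMSEQ_unique[OF tendsto_const] by fastforce
qed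

lemma det_fund_sol:
  assumes l: "l \<noteq> 0" "\<forall>r<N. l \<notin> qspiral q (xi r)"
    and z: "z \<noteq> 0" "z \<notin> qspiral q (- 1 / l)" "z \<notin> qspiral q aa"
    and H: "det (mat n n (\<lambda>(i, k). resum_H l z i k)) \<noteq> 0"
  shows "det (fund_sol q Log A l z) \<noteq> 0"
proof -
  let ?H = "mat n n (\<lambda>(i, k). resum_H l z i k)" and ?S = "\<lambda>x. sandwich n Ve (\<lambda>r. exp (x * \<nu> r)) We"
  let ?D = "\<lambda>e. mat_diag n (\<lambda>i. if i = n - 1 then e else 1 :: complex)"
  have c: "?H \<in> carrier_mat n n" "?S x \<in> carrier_mat n n" "?D e \<in> carrier_mat n n" for x e by auto
  have "?S (Log z) * ?S (- Log z) = 1\<^sub>m n"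
    unfolding ext.sandwich_mult using ext.sandwich_one by (simp flip: exp_add)
  hence "det (?S (Log z)) * det (?S (- Log z)) = 1"
    using det_mult[OF c(2) c(2), of "Log z" "- Log z"] by simp
  hence S: "det (?S (Log z)) \<noteq> 0" by auto
  have "?D e * ?D (1 / e) = 1\<^sub>m n" if "e \<noteq> 0" for e
    using that unfolding mat_diag_diag by (intro eq_matI) (auto simp: mat_diag_def)
  hence "det (?D e) * det (?D (1 / e)) = 1" if "e \<noteq> 0" for e
    using that det_mult[OF c(3) c(3), of e "1 / e"] by simp
  from this[of "1 / qpoch q (z / aa)"] have D: "det (?D (1 / qpoch q (z / aa))) \<noteq> 0"
    using qpoch_generic[OF z(1,3)] by fastforce
  have "det (F * G * K) = det F * det G * det K"
    if "F \<in> carrier_mat n n" "G \<in> carrier_mat n n" "K \<in> carrier_mat n n" for F G K :: "complex mat"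
    using that by (simp add: det_mult[of _ n])
  from this[OF c] show ?thesis unfolding fund_sol_eq[OF l z] using H S D by simp
qed

subsection \<open>The Stokes matrix\<close>

lemma qtheta_scaled_analytic: "a \<noteq> 0 \<Longrightarrow> S \<subseteq> - {0} \<Longrightarrow> (\<lambda>z. qtheta q (a * z)) analytic_on S"
  by (intro analytic_intros) auto

lemma stokes_row_analytic:
  assumes l: "l \<noteq> 0" and m: "m \<noteq> 0" and L: "Log analytic_on S" and S: "S \<subseteq> - {0}"
    and nz: "\<And>z. z \<in> S \<Longrightarrow> z \<notin> qspiral q (- 1 / l)" "\<And>z. z \<in> S \<Longrightarrow> z \<notin> qspiral q (- 1 / m)"
  shows "(\<lambda>z. stokes_row l m (Log z) z k) analytic_on S"
  unfolding stokes_row_def stokes_sum_def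
proof (intro analytic_on_sum analytic_on_mult analytic_on_const analytic_on_divide[OF _ analytic_on_ident]
    analytic_on_divide[OF qtheta_scaled_analytic qtheta_scaled_analytic] analytic_intros L S)
  show "qtheta q (l * z) \<noteq> 0" if "z \<in> S" for z
    using nz(1)[OF that] qtheta_mult_eq_0_iff[of l z] l S that by auto
  show "qtheta q (m * z) \<noteq> 0" if "z \<in> S" for z
    using nz(2)[OF that] qtheta_mult_eq_0_iff[of m z] m S that by auto
qed (use l m S c_nz t_nz d_nz in auto)

lemma stokes_row_meromorphic:
  assumes l: "l \<noteq> 0" and m: "m \<noteq> 0" and L: "Log analytic_on S" and S: "S \<subseteq> - {0}"
  shows "(\<lambda>z. stokes_row l m (Log z) z k) meromorphic_on S"
proof -
  have th: "(\<lambda>z. qtheta q (a * z)) meromorphic_on S" if "a \<noteq> 0" for a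
    by (intro analytic_on_imp_meromorphic_on qtheta_scaled_analytic that S)
  have id: "(\<lambda>z. z) meromorphic_on S" by (intro analytic_on_imp_meromorphic_on analytic_on_ident)
  have ex: "(\<lambda>z. exp (Log z * a)) meromorphic_on S" for a
    by (intro analytic_on_imp_meromorphic_on analytic_intros L)
  show ?thesis unfolding stokes_row_def stokes_sum_def
    by (intro meromorphic_on_sum meromorphic_on_mult meromorphic_on_const meromorphic_on_divide id ex th)
       (use l m c_nz t_nz d_nz in auto)
qed

text \<open>The relation between the fundamental solutions is available off some spirals only, among
  them that of \<open>aa\<close>, on which z may lie. The candidate S1 is therefore the normalised
  continuation. Any other admissible S agrees with it off a discrete set by invertibility, hence at
  z, where the explicit entries are analytic.\<close>

theorem q_stokes_eq:
  assumes l: "l \<noteq> 0" "\<forall>r<N. l \<notin> qspiral q (xi r)" and m: "m \<noteq> 0" "\<forall>r<N. m \<notin> qspiral q (xi r)"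
    and br: "log_branch \<Omega> Log" and z: "z \<in> \<Omega>" "z \<notin> qspiral q (- 1 / l)" "z \<notin> qspiral q (- 1 / m)"
  shows "q_stokes q \<Omega> Log A l m z = mat n n (\<lambda>(i, k). stokes_entry l m (Log z) z i k)"
proof -
  have op: "open \<Omega>" and cont: "continuous_on \<Omega> Log" and ex: "\<And>w. w \<in> \<Omega> \<Longrightarrow> exp (Log w) = w"
    using br by (auto simp: log_branch_def)
  have sub: "\<Omega> \<subseteq> - {0}"
  proof
    fix w assume "w \<in> \<Omega>"
    hence "w = exp (Log w)" by (simp add: ex)
    thus "w \<in> - {0}" by (metis ComplI exp_not_eq_zero singletonD)
  qed
  \<comment> \<open>\<open>log_branch\<close> gives continuity only. A continuous right inverse of
    exp is holomorphic, which the meromorphy of the entries requires.\<close>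
  have "(Log has_field_derivative inverse (exp (Log w))) (at w)" if w: "w \<in> \<Omega>" for w
    by (rule has_field_derivative_inverse_basic[OF DERIV_exp exp_not_eq_zero _ op w ex])
       (use w op cont in \<open>auto simp: continuous_on_eq_continuous_at\<close>)
  hence "Log holomorphic_on \<Omega>" using op by (auto simp: holomorphic_on_open)
  hence La: "Log analytic_on \<Omega>" using op by (simp add: analytic_on_open)
  have d: "dim_row A = n" using A by simp
  let ?f = "\<lambda>i k w. stokes_entry l m (Log w) w i k"
  define S1 where "S1 = (\<lambda>w. mat n n (\<lambda>(i, k). remove_sings (?f i k) w))"
  have mer: "?f i k meromorphic_on \<Omega>" for i k
  proof (cases "i = N \<and> k < N")
    case True
    thus ?thesis using stokes_row_meromorphic[OF l(1) m(1) La sub, of k] by (simp add: stokes_entry_def)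
  next
    case False
    hence "?f i k = (\<lambda>w. if i = k then 1 else 0)" by (auto simp: stokes_entry_def fun_eq_iff)
    thus ?thesis by (simp only: meromorphic_on_const)
  qed
  have rs: "\<forall>\<^sub>\<approx>w\<in>\<Omega>. remove_sings (?f i k) w = ?f i k w" for i k
    by (rule eventually_remove_sings_eq[OF mer])
  have cos: "\<forall>\<^sub>\<approx>w\<in>\<Omega>. P w" if "\<forall>\<^sub>\<approx>w\<in>- {0}. P w" for P :: "complex \<Rightarrow> bool"
    using that sub op by (auto simp: eventually_cosparse_open_eq open_Compl)
  have gen: "\<forall>\<^sub>\<approx>w\<in>\<Omega>. w \<in> \<Omega>" by (rule eventually_in_cosparse) (use op in auto)
  have gl: "\<forall>\<^sub>\<approx>w\<in>\<Omega>. w \<notin> qspiral q (- 1 / l)" by (intro cos qspiral_cosparse) (use l in auto)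
  have gm: "\<forall>\<^sub>\<approx>w\<in>\<Omega>. w \<notin> qspiral q (- 1 / m)" by (intro cos qspiral_cosparse) (use m in auto)
  have ga: "\<forall>\<^sub>\<approx>w\<in>\<Omega>. w \<notin> qspiral q aa" by (intro cos qspiral_cosparse aa_nz)
  have all_rs: "\<forall>\<^sub>\<approx>w\<in>\<Omega>. \<forall>i\<in>{..<n}. \<forall>k\<in>{..<n}. remove_sings (?f i k) w = ?f i k w"
    by (intro eventually_ball_finite ballI rs) auto
  have rel: "\<forall>\<^sub>\<approx>w\<in>\<Omega>. fund_sol q Log A m w = fund_sol q Log A l w * S1 w"
    using all_rs gen gl gm ga
  proof eventually_elim
    case (elim w)
    have "S1 w = mat n n (\<lambda>(i, k). ?f i k w)" unfolding S1_def by (rule eq_matI) (use elim in auto)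
    moreover have "w \<noteq> 0" using elim sub by auto
    ultimately show ?case using fund_sol_stokes[OF l m _ elim(3,4,5), of Log] by simp
  qed
  have is1: "is_q_stokes q \<Omega> Log A l m S1"
    unfolding is_q_stokes_def Let_def d
  proof (intro conjI allI impI ballI rel)
    show "S1 w \<in> carrier_mat n n" for w by (simp add: S1_def)
    fix i j assume "i < n" "j < n"
    thus "(\<lambda>z. S1 z $$ (i, j)) nicely_meromorphic_on \<Omega>"
      using remove_sings_nicely_meromorphic[OF mer, of i j] by (simp add: S1_def)
  qed
  have inv: "\<forall>\<^sub>\<approx>w\<in>\<Omega>. det (fund_sol q Log A l w) \<noteq> 0"
    using cos[OF det_resum_H[OF l]] gen gl ga
  proof eventually_elim
    case (elim w)
    have "w \<noteq> 0" using elim sub by auto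
    thus ?case using det_fund_sol[OF l _ elim(3,4,1), of Log] by simp
  qed
  define S where "S = q_stokes q \<Omega> Log A l m"
  have "is_q_stokes q \<Omega> Log A l m S" unfolding S_def q_stokes_def
    by (rule someI[of "is_q_stokes q \<Omega> Log A l m", OF is1])
  hence S: "\<And>w. w \<in> \<Omega> \<Longrightarrow> S w \<in> carrier_mat n n"
    "\<And>i j. i < n \<Longrightarrow> j < n \<Longrightarrow> (\<lambda>w. S w $$ (i, j)) nicely_meromorphic_on \<Omega>"
    "\<forall>\<^sub>\<approx>w\<in>\<Omega>. fund_sol q Log A m w = fund_sol q Log A l w * S w"
    unfolding is_q_stokes_def Let_def d by auto
  have eq: "\<forall>\<^sub>\<approx>w\<in>\<Omega>. S w = S1 w"
    using inv S(3) rel gen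
  proof eventually_elim
    case (elim w)
    have "S1 w \<in> carrier_mat n n" by (simp add: S1_def)
    thus ?case using elim by (intro mat_left_cancel[OF fund_sol_carrier S(1)]) auto
  qed
  have "S z = mat n n (\<lambda>(i, k). ?f i k z)"
  proof (rule eq_matI)
    fix i j assume "i < dim_row (mat n n (\<lambda>(i, k). ?f i k z))" "j < dim_col (mat n n (\<lambda>(i, k). ?f i k z))"
    hence ij: "i < n" "j < n" by auto
    have "S z $$ (i, j) = remove_sings (?f i j) z"
    proof (rule nicely_meromorphic_eqI[OF S(2)[OF ij] remove_sings_nicely_meromorphic[OF mer] op z(1)])
      show "\<forall>\<^sub>\<approx>w\<in>\<Omega>. S w $$ (i, j) = remove_sings (?f i j) w"
        using eq by eventually_elim (use ij in \<open>simp add: S1_def\<close>)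
    qed
    also have "\<dots> = ?f i j z"
    proof (rule remove_sings_at_analytic)
      have "Log analytic_on {z}" using z(1) by (intro analytic_on_subset[OF La]) auto
      hence "(\<lambda>w. stokes_row l m (Log w) w j) analytic_on {z}"
        using sub z by (intro stokes_row_analytic l m) auto
      moreover have "?f i j = (if i = N \<and> j < N then (\<lambda>w. stokes_row l m (Log w) w j) else (\<lambda>w. if i = j then 1 else 0))"
        by (auto simp: stokes_entry_def fun_eq_iff)
      ultimately show "?f i j analytic_on {z}" by (simp split: if_split)
    qed
    finally show "S z $$ (i, j) = mat n n (\<lambda>(i, k). ?f i k z) $$ (i, j)" using ij by simp
  qed (use S(1)[OF z(1)] in auto)
  thus ?thesis by (simp add: S_def)
qed

end

text \<open>A Schur complement without inverting the block: multiplication by the unipotent matrix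
  U, whose last column is (v, 1), clears the last column of M above the corner.\<close>

lemma det_border:
  fixes M :: "complex mat"
  assumes M: "M \<in> carrier_mat (Suc N) (Suc N)"
    and v: "\<And>i. i < N \<Longrightarrow> (\<Sum>k<N. M $$ (i, k) * v k) + M $$ (i, N) = 0"
  shows "det M = ((\<Sum>k<N. M $$ (N, k) * v k) + M $$ (N, N)) * det (mat N N (\<lambda>(i, j). M $$ (i, j)))"
proof -
  define U where "U = mat (Suc N) (Suc N) (\<lambda>(i, j). if j = N \<and> i < N then v i else if i = j then 1 else 0)"
  have U: "U \<in> carrier_mat (Suc N) (Suc N)" by (simp add: U_def)
  have MU: "M * U \<in> carrier_mat (Suc N) (Suc N)" by (rule mult_carrier_mat[OF M U])
  have "det U = prod_list (diag_mat U)"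
    by (rule det_upper_triangular[OF _ U]) (auto simp: U_def)
  also have "diag_mat U = replicate (Suc N) 1"
    by (rule nth_equalityI) (auto simp: diag_mat_def U_def simp del: upt_Suc replicate_Suc)
  finally have dU: "det U = 1" by simp
  have e1: "(M * U) $$ (i, j) = M $$ (i, j)" if "i < Suc N" "j < N" for i j
    using that mat_mult_entry[OF M U, of i j]
    by (simp add: U_def if_distrib[of "\<lambda>x. _ * x"] cong: if_cong)
  have e2: "(M * U) $$ (i, N) = (\<Sum>k<N. M $$ (i, k) * v k) + M $$ (i, N)" if "i < Suc N" for i
    using that mat_mult_entry[OF M U, of i N] by (simp add: U_def)
  have "det M = det (M * U)" using det_mult[OF M U] dU by simp
  also have "\<dots> = (\<Sum>i<Suc N. (M * U) $$ (i, N) * cofactor (M * U) i N)"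
    by (rule laplace_expansion_column[OF MU]) simp
  also have "\<dots> = (M * U) $$ (N, N) * cofactor (M * U) N N"
    using v by (simp add: e2)
  also have "cofactor (M * U) N N = det (mat N N (\<lambda>(i, j). M $$ (i, j)))"
  proof -
    have "mat_delete (M * U) N N = mat N N (\<lambda>(i, j). (M * U) $$ (i, j))"
      using MU unfolding mat_delete_def carrier_mat_def by (intro eq_matI) auto
    also have "\<dots> = mat N N (\<lambda>(i, j). M $$ (i, j))"
      by (rule eq_matI) (simp_all add: e1 del: index_mult_mat)
    finally have "mat_delete (M * U) N N = mat N N (\<lambda>(i, j). M $$ (i, j))" .
    thus ?thesis by (simp add: cofactor_def)
  qed
  finally show ?thesis by (simp add: e2)
qed

lemma prod_Suc_shift:
  shows "(\<Prod>i=1..N. f i) = (\<Prod>i<N. f (Suc i))"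
    and "(\<Prod>i\<in>{1..N}-{Suc j}. f i) = (\<Prod>i\<in>{..<N}-{j}. f (Suc i))"
    and "(\<Prod>i\<in>{1..Suc N}-{Suc j}. f i) = (\<Prod>i\<in>{..N}-{j}. f (Suc i))"
  by (rule prod.reindex_bij_witness[of _ Suc "\<lambda>i. i - 1"]; auto)+

lemma sum_Suc_shift:
  shows "(\<Sum>i=1..N. f i) = (\<Sum>i<N. f (Suc i))"
    and "(\<Sum>i=1..Suc N. f i) = (\<Sum>i\<le>N. f (Suc i))"
  by (rule sum.reindex_bij_witness[of _ Suc "\<lambda>i. i - 1"]; auto)+

section \<open>Powers of q and principal logarithms\<close>

context q_base
begin

lemma powr_eq_exp: "Q powr a = exp (of_real (ln q) * a)"
  using q0 by (simp add: powr_def Ln_of_real mult.commute)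

lemma ln_q_nz: "of_real (ln q) \<noteq> (0 :: complex)"
  using q0 q1 by simp

lemma powr_logq: "y \<noteq> 0 \<Longrightarrow> Q powr logq q y = y"
  unfolding powr_eq_exp logq_def using ln_q_nz by simp

text \<open>For y = y' q^k the two logarithms differ by k ln q + 2 \<pi> i r. Principal imaginary
  parts differ by less than 2 \<pi>, so r = 0 and the quotient by ln q is the integer k.\<close>

lemma logq_nonres:
  assumes y: "y \<noteq> 0" "y' \<noteq> 0" and "logq q y - logq q y' \<notin> \<int>"
  shows "y \<notin> qspiral q y'"
proof
  assume "y \<in> qspiral q y'"
  then obtain k :: int where k: "y = y' * Q powi k" by (auto simp: qspiral_def)
  have "Q powi k = exp (of_int k * of_real (ln q))"
    using q0 by (simp add: exp_power_int[symmetric] exp_of_real)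
  hence "exp (Ln y) = exp (Ln y' + of_int k * of_real (ln q))"
    using y by (simp add: exp_add k)
  then obtain r :: int where r: "Ln y = Ln y' + of_int k * of_real (ln q) + of_int (2 * r) * of_real pi * \<i>"
    unfolding exp_eq by auto
  hence "Im (Ln y) = Im (Ln y') + of_int (2 * r) * pi"
    by simp
  moreover have "- pi < Im (Ln y)" "Im (Ln y) \<le> pi" "- pi < Im (Ln y')" "Im (Ln y') \<le> pi"
    using y mpi_less_Im_Ln Im_Ln_le_pi by auto
  ultimately have "\<bar>of_int (2 * r) * pi\<bar> < 2 * pi" by linarith
  hence "\<bar>of_int r\<bar> * (2 * pi) < 1 * (2 * pi)" by (simp add: abs_mult)
  hence "\<bar>of_int r :: real\<bar> < 1" using pi_gt_zero by (subst (asm) mult_less_cancel_right) auto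
  hence "r = 0" by linarith
  hence "Ln y - Ln y' = of_int k * of_real (ln q)" using r by simp
  hence "logq q y - logq q y' = of_int k"
    unfolding logq_def diff_divide_distrib[symmetric] using ln_q_nz by simp
  thus False using assms(3) by simp
qed

end

section \<open>The data of the theorem as an arrow matrix, and the translation of the
  formula\<close>

theorem theorem1p1:
  fixes q :: real and n :: nat and A :: "complex mat"
    and lam :: "nat \<Rightarrow> nat \<Rightarrow> complex" and mu nu :: "nat \<Rightarrow> complex"
    and l m z :: complex and \<Omega> :: "complex set" and Log :: "complex \<Rightarrow> complex"
  assumes q: "0 < q" "q < 1" and n: "2 \<le> n" and A: "A \<in> carrier_mat n n"
    and eigenvalues: "\<And>k. 1 \<le> k \<Longrightarrow> k \<le> n \<Longrightarrow>
          char_poly (leading k A) = (\<Prod>i=1..k. [:- lam k i, 1:])"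
    and nonzero_n: "\<And>i. i \<in> {1..n} \<Longrightarrow> 1 - (1 - of_real q) * lam n i \<noteq> 0"
    and nonzero_n1: "\<And>i. i \<in> {1..n-1} \<Longrightarrow> 1 - (1 - of_real q) * lam (n-1) i \<noteq> 0"
    and mu: "\<And>i. i \<in> {1..n} \<Longrightarrow> mu i = logq q (1 - (1 - of_real q) * lam n i)"
    and nu: "\<And>i. i \<in> {1..n-1} \<Longrightarrow> nu i = logq q (1 - (1 - of_real q) * lam (n-1) i)"
    and nu_n: "nu n = (\<Sum>i=1..n. mu i) - (\<Sum>i=1..n-1. nu i)"
    and mu_nonres: "\<And>i j. i \<in> {1..n} \<Longrightarrow> j \<in> {1..n} \<Longrightarrow> i \<noteq> j \<Longrightarrow> mu i - mu j \<notin> \<int>"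
    and nu_nonres: "\<And>i j. i \<in> {1..n-1} \<Longrightarrow> j \<in> {1..n-1} \<Longrightarrow> i \<noteq> j \<Longrightarrow> nu i - nu j \<notin> \<int>"
    and lam_neq: "\<And>i j. j \<in> {1..n-1} \<Longrightarrow> i \<in> {1..n-2} \<Longrightarrow> lam (n-1) j \<noteq> lam (n-2) i"
    and l: "l \<noteq> 0" and m: "m \<noteq> 0" and m_l: "m \<notin> qspiral q l"
    and l_sing: "\<And>i. i \<in> {1..n-1} \<Longrightarrow>
          l \<notin> qspiral q (- (1 - of_real q) / of_real q powr nu i)"
    and m_sing: "\<And>i. i \<in> {1..n-1} \<Longrightarrow>
          m \<notin> qspiral q (- (1 - of_real q) / of_real q powr nu i)"
    and branch: "log_branch \<Omega> Log" and z: "z \<in> \<Omega>"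
    and z_m: "z \<notin> qspiral q (- 1 / m)" and z_l: "z \<notin> qspiral q (- 1 / l)"
  shows "q_stokes q \<Omega> Log A l m z =
           four_block_mat (1\<^sub>m (n-1)) (0\<^sub>m (n-1) 1)
             (mat 1 (n-1) (\<lambda>(_, k). stokes_b q n A lam mu nu l m z (Log z) (k + 1))) (1\<^sub>m 1)"
proof -
  obtain N where nN: "n = Suc N" and N: "N \<ge> 1" using n by (cases n) auto
  have n1: "n - 1 = N" and n2: "n - 2 = N - 1" using nN by auto
  interpret q_base q using q by unfold_locales
  note nu = nu[unfolded n1] and nonzero_n1 = nonzero_n1[unfolded n1] and nu_nonres = nu_nonres[unfolded n1]
    and lam_neq = lam_neq[unfolded n1 n2] and l_sing = l_sing[unfolded n1] and m_sing = m_sing[unfolded n1]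
  define x where "x = (\<lambda>i. lam N (Suc i))"
  define c t \<nu> where "c = (\<lambda>i. Q powr nu (Suc i))" and "t = (\<lambda>i. Q powr mu (Suc i))" and "\<nu> = (\<lambda>i. nu (Suc i))"
  define B where "B = (\<lambda>i k. (if i = k then 1 else 0) - (1 - Q) * A $$ (i, k))"
  have A': "A \<in> carrier_mat (Suc N) (Suc N)" using A nN by simp
  have lN: "leading N A \<in> carrier_mat N N" by (simp add: leading_def)
  have nu': "\<nu> i = logq q (1 - (1 - Q) * x i)" and nz': "1 - (1 - Q) * x i \<noteq> 0" if "i < N" for i
    using nu[of "Suc i"] nonzero_n1[of "Suc i"] that by (auto simp: \<nu>_def x_def)
  have mu': "mu (Suc i) = logq q (1 - (1 - Q) * lam n (Suc i))" and mz': "1 - (1 - Q) * lam n (Suc i) \<noteq> 0" if "i \<le> N" for i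
    using mu[of "Suc i"] nonzero_n[of "Suc i"] that by (auto simp: nN)
  have c: "c i = 1 - (1 - Q) * x i" if "i < N" for i
    unfolding c_def \<nu>_def[THEN fun_cong, symmetric] nu'[OF that] by (rule powr_logq[OF nz'[OF that]])
  have t: "t i = 1 - (1 - Q) * lam n (Suc i)" if "i \<le> N" for i
    unfolding t_def mu'[OF that] by (rule powr_logq[OF mz'[OF that]])
  have c_nonres: "c i \<notin> qspiral q (c j)" if "i < N" "j < N" "i \<noteq> j" for i j
    unfolding c[OF that(1)] c[OF that(2)]
  proof (rule logq_nonres[OF nz' nz'])
    show "logq q (1 - (1 - Q) * x i) - logq q (1 - (1 - Q) * x j) \<notin> \<int>"
      unfolding nu'[OF that(1), symmetric] nu'[OF that(2), symmetric]
      using nu_nonres[of "Suc i" "Suc j"] that by (simp add: \<nu>_def)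
  qed (use that in auto)
  have t_nonres: "t i \<notin> qspiral q (t j)" if "i \<le> N" "j \<le> N" "i \<noteq> j" for i j
    unfolding t[OF that(1)] t[OF that(2)]
  proof (rule logq_nonres[OF mz' mz'])
    show "logq q (1 - (1 - Q) * lam n (Suc i)) - logq q (1 - (1 - Q) * lam n (Suc j)) \<notin> \<int>"
      unfolding mu'[OF that(1), symmetric] mu'[OF that(2), symmetric]
      using mu_nonres[of "Suc i" "Suc j"] that by (simp add: nN)
  qed (use that in auto)
  have c_dist: "c i \<noteq> c j" if "i < N" "j < N" "i \<noteq> j" for i j
  proof
    assume "c i = c j"
    hence "c i \<in> qspiral q (c j)" unfolding qspiral_def by (auto intro!: image_eqI[of _ _ 0])
    thus False using c_nonres[OF that] by simp
  qed
  have x_dist: "x i \<noteq> x j" if "i < N" "j < N" "i \<noteq> j" for i j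
    using c_dist[OF that] c[OF that(1)] c[OF that(2)] by auto
  have oneQ: "1 - Q \<noteq> 0" using one_minus_Q[of 0] by simp

  define K where "K = (\<lambda>y. leading N A - y \<cdot>\<^sub>m 1\<^sub>m N)"
  have Kc: "K y \<in> carrier_mat N N" for y using lN by (auto simp: K_def)
  have detK: "det (K y) = (\<Prod>i<N. x i - y)" for y
    unfolding K_def x_def by (rule det_minus_scalar[OF lN eigenvalues]) (use N nN in auto)
  \<comment> \<open>Eigenvectors are taken from the last column and the last row of the adjugate
    because these choices make \<gamma> and W, up to explicit factors, the two minors in the
    formula.\<close>
  define P where "P = (\<lambda>i j. adj_mat (K (x j)) $$ (i, N - 1))"
  define W where "W = (\<lambda>j k. adj_mat (K (x j)) $$ (N - 1, k) /
    ((\<Prod>l\<in>{..<N}-{j}. x l - x j) * adj_mat (K (x j)) $$ (N - 1, N - 1)))"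
  \<comment> \<open>Deleting the last row and column leaves the leading block of size N - 1. The
    hypothesis that the eigenvalues of sizes N and N - 1 are disjoint thus makes the normalisation
    of W possible.\<close>
  have corner: "adj_mat (K y) $$ (N - 1, N - 1) = (\<Prod>i<N-1. lam (N-1) (Suc i) - y)" for y
  proof -
    have "adj_mat (K y) $$ (N - 1, N - 1) = det (mat_delete (K y) (N - 1) (N - 1))"
      using N by (simp add: adj_entry[OF Kc] cofactor_def)
    also have "mat_delete (K y) (N - 1) (N - 1) = leading (N - 1) A - y \<cdot>\<^sub>m 1\<^sub>m (N - 1)"
      by (rule eq_matI) (auto simp: mat_delete_def K_def leading_def)
    also have "det \<dots> = (\<Prod>i<N-1. lam (N-1) (Suc i) - y)"
    proof (cases "N = 1")
      case True
      have "leading 0 A - y \<cdot>\<^sub>m 1\<^sub>m 0 \<in> carrier_mat 0 0" by (auto simp: leading_def)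
      thus ?thesis using True by (simp add: det_dim_zero)
    next
      case False
      thus ?thesis by (intro det_minus_scalar eigenvalues) (use N nN in \<open>auto simp: leading_def\<close>)
    qed
    finally show ?thesis .
  qed
  have corner_nz: "adj_mat (K (x j)) $$ (N - 1, N - 1) \<noteq> 0" if j: "j < N" for j
  proof -
    have "lam (N-1) (Suc i) - x j \<noteq> 0" if "i < N - 1" for i
      using lam_neq[of "Suc j" "Suc i"] j that by (auto simp: x_def)
    thus ?thesis unfolding corner by simp
  qed
  note spec = adjugate_spectral[OF lN N detK[unfolded K_def] x_dist corner_nz[unfolded K_def]]
  have P_eigen: "(\<Sum>k<N. leading N A $$ (i, k) * P k j) = x j * P i j" if "i < N" "j < N" for i j
    unfolding P_def K_def by (rule spec(1)) (use that in auto)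
  have WP: "(\<Sum>k<N. W i k * P k j) = (if i = j then 1 else 0)" if "i < N" "j < N" for i j
    unfolding P_def W_def K_def by (rule spec(3)) (use that in auto)
  have PW: "(\<Sum>k<N. P i k * W k j) = (if i = j then 1 else 0)" if "i < N" "j < N" for i j
    unfolding P_def W_def K_def by (rule spec(4)) (use that in auto)
  have AP: "(\<Sum>k<N. A $$ (i, k) * P k j) = x j * P i j" if "i < N" "j < N" for i j
  proof -
    have "(\<Sum>k<N. A $$ (i, k) * P k j) = (\<Sum>k<N. leading N A $$ (i, k) * P k j)"
      by (rule sum.cong) (use that in \<open>auto simp: leading_def\<close>)
    thus ?thesis using P_eigen[OF that] by simp
  qed
  interpret block: inverse_pair N P W
    by unfold_locales (use WP PW in auto)
  have BP: "(\<Sum>k<N. B i k * P k j) = c j * P i j" if "i < N" "j < N" for i j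
  proof -
    have "(\<Sum>k<N. B i k * P k j) = (\<Sum>k<N. (if i = k then P k j else 0)) - (\<Sum>k<N. (1 - Q) * (A $$ (i, k) * P k j))"
      unfolding sum_subtractf[symmetric] by (rule sum.cong) (auto simp: B_def left_diff_distrib)
    also have "\<dots> = P i j - (1 - Q) * (x j * P i j)"
      using that by (simp add: sum_distrib_left[symmetric] AP)
    finally show ?thesis using c[OF that(2)] by (simp add: left_diff_distrib)
  qed
  define \<beta> \<gamma> where "\<beta> = (\<lambda>i. \<Sum>k<N. W i k * B k N)" and "\<gamma> = (\<lambda>j. \<Sum>k<N. B N k * P k j)"

  interpret arrow q N c \<beta> \<gamma> "B N N" t
  proof unfold_locales
    show "c i \<noteq> 0" if "i < N" for i using c[OF that] nz'[OF that] by simp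
    show "t i \<noteq> 0" if "i \<le> N" for i using t[OF that] mz'[OF that] by simp
    show "c i \<notin> qspiral q (c j)" if "i < N" "j < N" "i \<noteq> j" for i j by (rule c_nonres[OF that])
    show "(w - B N N) * (\<Prod>i<N. w - c i) - (\<Sum>i<N. \<gamma> i * \<beta> i * (\<Prod>k\<in>{..<N}-{i}. w - c k)) = (\<Prod>l\<le>N. w - t l)"
      if w: "\<And>i. i < N \<Longrightarrow> w \<noteq> c i" for w
    proof -
      \<comment> \<open>With this value w - B = (1 - q)(A - y), so both determinants of w - B are
        products over the eigenvalues of A and of its leading block.\<close>
      define y where "y = (1 - w) / (1 - Q)"
      have wy: "w = 1 - (1 - Q) * y" using oneQ by (simp add: y_def)
      define M where "M = mat (Suc N) (Suc N) (\<lambda>(i, j). (if i = j then w else 0) - B i j)"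
      \<comment> \<open>The resolvent of the leading block of B at w, applied to the last column of
        B and written in the eigenbasis. It solves the first N rows in \<open>det_border\<close>,
        and the corner becomes w - b minus the sum of the \<gamma>_s \<beta>_s / (w - c_s).\<close>
      define v where "v = (\<lambda>k. \<Sum>s<N. P k s * (\<beta> s / (w - c s)))"
      have Mc: "M \<in> carrier_mat (Suc N) (Suc N)" by (simp add: M_def)
      have Me: "M $$ (i, j) = (if i = j then w else 0) - B i j" if "i \<le> N" "j \<le> N" for i j
        using that by (simp add: M_def)
      have MA: "M = (1 - Q) \<cdot>\<^sub>m (A - y \<cdot>\<^sub>m 1\<^sub>m (Suc N))"
        using A' by (intro eq_matI) (auto simp: M_def B_def wy algebra_simps)
      have MK: "mat N N (\<lambda>(i, j). M $$ (i, j)) = (1 - Q) \<cdot>\<^sub>m K y"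
        using A' by (intro eq_matI) (auto simp: MA K_def leading_def)
      have lead: "leading (Suc N) A = A" using A' by (intro eq_matI) (auto simp: leading_def)
      have "det M = (1 - Q) ^ Suc N * det (A - y \<cdot>\<^sub>m 1\<^sub>m (Suc N))"
        unfolding MA using A' by (subst det_smult) auto
      also have "det (A - y \<cdot>\<^sub>m 1\<^sub>m (Suc N)) = (\<Prod>i<Suc N. lam n (Suc i) - y)"
        by (rule det_minus_scalar[OF A']) (use eigenvalues[of n] nN lead in auto)
      also have "(1 - Q) ^ Suc N * \<dots> = (\<Prod>l<Suc N. (1 - Q) * (lam n (Suc l) - y))"
        unfolding prod.distrib by simp
      also have "\<dots> = (\<Prod>l\<le>N. w - t l)"
        unfolding lessThan_Suc_atMost by (rule prod.cong) (simp_all add: t wy algebra_simps)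
      finally have 1: "det M = (\<Prod>l\<le>N. w - t l)" .
      have "det (mat N N (\<lambda>(i, j). M $$ (i, j))) = (1 - Q) ^ N * (\<Prod>i<N. x i - y)"
        unfolding MK detK[symmetric] using Kc[of y] by simp
      also have "\<dots> = (\<Prod>i<N. (1 - Q) * (x i - y))" unfolding prod.distrib by simp
      also have "\<dots> = (\<Prod>i<N. w - c i)"
        by (rule prod.cong) (simp_all add: c wy algebra_simps)
      finally have 2: "det (mat N N (\<lambda>(i, j). M $$ (i, j))) = (\<Prod>i<N. w - c i)" .
      have Bv: "(\<Sum>k<N. B i k * v k) = (\<Sum>s<N. (\<Sum>k<N. B i k * P k s) * (\<beta> s / (w - c s)))" for i
        unfolding v_def by (rule sum_mult_swap[symmetric])
      have row: "(\<Sum>k<N. M $$ (i, k) * v k) + M $$ (i, N) = 0" if i: "i < N" for i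
      proof -
        have "(\<Sum>k<N. M $$ (i, k) * v k) = (\<Sum>k<N. (if i = k then w * v k else 0)) - (\<Sum>k<N. B i k * v k)"
          unfolding sum_subtractf[symmetric] using i by (intro sum.cong) (auto simp: Me left_diff_distrib)
        also have "\<dots> = w * v i - (\<Sum>s<N. c s * P i s * (\<beta> s / (w - c s)))"
          unfolding Bv using i by (simp add: BP)
        also have "\<dots> = (\<Sum>s<N. P i s * \<beta> s)"
          unfolding v_def sum_distrib_left sum_subtractf[symmetric]
        proof (rule sum.cong[OF refl])
          fix s assume "s \<in> {..<N}"
          hence "w - c s \<noteq> 0" using w by auto
          moreover have "w * (p * (b / (w - k))) - k * p * (b / (w - k)) = p * b" if "w - k \<noteq> 0" for p b k :: complex
          proof -
            have "w * (p * (b / (w - k))) - k * p * (b / (w - k)) = (w - k) * (p * b) / (w - k)"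
              by (simp only: left_diff_distrib diff_divide_distrib times_divide_eq_right mult.assoc)
            thus ?thesis using that by simp
          qed
          ultimately show "w * (P i s * (\<beta> s / (w - c s))) - c s * P i s * (\<beta> s / (w - c s)) = P i s * \<beta> s" by blast
        qed
        also have "\<dots> = B i N" unfolding \<beta>_def by (rule block.V_collapse[OF i])
        finally show ?thesis using i by (simp add: Me)
      qed
      have "(\<Sum>k<N. M $$ (N, k) * v k) = - (\<Sum>s<N. \<gamma> s * (\<beta> s / (w - c s)))"
      proof -
        have "(\<Sum>k<N. M $$ (N, k) * v k) = - (\<Sum>k<N. B N k * v k)"
          unfolding sum_negf[symmetric] by (rule sum.cong) (auto simp: Me)
        thus ?thesis unfolding Bv \<gamma>_def .
      qed
      hence "det M = (w - B N N - (\<Sum>s<N. \<gamma> s * (\<beta> s / (w - c s)))) * (\<Prod>i<N. w - c i)"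
        using det_border[OF Mc row] unfolding 2 by (simp add: Me)
      also have "\<dots> = (w - B N N) * (\<Prod>i<N. w - c i) - (\<Sum>s<N. \<gamma> s * \<beta> s * (\<Prod>k\<in>{..<N}-{s}. w - c k))"
      proof -
        have "\<gamma> s * (\<beta> s / (w - c s)) * (\<Prod>i<N. w - c i) = \<gamma> s * \<beta> s * (\<Prod>k\<in>{..<N}-{s}. w - c k)" if "s < N" for s
          using that w[of s] by (simp add: prod.remove[of "{..<N}" s])
        thus ?thesis unfolding left_diff_distrib sum_distrib_right by simp
      qed
      finally show ?thesis unfolding 1 by simp
    qed
  qed

  have exp_nu: "exp (of_real (ln q) * \<nu> r) = c r" for r by (simp add: c_def \<nu>_def powr_eq_exp)
  have d: "d = Q powr nu n"
  proof -
    have "nu n = (\<Sum>i\<le>N. mu (Suc i)) - (\<Sum>i<N. nu (Suc i))"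
      using nu_n unfolding n1 sum_Suc_shift(1)[of _ N] unfolding nN sum_Suc_shift(2) .
    hence "Q powr nu n = exp (\<Sum>i\<le>N. of_real (ln q) * mu (Suc i)) / exp (\<Sum>i<N. of_real (ln q) * nu (Suc i))"
      by (simp only: powr_eq_exp right_diff_distrib exp_diff sum_distrib_left)
    also have "\<dots> = d"
      unfolding d_def by (simp add: exp_sum t_def c_def powr_eq_exp)
    finally show ?thesis by (rule sym)
  qed
  have nul: "nu_last q A = nu n"
  proof -
    have "sum_logq_eigenvalues q n A = (\<Sum>i=1..n. mu i)"
      using sum_logq_eigenvalues_eq[OF eigenvalues[of n], of q] n mu by simp
    moreover have "sum_logq_eigenvalues q (n - 1) A = (\<Sum>i=1..n-1. nu i)"
      unfolding n1 using sum_logq_eigenvalues_eq[OF eigenvalues[of N], of q] N nN nu by simp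
    ultimately show ?thesis using A nu_n by (simp add: nu_last_def)
  qed
  define Ve We :: "nat \<Rightarrow> nat \<Rightarrow> complex"
    where "Ve = (\<lambda>i r. if i < N \<and> r < N then P i r else if i = r then 1 else 0)"
      and "We = (\<lambda>i r. if i < N \<and> r < N then W i r else if i = r then 1 else 0)"
  have delta: "delta q A = sandwich n Ve \<nu> We"
  proof -
    have "1\<^sub>m N - (1 - Q) \<cdot>\<^sub>m leading N A = sandwich N P c W"
    proof (rule eq_matI)
      fix i j assume "i < dim_row (sandwich N P c W)" "j < dim_col (sandwich N P c W)"
      hence ij: "i < N" "j < N" by auto
      have "sandwich N P c W $$ (i, j) = (\<Sum>r<N. (\<Sum>k<N. B i k * P k r) * W r j)"
        using ij by (simp add: sandwich_def BP mult_ac)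
      also have "\<dots> = (\<Sum>k<N. B i k * (\<Sum>r<N. P k r * W r j))" by (rule sum_mult_swap)
      also have "\<dots> = (\<Sum>k<N. B i k * (if k = j then 1 else 0))"
        by (rule sum.cong[OF refl]) (simp only: block.VW[OF _ ij(2)] lessThan_iff)
      also have "\<dots> = B i j" using ij by (simp add: if_distrib[of "\<lambda>x. _ * x"] cong: if_cong)
      finally show "(1\<^sub>m N - (1 - Q) \<cdot>\<^sub>m leading N A) $$ (i, j) = sandwich N P c W $$ (i, j)"
        using ij by (simp add: B_def leading_def)
    qed (auto simp: leading_def)
    hence "mat_logq q (1\<^sub>m N - (1 - Q) \<cdot>\<^sub>m leading N A) = sandwich N P (\<lambda>r. 1 / of_real (ln q) * Ln (c r)) W"
      using block.mat_Ln_sandwich[OF c_dist c_nz] by (simp add: mat_logq_def smult_sandwich)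
    also have "\<dots> = sandwich N P \<nu> W"
      by (rule sandwich_cong) (simp add: nu' c logq_def)
    finally have L: "mat_logq q (1\<^sub>m N - (1 - Q) \<cdot>\<^sub>m leading N A) = sandwich N P \<nu> W" .
    have dA: "dim_row A = Suc N" using A' by simp
    show ?thesis unfolding delta_def Let_def dA diff_Suc_1 L nul nN
      by (rule eq_matI) (auto simp: sandwich_def Ve_def We_def \<nu>_def less_Suc_eq)
  qed

  interpret stokes_system q N c \<beta> \<gamma> "B N N" t P W n A \<nu> B Ve We
  proof unfold_locales
    show "n = Suc N" "1 \<le> N" by fact+
    show "A \<in> carrier_mat n n" by fact
    show "B i k = (if i = k then 1 else 0) - (1 - Q) * A $$ (i, k)" for i k by (simp add: B_def)
    show "Ve i r = (if i < N \<and> r < N then P i r else if i = r then 1 else 0)" for i r by (simp add: Ve_def)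
    show "We i r = (if i < N \<and> r < N then W i r else if i = r then 1 else 0)" for i r by (simp add: We_def)
    show "(\<Sum>k<N. B i k * P k j) = c j * P i j" if "i < N" "j < N" for i j by (rule BP[OF that])
    show "t r \<notin> qspiral q (t s)" if "r \<le> N" "s \<le> N" "r \<noteq> s" for r s by (rule t_nonres[OF that])
    show "exp (of_real (ln q) * \<nu> r) = c r" for r by (rule exp_nu)
    show "exp (of_real (ln q) * \<nu> N) = d" by (simp add: d powr_eq_exp \<nu>_def nN)
    show "nu_last q A = \<nu> N" by (simp add: nul \<nu>_def nN)
    show "delta q A = sandwich n Ve \<nu> We" by (rule delta)
  qed (simp_all add: \<beta>_def \<gamma>_def)

  have xi: "xi i = - (1 - Q) / Q powr nu (Suc i)" for i unfolding xi_def unfolding c_def ..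
  have ls: "\<forall>r<N. l \<notin> qspiral q (xi r)" unfolding xi using l_sing by (intro allI impI) auto
  have ms: "\<forall>r<N. m \<notin> qspiral q (xi r)" unfolding xi using m_sing by (intro allI impI) auto
  have z0: "exp (Log z) = z" using branch z by (auto simp: log_branch_def)
  \<comment> \<open>The factor - (1 - q) between B and A off the diagonal leaves a sign - 1 after
    division. Together with the cofactor sign of W at the index k from 0 it is the sign of the
    formula at k + 1.\<close>
  have coef: "W j k * (\<gamma> j / (1 - Q)) =
      (-1) ^ (n + (k + 1))
          * minor ({1..n-2} \<union> {n}) {1..n-1} (A - lam (n-1) (Suc j) \<cdot>\<^sub>m 1\<^sub>m n)
          * minor ({1..n-1} - {k + 1}) {1..n-2} (A - lam (n-1) (Suc j) \<cdot>\<^sub>m 1\<^sub>m n)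
        / ((\<Prod>i\<in>{1..n-1}-{Suc j}. lam (n-1) i - lam (n-1) (Suc j))
           * (\<Prod>i=1..n-2. lam (n-2) i - lam (n-1) (Suc j)))" if j: "j < N" and k: "k < N" for j k
  proof -
    let ?m1 = "minor ({1..N-1} \<union> {Suc N}) {1..N} (A - x j \<cdot>\<^sub>m 1\<^sub>m (Suc N))"
    let ?m2 = "minor ({1..N} - {Suc k}) {1..N-1} (A - x j \<cdot>\<^sub>m 1\<^sub>m (Suc N))"
    let ?D = "(\<Prod>l\<in>{..<N}-{j}. x l - x j) * (\<Prod>i<N-1. lam (N-1) (Suc i) - x j)"
    have Kx: "leading N A - x j \<cdot>\<^sub>m 1\<^sub>m N = K (x j)" by (simp add: K_def)
    have "\<gamma> j = - (1 - Q) * (\<Sum>i<N. A $$ (N, i) * P i j)"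
      unfolding \<gamma>_def sum_distrib_left by (rule sum.cong) (auto simp: B_def algebra_simps)
    also have "(\<Sum>i<N. A $$ (N, i) * P i j) = ?m1"
      unfolding minor_last_row[OF A' N] Kx P_def
      by (rule sum.cong) (use N in \<open>auto simp: adj_entry[OF Kc]\<close>)
    finally have g: "\<gamma> j / (1 - Q) = - ?m1"
      using oneQ by (simp only: mult_minus_left minus_divide_left[symmetric] nonzero_mult_div_cancel_left not_False_eq_True)
    have Wjk: "W j k = (-1) ^ (k + (N - 1)) * ?m2 / ?D"
      unfolding W_def corner minor_delete[OF A' k] Kx using N k
      by (simp add: adj_entry[OF Kc] cofactor_def)
    have sg: "- ((-1) ^ (k + (N - 1))) = ((-1) ^ (n + (k + 1)) :: complex)"
      using N by (cases N) (simp_all add: nN power_add)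
    have "W j k * (\<gamma> j / (1 - Q)) = - ((-1) ^ (k + (N - 1))) * ?m1 * ?m2 / ?D"
      unfolding g Wjk by simp
    thus ?thesis unfolding sg unfolding n1 n2 prod_Suc_shift by (simp add: nN x_def)
  qed
  have ssum: "(\<Sum>s=1..n.
           ((\<Prod>i=1..n-1. qpoch q (Q powr (1 + mu s - nu i)))
             / (\<Prod>i\<in>{1..n}-{s}. qpoch q (Q powr (1 + mu s - mu i))))
         * ((\<Prod>i\<in>{1..n}-{s}. qtheta q ((1 - Q) * Q powr (1 - mu i) / l))
             / (\<Prod>i=1..n-1. qtheta q ((1 - Q) * Q powr (1 - nu i) / l)))
         * (qtheta q (Q powr (mu s - nu n) * l * z) / qtheta q (l * z))
         * (((\<Prod>i\<in>{1..n}-{s}. qpoch q (Q powr (1 + mu i - nu (Suc j))))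
              * (\<Prod>i\<in>{1..n-1}-{Suc j}. qpoch q (Q powr (nu i - mu s))))
             / ((\<Prod>i\<in>{1..n-1}-{Suc j}. qpoch q (Q powr (1 + nu i - nu (Suc j))))
              * (\<Prod>i\<in>{1..n}-{s}. qpoch q (Q powr (mu i - mu s)))))
         * (qtheta q (Q powr (nu (Suc j) - mu s - 1) * m * z) / qtheta q (m * z))
         * (qtheta q (Q powr (mu s) * m / (1 - Q)) / qtheta q (Q powr (nu (Suc j) - 1) * m / (1 - Q)))
         * (cpow (Log z) (nu (Suc j)) / cpow (Log z) (nu n + 1))) =
     stokes_sum j l m z / z * exp (Log z * (\<nu> j - \<nu> N))" for j
  proof -
    have pw: "Q powr (a + b) = Q powr a * Q powr b" "Q powr (a - b) = Q powr a / Q powr b" "Q powr 1 = Q" for a b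
      using q by (simp_all add: powr_eq_exp distrib_left right_diff_distrib exp_add exp_diff exp_of_real)
    \<comment> \<open>The summand 1 in the exponent of the denominator is the division by z in
      \<open>stokes_row\<close>, since exp (Log z) = z.\<close>
    have cp: "cpow (Log z) (nu (Suc j)) / cpow (Log z) (nu n + 1) = exp (Log z * (\<nu> j - \<nu> N)) / z"
      unfolding cpow_def \<nu>_def nN
      by (simp add: distrib_right distrib_left exp_add z0 right_diff_distrib exp_diff mult.commute)
    have "u * (e / z) = v / z * e" if "u = v" for u v e :: complex using that by simp
    note swap = this
    show ?thesis
      unfolding cp sum_distrib_right[symmetric]
      by (rule swap, unfold stokes_sum_def n1 d, unfold nN, unfold sum_Suc_shift(2), unfold prod_Suc_shift(3),
          unfold prod_Suc_shift(1,2) pw, simp only: c_def t_def divide_divide_eq_left)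
  qed
  have b: "stokes_row l m (Log z) z k = stokes_b q n A lam mu nu l m z (Log z) (k + 1)" if k: "k < N" for k
  proof -
    have "stokes_row l m (Log z) z k = (\<Sum>j<N. W j k * (\<gamma> j / (1 - Q)) * (stokes_sum j l m z / z * exp (Log z * (\<nu> j - \<nu> N))))"
      unfolding stokes_row_def by (simp add: mult_ac)
    also have "\<dots> = stokes_b q n A lam mu nu l m z (Log z) (k + 1)"
      unfolding stokes_b_def Let_def n1 sum_Suc_shift(1)[of _ N]
      by (rule sum.cong[OF refl]) (simp only: coef[OF _ k, unfolded n1] ssum[unfolded n1] lessThan_iff)
    finally show ?thesis .
  qed
  have "q_stokes q \<Omega> Log A l m z = mat n n (\<lambda>(i, k). stokes_entry l m (Log z) z i k)"
    by (rule q_stokes_eq[OF l ls m ms branch z z_l z_m])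
  also have "\<dots> = four_block_mat (1\<^sub>m (n-1)) (0\<^sub>m (n-1) 1)
             (mat 1 (n-1) (\<lambda>(_, k). stokes_b q n A lam mu nu l m z (Log z) (k + 1))) (1\<^sub>m 1)"
    unfolding n1 by (rule eq_matI) (auto simp: stokes_entry_def nN less_Suc_eq b[unfolded nN])
  finally show ?thesis .
qed

end
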